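(* Let $1/2<\alpha<1$, and let $T:[0,1]\to[0,1]$ be the map defined by $T(x)=x(1+2^\alpha x^\alpha)$ if $0\le x\le1/2$ and $T(x)=2x-1$ if $1/2<x\le1$. Let $h$ be the density of its unique absolutely continuous invariant probability measure $dm$. Let $f:[0,1]\to\mathbb{R}$ be Hölder, and $\gamma$-Hölder on a neighborhood of $0$ with $\gamma>\frac{2\alpha-1}{\alpha+1}$. Assume also $\int f\,dm=0$. Write $S_nf=\sum_{i=0}^{n-1}f\circ T^i$. If $f(0)=0$, there exists a constant $\sigma^2\ge0$ such that $\frac{S_nf}{\sqrt n}$ tends in distribution (with respect to $m$) to $\mathcal{N}(0,\sigma^2)$. Moreover, $\sigma^2=0$ if and only if there exists a measurable function $\chi$ with $f=\chi\circ T-\chi$. If $f(0)\ne0$, then $\frac{S_nf}{n^\alpha}$ converges in distribution (with respect to $m$) to the stable law $X_{1/\alpha,c,\mathrm{sgn}(f(0))}$ with $$c=\frac{h(1/2)}{4(\alpha/|f(0)|)^{1/\alpha}}\,\Gamma(1-1/\alpha)\cos\left(\frac{\pi}{2\alpha}\right).$$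
   Context: For $0<\alpha<1$ the map $T$ is known to have a unique absolutely continuous invariant probability measure, whose density $h$ (with respect to Lebesgue measure) is Lipschitz on every interval $(\epsilon,1]$, $\epsilon>0$; $h(1/2)$ denotes the value at $1/2$ of this version of the density. "Hölder" means Hölder continuous for some positive exponent. For $p\in(1,2)$, $c>0$, $\beta\in[-1,1]$, $X_{p,c,\beta}$ is the law with characteristic function $E(e^{itX_{p,c,\beta}})=e^{-c|t|^p\left(1-i\beta\,\mathrm{sgn}(t)\tan\left(\frac{p\pi}{2}\right)\right)}$. $\mathcal{N}(0,0)$ is the Dirac mass at $0$. Equalities between measurable functions are understood $m$-almost everywhere. *)

theory Defs
  imports "HOL-Probability.Probability"
begin

(* Only the restriction to the interval [0,1] matters. *)
definition lsv_map :: "real \<Rightarrow> real \<Rightarrow> real" where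
  "lsv_map \<alpha> x = (if x \<le> 1/2 then x * (1 + 2 powr \<alpha> * x powr \<alpha>) else 2 * x - 1)"

abbreviation leb01 :: "real measure" where
  "leb01 \<equiv> restrict_space lborel {0..1}"

definition is_acip :: "(real \<Rightarrow> real) \<Rightarrow> real measure \<Rightarrow> bool" where
  "is_acip T m \<longleftrightarrow>
     prob_space m \<and> sets m = sets leb01 \<and> absolutely_continuous leb01 m \<and>
     T \<in> measurable m m \<and> distr m m T = m"

(* The Lipschitz condition pins down h at every point of (0,1], hence makes h (1/2) meaningful;
   the value h 0 is irrelevant (the actual density is unbounded at 0). *)
definition is_lipschitz_density :: "real measure \<Rightarrow> (real \<Rightarrow> real) \<Rightarrow> bool" where
  "is_lipschitz_density m h \<longleftrightarrow>
     h \<in> borel_measurable leb01 \<and> (\<forall>x\<in>{0..1}. 0 \<le> h x) \<and>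
     m = density leb01 (\<lambda>x. ennreal (h x)) \<and>
     (\<forall>\<epsilon>>0. \<exists>L. L-lipschitz_on {\<epsilon><..1} h)"

definition holder_on :: "real \<Rightarrow> real set \<Rightarrow> (real \<Rightarrow> real) \<Rightarrow> bool" where
  "holder_on \<theta> S f \<longleftrightarrow> (\<exists>C. \<forall>x\<in>S. \<forall>y\<in>S. \<bar>f x - f y\<bar> \<le> C * \<bar>x - y\<bar> powr \<theta>)"

definition birkhoff_sum :: "('a \<Rightarrow> 'a) \<Rightarrow> ('a \<Rightarrow> real) \<Rightarrow> nat \<Rightarrow> 'a \<Rightarrow> real" where
  "birkhoff_sum T f n x = (\<Sum>i<n. f ((T ^^ i) x))"

(* The centred normal law, parametrised by its variance. *)
definition centred_normal :: "real \<Rightarrow> real measure" where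
  "centred_normal v =
     (if v = 0 then return borel 0 else density lborel (\<lambda>x. ennreal (normal_density 0 (sqrt v) x)))"

definition is_stable_law :: "real \<Rightarrow> real \<Rightarrow> real \<Rightarrow> real measure \<Rightarrow> bool" where
  "is_stable_law p c \<beta> X \<longleftrightarrow> real_distribution X \<and>
     (\<forall>t. char X t =
        exp (- of_real (c * \<bar>t\<bar> powr p) * (1 - \<i> * of_real (\<beta> * sgn t * tan (p * pi / 2)))))"

end

theory Submission
 imports Defs "HOL-Probability.Probability"
begin

text \<open>The map \<open>T\<close> expands on \<open>Y = (1/2, 1]\<close> but has a neutral fixed point at 0,
where excursions away from \<open>Y\<close> last long. The proof induces on \<open>Y\<close>: it studies the first
return map \<open>F\<close> to \<open>Y\<close>, which is uniformly hyperbolic, and recovers the Birkhoff sums of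
\<open>T\<close> by cutting orbits into excursions.

Independence. \<open>F\<close> maps each of its countably many branches onto \<open>Y\<close>; the inverse
branches contract by 1/2 and have log-Lipschitz derivatives with a common constant (\<open>dl_distortion\<close>).
For every such map the transfer operator \<open>L\<close> has a spectral gap on Lipschitz functions: log-Lipschitz
functions form a cone that \<open>L\<close> maps into a narrower one, so at each step a fixed fraction of the mass
of two functions with equal integrals can be replaced by one common constant (\<open>cone_coupling\<close>,
\<open>contraction\<close>). The characteristic function of the \<open>k\<close>-th Birkhoff sum of
\<open>X\<close> under \<open>F\<close> is the integral of the \<open>k\<close>-th iterate of
\<open>u \<mapsto> L (e^(isX) u)\<close> at the invariant density. For small \<open>s\<close> this operator is a
small perturbation of \<open>L\<close>, and the gap shows that the characteristic function is close to the
\<open>k\<close>-th power of that of \<open>X\<close> (\<open>charS_power\<close>). In limit theorems the sums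
thus behave as if the summands were independent.

The heavy tail. The return time exceeds \<open>n\<close> on an interval at 1/2 whose length is half the
\<open>n\<close>-th preimage of 1 under the left branch, which is asymptotic to
\<open>(\<alpha> n)^(-1/\<alpha>) / 2\<close>. Let \<open>\<kappa> = m Y\<close>. By Kac's formula the mean return
time for the normalised restriction \<open>\<mu>\<close> of \<open>m\<close> to \<open>Y\<close> is
\<open>1/\<kappa>\<close>, and the tail is asymptotic to
\<open>h(1/2)/(4\<kappa>) (\<alpha> n)^(-1/\<alpha>)\<close>. So the \<open>k\<close>-th return time
\<open>\<tau> k\<close>, centred and divided by \<open>k^\<alpha>\<close>, converges to a totally asymmetric
stable law of index \<open>1/\<alpha>\<close> (\<open>stable_expansion\<close>, \<open>return_time_char\<close>).
Let \<open>N\<close> be the number of returns up to time \<open>n\<close>. Since \<open>N \<ge> k\<close> means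
\<open>\<tau> k \<le> n\<close>, also \<open>(n - N/\<kappa>) / n^\<alpha>\<close> has a stable limit
(\<open>lag_limit\<close>).

Splitting the Birkhoff sum. Write \<open>f = f 0 + (f - f 0)\<close>, and let \<open>X\<close> be the sum of
\<open>f - f 0\<close> over an excursion, centred. The Hoelder condition at 0 bounds \<open>X\<close> by the power
\<open>1 - \<gamma>/\<alpha>\<close> of the return time, which makes \<open>X\<close> square integrable. Gordin's
method writes \<open>X = D - \<psi> + \<psi> \<circ> F\<close> with reverse martingale differences
\<open>D \<circ> F^i\<close> and bounded \<open>\<psi>\<close>. Up to the last, incomplete excursion and a bounded
error (\<open>birkhoff_sum_decomposition\<close>),
\<open>S_n f = f 0 (n - N/\<kappa>) + (D + \<dots> + D \<circ> F^(N-1))\<close>. If \<open>f 0 \<noteq> 0\<close>,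
the first term dominates, because a maximal inequality for orthogonal sums (\<open>fluctuation\<close>) makes the
second one \<open>o(n^\<alpha>)\<close>; this gives the stable law. If \<open>f 0 = 0\<close>, the first term
vanishes, the same inequality allows replacing the random \<open>N\<close> by \<open>\<kappa> n\<close>, and the
central limit theorem for \<open>D\<close> gives the variance \<open>\<kappa>\<close> times the second moment of
\<open>D\<close>.

From \<open>\<mu>\<close> to \<open>m\<close>. Normalised Birkhoff sums change little along an orbit, so by Kac's
formula and mixing of \<open>F\<close> they have the same limit law for \<open>m\<close> as for
\<open>\<mu>\<close> (\<open>char_m_limit\<close>).

Degeneracy. If the variance is 0, then \<open>D = 0\<close>, so \<open>X\<close> is a coboundary of
\<open>F\<close>, and unfolding the excursions makes \<open>f\<close> a coboundary of \<open>T\<close>.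
Conversely, the Birkhoff sums of a coboundary are bounded in probability, so \<open>S_n f / sqrt n\<close> tends
to 0.\<close>

section \<open>Full-branch Markov maps\<close>

text \<open>Unqualified names for facts about the Bochner integral.\<close>

lemmas bochner_cong = Bochner_Integration.integral_cong
lemmas bochner_diff = Bochner_Integration.integral_diff
lemmas bochner_dominated = Bochner_Integration.integrable_bound

text \<open>A full-branch map \<open>F\<close> is described through its inverse branches \<open>v n\<close>,
with Jacobians \<open>g n\<close> and with \<open>ix y\<close> the index of the branch containing
\<open>y\<close>. The distance \<open>d\<close> is a parameter because it will be a power of the usual one,
which turns Hoelder functions into Lipschitz functions.\<close>
locale full_branch_map = finite_measure \<nu> for \<nu> :: "'a measure" +
 fixes d :: "'a => 'a => real" and v :: "nat => 'a => 'a" and F :: "'a => 'a" and ix :: "'a => nat"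
  and g :: "nat => 'a => real" and p :: "nat => real" and r K :: real
 assumes vol_pos: "0 < measure \<nu> (space \<nu>)"
  and d_nonneg: "\<And>x y. x \<in> space \<nu> ==> y \<in> space \<nu> ==> 0 <= d x y"
  and d_le_1: "\<And>x y. x \<in> space \<nu> ==> y \<in> space \<nu> ==> d x y <= 1"
  and d_sym: "\<And>x y. x \<in> space \<nu> ==> y \<in> space \<nu> ==> d x y = d y x"
  and d_measurable: "\<And>u :: 'a => real. (\<And>x y. x \<in> space \<nu> ==> y \<in> space \<nu> ==> \<bar>u x - u y\<bar> <= d x y)
    ==> u \<in> borel_measurable \<nu>"
  and v_measurable[measurable]: "\<And>n. v n \<in> measurable \<nu> \<nu>"
  and F_measurable[measurable]: "F \<in> measurable \<nu> \<nu>"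
  and ix_measurable[measurable]: "ix \<in> measurable \<nu> (count_space UNIV)"
  and F_v: "\<And>n x. x \<in> space \<nu> ==> F (v n x) = x"
  and ix_v: "\<And>n x. x \<in> space \<nu> ==> ix (v n x) = n"
  and v_F: "\<And>y. y \<in> space \<nu> ==> v (ix y) (F y) = y"
  and r: "0 < r" "r < 1"
  and v_contraction: "\<And>n x y. x \<in> space \<nu> ==> y \<in> space \<nu> ==> d (v n x) (v n y) <= r * d x y"
  and g_nonneg: "\<And>n x. x \<in> space \<nu> ==> 0 <= g n x"
  and g_le: "\<And>n x. x \<in> space \<nu> ==> g n x <= p n"
  and p_summable: "summable p"
  and K: "0 <= K"
  and distortion: "\<And>n x y. x \<in> space \<nu> ==> y \<in> space \<nu> ==> g n x <= g n y * exp (K * d x y)"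
  and change_of_variables: "\<And>n (u :: 'a => ennreal). u \<in> borel_measurable \<nu> ==>
    (\<integral>\<^sup>+y. u y * indicator {y. ix y = n} y \<partial>\<nu>) = (\<integral>\<^sup>+x. ennreal (g n x) * u (v n x) \<partial>\<nu>)"
begin

abbreviation vol :: real where "vol \<equiv> measure \<nu> (space \<nu>)"

definition transfer :: "('a => 'b::euclidean_space) => 'a => 'b" where
 "transfer u x = (\<Sum>n. g n x *\<^sub>R u (v n x))"

text \<open>A single constant bounds both the supremum and the Lipschitz seminorm, so that each estimate below
tracks one number.\<close>
definition hol :: "real => ('a => 'b::euclidean_space) => bool" where
 "hol M u \<longleftrightarrow> (\<forall>x\<in>space \<nu>. norm (u x) <= M) \<and>
   (\<forall>x\<in>space \<nu>. \<forall>y\<in>space \<nu>. norm (u x - u y) <= M * d x y)"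

text \<open>Unbounded observables, such as the return time, are only controlled branch by branch. The condition
\<open>summable (\<lambda>n. p n * b n)\<close> accompanying this predicate below is the corresponding
integrability.\<close>
definition branch_hol :: "(nat => real) => ('a => 'b::euclidean_space) => bool" where
 "branch_hol b w \<longleftrightarrow> (\<forall>n. \<forall>x\<in>space \<nu>. norm (w (v n x)) <= b n) \<and>
   (\<forall>n. \<forall>x\<in>space \<nu>. \<forall>y\<in>space \<nu>. norm (w (v n x) - w (v n y)) <= b n * d x y)"

lemma v_in: "x \<in> space \<nu> ==> v n x \<in> space \<nu>"
 using measurable_space[OF v_measurable] .

lemma F_in: "x \<in> space \<nu> ==> F x \<in> space \<nu>"
 using measurable_space[OF F_measurable] .

lemma p_nonneg: "0 <= p n"
proof -
 obtain x where "x \<in> space \<nu>"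
  using vol_pos by (cases "space \<nu> = {}") auto
 then show ?thesis using g_nonneg[of x n] g_le[of x n] by linarith
qed

lemma space_nonempty: "\<exists>x. x \<in> space \<nu>"
 using vol_pos by (cases "space \<nu> = {}") auto

lemma holD:
 assumes "hol M u" "x \<in> space \<nu>"
 shows "norm (u x) <= M" "\<And>y. y \<in> space \<nu> ==> norm (u x - u y) <= M * d x y"
 using assms by (auto simp: hol_def)

lemma hol_nonneg: assumes "hol M u" shows "0 <= M"
proof -
 obtain x where "x \<in> space \<nu>" using space_nonempty by auto
 from order_trans[OF norm_ge_zero holD(1)[OF assms this]] show ?thesis .
qed

lemma branch_holD:
 assumes "branch_hol b w" "x \<in> space \<nu>"
 shows "norm (w (v n x)) <= b n" "\<And>y. y \<in> space \<nu> ==> norm (w (v n x) - w (v n y)) <= b n * d x y"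
 using assms by (auto simp: branch_hol_def)

lemma branch_hol_nonneg: assumes "branch_hol b w" shows "0 <= b n"
proof -
 obtain x where "x \<in> space \<nu>" using space_nonempty by auto
 from order_trans[OF norm_ge_zero branch_holD(1)[OF assms this]] show ?thesis .
qed

lemma lipschitz_measurable:
 fixes u :: "'a => 'b::euclidean_space"
 assumes "\<And>x y. x \<in> space \<nu> ==> y \<in> space \<nu> ==> norm (u x - u y) <= C * d x y"
 shows "u \<in> borel_measurable \<nu>"
proof -
 have "(\<lambda>x. inner (u x) i) \<in> borel_measurable \<nu>" if i: "i \<in> Basis" for i
 proof -
  define D where "D = \<bar>C\<bar> + 1"
  have D: "D > 0" by (simp add: D_def)
  have "(\<lambda>x. inner (u x) i / D) \<in> borel_measurable \<nu>"
  proof (rule d_measurable)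
   fix x y assume xy: "x \<in> space \<nu>" "y \<in> space \<nu>"
   have "\<bar>inner (u x) i - inner (u y) i\<bar> = \<bar>inner (u x - u y) i\<bar>"
    by (simp add: inner_diff_left)
   also have "\<dots> <= norm (u x - u y)" using Basis_le_norm[OF i] by blast
   also have "\<dots> <= C * d x y" using assms[OF xy] .
   also have "\<dots> <= D * d x y"
    by (intro mult_right_mono d_nonneg[OF xy]) (simp add: D_def)
   finally show "\<bar>inner (u x) i / D - inner (u y) i / D\<bar> <= d x y"
    using D by (simp add: field_simps flip: diff_divide_distrib)
  qed
  then have "(\<lambda>x. D * (inner (u x) i / D)) \<in> borel_measurable \<nu>" by measurable
  then show ?thesis using D by simp
 qed
 then show ?thesis by (subst borel_measurable_euclidean_space) blast
qed

lemma hol_measurable: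
 fixes u :: "'a => 'b::euclidean_space"
 shows "hol M u ==> u \<in> borel_measurable \<nu>"
 by (rule lipschitz_measurable[of _ M]) (auto simp: hol_def)

lemma branch_hol_measurable:
 fixes w :: "'a => 'b::euclidean_space"
 assumes "branch_hol b w"
 shows "w \<in> borel_measurable \<nu>"
proof -
 have [measurable]: "(\<lambda>x. w (v n x)) \<in> borel_measurable \<nu>" for n
  by (rule lipschitz_measurable[of _ "b n"]) (use branch_holD[OF assms] in auto)
 have "(\<lambda>y. w (v (ix y) (F y))) \<in> borel_measurable \<nu>"
  by (rule measurable_compose_countable[of "\<lambda>n y. w (v n (F y))"])
    (auto intro!: measurable_compose[OF F_measurable])
 then show ?thesis
  by (rule iffD1[OF measurable_cong, rotated]) (simp add: v_F)
qed

lemma g_lipschitz: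
 assumes "x \<in> space \<nu>" "y \<in> space \<nu>"
 shows "\<bar>g n x - g n y\<bar> <= p n * (K * exp K) * d x y"
proof -
 have *: "g n x - g n y <= p n * (K * exp K) * d x y"
  if xy: "x \<in> space \<nu>" "y \<in> space \<nu>" for x y
 proof -
  define t where "t = K * d x y"
  have t: "0 <= t" "t <= K"
   using K d_nonneg[OF xy] d_le_1[OF xy] by (auto simp: t_def mult_left_le)
  have "1 - t <= exp (- t)" using exp_ge_add_one_self[of "-t"] by simp
  then have "exp t * (1 - t) <= exp t * exp (-t)" by (intro mult_left_mono) auto
  then have "exp t - 1 <= t * exp t" by (simp add: exp_minus field_simps)
  also have "\<dots> <= t * exp K" using t by (intro mult_left_mono) auto
  finally have e: "exp t - 1 <= t * exp K" .
  have "g n x - g n y <= g n y * (exp t - 1)"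
   using distortion[OF xy, of n] by (simp add: t_def algebra_simps)
  also have "\<dots> <= p n * (exp t - 1)"
   using t g_le[OF xy(2)] by (intro mult_right_mono) auto
  also have "\<dots> <= p n * (t * exp K)"
   using e p_nonneg by (intro mult_left_mono) auto
  finally show ?thesis by (simp add: t_def mult_ac)
 qed
 from *[OF assms] *[OF assms(2,1)] d_sym[OF assms] show ?thesis by (simp add: abs_le_iff)
qed

lemma g_measurable[measurable]: "g n \<in> borel_measurable \<nu>"
 by (rule lipschitz_measurable[of _ "p n * (K * exp K)"]) (use g_lipschitz in auto)

lemma branch_summable:
 assumes w: "branch_hol b w" and s: "summable (\<lambda>n. p n * b n)" and x: "x \<in> space \<nu>"
 shows "summable (\<lambda>n. norm (g n x *\<^sub>R w (v n x)))" "summable (\<lambda>n. g n x *\<^sub>R w (v n x))"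
  "norm (g n x *\<^sub>R w (v n x)) <= p n * b n"
proof -
 show le: "norm (g n x *\<^sub>R w (v n x)) <= p n * b n" for n
  using g_nonneg[OF x] g_le[OF x] branch_holD(1)[OF w x] p_nonneg by (auto intro!: mult_mono)
 show "summable (\<lambda>n. norm (g n x *\<^sub>R w (v n x)))"
  by (rule summable_comparison_test'[OF s, of 0]) (use le in auto)
 then show "summable (\<lambda>n. g n x *\<^sub>R w (v n x))" by (rule summable_norm_cancel)
qed

definition CL :: real where "CL = K * exp K + 1"

lemma CL_ge_1: "1 <= CL"
 using K by (simp add: CL_def)

text \<open>The transfer operator averages over branches and so turns branchwise control into global control.
This is why unbounded observables can be treated inside the space of Lipschitz functions.\<close>
lemma hol_transfer_branch:
 fixes w :: "'a => 'b::euclidean_space"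
 assumes w: "branch_hol b w" and s: "summable (\<lambda>n. p n * b n)"
 shows "hol (CL * (\<Sum>n. p n * b n)) (transfer w)"
 unfolding hol_def
proof (intro conjI ballI)
 note b0 = branch_hol_nonneg[OF w]
 have S0: "0 <= (\<Sum>n. p n * b n)"
  using s by (intro suminf_nonneg) (auto simp: b0 p_nonneg)
 fix x assume x: "x \<in> space \<nu>"
 have "norm (transfer w x) <= (\<Sum>n. norm (g n x *\<^sub>R w (v n x)))"
  unfolding transfer_def by (rule summable_norm[OF branch_summable(1)[OF w s x]])
 also have "\<dots> <= (\<Sum>n. p n * b n)"
  by (rule suminf_le[OF branch_summable(3)[OF w s x] branch_summable(1)[OF w s x] s])
 also have "\<dots> <= CL * (\<Sum>n. p n * b n)"
  using CL_ge_1 S0 by (simp add: mult_le_cancel_right1)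
 finally show "norm (transfer w x) <= CL * (\<Sum>n. p n * b n)" .
 fix y assume y: "y \<in> space \<nu>"
 have le: "norm (g n x *\<^sub>R w (v n x) - g n y *\<^sub>R w (v n y)) <= CL * d x y * (p n * b n)" for n
 proof -
  have "g n x *\<^sub>R w (v n x) - g n y *\<^sub>R w (v n y)
    = (g n x - g n y) *\<^sub>R w (v n x) + g n y *\<^sub>R (w (v n x) - w (v n y))"
   by (simp add: algebra_simps)
  also have "norm \<dots> <= \<bar>g n x - g n y\<bar> * norm (w (v n x)) + g n y * norm (w (v n x) - w (v n y))"
   using g_nonneg[OF y] by (intro order_trans[OF norm_triangle_ineq]) auto
  also have "\<dots> <= (p n * (K * exp K) * d x y) * b n + p n * (b n * d x y)"
   using g_lipschitz[OF x y] branch_holD[OF w x] y g_nonneg[OF y] g_le[OF y] K p_nonneg d_nonneg[OF x y] b0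
   by (intro add_mono mult_mono) auto
  also have "\<dots> = CL * d x y * (p n * b n)" by (simp add: CL_def algebra_simps)
  finally show ?thesis .
 qed
 have sm: "summable (\<lambda>n. CL * d x y * (p n * b n))" using s by (rule summable_mult)
 have sd: "summable (\<lambda>n. norm (g n x *\<^sub>R w (v n x) - g n y *\<^sub>R w (v n y)))"
  by (rule summable_comparison_test'[OF sm, of 0]) (use le in auto)
 have "transfer w x - transfer w y = (\<Sum>n. g n x *\<^sub>R w (v n x) - g n y *\<^sub>R w (v n y))"
  unfolding transfer_def by (rule suminf_diff[OF branch_summable(2)[OF w s x] branch_summable(2)[OF w s y]])
 also have "norm \<dots> <= (\<Sum>n. norm (g n x *\<^sub>R w (v n x) - g n y *\<^sub>R w (v n y)))"
  by (rule summable_norm[OF sd])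
 also have "\<dots> <= (\<Sum>n. CL * d x y * (p n * b n))"
  by (rule suminf_le[OF le sd sm])
 also have "\<dots> = CL * (\<Sum>n. p n * b n) * d x y"
  using s by (simp add: suminf_mult)
 finally show "norm (transfer w x - transfer w y) <= CL * (\<Sum>n. p n * b n) * d x y" .
qed

lemma distr_branch:
 "distr (density \<nu> (\<lambda>x. ennreal (g n x))) \<nu> (v n) = density \<nu> (indicator {y. ix y = n})" (is "?A = ?B")
proof (rule measure_eqI)
 show "sets ?A = sets ?B" by simp
 fix A assume "A \<in> sets ?A"
 then have A[measurable]: "A \<in> sets \<nu>" by simp
 have "emeasure ?A A = emeasure (density \<nu> (\<lambda>x. ennreal (g n x))) (v n -` A \<inter> space \<nu>)"
  by (subst emeasure_distr) auto
 also have "\<dots> = (\<integral>\<^sup>+x. ennreal (g n x) * indicator (v n -` A \<inter> space \<nu>) x \<partial>\<nu>)"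
  by (subst emeasure_density) auto
 also have "\<dots> = (\<integral>\<^sup>+x. ennreal (g n x) * indicator A (v n x) \<partial>\<nu>)"
  by (intro nn_integral_cong) (auto simp: indicator_def)
 also have "\<dots> = (\<integral>\<^sup>+y. indicator A y * indicator {y. ix y = n} y \<partial>\<nu>)"
  by (subst change_of_variables) auto
 also have "\<dots> = emeasure ?B A"
  by (subst emeasure_density) (auto simp: mult.commute)
 finally show "emeasure ?A A = emeasure ?B A" .
qed

text \<open>Both claims follow by summing the change of variables over the branches, which partition the space;
the sum of \<open>p n * b n\<close> dominates the norms.\<close>
lemma
 fixes w :: "'a => 'b::euclidean_space"
 assumes [measurable]: "w \<in> borel_measurable \<nu>" and b: "\<And>n x. x \<in> space \<nu> ==> norm (w (v n x)) <= b n"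
  and s: "summable (\<lambda>n. p n * b n)"
 shows integrable_branch: "integrable \<nu> w"
  and integral_transfer: "(LINT x|\<nu>. transfer w x) = (LINT x|\<nu>. w x)"
proof -
 let ?V = "\<lambda>n. {y. ix y = n}"
 have ind[measurable]: "(\<lambda>y. indicator (?V n) y :: real) \<in> borel_measurable \<nu>"
  "(\<lambda>y. indicator (?V n) y :: ennreal) \<in> borel_measurable \<nu>" for n
  unfolding indicator_def mem_Collect_eq by measurable
 have le: "norm (g n x *\<^sub>R w (v n x)) <= p n * b n" if x: "x \<in> space \<nu>" for n x
 proof -
  have "norm (g n x *\<^sub>R w (v n x)) = g n x * norm (w (v n x))" using g_nonneg[OF x] by simp
  also have "\<dots> <= p n * b n"
   by (rule mult_mono[OF g_le[OF x] b[OF x] p_nonneg]) simp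
  finally show ?thesis .
 qed
 have sn: "summable (\<lambda>n. norm (g n x *\<^sub>R w (v n x)))" if x: "x \<in> space \<nu>" for x
  by (rule summable_comparison_test'[OF s, of 0]) (use le[OF x] in auto)
 have int: "integrable \<nu> (\<lambda>x. g n x *\<^sub>R w (v n x))" for n
  by (rule integrable_const_bound[OF AE_I2[OF le]]) simp_all
 have one: "integrable \<nu> (\<lambda>y. indicator (?V n) y *\<^sub>R w y)"
   "(LINT y|\<nu>. indicator (?V n) y *\<^sub>R w y) = (LINT x|\<nu>. g n x *\<^sub>R w (v n x))"
   "(LINT y|\<nu>. norm (indicator (?V n) y *\<^sub>R w y)) = (LINT x|\<nu>. norm (g n x *\<^sub>R w (v n x)))" for n
 proof -
  have dn: "density \<nu> (indicator (?V n)) = density \<nu> (\<lambda>y. ennreal (indicator (?V n) y))"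
   by (simp add: ennreal_indicator)
  note D = distr_branch[of n, unfolded dn]
  have *: "integrable \<nu> (\<lambda>y. indicator (?V n) y *\<^sub>R w' y) \<longleftrightarrow> integrable \<nu> (\<lambda>x. g n x *\<^sub>R w' (v n x))"
    "(LINT y|\<nu>. indicator (?V n) y *\<^sub>R w' y) = (LINT x|\<nu>. g n x *\<^sub>R w' (v n x))"
   if [measurable]: "w' \<in> borel_measurable \<nu>" for w' :: "'a => 'd::euclidean_space"
  proof -
   have "integrable (density \<nu> (\<lambda>y. ennreal (indicator (?V n) y))) w' \<longleftrightarrow> integrable \<nu> (\<lambda>y. indicator (?V n) y *\<^sub>R w' y)"
    by (subst integrable_density) auto
   moreover have "integrable (distr (density \<nu> (\<lambda>x. ennreal (g n x))) \<nu> (v n)) w' \<longleftrightarrow> integrable \<nu> (\<lambda>x. g n x *\<^sub>R w' (v n x))"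
    by (subst integrable_distr_eq, simp, simp) (subst integrable_density, auto simp: g_nonneg)
   ultimately show "integrable \<nu> (\<lambda>y. indicator (?V n) y *\<^sub>R w' y) \<longleftrightarrow> integrable \<nu> (\<lambda>x. g n x *\<^sub>R w' (v n x))"
    unfolding D by simp
   have "integral\<^sup>L (density \<nu> (\<lambda>y. ennreal (indicator (?V n) y))) w' = (LINT y|\<nu>. indicator (?V n) y *\<^sub>R w' y)"
    by (subst integral_density) auto
   moreover have "integral\<^sup>L (distr (density \<nu> (\<lambda>x. ennreal (g n x))) \<nu> (v n)) w' = (LINT x|\<nu>. g n x *\<^sub>R w' (v n x))"
    by (subst integral_distr, simp, simp) (subst integral_density, auto simp: g_nonneg)
   ultimately show "(LINT y|\<nu>. indicator (?V n) y *\<^sub>R w' y) = (LINT x|\<nu>. g n x *\<^sub>R w' (v n x))"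
    unfolding D by simp
  qed
  show "integrable \<nu> (\<lambda>y. indicator (?V n) y *\<^sub>R w y)" using *(1)[of w] int by simp
  show "(LINT y|\<nu>. indicator (?V n) y *\<^sub>R w y) = (LINT x|\<nu>. g n x *\<^sub>R w (v n x))" using *(2)[of w] by simp
  have "(LINT y|\<nu>. norm (indicator (?V n) y *\<^sub>R w y)) = (LINT y|\<nu>. indicator (?V n) y *\<^sub>R norm (w y))"
   by (intro bochner_cong) (auto simp: indicator_def)
  also have "\<dots> = (LINT x|\<nu>. g n x *\<^sub>R norm (w (v n x)))" using *(2)[of "\<lambda>x. norm (w x)"] by simp
  also have "\<dots> = (LINT x|\<nu>. norm (g n x *\<^sub>R w (v n x)))"
   by (intro bochner_cong) (auto simp: g_nonneg)
  finally show "(LINT y|\<nu>. norm (indicator (?V n) y *\<^sub>R w y)) = (LINT x|\<nu>. norm (g n x *\<^sub>R w (v n x)))" .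
 qed
 have sums_w: "(\<lambda>n. indicator (?V n) y *\<^sub>R w y) sums w y" for y
  using sums_single[of "ix y" "\<lambda>n. w y"] by (rule sums_cong[THEN iffD1, rotated]) (auto simp: indicator_def)
 have sn_w: "summable (\<lambda>n. norm (indicator (?V n) y *\<^sub>R w y))" for y
  by (rule summable_finite[of "{ix y}"]) (auto simp: indicator_def)
 have ile: "(LINT x|\<nu>. norm (g n x *\<^sub>R w (v n x))) <= p n * b n * vol" for n
  using integral_mono[OF integrable_norm[OF int[of n]] integrable_const[of "p n * b n"] le] by (simp add: mult_ac)
 have si: "summable (\<lambda>n. LINT x|\<nu>. norm (g n x *\<^sub>R w (v n x)))"
  by (rule summable_comparison_test'[OF summable_mult2[OF s, of vol], of 0]) (use ile in auto)
 have w_eq: "w = (\<lambda>y. \<Sum>n. indicator (?V n) y *\<^sub>R w y)"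
  using sums_unique[OF sums_w] by auto
 show "integrable \<nu> w"
  by (subst w_eq, rule integrable_suminf[OF one(1)]) (use sn_w si one(3) in auto)
 have "(LINT x|\<nu>. w x) = (\<Sum>n. LINT y|\<nu>. indicator (?V n) y *\<^sub>R w y)"
  by (subst w_eq, rule integral_suminf[OF one(1)]) (use sn_w si one(3) in auto)
 also have "\<dots> = (\<Sum>n. LINT x|\<nu>. g n x *\<^sub>R w (v n x))" by (simp only: one(2))
 also have "\<dots> = (LINT x|\<nu>. transfer w x)"
  unfolding transfer_def by (rule integral_suminf[OF int, symmetric]) (use sn si in auto)
 finally show "(LINT x|\<nu>. transfer w x) = (LINT x|\<nu>. w x)" ..
qed

end

section \<open>Spectral gap by coupling in cones of log-Lipschitz functions\<close>

lemma exp_minus_one_le: "0 <= (t::real) ==> exp t - 1 <= t * exp t"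
proof -
 assume "0 <= t"
 have "1 - t <= exp (- t)" using exp_ge_add_one_self[of "-t"] by simp
 then have "exp t * (1 - t) <= exp t * exp (-t)" by (intro mult_left_mono) auto
 then show "exp t - 1 <= t * exp t" by (simp add: exp_minus field_simps)
qed

context full_branch_map
begin

lemma hol_branch:
 fixes u :: "'a => 'b::euclidean_space"
 assumes "hol M u" shows "branch_hol (\<lambda>_. M) u"
 unfolding branch_hol_def
proof (intro conjI allI ballI)
 fix n x assume x: "x \<in> space \<nu>"
 show "norm (u (v n x)) <= M" using holD(1)[OF assms v_in[OF x]] .
 fix y assume y: "y \<in> space \<nu>"
 have "norm (u (v n x) - u (v n y)) <= M * d (v n x) (v n y)"
  using holD(2)[OF assms v_in[OF x] v_in[OF y]] .
 also have "\<dots> <= M * (1 * d x y)"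
  using v_contraction[OF x y] r d_nonneg[OF x y] hol_nonneg[OF assms]
  by (intro mult_left_mono order_trans[OF v_contraction[OF x y]] mult_right_mono) auto
 finally show "norm (u (v n x) - u (v n y)) <= M * d x y" by simp
qed

lemma p_summable_const: "summable (\<lambda>n. p n * M)"
 using p_summable by (rule summable_mult2)

lemma hol_transfer:
 fixes u :: "'a => 'b::euclidean_space"
 assumes "hol M u" shows "hol (CL * suminf p * M) (transfer u)"
 using hol_transfer_branch[OF hol_branch[OF assms] p_summable_const] suminf_mult2[OF p_summable, of M]
 by (simp add: mult.assoc)

lemma hol_integrable:
 fixes u :: "'a => 'b::euclidean_space"
 assumes "hol M u" shows "integrable \<nu> u"
 by (rule integrable_const_bound[OF AE_I2[OF holD(1)[OF assms]] hol_measurable[OF assms]])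

lemma hol_integral_transfer:
 fixes u :: "'a => 'b::euclidean_space"
 assumes "hol M u" shows "(LINT x|\<nu>. transfer u x) = (LINT x|\<nu>. u x)"
 by (rule integral_transfer[OF hol_measurable[OF assms] branch_holD(1)[OF hol_branch[OF assms]] p_summable_const])

lemma hol_summable:
 fixes u :: "'a => 'b::euclidean_space"
 assumes "hol M u" "x \<in> space \<nu>" shows "summable (\<lambda>n. g n x *\<^sub>R u (v n x))"
 by (rule branch_summable(2)[OF hol_branch[OF assms(1)] p_summable_const assms(2)])

lemma hol_mono: "hol M u ==> M <= M' ==> hol M' u"
 unfolding hol_def by (meson order_trans mult_right_mono d_nonneg)

lemma hol_cong: "(\<And>x. x \<in> space \<nu> ==> u x = w x) ==> hol M u = hol M w"
 by (simp add: hol_def)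

lemma hol_add:
 fixes u w :: "'a => 'b::euclidean_space"
 assumes u: "hol M u" and w: "hol N w" shows "hol (M + N) (\<lambda>x. u x + w x)"
 unfolding hol_def
proof (intro conjI ballI)
 fix x assume x: "x \<in> space \<nu>"
 show "norm (u x + w x) <= M + N"
  by (intro norm_triangle_le add_mono holD(1)[OF u x] holD(1)[OF w x])
 fix y assume y: "y \<in> space \<nu>"
 have "norm ((u x - u y) + (w x - w y)) <= M * d x y + N * d x y"
  by (intro norm_triangle_le add_mono holD(2)[OF u x y] holD(2)[OF w x y])
 then show "norm (u x + w x - (u y + w y)) <= (M + N) * d x y" by (simp add: algebra_simps)
qed

lemma hol_mult:
 fixes u w :: "'a => 'b::{euclidean_space, real_normed_algebra}"
 assumes u: "hol M u" and w: "hol N w" shows "hol (2 * M * N) (\<lambda>x. u x * w x)"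
 unfolding hol_def
proof (intro conjI ballI)
 note [simp] = hol_nonneg[OF u] hol_nonneg[OF w]
 fix x assume x: "x \<in> space \<nu>"
 have "norm (u x * w x) <= M * N"
  by (rule norm_mult_ineq[THEN order_trans], intro mult_mono holD(1)[OF u x] holD(1)[OF w x]) auto
 also have "\<dots> <= 2 * M * N" by (simp add: mult_right_mono)
 finally show "norm (u x * w x) <= 2 * M * N" .
 fix y assume y: "y \<in> space \<nu>"
 have "u x * w x - u y * w y = (u x - u y) * w x + u y * (w x - w y)" by (simp add: algebra_simps)
 also have "norm \<dots> <= (M * d x y) * N + M * (N * d x y)"
  by (intro norm_triangle_le add_mono norm_mult_ineq[THEN order_trans] mult_mono
    holD(1)[OF u y] holD(1)[OF w x] holD(2)[OF u x y] holD(2)[OF w x y]) (auto simp: d_nonneg[OF x y])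
 finally show "norm (u x * w x - u y * w y) <= 2 * M * N * d x y" by (simp add: algebra_simps)
qed

lemma hol_linear:
 fixes u :: "'a => 'b::euclidean_space" and f :: "'b => 'c::euclidean_space"
 assumes u: "hol M u" and f: "bounded_linear f" "\<And>x. norm (f x) <= norm x * B" and B: "0 <= B"
 shows "hol (B * M) (\<lambda>x. f (u x))"
proof -
 interpret f: bounded_linear f by fact
 show ?thesis unfolding hol_def
 proof (intro conjI ballI)
  fix x assume x: "x \<in> space \<nu>"
  show "norm (f (u x)) <= B * M"
   using f(2)[of "u x"] mult_right_mono[OF holD(1)[OF u x] B] by (simp add: mult.commute)
  fix y assume y: "y \<in> space \<nu>"
  show "norm (f (u x) - f (u y)) <= B * M * d x y"
   using f(2)[of "u x - u y"] mult_right_mono[OF holD(2)[OF u x y] B]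
   by (simp add: f.diff[symmetric] mult_ac)
 qed
qed

lemma hol_cmult:
 fixes u :: "'a => 'b::{euclidean_space, real_normed_algebra}"
 assumes u: "hol M u" shows "hol (norm c * M) (\<lambda>x. c * u x)"
 by (rule hol_linear[OF u bounded_linear_mult_right])
   (auto intro: order_trans[OF norm_mult_ineq] simp: mult.commute)

lemma hol_minus:
 fixes u :: "'a => 'b::euclidean_space"
 shows "hol M u ==> hol M (\<lambda>x. - u x)"
 by (simp add: hol_def norm_minus_commute)

lemma hol_diff:
 fixes u w :: "'a => 'b::euclidean_space"
 assumes u: "hol M u" and w: "hol N w" shows "hol (M + N) (\<lambda>x. u x - w x)"
 using hol_add[OF u hol_minus[OF w]] by simp

lemma hol_const: "hol (norm c) (\<lambda>_. c)"
 unfolding hol_def by (auto simp: d_nonneg)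

lemma transfer_cong: "(\<And>x. x \<in> space \<nu> ==> u x = w x) ==> x \<in> space \<nu> ==> transfer u x = transfer w x"
 unfolding transfer_def by (simp add: v_in)

lemma transfer_linear:
 fixes u :: "'a => 'b::euclidean_space" and f :: "'b => 'c::euclidean_space"
 assumes u: "branch_hol b u" "summable (\<lambda>n. p n * b n)" and f: "bounded_linear f" and x: "x \<in> space \<nu>"
 shows "transfer (\<lambda>x. f (u x)) x = f (transfer u x)"
proof -
 interpret f: bounded_linear f by fact
 show ?thesis
  unfolding transfer_def f.suminf[OF branch_summable(2)[OF u x]] by (simp add: f.scaleR)
qed

lemma transfer_diff:
 fixes u :: "'a => 'b::euclidean_space"
 assumes u: "branch_hol b u" "summable (\<lambda>n. p n * b n)" and w: "branch_hol c w" "summable (\<lambda>n. p n * c n)"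
  and x: "x \<in> space \<nu>"
 shows "transfer (\<lambda>x. u x - w x) x = transfer u x - transfer w x"
 unfolding transfer_def suminf_diff[OF branch_summable(2)[OF u x] branch_summable(2)[OF w x]]
 by (simp add: scaleR_diff_right)

lemma transfer_add:
 fixes u :: "'a => 'b::euclidean_space"
 assumes u: "branch_hol b u" "summable (\<lambda>n. p n * b n)" and w: "branch_hol c w" "summable (\<lambda>n. p n * c n)"
  and x: "x \<in> space \<nu>"
 shows "transfer (\<lambda>x. u x + w x) x = transfer u x + transfer w x"
 unfolding transfer_def suminf_add[OF branch_summable(2)[OF u x] branch_summable(2)[OF w x]]
 by (simp add: scaleR_add_right)

lemmas transfer_diff_hol = transfer_diff[OF hol_branch p_summable_const hol_branch p_summable_const]
lemmas transfer_add_hol = transfer_add[OF hol_branch p_summable_const hol_branch p_summable_const]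
lemmas transfer_linear_hol = transfer_linear[OF hol_branch p_summable_const]

abbreviation iter :: "nat => ('a => 'b::euclidean_space) => 'a => 'b" where
 "iter k u \<equiv> (transfer ^^ k) u"

lemma hol_iter:
 fixes u :: "'a => 'b::euclidean_space"
 shows "hol M u ==> \<exists>N. hol N (iter k u)"
 by (induction k) (auto dest: hol_transfer)

lemma iter_cong:
 fixes u w :: "'a => 'b::euclidean_space"
 shows "(\<And>x. x \<in> space \<nu> ==> u x = w x) ==> x \<in> space \<nu> ==> iter k u x = iter k w x"
proof (induction k arbitrary: x)
 case (Suc k)
 show ?case using transfer_cong[of "iter k u" "iter k w", OF Suc.IH] Suc.prems by simp
qed simp

lemma iter_add:
 fixes u w :: "'a => 'b::euclidean_space"
 assumes u: "hol M u" and w: "hol N w"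
 shows "x \<in> space \<nu> ==> iter k (\<lambda>x. u x + w x) x = iter k u x + iter k w x"
proof (induction k arbitrary: x)
 case (Suc k)
 obtain A B where "hol A (iter k u)" "hol B (iter k w)" using hol_iter[OF u] hol_iter[OF w] by metis
 from transfer_add_hol[OF this Suc.prems] transfer_cong[of "iter k (\<lambda>x. u x + w x)", OF Suc.IH] Suc.prems
 show ?case by simp
qed simp

lemma iter_linear:
 fixes u :: "'a => 'b::euclidean_space" and f :: "'b => 'c::euclidean_space"
 assumes u: "hol M u" and f: "bounded_linear f"
 shows "x \<in> space \<nu> ==> iter k (\<lambda>x. f (u x)) x = f (iter k u x)"
proof (induction k arbitrary: x)
 case (Suc k)
 obtain A where "hol A (iter k u)" using hol_iter[OF u] by metis
 from transfer_linear_hol[OF this f Suc.prems] transfer_cong[of "iter k (\<lambda>x. f (u x))", OF Suc.IH] Suc.prems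
 show ?case by simp
qed simp

definition cone :: "real => ('a => real) => bool" where
 "cone a u \<longleftrightarrow> (\<forall>x\<in>space \<nu>. 0 <= u x) \<and> (\<forall>x\<in>space \<nu>. \<forall>y\<in>space \<nu>. u x <= u y * exp (a * d x y))"

text \<open>The fixed point of \<open>a \<mapsto> r * a + K\<close>, the map that describes how
\<open>transfer\<close> narrows cones, would be \<open>K / (1 - r)\<close>. The larger value leaves a margin of
exactly 1 after one application of \<open>transfer\<close>.\<close>
definition cone_width :: real where "cone_width = (K + 1) / (1 - r)"

lemma cone_width: "1 <= cone_width" "r * cone_width + K = cone_width - 1"
 using r K by (auto simp: cone_width_def field_simps)

lemma coneD:
 assumes "cone a u" "x \<in> space \<nu>"
 shows "0 <= u x" "\<And>y. y \<in> space \<nu> ==> u x <= u y * exp (a * d x y)"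
 using assms by (auto simp: cone_def)

lemma cone_le:
 assumes c: "cone a u" and a: "0 <= a" and x: "x \<in> space \<nu>" and y: "y \<in> space \<nu>"
 shows "u x <= exp a * u y"
proof -
 have "u x <= u y * exp (a * d x y)" using coneD(2)[OF c x y] .
 also have "\<dots> <= u y * exp a"
  using coneD(1)[OF c y] a d_le_1[OF x y] by (intro mult_left_mono) (auto simp: mult_left_le)
 finally show ?thesis by (simp add: mult.commute)
qed

lemma cone_hol_bound:
 assumes c: "cone a u" and a: "0 <= a" and B: "\<And>x. x \<in> space \<nu> ==> u x <= B"
 shows "hol (B * (1 + a * exp a)) u"
proof -
 have B0: "0 <= B" using space_nonempty B coneD(1)[OF c] order_trans by blast
 have *: "u x - u y <= B * (1 + a * exp a) * d x y"
  if x: "x \<in> space \<nu>" and y: "y \<in> space \<nu>" for x y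
 proof -
  define t where "t = a * d x y"
  have t: "0 <= t" "t <= a" using a d_nonneg[OF x y] d_le_1[OF x y] by (auto simp: t_def mult_left_le)
  have "u x - u y <= u y * (exp t - 1)" using coneD(2)[OF c x y] by (simp add: t_def algebra_simps)
  also have "\<dots> <= B * (t * exp a)"
   using exp_minus_one_le[OF t(1)] t B[OF y] B0
   by (intro mult_mono order_trans[OF exp_minus_one_le[OF t(1)]]) (auto intro: mult_left_mono)
  also have "\<dots> <= B * (1 + a * exp a) * d x y"
   using B0 d_nonneg[OF x y] by (simp add: t_def algebra_simps)
  finally show ?thesis .
 qed
 show ?thesis unfolding hol_def
 proof (intro conjI ballI)
  fix x assume x: "x \<in> space \<nu>"
  have "B <= B * (1 + a * exp a)" using B0 a by (simp add: algebra_simps)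
  then show "norm (u x) <= B * (1 + a * exp a)"
   using B[OF x] coneD(1)[OF c x] by simp
  fix y assume y: "y \<in> space \<nu>"
  show "norm (u x - u y) <= B * (1 + a * exp a) * d x y"
   using *[OF x y] *[OF y x] d_sym[OF x y] by (simp add: abs_le_iff)
 qed
qed

lemma cone_is_hol: assumes c: "cone a u" and a: "0 <= a" shows "\<exists>M. hol M u"
proof -
 obtain x0 where "x0 \<in> space \<nu>" using space_nonempty by auto
 from cone_hol_bound[OF c a cone_le[OF c a _ this]] show ?thesis by blast
qed

lemma cone_integral_bounds:
 assumes c: "cone a u" and a: "0 <= a" and x: "x \<in> space \<nu>"
 shows "u x * vol <= exp a * (LINT x|\<nu>. u x)" "(LINT x|\<nu>. u x) <= exp a * u x * vol"
proof -
 obtain M where "hol M u" using cone_is_hol[OF c a] by auto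
 then have int: "integrable \<nu> u" by (rule hol_integrable)
 have "(LINT y|\<nu>. u x) <= (LINT y|\<nu>. exp a * u y)"
  using int by (intro integral_mono) (auto intro: cone_le[OF c a x])
 then show "u x * vol <= exp a * (LINT x|\<nu>. u x)" by (simp add: mult_ac)
 have "(LINT y|\<nu>. u y) <= (LINT y|\<nu>. exp a * u x)"
  using int by (intro integral_mono) (auto intro: cone_le[OF c a _ x])
 then show "(LINT x|\<nu>. u x) <= exp a * u x * vol" by (simp add: mult_ac)
qed

lemma cone_hol:
 assumes c: "cone a u" and a: "0 <= a"
 shows "hol (exp a * (LINT x|\<nu>. u x) / vol * (1 + a * exp a)) u"
 using vol_pos cone_integral_bounds(1)[OF c a]
 by (intro cone_hol_bound[OF c a]) (auto simp: field_simps)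

text \<open>A branch shrinks distances by \<open>r\<close>, which narrows the cone, and its Jacobian contributes
the distortion \<open>K\<close>.\<close>
lemma cone_transfer:
 assumes c: "cone a u" and a: "0 <= a"
 shows "cone (r * a + K) (transfer u)"
 unfolding cone_def
proof (intro conjI ballI)
 obtain M where h: "hol M u" using cone_is_hol[OF c a] by auto
 fix x assume x: "x \<in> space \<nu>"
 note sx = hol_summable[OF h x, simplified]
 show "0 <= transfer u x"
  unfolding transfer_def using hol_summable[OF h x] coneD(1)[OF c v_in[OF x]] g_nonneg[OF x]
  by (intro suminf_nonneg) auto
 fix y assume y: "y \<in> space \<nu>"
 note sy = hol_summable[OF h y, simplified]
 have le: "g n x * u (v n x) <= exp ((r * a + K) * d x y) * (g n y * u (v n y))" for n
 proof -
  have "u (v n x) <= u (v n y) * exp (a * d (v n x) (v n y))" using coneD(2)[OF c v_in[OF x] v_in[OF y]] .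
  also have "\<dots> <= u (v n y) * exp (a * (r * d x y))"
   using coneD(1)[OF c v_in[OF y]] v_contraction[OF x y] a by (intro mult_left_mono) (auto intro: mult_left_mono)
  finally have "g n x * u (v n x) <= (g n y * exp (K * d x y)) * (u (v n y) * exp (a * (r * d x y)))"
   using distortion[OF x y, of n] g_nonneg[OF y] coneD(1)[OF c v_in[OF x]] by (intro mult_mono) auto
  then show ?thesis by (simp add: algebra_simps exp_add)
 qed
 have "transfer u x <= (\<Sum>n. exp ((r * a + K) * d x y) * (g n y * u (v n y)))"
  unfolding transfer_def using le sx sy by (auto intro!: suminf_le summable_mult)
 also have "\<dots> = transfer u y * exp ((r * a + K) * d x y)"
  unfolding transfer_def real_scaleR_def suminf_mult[OF sy] by (rule mult.commute)
 finally show "transfer u x <= transfer u y * exp ((r * a + K) * d x y)" .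
qed

definition gap :: real where "gap = exp (- 2 * cone_width) / cone_width"

lemma gap: "0 < gap" "gap < 1"
proof -
 show "0 < gap" using cone_width(1) by (simp add: gap_def)
 have "exp (-2 * cone_width) < 1" using cone_width(1) by simp
 then have "exp (-2 * cone_width) < cone_width" using cone_width(1) by linarith
 then show "gap < 1" using cone_width(1) by (simp add: gap_def field_simps)
qed

text \<open>The margin of 1 in the width pays for subtracting a constant: since functions in the cone are at
least a fixed fraction of their mean, removing a small multiple of the mean worsens the log-Lipschitz constant
by at most 1.\<close>
lemma cone_subtract:
 assumes c: "cone (cone_width - 1) u"
 shows "cone cone_width (\<lambda>x. u x - gap * (LINT x|\<nu>. u x) / vol)"
proof -
 define a where "a = cone_width"
 define m where "m = gap * (LINT x|\<nu>. u x) / vol"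
 have a: "1 <= a" using cone_width(1) by (simp add: a_def)
 have c': "cone (a - 1) u" using c by (simp add: a_def)
 have I0: "0 <= (LINT x|\<nu>. u x)" using coneD(1)[OF c] by (intro integral_nonneg_AE AE_I2) auto
 then have m0: "0 <= m" using gap vol_pos by (simp add: m_def)
 (* The value of gap is chosen so that u exceeds the subtracted constant by the factor a * exp a. *)
 have low: "m * (a * exp a) <= u y" if y: "y \<in> space \<nu>" for y
 proof -
  have "(LINT x|\<nu>. u x) <= exp (a - 1) * u y * vol"
   using cone_integral_bounds(2)[OF c' _ y] a by simp
  also have "\<dots> <= exp a * u y * vol"
   using coneD(1)[OF c y] vol_pos by (intro mult_right_mono) auto
  finally have *: "(LINT x|\<nu>. u x) / vol * exp (-a) <= u y"
   using vol_pos by (simp add: field_simps exp_minus)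
  have "m * (a * exp a) = (LINT x|\<nu>. u x) / vol * exp (-a)"
  proof -
   have "m * (a * exp a) = (LINT x|\<nu>. u x) / vol * (exp (- 2 * a) * exp a)"
    using a by (simp add: m_def gap_def a_def[symmetric])
   also have "exp (- 2 * a) * exp a = exp (-a)" by (simp flip: exp_add)
   finally show ?thesis .
  qed
  with * show ?thesis by simp
 qed
 have big: "1 <= a * exp a" using a by (simp add: mult_ge1_I)
 show ?thesis unfolding cone_def m_def[symmetric] a_def[symmetric]
 proof (intro conjI ballI)
  fix x assume x: "x \<in> space \<nu>"
  have "m <= m * (a * exp a)" using m0 big by (simp add: mult_le_cancel_left1)
  then show "0 <= u x - m" using low[OF x] by simp
  fix y assume y: "y \<in> space \<nu>"
  define t where "t = d x y"
  have t: "0 <= t" "t <= 1" using d_nonneg[OF x y] d_le_1[OF x y] by (auto simp: t_def)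
  have "exp (a * t) - 1 <= a * t * exp (a * t)" using a t by (intro exp_minus_one_le) auto
  also have "\<dots> <= a * t * exp a" using a t by (intro mult_left_mono) (auto simp: mult_left_le)
  finally have "m * (exp (a * t) - 1) <= m * (a * t * exp a)" using m0 by (intro mult_left_mono)
  also have "\<dots> = t * (m * (a * exp a))" by simp
  also have "\<dots> <= t * u y" using low[OF y] t by (intro mult_left_mono)
  also have "\<dots> <= (exp t - 1) * u y"
  proof (rule mult_right_mono)
   show "t <= exp t - 1" using exp_ge_add_one_self[of t] by linarith
  qed (rule coneD(1)[OF c y])
  also have "\<dots> <= (exp t - 1) * u y * exp ((a - 1) * t)"
  proof -
   have "1 <= exp ((a - 1) * t)" using t a by simp
   moreover have "0 <= (exp t - 1) * u y" using t coneD(1)[OF c y] by simp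
   ultimately show ?thesis using mult_left_mono[of 1 "exp ((a - 1) * t)" "(exp t - 1) * u y"] by simp
  qed
  also have "\<dots> = u y * (exp (a * t) - exp ((a - 1) * t))"
   by (simp add: algebra_simps exp_add[symmetric])
  finally have "m * (exp (a * t) - 1) <= u y * (exp (a * t) - exp ((a - 1) * t))" .
  moreover have "u x <= u y * exp ((a - 1) * t)" using coneD(2)[OF c' x y] by (simp add: t_def)
  ultimately show "u x - m <= (u y - m) * exp (a * d x y)" by (simp add: t_def algebra_simps)
 qed
qed

text \<open>The coupling: after each application of \<open>transfer\<close> the same constant is subtracted from
both functions. Their difference is unaffected, while the mass of each decays geometrically.\<close>
lemma cone_coupling:
 assumes "cone cone_width u" "cone cone_width w" "(LINT x|\<nu>. u x) = I" "(LINT x|\<nu>. w x) = I"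
 shows "\<exists>u' w'. cone cone_width u' \<and> cone cone_width w' \<and>
  (LINT x|\<nu>. u' x) = (1 - gap) ^ k * I \<and> (LINT x|\<nu>. w' x) = (1 - gap) ^ k * I \<and>
  (\<forall>x\<in>space \<nu>. iter k u x - iter k w x = u' x - w' x)"
proof (induction k)
 case 0
 then show ?case using assms by (intro exI[of _ u] exI[of _ w]) auto
next
 case (Suc k)
 have a0: "0 <= cone_width" using cone_width(1) by simp
 define J where "J = (1 - gap) ^ k * I"
 obtain u' w' where u': "cone cone_width u'" "(LINT x|\<nu>. u' x) = J"
  and w': "cone cone_width w'" "(LINT x|\<nu>. w' x) = J"
  and eq: "\<And>x. x \<in> space \<nu> ==> iter k u x - iter k w x = u' x - w' x"
  using Suc by (auto simp: J_def)
 obtain A B where h: "hol A (iter k u)" "hol B (iter k w)"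
  using hol_iter cone_is_hol[OF assms(1) a0] cone_is_hol[OF assms(2) a0] by metis
 obtain A' B' where h': "hol A' u'" "hol B' w'"
  using cone_is_hol[OF u'(1) a0] cone_is_hol[OF w'(1) a0] by metis
 have step: "cone cone_width (\<lambda>x. transfer z x - gap * J / vol) \<and>
   (LINT x|\<nu>. transfer z x - gap * J / vol) = (1 - gap) ^ Suc k * I"
  if z: "cone cone_width z" "(LINT x|\<nu>. z x) = J" "hol M z" for z M
 proof -
  have i: "(LINT x|\<nu>. transfer z x) = J" using hol_integral_transfer[OF z(3)] z(2) by simp
  have "cone (cone_width - 1) (transfer z)" using cone_transfer[OF z(1) a0] by (simp add: cone_width(2))
  from cone_subtract[OF this] have "cone cone_width (\<lambda>x. transfer z x - gap * J / vol)" by (simp add: i)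
  moreover have "(LINT x|\<nu>. transfer z x - gap * J / vol) = J - gap * J"
   using hol_integrable[OF hol_transfer[OF z(3)]] vol_pos by (simp add: i)
  moreover have "J - gap * J = (1 - gap) ^ Suc k * I" by (simp add: J_def algebra_simps)
  ultimately show ?thesis by simp
 qed
 have "iter (Suc k) u x - iter (Suc k) w x
   = (transfer u' x - gap * J / vol) - (transfer w' x - gap * J / vol)" if x: "x \<in> space \<nu>" for x
 proof -
  have "iter (Suc k) u x - iter (Suc k) w x = transfer (\<lambda>x. iter k u x - iter k w x) x"
   using transfer_diff_hol[OF h x] by simp
  also have "\<dots> = transfer (\<lambda>x. u' x - w' x) x" by (rule transfer_cong[OF eq x])
  also have "\<dots> = transfer u' x - transfer w' x" by (rule transfer_diff_hol[OF h' x])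
  finally show ?thesis by simp
 qed
 then show ?case using step[OF u' h'(1)] step[OF w' h'(2)] by blast
qed

definition Cgap :: real where
 "Cgap = 2 * (2 * (exp cone_width * 2 * (1 + cone_width * exp cone_width)))"

text \<open>Adding the constant \<open>2 * M\<close> moves \<open>u\<close> into the cone; it is then coupled
with that constant. What is left of both has small mass, and inside the cone the mass controls the norm.\<close>
lemma contraction_real:
 fixes u :: "'a => real"
 assumes u: "hol M u" and I: "(LINT x|\<nu>. u x) = 0"
 shows "hol (Cgap / 2 * (1 - gap) ^ k * M) (iter k u)"
proof -
 define a where "a = cone_width"
 have a: "1 <= a" using cone_width(1) by (simp add: a_def)
 have M0: "0 <= M" using hol_nonneg[OF u] .
 have "cone a (\<lambda>x. u x + 2 * M)"
  unfolding cone_def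
 proof (intro conjI ballI)
  fix x assume x: "x \<in> space \<nu>"
  show "0 <= u x + 2 * M" using holD(1)[OF u x] by auto
  fix y assume y: "y \<in> space \<nu>"
  have y1: "M <= u y + 2 * M" using holD(1)[OF u y] by auto
  have "u x + 2 * M <= u y + 2 * M + M * d x y" using holD(2)[OF u x y] by auto
  also have "\<dots> <= (u y + 2 * M) * (1 + d x y)"
   using mult_right_mono[OF y1 d_nonneg[OF x y]] by (simp add: algebra_simps)
  also have "\<dots> <= (u y + 2 * M) * exp (a * d x y)"
   using y1 M0 a d_nonneg[OF x y] exp_ge_add_one_self[of "d x y"]
   by (intro mult_left_mono order_trans[OF exp_ge_add_one_self]) (auto simp: mult_le_cancel_right1)
  finally show "u x + 2 * M <= (u y + 2 * M) * exp (a * d x y)" .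
 qed
 moreover have "cone a (\<lambda>x. 2 * M)"
  unfolding cone_def using M0 a d_nonneg by (auto simp: mult_le_cancel_left1)
 moreover have "(LINT x|\<nu>. u x + 2 * M) = 2 * M * vol"
  using hol_integrable[OF u] I by simp
 moreover have "(LINT x|\<nu>. 2 * M) = 2 * M * vol" by simp
 ultimately obtain u' w' where u': "cone a u'" "cone a w'"
   "(LINT x|\<nu>. u' x) = (1 - gap) ^ k * (2 * M * vol)" "(LINT x|\<nu>. w' x) = (1 - gap) ^ k * (2 * M * vol)"
  and eq: "\<And>x. x \<in> space \<nu> ==> iter k (\<lambda>x. u x + 2 * M) x - iter k (\<lambda>x. 2 * M) x = u' x - w' x"
  using cone_coupling[of "\<lambda>x. u x + 2 * M" "\<lambda>x. 2 * M" "2 * M * vol" k] unfolding a_def by blast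
 define N where "N = exp a * ((1 - gap) ^ k * (2 * M * vol)) / vol * (1 + a * exp a)"
 have "hol N u'" "hol N w'"
  using cone_hol[OF u'(1)] cone_hol[OF u'(2)] a u'(3,4) by (auto simp: N_def)
 from hol_diff[OF this] have "hol (N + N) (\<lambda>x. u' x - w' x)" .
 also have "N + N = Cgap / 2 * (1 - gap) ^ k * M"
  using vol_pos by (simp add: N_def Cgap_def a_def field_simps)
 also have "hol (Cgap / 2 * (1 - gap) ^ k * M) (\<lambda>x. u' x - w' x) = hol (Cgap / 2 * (1 - gap) ^ k * M) (iter k u)"
 proof (rule hol_cong)
  fix x assume x: "x \<in> space \<nu>"
  have "hol (2 * M) (\<lambda>_. 2 * M)" using hol_const[of "2 * M"] M0 by simp
  from iter_add[OF u this x, of k] eq[OF x] show "u' x - w' x = iter k u x" by simp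
 qed
 finally show ?thesis .
qed

lemma Cgap_ge_1: "1 <= Cgap"
proof -
 have "1 <= exp cone_width" "1 <= 1 + cone_width * exp cone_width" using cone_width(1) by auto
 then have "1 * 1 <= exp cone_width * (1 + cone_width * exp cone_width)" by (intro mult_mono) auto
 then show ?thesis by (simp add: Cgap_def)
qed

lemma hol_Re: "hol M u ==> hol M (\<lambda>x. Re (u x))" and hol_Im: "hol M u ==> hol M (\<lambda>x. Im (u x))"
 unfolding hol_def by (auto simp flip: minus_complex.sel intro: order_trans[OF abs_Re_le_cmod] order_trans[OF abs_Im_le_cmod])

lemma hol_of_real: "hol M u ==> hol M (\<lambda>x. complex_of_real (u x))"
 by (simp add: hol_def flip: of_real_diff)

lemma contraction:
 fixes u :: "'a => complex"
 assumes u: "hol M u" and I: "(LINT x|\<nu>. u x) = 0"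
 shows "hol (Cgap * (1 - gap) ^ k * M) (iter k u)"
proof -
 have "(LINT x|\<nu>. Re (u x)) = 0" "(LINT x|\<nu>. Im (u x)) = 0"
  using hol_integrable[OF u] I by simp_all
 note h = contraction_real[OF hol_Re[OF u] this(1), of k] contraction_real[OF hol_Im[OF u] this(2), of k]
 have eq: "iter k (\<lambda>x. Re (u x)) x = Re (iter k u x)" "iter k (\<lambda>x. Im (u x)) x = Im (iter k u x)"
  if "x \<in> space \<nu>" for x
  using iter_linear[OF u bounded_linear_Re that] iter_linear[OF u bounded_linear_Im that] by auto
 define N where "N = Cgap / 2 * (1 - gap) ^ k * M"
 have h1: "hol N (\<lambda>x. complex_of_real (Re (iter k u x)))" "hol N (\<lambda>x. complex_of_real (Im (iter k u x)))"
  using h hol_cong[OF eq(1)] hol_cong[OF eq(2)] by (auto intro!: hol_of_real simp: N_def)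
 have "hol (N + norm \<i> * N) (\<lambda>x. complex_of_real (Re (iter k u x)) + \<i> * complex_of_real (Im (iter k u x)))"
  by (intro hol_add hol_cmult h1)
 moreover have "N + norm \<i> * N = Cgap * (1 - gap) ^ k * M" by (simp add: N_def)
 ultimately show ?thesis by (simp add: complex_eq[symmetric] del: norm_ii)
qed

end

section \<open>The invariant density and twisted transfer operators\<close>

lemma norm_cis_diff: "norm (cis a - cis b) <= \<bar>a - b\<bar>"
proof -
 have "cis a - cis b = cis b * (cis (a - b) - 1)" by (simp add: algebra_simps cis_mult)
 then have "norm (cis a - cis b) = norm (cis (a - b) - 1)" by (simp add: norm_mult)
 also have "\<dots> <= \<bar>a - b\<bar>" using iexp_approx1[of "a - b" 0] by (simp add: cis_conv_exp)
 finally show ?thesis .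
qed

lemma norm_cis_minus_one: "norm (cis a - 1) <= \<bar>a\<bar>"
 using norm_cis_diff[of a 0] by simp

lemma birkhoff_sum_Suc: "birkhoff_sum T f (Suc n) x = f x + birkhoff_sum T f n (T x)"
 unfolding birkhoff_sum_def by (subst sum.lessThan_Suc_shift) (simp add: funpow_swap1)

lemma birkhoff_sum_add: "birkhoff_sum T f (m + n) x = birkhoff_sum T f m x + birkhoff_sum T f n ((T ^^ m) x)"
 by (induction m arbitrary: x) (simp_all add: birkhoff_sum_def[of _ _ 0] birkhoff_sum_Suc funpow_swap1)

lemma distr_funpow:
 assumes F: "F \<in> measurable M M" and inv: "distr M M F = M"
 shows "distr M M (F ^^ k) = M"
proof (induction k)
 case 0
 show ?case by (simp add: distr_id[unfolded id_def] id_def)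
next
 case (Suc k)
 have Fk: "(F ^^ k) \<in> measurable M M" using F by (induction k) (auto simp: measurable_comp)
 have "distr M M (F \<circ> (F ^^ k)) = distr (distr M M (F ^^ k)) M F"
  by (rule distr_distr[symmetric, OF F Fk])
 then show ?case by (simp only: Suc inv funpow.simps)
qed

context full_branch_map
begin

lemma duality:
 fixes u w :: "'a => 'b::{euclidean_space, real_normed_algebra}"
 assumes u: "branch_hol b u" "summable (\<lambda>n. p n * b n)"
  and [measurable]: "w \<in> borel_measurable \<nu>" and w: "\<And>x. x \<in> space \<nu> ==> norm (w x) <= B"
 shows "(LINT x|\<nu>. u x * w (F x)) = (LINT x|\<nu>. transfer u x * w x)"
  and "integrable \<nu> (\<lambda>x. u x * w (F x))"
proof -
 note [measurable] = branch_hol_measurable[OF u(1)]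
 have m: "(\<lambda>x. u x * w (F x)) \<in> borel_measurable \<nu>" by measurable
 have s: "summable (\<lambda>n. p n * (b n * B))" using summable_mult2[OF u(2), of B] by (simp add: mult.assoc)
 have le: "norm (u (v n x) * w (F (v n x))) <= b n * B" if x: "x \<in> space \<nu>" for n x
  using branch_holD(1)[OF u(1) x] w[OF x] branch_hol_nonneg[OF u(1)] x
  by (intro norm_mult_ineq[THEN order_trans] mult_mono) (auto simp: F_v)
 show "integrable \<nu> (\<lambda>x. u x * w (F x))" by (rule integrable_branch[OF m le s])
 have "(LINT x|\<nu>. u x * w (F x)) = (LINT x|\<nu>. transfer (\<lambda>x. u x * w (F x)) x)"
  by (rule integral_transfer[OF m le s, symmetric])
 also have "\<dots> = (LINT x|\<nu>. transfer u x * w x)"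
 proof (rule bochner_cong[OF refl])
  fix x assume x: "x \<in> space \<nu>"
  have "transfer (\<lambda>x. u x * w (F x)) x = (\<Sum>n. (g n x *\<^sub>R u (v n x)) * w x)"
   unfolding transfer_def using x by (simp add: F_v)
  also have "\<dots> = transfer u x * w x"
   unfolding transfer_def by (rule suminf_mult2[OF branch_summable(2)[OF u x], symmetric])
  finally show "transfer (\<lambda>x. u x * w (F x)) x = transfer u x * w x" .
 qed
 finally show "(LINT x|\<nu>. u x * w (F x)) = (LINT x|\<nu>. transfer u x * w x)" .
qed

lemmas duality_hol = duality[OF hol_branch p_summable_const]

lemma cone_mono:
 assumes c: "cone a u" and ab: "a <= b" shows "cone b u"
 unfolding cone_def
proof (intro conjI ballI)
 fix x assume x: "x \<in> space \<nu>"
 show "0 <= u x" by (rule coneD(1)[OF c x])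
 fix y assume y: "y \<in> space \<nu>"
 have "u x <= u y * exp (a * d x y)" by (rule coneD(2)[OF c x y])
 also have "\<dots> <= u y * exp (b * d x y)"
  using coneD(1)[OF c y] d_nonneg[OF x y] ab by (intro mult_left_mono) (auto intro: mult_right_mono)
 finally show "u x <= u y * exp (b * d x y)" .
qed

text \<open>An invariant \<open>h\<close> is the limit of the iterates of the constant function with the same
integral. These stay in the cone, where the mean bounds the values from below.\<close>
lemma invariant_density_lower_bound:
 fixes h :: "'a => real"
 assumes h: "hol H h" and inv: "\<And>x. x \<in> space \<nu> ==> transfer h x = h x" and x: "x \<in> space \<nu>"
 and I0: "0 <= (LINT x|\<nu>. h x)"
 shows "exp (- cone_width) * (LINT x|\<nu>. h x) / vol <= h x"
proof -
 define c where "c = (LINT x|\<nu>. h x) / vol"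
 have c0: "0 <= c" using I0 vol_pos by (simp add: c_def)
 have hc: "hol \<bar>c\<bar> (\<lambda>_. c)" using hol_const[of c] by simp
 have u: "hol (H + \<bar>c\<bar>) (\<lambda>x. h x - c)" by (rule hol_diff[OF h hc])
 have u0: "(LINT x|\<nu>. h x - c) = 0"
  using hol_integrable[OF h] vol_pos by (simp add: c_def)
 have iter_h: "iter k h x = h x" if "x \<in> space \<nu>" for k x
  using that
 proof (induction k arbitrary: x)
  case (Suc k)
  then show ?case using transfer_cong[OF Suc.IH Suc.prems] inv[OF Suc.prems] by simp
 qed simp
 have cone_c: "cone cone_width (iter k (\<lambda>_. c)) \<and> (LINT x|\<nu>. iter k (\<lambda>_. c) x) = c * vol" for k
 proof (induction k)
  case 0
  have "1 <= exp (cone_width * d x y)" if "x \<in> space \<nu>" "y \<in> space \<nu>" for x y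
   using d_nonneg[OF that] cone_width(1) by simp
  then show ?case using c0 by (auto simp: cone_def mult_le_cancel_left1)
 next
  case (Suc k)
  have w: "0 <= cone_width" using cone_width(1) by simp
  have "cone (cone_width - 1) (transfer (iter k (\<lambda>_. c)))"
   using cone_transfer[OF conjunct1[OF Suc] w] by (simp add: cone_width(2))
  then have "cone cone_width (transfer (iter k (\<lambda>_. c)))"
   by (rule cone_mono) simp
  moreover obtain N where N: "hol N (iter k (\<lambda>_. c))" using hol_iter[OF hc] by blast
  have "(LINT x|\<nu>. transfer (iter k (\<lambda>_. c)) x) = c * vol"
   using hol_integral_transfer[OF N] conjunct2[OF Suc] by simp
  ultimately show ?case by simp
 qed
 have lower: "exp (- cone_width) * c <= iter k (\<lambda>_. c) x" for k
 proof -
  have w: "0 <= cone_width" using cone_width(1) by simp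
  have "c * vol <= exp cone_width * iter k (\<lambda>_. c) x * vol"
   using cone_integral_bounds(2)[OF conjunct1[OF cone_c] w x, of k] cone_c[of k] by simp
  then have "c <= exp cone_width * iter k (\<lambda>_. c) x" using vol_pos by simp
  then show ?thesis by (simp add: exp_minus field_simps)
 qed
 have "(\<lambda>k. iter k (\<lambda>x. h x - c) x) \<longlonglongrightarrow> 0"
 proof (rule Lim_null_comparison)
  show "\<forall>\<^sub>F k in sequentially. norm (iter k (\<lambda>x. h x - c) x) <= (Cgap / 2 * (H + \<bar>c\<bar>)) * (1 - gap) ^ k"
   using holD(1)[OF contraction_real[OF u u0] x] by (intro always_eventually allI) (simp add: mult_ac)
  show "(\<lambda>k. (Cgap / 2 * (H + \<bar>c\<bar>)) * (1 - gap) ^ k) \<longlonglongrightarrow> 0"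
   using gap by (intro tendsto_mult_right_zero LIMSEQ_realpow_zero) auto
 qed
 then have lim: "(\<lambda>k. h x - iter k (\<lambda>x. h x - c) x) \<longlonglongrightarrow> h x - 0" by (intro tendsto_diff tendsto_const)
 have eq: "h x - iter k (\<lambda>x. h x - c) x = iter k (\<lambda>_. c) x" for k
 proof -
  have "iter k (\<lambda>x. (h x - c) + c) x = iter k (\<lambda>x. h x - c) x + iter k (\<lambda>_. c) x" by (rule iter_add[OF u hc x])
  then show ?thesis using iter_h[OF x, of k] by simp
 qed
 have "exp (- cone_width) * c <= h x - 0"
  by (rule LIMSEQ_le_const[OF lim]) (use lower eq in auto)
 then show ?thesis by (simp add: c_def)
qed

end

locale full_branch_density = full_branch_map +
 fixes h :: "'a => real" and H hmin :: real
 assumes h_hol: "hol H h"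
  and hmin: "0 < hmin" "\<And>x. x \<in> space \<nu> ==> hmin <= h x"
  and transfer_h: "\<And>x. x \<in> space \<nu> ==> transfer h x = h x"
begin

definition \<kappa> :: real where "\<kappa> = (LINT x|\<nu>. h x)"

definition \<mu> :: "'a measure" where "\<mu> = density \<nu> (\<lambda>x. ennreal (h x / \<kappa>))"

lemma h_pos: "x \<in> space \<nu> ==> 0 < h x"
 using hmin by (force intro: less_le_trans)

lemma h_measurable[measurable]: "h \<in> borel_measurable \<nu>"
 by (rule hol_measurable[OF h_hol])

lemma h_integrable: "integrable \<nu> h"
 by (rule hol_integrable[OF h_hol])

lemma \<kappa>_pos: "0 < \<kappa>"
proof -
 have "(LINT x|\<nu>. hmin) <= \<kappa>"
  unfolding \<kappa>_def by (rule integral_mono) (auto simp: hmin h_integrable)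
 moreover have "0 < hmin * vol" using hmin vol_pos by simp
 ultimately show ?thesis by (simp add: mult.commute)
qed

lemma sets_\<mu>[measurable_cong, simp]: "sets \<mu> = sets \<nu>" and space_\<mu>[simp]: "space \<mu> = space \<nu>"
 by (simp_all add: \<mu>_def)

lemma integral_\<mu>:
 fixes w :: "'a => 'b::euclidean_space"
 assumes [measurable]: "w \<in> borel_measurable \<nu>"
 shows "(LINT x|\<mu>. w x) = (LINT x|\<nu>. h x *\<^sub>R w x) /\<^sub>R \<kappa>"
  and "integrable \<mu> w \<longleftrightarrow> integrable \<nu> (\<lambda>x. h x *\<^sub>R w x)"
proof -
 have [simp]: "AE x in \<nu>. 0 <= h x / \<kappa>" using h_pos \<kappa>_pos by (auto intro!: AE_I2 less_imp_le)
 have eq: "(h x / \<kappa>) *\<^sub>R w x = inverse \<kappa> *\<^sub>R (h x *\<^sub>R w x)" for x by (simp add: divide_inverse mult.commute)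
 show "(LINT x|\<mu>. w x) = (LINT x|\<nu>. h x *\<^sub>R w x) /\<^sub>R \<kappa>"
  unfolding \<mu>_def by (subst integral_density) (simp_all add: eq del: scaleR_scaleR)
 show "integrable \<mu> w \<longleftrightarrow> integrable \<nu> (\<lambda>x. h x *\<^sub>R w x)"
 proof -
  have "integrable \<mu> w \<longleftrightarrow> integrable \<nu> (\<lambda>x. inverse \<kappa> *\<^sub>R (h x *\<^sub>R w x))"
   unfolding \<mu>_def by (subst integrable_density) (simp_all add: eq del: scaleR_scaleR)
  also have "\<dots> \<longleftrightarrow> integrable \<nu> (\<lambda>x. h x *\<^sub>R w x)"
  proof
   assume "integrable \<nu> (\<lambda>x. inverse \<kappa> *\<^sub>R (h x *\<^sub>R w x))"
   from integrable_scaleR_right[OF this, of \<kappa>] show "integrable \<nu> (\<lambda>x. h x *\<^sub>R w x)"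
    using \<kappa>_pos by (simp add: mult.assoc[symmetric])
  qed (rule integrable_scaleR_right)
  finally show ?thesis .
 qed
qed

lemma prob_space_\<mu>: "prob_space \<mu>"
proof (rule prob_spaceI)
 have "emeasure \<mu> (space \<mu>) = (\<integral>\<^sup>+x. ennreal (h x / \<kappa>) \<partial>\<nu>)"
  unfolding \<mu>_def by (subst emeasure_density) (auto intro!: nn_integral_cong simp: indicator_def)
 also have "\<dots> = ennreal (LINT x|\<nu>. h x / \<kappa>)"
  using h_pos \<kappa>_pos h_integrable
  by (intro nn_integral_eq_integral) (auto intro!: AE_I2 less_imp_le)
 also have "(LINT x|\<nu>. h x / \<kappa>) = 1" using \<kappa>_pos by (simp add: \<kappa>_def)
 finally show "emeasure \<mu> (space \<mu>) = 1" by simp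
qed

sublocale \<mu>: prob_space \<mu> by (rule prob_space_\<mu>)

lemma measure_\<mu>_space[simp]: "measure \<mu> (space \<nu>) = 1"
 using \<mu>.prob_space by simp

lemma distr_F: "distr \<mu> \<mu> F = \<mu>"
proof (rule measure_eqI)
 fix A assume "A \<in> sets (distr \<mu> \<mu> F)"
 then have A[measurable]: "A \<in> sets \<nu>" by simp
 have "measure \<mu> (F -` A \<inter> space \<nu>) = (LINT x|\<mu>. indicator A (F x))"
 proof -
  have "(LINT x|\<mu>. indicator A (F x)) = (\<integral>x. indicator (F -` A \<inter> space \<nu>) x \<partial>\<mu> :: real)"
   by (intro bochner_cong) (auto simp: indicator_def)
  then show ?thesis by simp
 qed
 also have "\<dots> = (LINT x|\<nu>. h x * indicator A (F x)) / \<kappa>"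
  by (subst integral_\<mu>) (auto simp: divide_inverse_commute)
 also have "(LINT x|\<nu>. h x * indicator A (F x)) = (LINT x|\<nu>. transfer h x * indicator A x)"
  by (rule duality_hol(1)[OF h_hol, of _ 1]) auto
 also have "\<dots> = (LINT x|\<nu>. h x * indicator A x)"
  by (intro bochner_cong) (auto simp: transfer_h)
 also have "\<dots> / \<kappa> = (LINT x|\<mu>. indicator A x)"
  by (subst integral_\<mu>) (auto simp: divide_inverse_commute)
 also have "\<dots> = measure \<mu> A" by simp
 finally show "emeasure (distr \<mu> \<mu> F) A = emeasure \<mu> A"
  by (subst emeasure_distr) (auto simp: \<mu>.emeasure_eq_measure)
qed simp

lemma branch_hol_mult:
 fixes u w :: "'a => 'b::{euclidean_space, real_normed_algebra}"
 assumes w: "branch_hol b w" and u: "hol M u"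
 shows "branch_hol (\<lambda>n. 2 * b n * M) (\<lambda>x. w x * u x)"
 unfolding branch_hol_def
proof (intro conjI ballI allI)
 note u' = branch_holD[OF hol_branch[OF u]]
 note [simp] = hol_nonneg[OF u] branch_hol_nonneg[OF w]
 fix n x assume x: "x \<in> space \<nu>"
 have "norm (w (v n x) * u (v n x)) <= b n * M"
  by (rule norm_mult_ineq[THEN order_trans], intro mult_mono branch_holD(1)[OF w x] u'(1)[OF x]) auto
 also have "\<dots> <= 2 * b n * M" by (simp add: mult_right_mono)
 finally show "norm (w (v n x) * u (v n x)) <= 2 * b n * M" .
 fix y assume y: "y \<in> space \<nu>"
 have "w (v n x) * u (v n x) - w (v n y) * u (v n y)
   = (w (v n x) - w (v n y)) * u (v n x) + w (v n y) * (u (v n x) - u (v n y))" by (simp add: algebra_simps)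
 also have "norm \<dots> <= (b n * d x y) * M + b n * (M * d x y)"
  by (intro norm_triangle_le add_mono norm_mult_ineq[THEN order_trans] mult_mono
    branch_holD(1)[OF w y] u'(1)[OF x] branch_holD(2)[OF w x y] u'(2)[OF x y]) (auto simp: d_nonneg[OF x y])
 finally show "norm (w (v n x) * u (v n x) - w (v n y) * u (v n y)) <= 2 * b n * M * d x y"
  by (simp add: algebra_simps)
qed

lemma summable_branch_mult: "summable (\<lambda>n. p n * b n) ==> summable (\<lambda>n. p n * (2 * b n * M))"
 using summable_mult2[of "\<lambda>n. p n * b n" "2 * M"] by (simp add: mult_ac)

lemma hol_transfer_mult:
 fixes u w :: "'a => 'b::{euclidean_space, real_normed_algebra}"
 assumes w: "branch_hol b w" and s: "summable (\<lambda>n. p n * b n)" and u: "hol M u"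
 shows "hol (CL * 2 * (\<Sum>n. p n * b n) * M) (transfer (\<lambda>x. w x * u x))"
proof -
 have "(\<Sum>n. p n * (2 * b n * M)) = 2 * (\<Sum>n. p n * b n) * M"
  using suminf_mult2[OF s, of "2 * M"] by (simp add: mult_ac)
 with hol_transfer_branch[OF branch_hol_mult[OF w u] summable_branch_mult[OF s]] show ?thesis
  by (simp add: mult_ac)
qed

lemma F_funpow_measurable[measurable]: "(F ^^ k) \<in> measurable \<nu> \<nu>"
 by (induction k) (auto simp: measurable_comp)

lemma birkhoff_measurable[measurable]:
 fixes X :: "'a => real"
 assumes [measurable]: "X \<in> borel_measurable \<nu>"
 shows "birkhoff_sum F X k \<in> borel_measurable \<nu>"
 unfolding birkhoff_sum_def by measurable

lemma norm_le_vol: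
 fixes u :: "'a => 'b::euclidean_space"
 assumes u: "hol M u" shows "norm (LINT x|\<nu>. u x) <= M * vol"
proof -
 have "norm (LINT x|\<nu>. u x) <= (LINT x|\<nu>. norm (u x))" by (rule integral_norm_bound)
 also have "\<dots> <= (LINT x|\<nu>. M)"
  using hol_integrable[OF u] holD(1)[OF u] by (intro integral_mono) auto
 finally show ?thesis by (simp add: mult.commute)
qed

definition Cpert :: real where "Cpert = Cgap * (1 + vol * H / \<kappa>)"

lemma H_pos: "0 < H"
proof -
 obtain x where x: "x \<in> space \<nu>" using space_nonempty by auto
 from holD(1)[OF h_hol x] h_pos[OF x] show ?thesis by simp
qed

lemma Cpert_pos: "0 < Cpert"
 unfolding Cpert_def using Cgap_ge_1 H_pos \<kappa>_pos by (intro mult_pos_pos add_pos_nonneg) auto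

text \<open>Subtracting this multiple of \<open>h\<close> projects along the invariant density onto functions of
integral 0, where the iterates contract.\<close>
lemma contraction_projected:
 fixes w :: "'a => complex"
 assumes w: "hol M w"
 shows "hol (Cpert * (1 - gap) ^ k * M) (iter k (\<lambda>x. w x - (LINT x|\<nu>. w x) / \<kappa> * h x))"
proof -
 let ?c = "(LINT x|\<nu>. w x) / \<kappa>"
 have M: "0 <= M" using hol_nonneg[OF w] .
 have "norm ?c <= M * vol / \<kappa>" using norm_le_vol[OF w] \<kappa>_pos by (simp add: norm_divide divide_right_mono)
 moreover have hc: "hol (norm ?c * H) (\<lambda>x. ?c * h x)" by (rule hol_cmult[OF hol_of_real[OF h_hol]])
 ultimately have "hol (M * vol / \<kappa> * H) (\<lambda>x. ?c * h x)"
  using H_pos by (elim hol_mono) (blast intro: mult_right_mono less_imp_le)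
 from hol_diff[OF w this] have 1: "hol (M * (1 + vol * H / \<kappa>)) (\<lambda>x. w x - ?c * h x)"
  by (simp add: algebra_simps)
 have "(LINT x|\<nu>. w x - ?c * h x) = (LINT x|\<nu>. w x) - ?c * (LINT x|\<nu>. complex_of_real (h x))"
  using hol_integrable[OF w] h_integrable by (subst bochner_diff) auto
 also have "\<dots> = 0" using \<kappa>_pos by (simp add: \<kappa>_def)
 finally show ?thesis using contraction[OF 1, of k] by (simp add: Cpert_def mult_ac)
qed

end

text \<open>Characteristic functions of Birkhoff sums of \<open>X\<close> are encoded by twisting the transfer
operator with \<open>cis (s * X)\<close>.\<close>
locale twisted_transfer = full_branch_density +
 fixes X :: "'a => real" and b :: "nat => real"
 assumes X: "branch_hol b X" and X_summable: "summable (\<lambda>n. p n * b n)"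
begin

lemma X_measurable[measurable]: "X \<in> borel_measurable \<nu>"
 by (rule branch_hol_measurable[OF X])

definition twist :: "real => ('a => complex) => 'a => complex" where
 "twist s u = transfer (\<lambda>x. cis (s * X x) * u x)"

definition pert :: "real => ('a => complex) => 'a => complex" where
 "pert s u = transfer (\<lambda>x. (cis (s * X x) - 1) * u x)"

lemma branch_cis_minus: "branch_hol (\<lambda>n. \<bar>s\<bar> * b n) (\<lambda>x. cis (s * X x) - 1)"
 unfolding branch_hol_def
proof (intro conjI ballI allI)
 fix n x assume x: "x \<in> space \<nu>"
 have "norm (cis (s * X (v n x)) - 1) <= \<bar>s\<bar> * \<bar>X (v n x)\<bar>"
  using norm_cis_minus_one[of "s * X (v n x)"] by (simp add: abs_mult)
 also have "\<dots> <= \<bar>s\<bar> * b n" using branch_holD(1)[OF X x, of n] by (intro mult_left_mono) auto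
 finally show "norm (cis (s * X (v n x)) - 1) <= \<bar>s\<bar> * b n" .
 fix y assume y: "y \<in> space \<nu>"
 have "norm (cis (s * X (v n x)) - 1 - (cis (s * X (v n y)) - 1)) <= \<bar>s\<bar> * \<bar>X (v n x) - X (v n y)\<bar>"
  using norm_cis_diff[of "s * X (v n x)" "s * X (v n y)"] by (simp add: abs_mult flip: right_diff_distrib)
 also have "\<dots> <= \<bar>s\<bar> * (b n * d x y)"
  using branch_holD(2)[OF X x y, of n] by (intro mult_left_mono) auto
 finally show "norm (cis (s * X (v n x)) - 1 - (cis (s * X (v n y)) - 1)) <= \<bar>s\<bar> * b n * d x y" by simp
qed

lemma summable_s: "summable (\<lambda>n. p n * (\<bar>s\<bar> * b n))"
 using summable_mult2[OF X_summable, of "\<bar>s\<bar>"] by (simp add: mult_ac)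

definition Ctw :: real where "Ctw = CL * 2 * (\<Sum>n. p n * b n)"

lemma hol_pert: "hol M u ==> hol (Ctw * \<bar>s\<bar> * M) (pert s u)"
proof -
 assume u: "hol M u"
 have "(\<Sum>n. p n * (\<bar>s\<bar> * b n)) = (\<Sum>n. p n * b n) * \<bar>s\<bar>"
  using suminf_mult2[OF X_summable, of "\<bar>s\<bar>"] by (simp add: mult_ac)
 with hol_transfer_mult[OF branch_cis_minus summable_s u, of s] show ?thesis
  by (simp add: pert_def Ctw_def mult_ac)
qed

lemma twist_eq:
 assumes u: "hol M u" and x: "x \<in> space \<nu>"
 shows "twist s u x = transfer u x + pert s u x"
proof -
 have "twist s u x = transfer (\<lambda>x. u x + (cis (s * X x) - 1) * u x) x"
  by (simp add: twist_def algebra_simps)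
 also have "\<dots> = transfer u x + pert s u x"
  unfolding pert_def
  by (rule transfer_add[OF hol_branch[OF u] p_summable_const branch_hol_mult[OF branch_cis_minus u] summable_branch_mult[OF summable_s] x])
 finally show ?thesis .
qed

lemma hol_twist: assumes u: "hol M u" shows "\<exists>N. hol N (twist s u)"
 using hol_add[OF hol_transfer[OF u] hol_pert[OF u, of s]] hol_cong[of "twist s u", OF twist_eq[OF u]] by blast

abbreviation twists :: "real => nat => 'a => complex" where
 "twists s k \<equiv> (twist s ^^ k) (\<lambda>x. complex_of_real (h x))"

lemma hol_twists: "\<exists>N. hol N (twists s k)"
proof (induction k)
 case 0 then show ?case using hol_of_real[OF h_hol] by auto
next
 case (Suc k) then show ?case using hol_twist by auto
qed

text \<open>By duality the factor \<open>cis (s * X)\<close> is absorbed one step of the orbit at a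
time.\<close>
lemma integral_twist_iterate:
 "hol M u ==> (LINT x|\<nu>. u x * cis (s * birkhoff_sum F X k x)) = (LINT x|\<nu>. (twist s ^^ k) u x)"
proof (induction k arbitrary: u M)
 case 0
 then show ?case by (simp add: birkhoff_sum_def)
next
 case (Suc k)
 obtain N where N: "hol N (twist s u)" using hol_twist[OF Suc.prems] by auto
 have b1: "branch_hol (\<lambda>n. 2 * (1 + \<bar>s\<bar> * b n) * M) (\<lambda>x. cis (s * X x) * u x)"
 proof (rule branch_hol_mult[OF _ Suc.prems])
  have 1: "norm (cis t) <= 1 + \<bar>s\<bar> * b n" for t n using branch_hol_nonneg[OF X] by simp
  have 2: "norm (cis (s * X (v n x)) - cis (s * X (v n y))) <= (1 + \<bar>s\<bar> * b n) * d x y"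
   if "x \<in> space \<nu>" "y \<in> space \<nu>" for n x y
  proof -
   have "norm (cis (s * X (v n x)) - cis (s * X (v n y))) <= (\<bar>s\<bar> * b n) * d x y"
    using branch_holD(2)[OF branch_cis_minus that(1,1)] branch_holD(2)[OF branch_cis_minus that, of s n] by simp
   also have "\<dots> <= (1 + \<bar>s\<bar> * b n) * d x y" using d_nonneg[OF that] by (intro mult_right_mono) auto
   finally show ?thesis .
  qed
  show "branch_hol (\<lambda>n. 1 + \<bar>s\<bar> * b n) (\<lambda>x. cis (s * X x))"
   unfolding branch_hol_def using 1 2 by auto
 qed
 have s1: "summable (\<lambda>n. p n * (2 * (1 + \<bar>s\<bar> * b n) * M))"
  by (rule summable_branch_mult) (use summable_add[OF p_summable summable_s[of s]] in \<open>simp add: algebra_simps\<close>)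
 have "(LINT x|\<nu>. u x * cis (s * birkhoff_sum F X (Suc k) x))
   = (LINT x|\<nu>. (cis (s * X x) * u x) * cis (s * birkhoff_sum F X k (F x)))"
  by (simp add: birkhoff_sum_Suc distrib_left mult_ac flip: cis_mult)
 also have "\<dots> = (LINT x|\<nu>. twist s u x * cis (s * birkhoff_sum F X k x))"
  unfolding twist_def
 proof (rule duality(1)[OF b1 s1, of _ 1])
  have "(\<lambda>x. exp (\<i> * complex_of_real (s * birkhoff_sum F X k x))) \<in> borel_measurable \<nu>" by measurable
  then show "(\<lambda>x. cis (s * birkhoff_sum F X k x)) \<in> borel_measurable \<nu>" by (simp add: cis_conv_exp)
 qed simp
 also have "\<dots> = (LINT x|\<nu>. (twist s ^^ k) (twist s u) x)" by (rule Suc.IH[OF N])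
 finally show ?case by (simp add: funpow_swap1)
qed

definition charS :: "real => nat => complex" where
 "charS s k = (LINT x|\<mu>. cis (s * birkhoff_sum F X k x))"

lemma cis_measurable[measurable]: "f \<in> borel_measurable M ==> (\<lambda>x. cis (f x)) \<in> borel_measurable M"
 unfolding cis_conv_exp by measurable

lemma charS_eq: "charS s k = (LINT x|\<nu>. twists s k x) / \<kappa>"
 unfolding charS_def integral_twist_iterate[OF hol_of_real[OF h_hol], symmetric]
 by (subst integral_\<mu>) (auto simp: scaleR_conv_of_real divide_inverse_commute)

lemma norm_charS: "norm (charS s k) <= 1"
proof -
 have "norm (charS s k) <= (LINT x|\<mu>. norm (cis (s * birkhoff_sum F X k x)))"
  unfolding charS_def by (rule integral_norm_bound)
 then show ?thesis by (simp add: \<mu>.prob_space)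
qed

text \<open>The part of the twisted iterates of \<open>h\<close> that is not proportional to \<open>h\<close>;
it has integral 0. Bounding it replaces a perturbation theory for the leading eigenvalue.\<close>
definition defect :: "real => nat => 'a => complex" where
 "defect s k x = twists s k x - charS s k * h x"

lemma hol_defect_ex: "\<exists>N. hol N (defect s k)"
proof -
 obtain N where "hol N (twists s k)" using hol_twists by blast
 from hol_diff[OF this hol_cmult[OF hol_of_real[OF h_hol]]] show ?thesis
  unfolding defect_def[abs_def] by blast
qed

lemma transfer_complex_h: "x \<in> space \<nu> ==> transfer (\<lambda>x. complex_of_real (h x)) x = h x"
 using transfer_linear_hol[OF h_hol bounded_linear_of_real] transfer_h by metis

lemma pert_twists:
 assumes x: "x \<in> space \<nu>"
 shows "pert s (twists s k) x = pert s (defect s k) x + charS s k * pert s (\<lambda>x. complex_of_real (h x)) x"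
proof -
 obtain N where N: "hol N (defect s k)" using hol_defect_ex by blast
 note B = branch_hol_mult[OF branch_cis_minus[of s]] summable_branch_mult[OF summable_s[of s]]
 have "pert s (twists s k) x = transfer (\<lambda>x. (cis (s * X x) - 1) * defect s k x
   + charS s k * ((cis (s * X x) - 1) * h x)) x"
  by (simp add: pert_def defect_def algebra_simps)
 also have "(\<lambda>x. (cis (s * X x) - 1) * defect s k x + charS s k * ((cis (s * X x) - 1) * h x))
   = (\<lambda>x. (cis (s * X x) - 1) * defect s k x + (cis (s * X x) - 1) * (charS s k * h x))"
  by (simp add: fun_eq_iff)
 also have "transfer \<dots> x = pert s (defect s k) x + transfer (\<lambda>x. (cis (s * X x) - 1) * (charS s k * h x)) x"
  unfolding pert_def
  by (rule transfer_add[OF B(1)[OF N] B(2) B(1)[OF hol_cmult[OF hol_of_real[OF h_hol]]] B(2) x])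
 also have "transfer (\<lambda>x. (cis (s * X x) - 1) * (charS s k * h x)) x
   = transfer (\<lambda>x. charS s k * ((cis (s * X x) - 1) * h x)) x"
  by (simp add: mult_ac)
 also have "\<dots> = charS s k * pert s (\<lambda>x. complex_of_real (h x)) x"
  unfolding pert_def
  by (rule transfer_linear[OF B(1)[OF hol_of_real[OF h_hol]] B(2) bounded_linear_mult_right x])
 finally show ?thesis .
qed

lemma integral_pert:
 assumes u: "hol M u" shows "(LINT x|\<nu>. pert s u x) = (LINT x|\<nu>. (cis (s * X x) - 1) * u x)"
  "integrable \<nu> (\<lambda>x. (cis (s * X x) - 1) * u x)"
proof -
 note B = branch_hol_mult[OF branch_cis_minus[of s] u] summable_branch_mult[OF summable_s[of s]]
 show "(LINT x|\<nu>. pert s u x) = (LINT x|\<nu>. (cis (s * X x) - 1) * u x)"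
  unfolding pert_def by (rule integral_transfer[OF branch_hol_measurable[OF B(1)] branch_holD(1)[OF B(1)] B(2)])
 show "integrable \<nu> (\<lambda>x. (cis (s * X x) - 1) * u x)"
  by (rule integrable_branch[OF branch_hol_measurable[OF B(1)] branch_holD(1)[OF B(1)] B(2)])
qed

lemma defect_Suc:
 assumes x: "x \<in> space \<nu>"
 shows "defect s (Suc k) x = transfer (defect s k) x +
   (pert s (twists s k) x - (LINT x|\<nu>. pert s (twists s k) x) / \<kappa> * h x)"
proof -
 obtain N where N: "hol N (defect s k)" using hol_defect_ex by blast
 obtain N' where N': "hol N' (twists s k)" using hol_twists by blast
 have eq: "twists s (Suc k) x = transfer (twists s k) x + pert s (twists s k) x" if "x \<in> space \<nu>" for x
  using twist_eq[OF N' that] by simp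
 have "charS s (Suc k) = (LINT x|\<nu>. transfer (twists s k) x + pert s (twists s k) x) / \<kappa>"
  unfolding charS_eq by (subst bochner_cong[OF refl eq]) auto
 also have "\<dots> = charS s k + (LINT x|\<nu>. pert s (twists s k) x) / \<kappa>"
  using hol_integrable[OF hol_transfer[OF N']] hol_integrable[OF hol_pert[OF N', of s]] hol_integral_transfer[OF N']
  by (simp add: charS_eq add_divide_distrib)
 finally have a: "charS s (Suc k) = charS s k + (LINT x|\<nu>. pert s (twists s k) x) / \<kappa>" .
 have "transfer (twists s k) x = transfer (\<lambda>x. defect s k x + charS s k * h x) x"
  by (simp add: defect_def)
 also have "\<dots> = transfer (defect s k) x + transfer (\<lambda>x. charS s k * h x) x"
  by (rule transfer_add_hol[OF N hol_cmult[OF hol_of_real[OF h_hol]] x])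
 also have "transfer (\<lambda>x. charS s k * h x) x = charS s k * h x"
  using transfer_linear_hol[OF hol_of_real[OF h_hol] bounded_linear_mult_right x] transfer_complex_h[OF x] by simp
 finally have t: "transfer (twists s k) x = transfer (defect s k) x + charS s k * h x" .
 have "defect s (Suc k) x = twists s (Suc k) x - charS s (Suc k) * h x" by (rule defect_def)
 also have "\<dots> = transfer (defect s k) x +
   (pert s (twists s k) x - (LINT x|\<nu>. pert s (twists s k) x) / \<kappa> * h x)"
  unfolding eq[OF x] t a by (simp add: algebra_simps)
 finally show ?thesis .
qed

text \<open>Each step contracts the old defect by \<open>1 - gap\<close> and adds a projected perturbation. A
contraction constant is lost when a function is projected, and losing it at each step would accumulate;
therefore the induction controls all iterates \<open>iter i\<close> of the defect at once, so that the constant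
enters only through the newly added term.\<close>
lemma hol_iter_defect:
 assumes e: "hol \<epsilon> (pert s (\<lambda>x. complex_of_real (h x)))"
  and small: "Cpert * Ctw * \<bar>s\<bar> <= gap / 2"
 shows "hol ((1 - gap) ^ i * (2 * Cpert * \<epsilon> / gap)) (iter i (defect s k))"
proof (induction k arbitrary: i)
 case 0
 have "twists s 0 x - charS s 0 * h x = 0" for x
  using \<kappa>_pos by (simp add: charS_def birkhoff_sum_def \<mu>.prob_space)
 then have "defect s 0 x = 0 * 1" for x by (simp add: defect_def)
 then have "iter i (defect s 0) x = 0" if "x \<in> space \<nu>" for x
  using iter_linear[OF hol_const[of "1::complex"] bounded_linear_mult_right[of 0] that] iter_cong[OF _ that, of "defect s 0" "\<lambda>x. 0 * 1" i] by simp
 then show ?case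
  using hol_nonneg[OF e] gap Cpert_pos by (auto simp: hol_def d_nonneg)
next
 case (Suc k)
 (* R solves (1 - gap) * R + gap / 2 * R + Cpert * \<epsilon> = R, the recursion reached at the end. *)
 define R where "R = 2 * Cpert * \<epsilon> / gap"
 have e0: "0 <= \<epsilon>" using hol_nonneg[OF e] .
 have R0: "0 <= R" using e0 gap Cpert_pos by (simp add: R_def)
 have IH: "hol ((1 - gap) ^ i * R) (iter i (defect s k))" for i using Suc.IH by (simp add: R_def)
 define w where "w x = pert s (twists s k) x" for x
 have hd: "hol R (defect s k)" using IH[of 0] by simp
 have "hol (Ctw * \<bar>s\<bar> * R + norm (charS s k) * \<epsilon>) (\<lambda>x. pert s (defect s k) x + charS s k * pert s (\<lambda>x. complex_of_real (h x)) x)"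
  by (intro hol_add hol_cmult e hol_pert hd)
 then have "hol (Ctw * \<bar>s\<bar> * R + norm (charS s k) * \<epsilon>) w"
  using hol_cong[of w "\<lambda>x. pert s (defect s k) x + charS s k * pert s (\<lambda>x. complex_of_real (h x)) x"]
  by (simp add: w_def pert_twists)
 then have w: "hol (Ctw * \<bar>s\<bar> * R + \<epsilon>) w"
  using norm_charS[of s k] e0 by (elim hol_mono) (auto simp: mult_left_le_one_le)
 have "hol (Cpert * (1 - gap) ^ i * (Ctw * \<bar>s\<bar> * R + \<epsilon>)) (iter i (\<lambda>x. w x - (LINT x|\<nu>. w x) / \<kappa> * h x))"
  by (rule contraction_projected[OF w])
 from hol_add[OF IH[of "Suc i"] this]
 have *: "hol ((1 - gap) ^ Suc i * R + Cpert * (1 - gap) ^ i * (Ctw * \<bar>s\<bar> * R + \<epsilon>))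
   (\<lambda>x. iter (Suc i) (defect s k) x + iter i (\<lambda>x. w x - (LINT x|\<nu>. w x) / \<kappa> * h x) x)" .
 have "iter i (defect s (Suc k)) x = iter (Suc i) (defect s k) x + iter i (\<lambda>x. w x - (LINT x|\<nu>. w x) / \<kappa> * h x) x"
  if x: "x \<in> space \<nu>" for x
 proof -
  have hw: "\<exists>N. hol N (\<lambda>x. w x - (LINT x|\<nu>. w x) / \<kappa> * h x)"
   using hol_diff[OF w hol_cmult[OF hol_of_real[OF h_hol]]] by blast
  then obtain N where N: "hol N (\<lambda>x. w x - (LINT x|\<nu>. w x) / \<kappa> * h x)" ..
  have "iter i (defect s (Suc k)) x = iter i (\<lambda>x. transfer (defect s k) x + (w x - (LINT x|\<nu>. w x) / \<kappa> * h x)) x"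
   unfolding w_def by (rule iter_cong[OF defect_Suc x])
  also have "\<dots> = iter i (transfer (defect s k)) x + iter i (\<lambda>x. w x - (LINT x|\<nu>. w x) / \<kappa> * h x) x"
   by (rule iter_add[OF hol_transfer[OF hd] N x])
  finally show ?thesis by (simp add: funpow_swap1)
 qed
 from hol_cong[OF this] * have **: "hol ((1 - gap) ^ Suc i * R + Cpert * (1 - gap) ^ i * (Ctw * \<bar>s\<bar> * R + \<epsilon>)) (iter i (defect s (Suc k)))"
  by simp
 have "(1 - gap) ^ Suc i * R + Cpert * (1 - gap) ^ i * (Ctw * \<bar>s\<bar> * R + \<epsilon>)
   = (1 - gap) ^ i * ((1 - gap) * R + (Cpert * Ctw * \<bar>s\<bar>) * R + Cpert * \<epsilon>)"
  by (simp add: algebra_simps)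
 also have "\<dots> <= (1 - gap) ^ i * ((1 - gap) * R + gap / 2 * R + Cpert * \<epsilon>)"
  using small R0 gap less_imp_le[OF Cpert_pos] e0 by (intro mult_left_mono add_mono mult_right_mono) auto
 also have "(1 - gap) * R + gap / 2 * R + Cpert * \<epsilon> = R" using gap by (simp add: R_def field_simps)
 finally show ?case using hol_mono[OF **] by (simp add: R_def)
qed

definition Drate :: real where "Drate = Ctw * vol * 2 * Cpert / gap / \<kappa>"

definition char1 :: "real => complex" where "char1 s = (LINT x|\<mu>. cis (s * X x))"

text \<open>If the twisted iterates were exactly multiples of \<open>h\<close>, the characteristic functions
would satisfy \<open>charS s (k + 1) = char1 s * charS s k\<close>. The error in this recursion is the integral
of the perturbed defect, a product of two small factors.\<close>
lemma charS_power:
 assumes e: "hol \<epsilon> (pert s (\<lambda>x. complex_of_real (h x)))"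
  and small: "Cpert * Ctw * \<bar>s\<bar> <= gap / 2"
 shows "norm (charS s k - char1 s ^ k) <= k * (Drate * \<bar>s\<bar> * \<epsilon>)"
proof (induction k)
 case 0
 then show ?case by (simp add: charS_def birkhoff_sum_def \<mu>.prob_space)
next
 case (Suc k)
 define R where "R = 2 * Cpert * \<epsilon> / gap"
 have hd: "hol R (defect s k)" using hol_iter_defect[OF e small, of 0 k] by (simp add: R_def)
 obtain N where N: "hol N (twists s k)" using hol_twists by blast
 have c1: "char1 s = charS s 1" by (simp add: char1_def charS_def birkhoff_sum_def)
 have h1: "integrable \<nu> (\<lambda>x. cis (s * X x) * complex_of_real (h x))"
 proof -
  have "integrable \<nu> (\<lambda>x. (cis (s * X x) - 1) * complex_of_real (h x) + complex_of_real (h x))"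
   using h_integrable by (intro Bochner_Integration.integrable_add integral_pert(2)[OF hol_of_real[OF h_hol]]) simp
  then show ?thesis by (simp add: left_diff_distrib)
 qed
 have e1: "charS s (Suc k) = (LINT x|\<nu>. transfer (twists s k) x + pert s (twists s k) x) / \<kappa>"
  unfolding charS_eq by (subst bochner_cong[OF refl]) (auto simp: twist_eq[OF N])
 also have "\<dots> = charS s k + (LINT x|\<nu>. pert s (twists s k) x) / \<kappa>"
  using hol_integrable[OF hol_transfer[OF N]] hol_integrable[OF hol_pert[OF N, of s]] hol_integral_transfer[OF N]
  by (simp add: charS_eq add_divide_distrib)
 also have "(LINT x|\<nu>. pert s (twists s k) x)
   = (LINT x|\<nu>. pert s (defect s k) x) + charS s k * (LINT x|\<nu>. pert s (\<lambda>x. complex_of_real (h x)) x)"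
  using hol_integrable[OF hol_pert[OF hd, of s]] hol_integrable[OF e]
  by (subst bochner_cong[OF refl pert_twists]) auto
 also have "(LINT x|\<nu>. pert s (\<lambda>x. complex_of_real (h x)) x) = \<kappa> * (char1 s - 1)"
 proof -
  have "(LINT x|\<nu>. pert s (\<lambda>x. complex_of_real (h x)) x) = (LINT x|\<nu>. cis (s * X x) * h x - h x)"
   unfolding integral_pert(1)[OF hol_of_real[OF h_hol]] by (simp add: algebra_simps)
  also have "\<dots> = (LINT x|\<nu>. cis (s * X x) * h x) - \<kappa>"
   using h1 h_integrable by (simp add: \<kappa>_def)
  also have "(LINT x|\<nu>. cis (s * X x) * h x) = \<kappa> * char1 s"
   unfolding char1_def using \<kappa>_pos by (subst integral_\<mu>) (auto simp: scaleR_conv_of_real mult.commute)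
  finally show ?thesis by (simp add: algebra_simps)
 qed
 finally have "charS s (Suc k) - char1 s * charS s k = (LINT x|\<nu>. pert s (defect s k) x) / \<kappa>"
  using \<kappa>_pos by (simp add: field_simps)
 moreover have "norm ((LINT x|\<nu>. pert s (defect s k) x) / \<kappa>) <= Drate * \<bar>s\<bar> * \<epsilon>"
 proof -
  have "norm (LINT x|\<nu>. pert s (defect s k) x) <= Ctw * \<bar>s\<bar> * R * vol" by (rule norm_le_vol[OF hol_pert[OF hd]])
  then show ?thesis using \<kappa>_pos gap by (simp add: norm_divide Drate_def R_def field_simps)
 qed
 ultimately have *: "norm (charS s (Suc k) - char1 s * charS s k) <= Drate * \<bar>s\<bar> * \<epsilon>" by simp
 have "charS s (Suc k) - char1 s ^ Suc k = (charS s (Suc k) - char1 s * charS s k) + char1 s * (charS s k - char1 s ^ k)"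
  by (simp add: algebra_simps)
 also have "norm \<dots> <= Drate * \<bar>s\<bar> * \<epsilon> + 1 * (k * (Drate * \<bar>s\<bar> * \<epsilon>))"
  using * Suc norm_charS[of s 1] unfolding c1
  by (intro norm_triangle_le add_mono norm_mult_ineq[THEN order_trans] mult_mono) auto
 finally show ?case by (simp add: algebra_simps)
qed

text \<open>The norm of \<open>pert s h\<close> is at most of order \<open>s\<close>, so the error is of order
\<open>k * s^2\<close>. For \<open>s\<close> of order \<open>k^(-\<alpha>)\<close> with
\<open>\<alpha> > 1/2\<close>, the scale of the stable law, this tends to 0.\<close>
lemma charS_power_crude:
 assumes small: "Cpert * Ctw * \<bar>s\<bar> <= gap / 2"
 shows "norm (charS s k - char1 s ^ k) <= k * (Drate * Ctw * H * s\<^sup>2)"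
 using charS_power[OF hol_pert[OF hol_of_real[OF h_hol]] small, of k]
 by (simp add: power2_eq_square mult_ac)

end

section \<open>Mixing, martingale decomposition and the central limit theorem\<close>

context full_branch_density
begin

lemma bounded_integrable:
 fixes w :: "'a => 'b::euclidean_space"
 assumes "w \<in> borel_measurable \<nu>" "\<And>x. x \<in> space \<nu> ==> norm (w x) <= B"
 shows "integrable \<nu> w" "integrable \<mu> w"
 using assms by (auto intro!: integrable_const_bound[of _ B] \<mu>.integrable_const_bound[of _ B] AE_I2)

lemma integral_iter_duality:
 fixes u w :: "'a => complex"
 assumes "hol M u" and w[measurable]: "w \<in> borel_measurable \<nu>" "\<And>x. x \<in> space \<nu> ==> norm (w x) <= B"
 shows "(LINT x|\<nu>. u x * w ((F ^^ k) x)) = (LINT x|\<nu>. iter k u x * w x)"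
 using assms(1)
proof (induction k arbitrary: u M)
 case (Suc k)
 have "(LINT x|\<nu>. u x * w ((F ^^ Suc k) x)) = (LINT x|\<nu>. u x * (\<lambda>y. w ((F ^^ k) y)) (F x))"
  by (simp add: funpow_swap1)
 also have "\<dots> = (LINT x|\<nu>. transfer u x * w ((F ^^ k) x))"
  by (rule duality_hol(1)[OF Suc.prems, where B = B])
    (use measurable_space[OF F_funpow_measurable] in \<open>auto intro!: w(2) measurable_compose[OF F_funpow_measurable w(1)]\<close>)
 also have "\<dots> = (LINT x|\<nu>. iter (Suc k) u x * w x)"
  using Suc.IH[OF hol_transfer[OF Suc.prems]] by (simp add: funpow_swap1)
 finally show ?case .
qed simp

text \<open>Almost invariance allows replacing \<open>G n\<close> by \<open>G n \<circ> F^k\<close> for a large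
fixed \<open>k\<close>. By duality \<open>F^k\<close> then moves to \<open>u\<close>, as the \<open>k\<close>-th
iterate of \<open>transfer\<close>, which is small.\<close>
lemma mixing_zero:
 fixes u :: "'a => complex" and G :: "nat => 'a => complex"
 assumes u: "hol M u" "(LINT x|\<nu>. u x) = 0"
  and G[measurable]: "\<And>n. G n \<in> borel_measurable \<nu>" and G1: "\<And>n x. x \<in> space \<nu> ==> norm (G n x) <= 1"
  and inv: "\<And>k x. x \<in> space \<nu> ==> (\<lambda>n. G n ((F ^^ k) x) - G n x) \<longlonglongrightarrow> 0"
 shows "(\<lambda>n. LINT x|\<nu>. u x * G n x) \<longlonglongrightarrow> 0"
proof (rule LIMSEQ_I)
 note M = hol_nonneg[OF u(1)]
 note um[measurable] = hol_measurable[OF u(1)]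
 fix e :: real assume e: "0 < e"
 have "(\<lambda>k. Cgap * (1 - gap) ^ k * M * vol) \<longlonglongrightarrow> Cgap * 0 * M * vol"
  using gap by (intro tendsto_intros LIMSEQ_realpow_zero) auto
 then have "eventually (\<lambda>k. Cgap * (1 - gap) ^ k * M * vol < e / 2) sequentially"
  using e by (intro order_tendstoD(2)[where a = "e/2"]) (auto dest: order_tendstoD)
 then obtain k where k: "Cgap * (1 - gap) ^ k * M * vol < e / 2"
  by (auto simp: eventually_sequentially)
 have Gk: "norm (G n ((F ^^ k) x)) <= 1" if "x \<in> space \<nu>" for n x
  using G1[OF measurable_space[OF F_funpow_measurable that]] .
 have Gkm[measurable]: "(\<lambda>x. G n ((F ^^ k) x)) \<in> borel_measurable \<nu>" for n
  by (rule measurable_compose[OF F_funpow_measurable G])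
 have b2: "norm (u x * (G n ((F ^^ k) x) - G n x)) <= M * 2" if x: "x \<in> space \<nu>" for n x
  using holD(1)[OF u(1) x] norm_triangle_ineq4[of "G n ((F ^^ k) x)" "G n x"] G1[OF x, of n] Gk[OF x, of n]
  by (intro norm_mult_ineq[THEN order_trans] mult_mono) (auto simp: M)
 have "(\<lambda>n. LINT x|\<nu>. u x * (G n ((F ^^ k) x) - G n x)) \<longlonglongrightarrow> (LINT x|\<nu>. 0)"
 proof (rule integral_dominated_convergence[where w = "\<lambda>_. M * 2"])
  show "AE x in \<nu>. (\<lambda>n. u x * (G n ((F ^^ k) x) - G n x)) \<longlonglongrightarrow> 0"
   using inv by (auto intro!: AE_I2 tendsto_mult_right_zero)
 qed (auto intro!: AE_I2 b2)
 then have "(\<lambda>n. LINT x|\<nu>. u x * (G n ((F ^^ k) x) - G n x)) \<longlonglongrightarrow> 0" by simp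
 from LIMSEQ_D[OF this, of "e/2"] e obtain N
  where N: "\<And>n. n \<ge> N ==> norm (LINT x|\<nu>. u x * (G n ((F ^^ k) x) - G n x)) < e / 2" by auto
 show "\<exists>no. \<forall>n\<ge>no. norm ((LINT x|\<nu>. u x * G n x) - 0) < e"
 proof (intro exI allI impI)
  fix n assume n: "n \<ge> N"
  have b: "norm (u x * G n ((F ^^ k) x)) <= M * 1" "norm (u x * G n x) <= M * 1" if x: "x \<in> space \<nu>" for x
   using mult_mono[OF holD(1)[OF u(1) x] G1[OF x, of n] M] mult_mono[OF holD(1)[OF u(1) x] Gk[OF x, of n] M]
   by (simp_all add: norm_mult)
  have i: "integrable \<nu> (\<lambda>x. u x * G n ((F ^^ k) x))" "integrable \<nu> (\<lambda>x. u x * G n x)"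
   by (rule bounded_integrable(1)[OF _ b(1)], measurable) (rule bounded_integrable(1)[OF _ b(2)], measurable)
  have "(LINT x|\<nu>. u x * G n ((F ^^ k) x)) = (LINT x|\<nu>. iter k u x * G n x)"
   by (rule integral_iter_duality[OF u(1) G G1])
  also have "norm \<dots> <= (LINT x|\<nu>. norm (iter k u x * G n x))" by (rule integral_norm_bound)
  also have "\<dots> <= (LINT x|\<nu>. Cgap * (1 - gap) ^ k * M)"
  proof (rule integral_mono)
   have hi: "hol (Cgap * (1 - gap) ^ k * M) (iter k u)" by (rule contraction[OF u])
   note [measurable] = hol_measurable[OF hi]
   show *: "norm (iter k u x * G n x) <= Cgap * (1 - gap) ^ k * M" if x: "x \<in> space \<nu>" for x
    using mult_mono[OF holD(1)[OF hi x] G1[OF x, of n]] hol_nonneg[OF hi] by (simp add: norm_mult)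
   show "integrable \<nu> (\<lambda>x. norm (iter k u x * G n x))"
    by (rule bounded_integrable(1)[where B = "Cgap * (1 - gap) ^ k * M"]) (use * in auto)
  qed simp
  also have "\<dots> < e / 2" using k by (simp add: mult_ac)
  finally have 1: "norm (LINT x|\<nu>. u x * G n ((F ^^ k) x)) < e / 2" .
  have "(LINT x|\<nu>. u x * G n x) = (LINT x|\<nu>. u x * G n ((F ^^ k) x)) - (LINT x|\<nu>. u x * (G n ((F ^^ k) x) - G n x))"
   using i by (simp add: right_diff_distrib)
  also have "norm \<dots> < e / 2 + e / 2"
   using norm_triangle_ineq4 1 N[OF n] by (meson add_strict_mono order_le_less_trans)
  finally show "norm ((LINT x|\<nu>. u x * G n x) - 0) < e" by simp
 qed
qed

text \<open>For \<open>G n = cis (t * A n)\<close> this says that limit laws do not depend on the initial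
density \<open>w\<close>. One application of \<open>transfer\<close> reduces to a Lipschitz density.\<close>
lemma mixing_branch:
 fixes w :: "'a => real" and G :: "nat => 'a => complex"
 assumes w: "branch_hol b w" and s: "summable (\<lambda>n. p n * b n)"
  and G[measurable]: "\<And>n. G n \<in> borel_measurable \<nu>" and G1: "\<And>n x. x \<in> space \<nu> ==> norm (G n x) <= 1"
  and inv: "\<And>k x. x \<in> space \<nu> ==> (\<lambda>n. G n ((F ^^ k) x) - G n x) \<longlonglongrightarrow> 0"
 shows "(\<lambda>n. (LINT x|\<nu>. w x * G n x) - (LINT x|\<nu>. w x) * (LINT x|\<mu>. G n x)) \<longlonglongrightarrow> 0"
proof -
 note wm[measurable] = branch_hol_measurable[OF w]
 have wi: "integrable \<nu> w" by (rule integrable_branch[OF wm branch_holD(1)[OF w] s])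
 define wc where "wc x = complex_of_real (w x)" for x
 have wc: "branch_hol b wc" using w by (simp add: branch_hol_def wc_def flip: of_real_diff)
 have wcm[measurable]: "wc \<in> borel_measurable \<nu>" using branch_hol_measurable[OF wc] .
 have wci: "integrable \<nu> wc" using wi by (simp add: wc_def[abs_def])
 define I where "I = (LINT x|\<nu>. wc x)"
 define u where "u x = transfer wc x - I / \<kappa> * h x" for x
 note ht = hol_transfer_branch[OF wc s]
 have hh: "hol (norm (I / \<kappa>) * H) (\<lambda>x. I / \<kappa> * h x)" by (rule hol_cmult[OF hol_of_real[OF h_hol]])
 have u: "hol (CL * (\<Sum>n. p n * b n) + norm (I / \<kappa>) * H) u"
  unfolding u_def by (rule hol_diff[OF ht hh])
 have tI: "(LINT x|\<nu>. transfer wc x) = I"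
  unfolding I_def by (rule integral_transfer[OF wcm branch_holD(1)[OF wc] s])
 have hI: "(LINT x|\<nu>. complex_of_real (h x)) = \<kappa>" by (simp add: \<kappa>_def)
 have u0: "(LINT x|\<nu>. u x) = 0"
  unfolding u_def using hol_integrable[OF ht] hol_integrable[OF hh] h_integrable \<kappa>_pos
  by (subst bochner_diff) (auto simp: tI \<kappa>_def)
 have GF: "norm (G n (F x)) <= 1" if "x \<in> space \<nu>" for n x using G1[OF F_in[OF that]] .
 have 1: "(\<lambda>n. LINT x|\<nu>. wc x * (G n (F x) - G n x)) \<longlonglongrightarrow> (LINT x|\<nu>. 0)"
 proof (rule integral_dominated_convergence[where w = "\<lambda>x. \<bar>w x\<bar> * 2"])
  show "AE x in \<nu>. (\<lambda>n. wc x * (G n (F x) - G n x)) \<longlonglongrightarrow> 0"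
   using inv[of _ 1] by (auto intro!: AE_I2 tendsto_mult_right_zero)
  fix n
  show "AE x in \<nu>. norm (wc x * (G n (F x) - G n x)) <= \<bar>w x\<bar> * 2"
  proof (rule AE_I2)
   fix x assume x: "x \<in> space \<nu>"
   have "norm (G n (F x) - G n x) <= 2"
    using norm_triangle_ineq4[of "G n (F x)" "G n x"] G1[OF x, of n] GF[OF x, of n] by linarith
   then show "norm (wc x * (G n (F x) - G n x)) <= \<bar>w x\<bar> * 2"
    by (simp add: norm_mult wc_def mult_left_mono)
  qed
 qed (use wi in auto)
 have wG: "integrable \<nu> (\<lambda>x. wc x * G n x)" for n
 proof (rule bochner_dominated[OF wci])
  show "AE x in \<nu>. norm (wc x * G n x) <= norm (wc x)"
   using G1 by (auto intro!: AE_I2 simp: norm_mult mult_left_le)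
 qed measurable
 have D: "(LINT x|\<nu>. wc x * G n (F x)) = (LINT x|\<nu>. transfer wc x * G n x)" "integrable \<nu> (\<lambda>x. wc x * G n (F x))" for n
  using duality[OF wc s G G1, of n] by auto
 have 2: "(\<lambda>n. LINT x|\<nu>. u x * G n x) \<longlonglongrightarrow> 0" by (rule mixing_zero[OF u u0 G G1 inv])
 have "(LINT x|\<nu>. wc x * G n x) - I * (LINT x|\<mu>. G n x)
   = (LINT x|\<nu>. u x * G n x) - (LINT x|\<nu>. wc x * (G n (F x) - G n x))" for n
 proof -
  have i1: "integrable \<nu> (\<lambda>x. transfer wc x * G n x)"
  proof (rule bochner_dominated[OF hol_integrable[OF ht]])
   show "AE x in \<nu>. norm (transfer wc x * G n x) <= norm (transfer wc x)"
    using G1 by (auto intro!: AE_I2 simp: norm_mult mult_left_le)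
  qed (use hol_measurable[OF ht] in measurable)
  have i2: "integrable \<nu> (\<lambda>x. complex_of_real (h x) * G n x)"
  proof (rule bochner_dominated[OF h_integrable])
   show "AE x in \<nu>. norm (complex_of_real (h x) * G n x) <= norm (h x)"
    using G1 by (auto intro!: AE_I2 simp: norm_mult mult_left_le)
  qed measurable
  have "(LINT x|\<nu>. u x * G n x) = (LINT x|\<nu>. transfer wc x * G n x - I / \<kappa> * (h x * G n x))"
   by (simp add: u_def algebra_simps)
  also have "\<dots> = (LINT x|\<nu>. transfer wc x * G n x) - I / \<kappa> * (LINT x|\<nu>. h x * G n x)"
   using i1 i2 by (subst bochner_diff) auto
  also have "I / \<kappa> * (LINT x|\<nu>. h x * G n x) = I * (LINT x|\<mu>. G n x)"
   by (subst integral_\<mu>) (auto simp: scaleR_conv_of_real divide_inverse)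
  finally have 3: "(LINT x|\<nu>. u x * G n x) = (LINT x|\<nu>. transfer wc x * G n x) - I * (LINT x|\<mu>. G n x)" .
  have "(LINT x|\<nu>. wc x * (G n (F x) - G n x)) = (LINT x|\<nu>. transfer wc x * G n x) - (LINT x|\<nu>. wc x * G n x)"
   using D[of n] wG[of n] by (simp add: right_diff_distrib)
  with 3 show ?thesis by simp
 qed
 then have "(\<lambda>n. (LINT x|\<nu>. wc x * G n x) - I * (LINT x|\<mu>. G n x)) \<longlonglongrightarrow> 0"
  using tendsto_diff[OF 2 1] by simp
 then show ?thesis by (simp add: wc_def I_def)
qed

lemma hol_suminf:
 fixes w :: "nat => 'a => 'b::euclidean_space"
 assumes w: "\<And>j. hol (c * q ^ j) (w j)" and q: "0 <= q" "q < 1"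
 shows "hol (c / (1 - q)) (\<lambda>x. \<Sum>j. w j x)" "x \<in> space \<nu> ==> summable (\<lambda>j. w j x)"
proof -
 have g: "(\<lambda>j. c * q ^ j) sums (c * (1 / (1 - q)))"
  using q by (intro sums_mult geometric_sums) auto
 then have gs: "summable (\<lambda>j. c * q ^ j)" "(\<Sum>j. c * q ^ j) = c / (1 - q)"
  by (auto simp: sums_iff)
 have sn: "summable (\<lambda>j. norm (w j x))" if x: "x \<in> space \<nu>" for x
  by (rule summable_comparison_test'[OF gs(1), of 0]) (use holD(1)[OF w x] in auto)
 then show "x \<in> space \<nu> ==> summable (\<lambda>j. w j x)" by (rule summable_norm_cancel)
 show "hol (c / (1 - q)) (\<lambda>x. \<Sum>j. w j x)"
  unfolding hol_def
 proof (intro conjI ballI)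
  fix x assume x: "x \<in> space \<nu>"
  have "norm (\<Sum>j. w j x) <= (\<Sum>j. norm (w j x))" by (rule summable_norm[OF sn[OF x]])
  also have "\<dots> <= (\<Sum>j. c * q ^ j)" by (rule suminf_le[OF holD(1)[OF w x] sn[OF x] gs(1)])
  finally show "norm (\<Sum>j. w j x) <= c / (1 - q)" by (simp add: gs(2))
  fix y assume y: "y \<in> space \<nu>"
  have le: "norm (w j x - w j y) <= c * q ^ j * d x y" for j by (rule holD(2)[OF w x y])
  have gd: "summable (\<lambda>j. c * q ^ j * d x y)" using gs(1) by (rule summable_mult2)
  have sd: "summable (\<lambda>j. norm (w j x - w j y))"
   by (rule summable_comparison_test'[OF gd, of 0]) (use le in auto)
  have "(\<Sum>j. w j x) - (\<Sum>j. w j y) = (\<Sum>j. w j x - w j y)"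
   by (rule suminf_diff) (use sn x y in \<open>auto intro: summable_norm_cancel\<close>)
  also have "norm \<dots> <= (\<Sum>j. norm (w j x - w j y))" by (rule summable_norm[OF sd])
  also have "\<dots> <= (\<Sum>j. c * q ^ j * d x y)" by (rule suminf_le[OF le sd gd])
  also have "\<dots> = c / (1 - q) * d x y" using suminf_mult2[OF gs(1), of "d x y"] by (simp add: gs(2))
  finally show "norm ((\<Sum>j. w j x) - (\<Sum>j. w j y)) <= c / (1 - q) * d x y" .
 qed
qed

text \<open>The solution is the sum of all iterates of \<open>q\<close>, which decay geometrically. Linearity
handles a finite part of the sum, and the remainder tends to 0 in norm.\<close>
lemma poisson_equation:
 fixes q :: "'a => real"
 assumes q: "hol M q" "(LINT x|\<nu>. q x) = 0"
 shows "\<exists>N G. hol N G \<and> (\<forall>x\<in>space \<nu>. transfer G x = G x - q x)"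
proof -
 define c where "c = Cgap / 2 * M"
 have k: "0 <= 1 - gap" "1 - gap < 1" using gap by auto
 have h1: "hol (c * (1 - gap) ^ j) (iter j q)" for j
  using contraction_real[OF q, of j] by (simp add: c_def mult_ac)
 have shift: "hol ((c * (1 - gap) ^ N) * (1 - gap) ^ j) (iter (j + N) q)" for j N
  using h1[of "j + N"] by (simp add: power_add mult_ac)
 define G where "G x = (\<Sum>j. iter j q x)" for x
 define P where "P N x = (\<Sum>j<N. iter j q x)" for N x
 define R where "R N x = (\<Sum>j. iter (j + N) q x)" for N x
 have hG: "hol (c / (1 - (1 - gap))) G"
  unfolding G_def using hol_suminf(1)[OF h1 k] by simp
 have hR: "hol (c * (1 - gap) ^ N / (1 - (1 - gap))) (R N)" for N
  unfolding R_def using hol_suminf(1)[OF shift[of N] k] .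
 have split: "G x = R N x + P N x" if x: "x \<in> space \<nu>" for x N
  unfolding G_def R_def P_def
  by (rule suminf_split_initial_segment) (rule hol_suminf(2)[OF h1 k x])
 have hP: "\<exists>B. hol B (P N) \<and> (\<forall>x\<in>space \<nu>. transfer (P N) x = P (Suc N) x - q x)" for N
 proof (induction N)
  case 0
  have "transfer (P 0) x = 0" if "x \<in> space \<nu>" for x by (simp add: P_def transfer_def)
  moreover have "hol 0 (P 0)" by (simp add: P_def hol_def)
  moreover have "P (Suc 0) x = q x" for x by (simp add: P_def)
  ultimately show ?case by auto
 next
  case (Suc N)
  then obtain B where B: "hol B (P N)" "\<And>x. x \<in> space \<nu> ==> transfer (P N) x = P (Suc N) x - q x" by auto
  have eq: "P (Suc N) = (\<lambda>x. P N x + iter N q x)" by (simp add: P_def fun_eq_iff)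
  have "transfer (P (Suc N)) x = P (Suc (Suc N)) x - q x" if x: "x \<in> space \<nu>" for x
   unfolding eq transfer_add_hol[OF B(1) h1 x] B(2)[OF x] by (simp add: P_def)
  with hol_add[OF B(1) h1[of N]] show ?case unfolding eq[symmetric] by blast
 qed
 have "transfer G x = G x - q x" if x: "x \<in> space \<nu>" for x
 proof -
  have eq: "transfer G x - (G x - q x) = transfer (R N) x - R (Suc N) x" for N
  proof -
   obtain B where B: "hol B (P N)" "\<And>x. x \<in> space \<nu> ==> transfer (P N) x = P (Suc N) x - q x" using hP by blast
   have "transfer G x = transfer (\<lambda>x. R N x + P N x) x" by (rule transfer_cong[OF split x])
   also have "\<dots> = transfer (R N) x + (P (Suc N) x - q x)"
    unfolding transfer_add_hol[OF hR B(1) x] B(2)[OF x] ..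
   finally show ?thesis using split[OF x, of "Suc N"] by simp
  qed
  have lim: "(\<lambda>N. A * (1 - gap) ^ N) \<longlonglongrightarrow> 0" for A
   using k gap by (intro tendsto_mult_right_zero LIMSEQ_realpow_zero) auto
  have "(\<lambda>N. transfer (R N) x) \<longlonglongrightarrow> 0"
  proof (rule Lim_null_comparison[OF _ lim])
   show "\<forall>\<^sub>F N in sequentially. norm (transfer (R N) x) <= (CL * suminf p * c / gap) * (1 - gap) ^ N"
    using holD(1)[OF hol_transfer[OF hR] x] by (intro always_eventually allI) (simp add: mult_ac)
  qed
  moreover have "(\<lambda>N. R (Suc N) x) \<longlonglongrightarrow> 0"
  proof (rule Lim_null_comparison[OF _ lim])
   show "\<forall>\<^sub>F N in sequentially. norm (R (Suc N) x) <= (c * (1 - gap) / gap) * (1 - gap) ^ N"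
    using holD(1)[OF hR x] by (intro always_eventually allI order_trans[OF holD(1)[OF hR x]]) (simp add: mult_ac)
  qed
  ultimately have "(\<lambda>N. transfer (R N) x - R (Suc N) x) \<longlonglongrightarrow> 0 - 0" by (rule tendsto_diff)
  then show ?thesis unfolding eq[symmetric] by (simp add: LIMSEQ_const_iff)
 qed
 with hG show ?thesis by blast
qed

lemma hol_divide_h:
 fixes u :: "'a => real"
 assumes u: "hol M u" shows "\<exists>N. hol N (\<lambda>x. u x / h x)"
proof -
 have "hol (1 / hmin + H / hmin\<^sup>2) (\<lambda>x. 1 / h x)"
  unfolding hol_def
 proof (intro conjI ballI)
  fix x assume x: "x \<in> space \<nu>"
  have "1 / h x <= 1 / hmin" using hmin(1) hmin(2)[OF x] by (simp add: frac_le)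
  also have "\<dots> <= 1 / hmin + H / hmin\<^sup>2" using H_pos hmin(1) by simp
  finally show "norm (1 / h x) <= 1 / hmin + H / hmin\<^sup>2" using h_pos[OF x] by simp
  fix y assume y: "y \<in> space \<nu>"
  have "norm (1 / h x - 1 / h y) = \<bar>h x - h y\<bar> / (h x * h y)"
   using h_pos[OF x] h_pos[OF y] by (simp add: field_simps abs_div abs_mult abs_minus_commute)
  also have "\<dots> <= H * d x y / (hmin * hmin)"
   using holD(2)[OF h_hol x y] hmin(1) hmin(2)[OF x] hmin(2)[OF y] H_pos d_nonneg[OF x y]
   by (intro frac_le mult_mono) auto
  also have "\<dots> = H / hmin\<^sup>2 * d x y" by (simp add: power2_eq_square)
  also have "\<dots> <= (1 / hmin + H / hmin\<^sup>2) * d x y"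
   using hmin(1) d_nonneg[OF x y] by (intro mult_right_mono) auto
  finally show "norm (1 / h x - 1 / h y) <= (1 / hmin + H / hmin\<^sup>2) * d x y" .
 qed
 from hol_mult[OF u this] show ?thesis by auto
qed

text \<open>With \<open>G\<close> solving the Poisson equation for \<open>q = transfer (X * h)\<close>, the
choice \<open>\<psi> = G / h\<close> makes the conditional expectation of
\<open>X + \<psi> - \<psi> \<circ> F\<close> given \<open>F\<close> vanish: its transfer is
\<open>q + (G - q) - \<psi> * h = 0\<close>.\<close>
lemma gordin_decomposition:
 assumes X: "branch_hol b X" and s: "summable (\<lambda>n. p n * b n)" and mean: "(LINT x|\<nu>. X x * h x) = 0"
 shows "\<exists>c. \<exists>\<psi> :: 'a => real. hol c \<psi> \<and> branch_hol (\<lambda>n. b n + 2 * c) (\<lambda>x. X x + \<psi> x - \<psi> (F x)) \<and>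
   (\<forall>x\<in>space \<nu>. transfer (\<lambda>x. (X x + \<psi> x - \<psi> (F x)) * h x) x = 0)"
proof -
 note B = branch_hol_mult[OF X h_hol] summable_branch_mult[OF s, of H]
 define q where "q = transfer (\<lambda>x. X x * h x)"
 have hq: "hol (CL * 2 * (\<Sum>n. p n * b n) * H) q" unfolding q_def by (rule hol_transfer_mult[OF X s h_hol])
 have q0: "(LINT x|\<nu>. q x) = 0"
  unfolding q_def using integral_transfer[OF branch_hol_measurable[OF B(1)] branch_holD(1)[OF B(1)] B(2)] mean by simp
 obtain N G where G: "hol N G" "\<And>x. x \<in> space \<nu> ==> transfer G x = G x - q x"
  using poisson_equation[OF hq q0] by blast
 obtain c where c: "hol c (\<lambda>x. G x / h x)" using hol_divide_h[OF G(1)] by blast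
 define \<psi> where "\<psi> x = G x / h x" for x
 have h\<psi>: "hol c \<psi>" using c by (simp add: \<psi>_def[abs_def])
 note c0 = hol_nonneg[OF h\<psi>]
 note b\<psi> = branch_holD[OF hol_branch[OF h\<psi>]]
 have bM: "branch_hol (\<lambda>n. b n + 2 * c) (\<lambda>x. X x + \<psi> x - \<psi> (F x))"
  unfolding branch_hol_def
 proof (intro conjI allI ballI)
  fix n x assume x: "x \<in> space \<nu>"
  show "norm (X (v n x) + \<psi> (v n x) - \<psi> (F (v n x))) <= b n + 2 * c"
   using branch_holD(1)[OF X x, of n] b\<psi>(1)[OF x, of n] holD(1)[OF h\<psi> x] F_v[OF x] by simp
  fix y assume y: "y \<in> space \<nu>"
  show "norm (X (v n x) + \<psi> (v n x) - \<psi> (F (v n x)) - (X (v n y) + \<psi> (v n y) - \<psi> (F (v n y)))) <= (b n + 2 * c) * d x y"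
   using branch_holD(2)[OF X x y, of n] b\<psi>(2)[OF x y, of n] holD(2)[OF h\<psi> x y] F_v[OF x] F_v[OF y]
   by (simp add: algebra_simps)
 qed
 have "transfer (\<lambda>x. (X x + \<psi> x - \<psi> (F x)) * h x) x = 0" if x: "x \<in> space \<nu>" for x
 proof -
  have "transfer (\<lambda>x. (X x + \<psi> x - \<psi> (F x)) * h x) x = (\<Sum>n. g n x *\<^sub>R (X (v n x) * h (v n x)) + g n x *\<^sub>R G (v n x) - \<psi> x * (g n x *\<^sub>R h (v n x)))"
   unfolding transfer_def using x h_pos[OF v_in[OF x]]
   by (intro suminf_cong) (simp add: F_v \<psi>_def algebra_simps less_imp_neq[symmetric])
  also have "\<dots> = transfer (\<lambda>x. X x * h x) x + transfer G x - \<psi> x * transfer h x"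
  proof -
   note s1 = branch_summable(2)[OF B x] and s2 = hol_summable[OF G(1) x] and s3 = hol_summable[OF h_hol x]
   show ?thesis
    unfolding transfer_def suminf_mult[OF s3, symmetric] suminf_add[OF s1 s2]
    by (rule suminf_diff[OF summable_add[OF s1 s2] summable_mult[OF s3], symmetric])
  qed
  also have "\<dots> = 0" using x h_pos[OF x] by (simp add: G(2) transfer_h q_def[symmetric] \<psi>_def)
  finally show ?thesis .
 qed
 with h\<psi> bM show ?thesis by blast
qed

end

text \<open>The condition \<open>transfer_X\<close> says that \<open>X \<circ> F^k\<close> are reverse
martingale differences for \<open>\<mu>\<close>.\<close>
locale martingale_transfer = twisted_transfer +
 assumes transfer_X: "\<And>x. x \<in> space \<nu> ==> transfer (\<lambda>x. X x * h x) x = 0"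
  and X2_\<nu>: "integrable \<nu> (\<lambda>x. (X x)\<^sup>2)"
begin

definition \<sigma>2 :: real where "\<sigma>2 = (LINT x|\<mu>. (X x)\<^sup>2)"

lemma X_integrable: "integrable \<mu> X" and X2_integrable: "integrable \<mu> (\<lambda>x. (X x)\<^sup>2)"
 and X_mean: "(LINT x|\<mu>. X x) = 0"
proof -
 note B = branch_hol_mult[OF X h_hol] summable_branch_mult[OF X_summable, of H]
 have i: "integrable \<nu> (\<lambda>x. X x * h x)"
  by (rule integrable_branch[OF branch_hol_measurable[OF B(1)] branch_holD(1)[OF B(1)] B(2)])
 then show "integrable \<mu> X" by (subst integral_\<mu>(2)) (auto simp: mult.commute)
 have "(LINT x|\<nu>. X x * h x) = (LINT x|\<nu>. transfer (\<lambda>x. X x * h x) x)"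
  by (rule integral_transfer[OF branch_hol_measurable[OF B(1)] branch_holD(1)[OF B(1)] B(2), symmetric])
 also have "\<dots> = (LINT x|\<nu>. 0)" by (rule bochner_cong[OF refl transfer_X])
 finally show "(LINT x|\<mu>. X x) = 0" by (subst integral_\<mu>(1)) (auto simp: mult.commute)
 have "integrable \<nu> (\<lambda>x. h x *\<^sub>R (X x)\<^sup>2)"
 proof (rule bochner_dominated[OF integrable_mult_right[OF X2_\<nu>, of H]])
  show "AE x in \<nu>. norm (h x *\<^sub>R (X x)\<^sup>2) <= norm (H * (X x)\<^sup>2)"
   using holD(1)[OF h_hol] H_pos by (auto intro!: AE_I2 mult_right_mono simp: abs_mult)
 qed measurable
 then show "integrable \<mu> (\<lambda>x. (X x)\<^sup>2)" by (subst integral_\<mu>(2)) auto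
qed

lemma \<sigma>2_nonneg: "0 <= \<sigma>2"
 unfolding \<sigma>2_def by (rule integral_nonneg_AE) simp

lemma cis_second_order:
 "norm (cis a - 1 - \<i> * a) <= 2 * \<bar>a\<bar> * min 1 \<bar>a\<bar>"
proof -
 have "norm (cis a - 1 - \<i> * a) <= \<bar>a\<bar>\<^sup>2 / 2" "norm (cis a - 1 - \<i> * a) <= 2 * \<bar>a\<bar>"
  using iexp_approx1[of a 1] iexp_approx2[of a 1]
  by (simp_all add: cis_conv_exp numeral_2_eq_2 algebra_simps diff_diff_eq)
 moreover have "\<bar>a\<bar>\<^sup>2 / 2 <= 2 * \<bar>a\<bar> * \<bar>a\<bar>"
  using mult_nonneg_nonneg[of "\<bar>a\<bar>" "\<bar>a\<bar>"] unfolding power2_eq_square by linarith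
 ultimately show ?thesis by (cases "\<bar>a\<bar> <= 1") (auto simp: min_def)
qed

lemma cis_second_order_diff:
 assumes B: "\<bar>a\<bar> <= B" "\<bar>a'\<bar> <= B"
 shows "norm ((cis a - 1 - \<i> * a) - (cis a' - 1 - \<i> * a')) <= \<bar>a - a'\<bar> * (2 * min 1 B)"
proof -
 have e: "(cis a - 1 - \<i> * a) - (cis a' - 1 - \<i> * a')
   = cis a' * (cis (a - a') - 1 - \<i> * (a - a')) + \<i> * (a - a') * (cis a' - 1)"
  by (simp add: algebra_simps cis_mult)
 have 1: "norm ((cis a - 1 - \<i> * a) - (cis a' - 1 - \<i> * a')) <= \<bar>a - a'\<bar> * (2 * B)"
 proof -
  have "norm (cis (a - a') - 1 - \<i> * (a - a')) <= \<bar>a - a'\<bar>\<^sup>2 / 2"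
   using iexp_approx1[of "a - a'" 1] by (simp add: cis_conv_exp numeral_2_eq_2 algebra_simps diff_diff_eq)
  also have "\<dots> <= \<bar>a - a'\<bar> * B"
  proof -
   have "\<bar>a - a'\<bar> * \<bar>a - a'\<bar> <= \<bar>a - a'\<bar> * (2 * B)" using B by (intro mult_left_mono) auto
   then show ?thesis unfolding power2_eq_square by linarith
  qed
  finally have "norm (cis a' * (cis (a - a') - 1 - \<i> * (a - a'))) <= \<bar>a - a'\<bar> * B" by (simp add: norm_mult)
  moreover have "norm (\<i> * (a - a') * (cis a' - 1)) <= \<bar>a - a'\<bar> * B"
   using mult_left_mono[OF order_trans[OF norm_cis_minus_one[of a'] B(2)], of "\<bar>a - a'\<bar>"]
   by (simp add: norm_mult flip: of_real_diff)
  ultimately show ?thesis unfolding e by (intro norm_triangle_le) simp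
 qed
 have 2: "norm ((cis a - 1 - \<i> * a) - (cis a' - 1 - \<i> * a')) <= \<bar>a - a'\<bar> * 2"
 proof -
  have "(cis a - 1 - \<i> * a) - (cis a' - 1 - \<i> * a') = (cis a - cis a') - \<i> * (a - a')" by (simp add: algebra_simps)
  also have "norm \<dots> <= \<bar>a - a'\<bar> + \<bar>a - a'\<bar>"
   by (intro norm_triangle_ineq4[THEN order_trans] add_mono norm_cis_diff) (simp add: norm_mult flip: of_real_diff)
  finally show ?thesis by simp
 qed
 from 1 2 show ?thesis by (simp add: min_def)
qed

text \<open>The second-order remainder of \<open>cis\<close>, integrated over the branches and divided by
\<open>s\<close>; it tends to 0 with \<open>s\<close> even if the second moment of the branch bounds is
infinite.\<close>
definition rem :: "real => real" where
 "rem s = (\<Sum>n. p n * (2 * b n * min 1 (\<bar>s\<bar> * b n)))"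

lemma rem_summable: "summable (\<lambda>n. p n * (2 * b n * min 1 (\<bar>s\<bar> * b n)))"
proof (rule summable_comparison_test'[OF summable_mult[OF X_summable, of 2], of 0])
 fix n
 have "p n * b n * min 1 (\<bar>s\<bar> * b n) <= p n * b n * 1"
  using p_nonneg branch_hol_nonneg[OF X] by (intro mult_left_mono) auto
 then show "norm (p n * (2 * b n * min 1 (\<bar>s\<bar> * b n))) <= 2 * (p n * b n)"
  using p_nonneg[of n] branch_hol_nonneg[OF X, of n] by (simp add: mult_ac)
qed

text \<open>The first-order term \<open>\<i> * s * transfer (X * h)\<close> of the perturbation vanishes by the
martingale property, which improves the order \<open>s\<close> to \<open>o(s)\<close>. This is what the central
limit theorem needs, since there \<open>k * s^2\<close> stays bounded.\<close>
lemma hol_pert_h: "hol (CL * 2 * H * \<bar>s\<bar> * rem s) (pert s (\<lambda>x. complex_of_real (h x)))"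
proof -
 define \<beta> where "\<beta> n = \<bar>s\<bar> * (2 * b n * min 1 (\<bar>s\<bar> * b n))" for n
 define w where "w x = cis (s * X x) - 1 - \<i> * (s * X x)" for x
 note b0 = branch_hol_nonneg[OF X]
 have w: "branch_hol \<beta> w"
  unfolding branch_hol_def
 proof (intro conjI allI ballI)
  fix n x assume x: "x \<in> space \<nu>"
  have a: "\<bar>s * X (v n x)\<bar> <= \<bar>s\<bar> * b n" if x: "x \<in> space \<nu>" for x
   using branch_holD(1)[OF X x, of n] by (simp add: abs_mult mult_left_mono)
  have "norm (w (v n x)) <= 2 * \<bar>s * X (v n x)\<bar> * min 1 \<bar>s * X (v n x)\<bar>"
   unfolding w_def using cis_second_order[of "s * X (v n x)"] by simp
  also have "\<dots> <= 2 * (\<bar>s\<bar> * b n) * min 1 (\<bar>s\<bar> * b n)"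
   using a[OF x] by (intro mult_mono) auto
  finally show "norm (w (v n x)) <= \<beta> n" by (simp add: \<beta>_def mult_ac)
  fix y assume y: "y \<in> space \<nu>"
  have "norm (w (v n x) - w (v n y)) <= \<bar>s * X (v n x) - s * X (v n y)\<bar> * (2 * min 1 (\<bar>s\<bar> * b n))"
   unfolding w_def using cis_second_order_diff[OF a[OF x] a[OF y]] by simp
  also have "\<dots> <= (\<bar>s\<bar> * (b n * d x y)) * (2 * min 1 (\<bar>s\<bar> * b n))"
  proof (rule mult_right_mono)
   have "\<bar>s * X (v n x) - s * X (v n y)\<bar> = \<bar>s\<bar> * \<bar>X (v n x) - X (v n y)\<bar>"
    by (simp add: abs_mult flip: right_diff_distrib)
   then show "\<bar>s * X (v n x) - s * X (v n y)\<bar> <= \<bar>s\<bar> * (b n * d x y)"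
    using branch_holD(2)[OF X x y, of n] by (simp add: mult_left_mono)
  qed (use b0[of n] in auto)
  finally show "norm (w (v n x) - w (v n y)) <= \<beta> n * d x y" by (simp add: \<beta>_def mult_ac)
 qed
 have s\<beta>: "summable (\<lambda>n. p n * \<beta> n)" "(\<Sum>n. p n * \<beta> n) = \<bar>s\<bar> * rem s"
  using summable_mult[OF rem_summable[of s], of "\<bar>s\<bar>"] suminf_mult[OF rem_summable[of s], of "\<bar>s\<bar>"]
  by (auto simp: \<beta>_def rem_def mult_ac)
 note hh = hol_of_real[OF h_hol]
 have "hol (CL * 2 * (\<bar>s\<bar> * rem s) * H) (transfer (\<lambda>x. w x * h x))"
  using hol_transfer_mult[OF w s\<beta>(1) hh] by (simp add: s\<beta>(2))
 moreover have "pert s (\<lambda>x. complex_of_real (h x)) x = transfer (\<lambda>x. w x * h x) x" if x: "x \<in> space \<nu>" for x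
 proof -
  note B = branch_hol_mult[OF X h_hol] summable_branch_mult[OF X_summable, of H]
  have bl: "bounded_linear (\<lambda>r. \<i> * (s * complex_of_real r))"
   by (intro bounded_linear_const_mult bounded_linear_of_real)
  have t0: "transfer (\<lambda>x. \<i> * (s * complex_of_real (X x * h x))) x = 0"
   using transfer_linear[OF B bl x] transfer_X[OF x] by (simp del: of_real_mult)
  have sm: "summable (\<lambda>n. g n x *\<^sub>R (\<i> * (s * complex_of_real (X (v n x) * h (v n x)))))"
   using bounded_linear.summable[OF bl branch_summable(2)[OF B x]] by (simp add: scaleR_conv_of_real mult_ac)
  have "pert s (\<lambda>x. complex_of_real (h x)) x = (\<Sum>n. g n x *\<^sub>R (w (v n x) * h (v n x)) + g n x *\<^sub>R (\<i> * (s * complex_of_real (X (v n x) * h (v n x)))))"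
   unfolding pert_def transfer_def by (intro suminf_cong) (simp add: w_def scaleR_conv_of_real algebra_simps)
  also have "\<dots> = transfer (\<lambda>x. w x * h x) x + transfer (\<lambda>x. \<i> * (s * complex_of_real (X x * h x))) x"
   unfolding transfer_def
   by (rule suminf_add[OF branch_summable(2)[OF branch_hol_mult[OF w hh] summable_branch_mult[OF s\<beta>(1)] x] sm, symmetric])
  finally show ?thesis unfolding t0 by simp
 qed
 ultimately show ?thesis using hol_cong[of "pert s (\<lambda>x. complex_of_real (h x))"] by (simp add: mult_ac)
qed

lemma rem_tendsto: "s \<longlonglongrightarrow> 0 ==> (\<lambda>n. rem (s n)) \<longlonglongrightarrow> 0"
proof -
 assume s: "s \<longlonglongrightarrow> 0"
 have "((\<lambda>n. \<Sum>k. p k * (2 * b k * min 1 (\<bar>s n\<bar> * b k))) \<longlongrightarrow> (\<Sum>k. 0)) sequentially"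
 proof (rule tannerys_theorem[THEN conjunct2, THEN conjunct2])
  fix k
  have "(\<lambda>n. p k * (2 * b k * min 1 (\<bar>s n\<bar> * b k))) \<longlonglongrightarrow> p k * (2 * b k * min 1 (\<bar>0\<bar> * b k))"
   by (intro tendsto_intros s)
  then show "(\<lambda>n. p k * (2 * b k * min 1 (\<bar>s n\<bar> * b k))) \<longlonglongrightarrow> 0" by simp
 next
  have "norm (p k * (2 * b k * min 1 (\<bar>s n\<bar> * b k))) <= 2 * (p k * b k)" for k n
  proof -
   have "p k * b k * min 1 (\<bar>s n\<bar> * b k) <= p k * b k * 1"
    using p_nonneg branch_hol_nonneg[OF X] by (intro mult_left_mono) auto
   then show ?thesis using p_nonneg[of k] branch_hol_nonneg[OF X, of k] by (simp add: mult_ac)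
  qed
  then show "\<forall>\<^sub>F (k, n) in at_top \<times>\<^sub>F sequentially. norm (p k * (2 * b k * min 1 (\<bar>s n\<bar> * b k))) <= 2 * (p k * b k)"
   by (intro always_eventually) auto
 qed (use summable_mult[OF X_summable] in auto)
 then show ?thesis by (simp add: rem_def[abs_def])
qed

text \<open>The characteristic function is close to \<open>char1 (t / sqrt n) ^ n\<close>, which is handled as
for independent variables with finite variance.\<close>
lemma char_clt: "(\<lambda>n. charS (t / sqrt n) n) \<longlonglongrightarrow> exp (- (t\<^sup>2 * \<sigma>2 / 2))"
proof -
 define s where "s n = t / sqrt (real n)" for n
 have s0: "s \<longlonglongrightarrow> 0"
  unfolding s_def by (intro tendsto_divide_0[OF tendsto_const] filterlim_at_top_imp_at_infinity
   filterlim_compose[OF sqrt_at_top filterlim_real_sequentially])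
 have s2: "real n * (s n)\<^sup>2 = t\<^sup>2" if "n > 0" for n using that by (simp add: s_def power_divide)
 have "(\<lambda>n. Cpert * Ctw * \<bar>s n\<bar>) \<longlonglongrightarrow> Cpert * Ctw * \<bar>0\<bar>" by (intro tendsto_intros s0)
 then have ev: "\<forall>\<^sub>F n in sequentially. Cpert * Ctw * \<bar>s n\<bar> < gap / 2"
  using gap by (intro order_tendstoD(2)) auto
 define C where "C = t\<^sup>2 * (Drate * (CL * 2 * H))"
 have 1: "(\<lambda>n. charS (s n) n - char1 (s n) ^ n) \<longlonglongrightarrow> 0"
 proof (rule Lim_null_comparison)
  show "\<forall>\<^sub>F n in sequentially. norm (charS (s n) n - char1 (s n) ^ n) <= C * rem (s n)"
   using ev eventually_gt_at_top[of 0]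
  proof eventually_elim
   case (elim n)
   have "norm (charS (s n) n - char1 (s n) ^ n) <= n * (Drate * \<bar>s n\<bar> * (CL * 2 * H * \<bar>s n\<bar> * rem (s n)))"
    by (rule charS_power[OF hol_pert_h]) (use elim in simp)
   also have "\<dots> = (n * (s n)\<^sup>2) * (Drate * (CL * 2 * H)) * rem (s n)"
    by (simp add: power2_eq_square mult_ac flip: abs_mult)
   finally show ?case unfolding s2[OF elim(2)] C_def .
  qed
  show "(\<lambda>n. C * rem (s n)) \<longlonglongrightarrow> 0" by (intro tendsto_mult_right_zero rem_tendsto s0)
 qed
 define A where "A n = (LINT x|\<mu>. min (6 * (X x)\<^sup>2) (\<bar>s n\<bar> * \<bar>X x\<bar> ^ 3))" for n
 have "A \<longlonglongrightarrow> (LINT x|\<mu>. 0)"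
  unfolding A_def
 proof (rule integral_dominated_convergence[where w = "\<lambda>x. 6 * (X x)\<^sup>2"])
  show "AE x in \<mu>. (\<lambda>n. min (6 * (X x)\<^sup>2) (\<bar>s n\<bar> * \<bar>X x\<bar> ^ 3)) \<longlonglongrightarrow> 0"
  proof (rule AE_I2)
   fix x
   have "(\<lambda>n. min (6 * (X x)\<^sup>2) (\<bar>s n\<bar> * \<bar>X x\<bar> ^ 3)) \<longlonglongrightarrow> min (6 * (X x)\<^sup>2) (\<bar>0\<bar> * \<bar>X x\<bar> ^ 3)"
    by (intro tendsto_intros s0)
   then show "(\<lambda>n. min (6 * (X x)\<^sup>2) (\<bar>s n\<bar> * \<bar>X x\<bar> ^ 3)) \<longlonglongrightarrow> 0" by simp
  qed
 qed (use X2_integrable in auto)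
 then have A0: "A \<longlonglongrightarrow> 0" by simp
 have c1: "char1 s' = char (distr \<mu> borel X) s'" for s'
  unfolding char1_def char_def by (subst integral_distr) (auto simp: cis_conv_exp)
 have var: "\<mu>.variance X = \<sigma>2" by (simp add: X_mean \<sigma>2_def)
 define z where "z n = (1 + (- (t\<^sup>2 * \<sigma>2 / 2)) / real n)" for n
 have 2: "(\<lambda>n. char1 (s n) ^ n - complex_of_real (z n) ^ n) \<longlonglongrightarrow> 0"
 proof (rule Lim_null_comparison)
  have "(\<lambda>n. t\<^sup>2 * \<sigma>2 / 2 / real n) \<longlonglongrightarrow> 0"
   by (intro tendsto_divide_0[OF tendsto_const] filterlim_at_top_imp_at_infinity filterlim_real_sequentially)
  then have "\<forall>\<^sub>F n in sequentially. t\<^sup>2 * \<sigma>2 / 2 / real n < 1" by (rule order_tendstoD) simp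
  then show "\<forall>\<^sub>F n in sequentially. norm (char1 (s n) ^ n - complex_of_real (z n) ^ n) <= t\<^sup>2 / 6 * A n"
   using eventually_gt_at_top[of 0]
  proof eventually_elim
   case (elim n)
   have z1: "norm (complex_of_real (z n)) <= 1"
    unfolding norm_of_real using elim \<sigma>2_nonneg by (simp add: z_def abs_le_iff)
   have "norm (char1 (s n) - (1 - (s n)\<^sup>2 * \<sigma>2 / 2)) <= (s n)\<^sup>2 / 6 * A n"
    unfolding c1 A_def by (rule \<mu>.char_approx3'[OF _ X_integrable X2_integrable X_mean var refl]) simp
   moreover have "(1 - (s n)\<^sup>2 * \<sigma>2 / 2) = z n"
    using s2[OF elim(2)] elim(2) by (simp add: z_def field_simps)
   ultimately have 3: "norm (char1 (s n) - complex_of_real (z n)) <= (s n)\<^sup>2 / 6 * A n" by (metis of_real_diff of_real_1)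
   have "norm (char1 (s n) ^ n - complex_of_real (z n) ^ n) <= n * norm (char1 (s n) - complex_of_real (z n))"
    using norm_charS[of "s n" 1] z1
    by (intro norm_power_diff) (auto simp: charS_def char1_def birkhoff_sum_def)
   also have "\<dots> <= n * ((s n)\<^sup>2 / 6 * A n)" by (intro mult_left_mono 3) simp
   also have "\<dots> = t\<^sup>2 / 6 * A n" using s2[OF elim(2)] by simp
   finally show ?case .
  qed
  show "(\<lambda>n. t\<^sup>2 / 6 * A n) \<longlonglongrightarrow> 0" by (intro tendsto_mult_right_zero A0)
 qed
 have "(\<lambda>n. z n ^ n) \<longlonglongrightarrow> exp (- (t\<^sup>2 * \<sigma>2 / 2))"
  unfolding z_def by (rule tendsto_exp_limit_sequentially)
 then have 3: "(\<lambda>n. complex_of_real (z n ^ n)) \<longlonglongrightarrow> complex_of_real (exp (- (t\<^sup>2 * \<sigma>2 / 2)))"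
  by (rule tendsto_of_real)
 have "(\<lambda>n. (charS (s n) n - char1 (s n) ^ n) + (char1 (s n) ^ n - complex_of_real (z n) ^ n) + complex_of_real (z n ^ n))
   \<longlonglongrightarrow> 0 + 0 + complex_of_real (exp (- (t\<^sup>2 * \<sigma>2 / 2)))"
  by (intro tendsto_add 1 2 3)
 then show ?thesis by (simp add: s_def)
qed

lemma distr_F_funpow: "distr \<mu> \<mu> (F ^^ k) = \<mu>"
 by (rule distr_funpow[OF _ distr_F]) measurable

text \<open>For bounded functions in place of \<open>X \<circ> F^j\<close> this is duality; truncation and
dominated convergence give the general case.\<close>
lemma orthogonal:
 "(LINT x|\<mu>. X x * X ((F ^^ Suc j) x)) = 0"
 "integrable \<mu> (\<lambda>x. X x * X ((F ^^ j) x))"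
proof -
 have i2: "integrable \<mu> (\<lambda>x. (X ((F ^^ j) x))\<^sup>2)" for j
 proof -
  have "integrable (distr \<mu> \<mu> (F ^^ j)) (\<lambda>x. (X x)\<^sup>2)" using X2_integrable by (simp add: distr_F_funpow)
  then show ?thesis by (subst (asm) integrable_distr_eq) auto
 qed
 have ab: "\<bar>a * b\<bar> <= a\<^sup>2 + b\<^sup>2" for a b :: real
  using sum_squares_bound[of "\<bar>a\<bar>" "\<bar>b\<bar>"] mult_nonneg_nonneg[of "\<bar>a\<bar>" "\<bar>b\<bar>"]
  unfolding abs_mult power2_abs by linarith
 show i: "integrable \<mu> (\<lambda>x. X x * X ((F ^^ j) x))" for j
  by (rule bochner_dominated[OF Bochner_Integration.integrable_add[OF X2_integrable i2[of j]]])
    (auto intro!: AE_I2 order_trans[OF ab])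
 note B = branch_hol_mult[OF X h_hol] summable_branch_mult[OF X_summable, of H]
 define w where "w N x = max (- real N) (min (real N) (X ((F ^^ j) x)))" for N x
 have wm[measurable]: "w N \<in> borel_measurable \<nu>" for N unfolding w_def[abs_def] by measurable
 have wN: "\<bar>w N x\<bar> <= real N" for N x by (simp add: w_def)
 have wX: "\<bar>w N x\<bar> <= \<bar>X ((F ^^ j) x)\<bar>" for N x by (auto simp: w_def)
 have z: "(LINT x|\<mu>. X x * w N (F x)) = 0" for N
 proof -
  have "(LINT x|\<mu>. X x * w N (F x)) = (LINT x|\<nu>. (X x * h x) * w N (F x)) / \<kappa>"
   by (subst integral_\<mu>) (auto simp: mult_ac divide_inverse)
  also have "(LINT x|\<nu>. (X x * h x) * w N (F x)) = (LINT x|\<nu>. transfer (\<lambda>x. X x * h x) x * w N x)"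
   by (rule duality(1)[OF B, of _ "real N"]) (use wN in auto)
  also have "\<dots> = (LINT x|\<nu>. 0)" by (rule bochner_cong) (auto simp: transfer_X)
  finally show ?thesis by simp
 qed
 have "(\<lambda>N. LINT x|\<mu>. X x * w N (F x)) \<longlonglongrightarrow> (LINT x|\<mu>. X x * X ((F ^^ Suc j) x))"
 proof (rule integral_dominated_convergence[where w = "\<lambda>x. \<bar>X x * X ((F ^^ Suc j) x)\<bar>"])
  show "AE x in \<mu>. (\<lambda>N. X x * w N (F x)) \<longlonglongrightarrow> X x * X ((F ^^ Suc j) x)"
  proof (rule AE_I2)
   fix x
   define y where "y = X ((F ^^ Suc j) x)"
   have "\<forall>\<^sub>F N in sequentially. w N (F x) = y"
    using eventually_ge_at_top[of "nat \<lceil>\<bar>y\<bar>\<rceil>"]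
   proof eventually_elim
    case (elim N)
    then have "\<bar>y\<bar> <= real N" by linarith
    then show ?case by (auto simp: w_def y_def funpow_swap1)
   qed
   then have "\<forall>\<^sub>F N in sequentially. X x * w N (F x) = X x * y" by eventually_elim simp
   then show "(\<lambda>N. X x * w N (F x)) \<longlonglongrightarrow> X x * X ((F ^^ Suc j) x)"
    unfolding y_def by (rule tendsto_eventually)
  qed
  show "AE x in \<mu>. norm (X x * w N (F x)) <= \<bar>X x * X ((F ^^ Suc j) x)\<bar>" for N
   using wX[of N "F x" for x] by (auto intro!: AE_I2 mult_left_mono simp: abs_mult funpow_swap1)
 qed (use i[of "Suc j"] in auto)
 then show "(LINT x|\<mu>. X x * X ((F ^^ Suc j) x)) = 0" by (simp add: z LIMSEQ_const_iff)
qed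

end

section \<open>Maximal inequality, existence of limit laws and closeness in law\<close>

text \<open>Exceptional sets in convergence in probability; measurability is included because finite unions are
formed.\<close>
definition (in prob_space) vanishing :: "(nat => 'a set) => bool" where
 "vanishing U \<longleftrightarrow> (\<forall>n. U n \<in> sets M) \<and> (\<lambda>n. prob (U n)) \<longlonglongrightarrow> 0"

lemma (in prob_space) vanishing_Un:
 assumes U: "vanishing U" and V: "vanishing V" shows "vanishing (\<lambda>n. U n \<union> V n)"
proof -
 have "(\<lambda>n. prob (U n) + prob (V n)) \<longlonglongrightarrow> 0 + 0" using U V by (intro tendsto_add) (simp_all add: vanishing_def)
 then have 0: "(\<lambda>n. prob (U n) + prob (V n)) \<longlonglongrightarrow> 0" by simp
 have "(\<lambda>n. prob (U n \<union> V n)) \<longlonglongrightarrow> 0"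
  by (rule Lim_null_comparison[OF _ 0], rule always_eventually) (use U V in \<open>auto simp: vanishing_def intro!: measure_Un_le\<close>)
 then show ?thesis using U V by (auto simp: vanishing_def)
qed

locale orthogonal_stationary = prob_space +
 fixes F :: "'a => 'a" and X :: "'a => real"
 assumes F[measurable]: "F \<in> measurable M M" and inv: "distr M M F = M"
  and X[measurable]: "X \<in> borel_measurable M" and X2: "integrable M (\<lambda>x. (X x)\<^sup>2)"
  and XX_integrable: "\<And>j. integrable M (\<lambda>x. X x * X ((F ^^ j) x))"
  and orth: "\<And>j. (LINT x|M. X x * X ((F ^^ Suc j) x)) = 0"
begin

lemma F_pow[measurable]: "(F ^^ k) \<in> measurable M M"
 by (induction k) (auto simp: measurable_comp)

lemmas inv_pow = distr_funpow[OF F inv]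

lemma invariant_integral:
 fixes u :: "'a => real"
 assumes [measurable]: "u \<in> borel_measurable M"
 shows "(LINT x|M. u ((F ^^ k) x)) = (LINT x|M. u x)" "integrable M (\<lambda>x. u ((F ^^ k) x)) \<longleftrightarrow> integrable M u"
proof -
 have "integral\<^sup>L (distr M M (F ^^ k)) u = (LINT x|M. u ((F ^^ k) x))" by (rule integral_distr) measurable
 then show "(LINT x|M. u ((F ^^ k) x)) = (LINT x|M. u x)" by (simp add: inv_pow)
 have "integrable (distr M M (F ^^ k)) u \<longleftrightarrow> integrable M (\<lambda>x. u ((F ^^ k) x))" by (rule integrable_distr_eq) measurable
 then show "integrable M (\<lambda>x. u ((F ^^ k) x)) \<longleftrightarrow> integrable M u" by (simp add: inv_pow)
qed

abbreviation S where "S \<equiv> birkhoff_sum F X"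

lemma S_measurable[measurable]: "S n \<in> borel_measurable M"
 unfolding birkhoff_sum_def by measurable

lemma S_square: "integrable M (\<lambda>x. (S n x)\<^sup>2)" "(LINT x|M. (S n x)\<^sup>2) = n * (LINT x|M. (X x)\<^sup>2)"
proof (induction n)
 case 0
 { case 1 show ?case by (simp add: birkhoff_sum_def) }
 { case 2 show ?case by (simp add: birkhoff_sum_def) }
next
 case (Suc n)
 have SF: "S n (F x) = (\<Sum>i<n. X ((F ^^ Suc i) x))" for x
  by (simp add: birkhoff_sum_def funpow_swap1)
 have i1: "integrable M (\<lambda>x. X x * S n (F x))"
  unfolding SF sum_distrib_left by (intro Bochner_Integration.integrable_sum XX_integrable)
 have e1: "(LINT x|M. X x * S n (F x)) = 0"
  unfolding SF sum_distrib_left by (subst Bochner_Integration.integral_sum) (auto intro!: XX_integrable simp: orth simp del: funpow.simps)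
 have i2: "integrable M (\<lambda>x. (S n (F x))\<^sup>2)" and e2: "(LINT x|M. (S n (F x))\<^sup>2) = (LINT x|M. (S n x)\<^sup>2)"
  using invariant_integral[of "\<lambda>x. (S n x)\<^sup>2" 1] Suc by auto
 have eq: "(S (Suc n) x)\<^sup>2 = (X x)\<^sup>2 + 2 * (X x * S n (F x)) + (S n (F x))\<^sup>2" for x
  by (simp add: birkhoff_sum_Suc power2_sum)
 { case 1 show ?case unfolding eq using X2 i1 i2 by auto }
 { case 2
  have "(LINT x|M. (S (Suc n) x)\<^sup>2) = (LINT x|M. (X x)\<^sup>2) + 2 * (LINT x|M. X x * S n (F x)) + (LINT x|M. (S n (F x))\<^sup>2)"
   unfolding eq using X2 i1 i2 by simp
  then show ?case using Suc e1 e2 by (simp add: algebra_simps) }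
qed

text \<open>The sum of the squares of all Birkhoff sums over the dyadic blocks of \<open>{0..<2^r}\<close>, as
in the Rademacher-Menshov inequality.\<close>
fun Q :: "nat => 'a => real" where
 "Q 0 x = (X x)\<^sup>2"
| "Q (Suc r) x = Q r x + Q r ((F ^^ (2 ^ r)) x) + (S (2 ^ Suc r) x)\<^sup>2"

lemma Q_nonneg: "0 <= Q r x"
 by (induction r arbitrary: x) auto

lemma S_le_Q_top: "(S (2 ^ r) x)\<^sup>2 <= Q r x"
 by (cases r) (auto simp: Q_nonneg birkhoff_sum_def)

text \<open>A partial sum up to \<open>j\<close> is a sum of at most \<open>r + 1\<close> dyadic blocks of
different sizes, so the claim is Cauchy-Schwarz, unfolded along the recursion.\<close>
lemma S_le_Q: "j <= 2 ^ r ==> (S j x)\<^sup>2 <= (real r + 1) * Q r x"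
proof (induction r arbitrary: j x)
 case 0
 then have "j = 0 \<or> j = 1" by auto
 then show ?case by (auto simp: birkhoff_sum_def)
next
 case (Suc r)
 show ?case
 proof (cases "j <= 2 ^ r")
  case True
  have "(S j x)\<^sup>2 <= (real r + 1) * Q r x" by (rule Suc.IH[OF True])
  also have "\<dots> <= (real (Suc r) + 1) * Q (Suc r) x"
   using Q_nonneg by (intro mult_mono) (auto intro: add_nonneg_nonneg)
  finally show ?thesis .
 next
  case False
  define k where "k = j - 2 ^ r"
  have j: "j = 2 ^ r + k" "k <= 2 ^ r" using False Suc.prems by (auto simp: k_def)
  define A where "A = S (2 ^ r) x"
  define B where "B = S k ((F ^^ (2 ^ r)) x)"
  have A: "A\<^sup>2 <= Q r x" unfolding A_def by (rule S_le_Q_top)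
  have B: "B\<^sup>2 <= (real r + 1) * Q r ((F ^^ (2 ^ r)) x)" unfolding B_def by (rule Suc.IH[OF j(2)])
  define c where "c = real r + 1"
  have c: "c > 0" by (simp add: c_def)
  (* The weighted inequality lets the constant grow only by 1 for each dyadic level. *)
  have "(A + B)\<^sup>2 <= (c + 1) * (A\<^sup>2 + B\<^sup>2 / c)"
  proof -
   have "(c + 1) * (A\<^sup>2 + B\<^sup>2 / c) - (A + B)\<^sup>2 = (c * A - B)\<^sup>2 / c"
    using c by (simp add: field_simps power2_eq_square)
   also have "\<dots> \<ge> 0" using c by simp
   finally show ?thesis by simp
  qed
  also have "\<dots> <= (c + 1) * (Q r x + Q r ((F ^^ (2 ^ r)) x))"
   using A B c by (intro mult_left_mono add_mono) (auto simp: c_def field_simps)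
  also have "\<dots> <= (c + 1) * Q (Suc r) x" using c by (intro mult_left_mono) auto
  finally show ?thesis using j(1) by (simp add: birkhoff_sum_add A_def B_def c_def)
 qed
qed

lemma Q_measurable[measurable]: "Q r \<in> borel_measurable M"
proof (induction r)
 case (Suc r)
 then have [measurable]: "Q r \<in> borel_measurable M" by simp
 show ?case unfolding Q.simps[abs_def] by measurable
qed (simp add: Q.simps[abs_def])

lemma Q_integral: "integrable M (Q r)" "(LINT x|M. Q r x) = (real r + 1) * 2 ^ r * (LINT x|M. (X x)\<^sup>2)"
proof (induction r)
 case 0
 { case 1 show ?case by (simp add: X2 Q.simps[abs_def]) }
 { case 2 show ?case by simp }
next
 case (Suc r)
 note i = invariant_integral[OF Q_measurable, of _ "2 ^ r"]
 { case 1 show ?case unfolding Q.simps[abs_def] using Suc i S_square by auto }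
 { case 2
  have "(LINT x|M. Q (Suc r) x) = (LINT x|M. Q r x) + (LINT x|M. Q r ((F ^^ (2 ^ r)) x)) + (LINT x|M. (S (2 ^ Suc r) x)\<^sup>2)"
   unfolding Q.simps using Suc i S_square by (subst Bochner_Integration.integral_add; auto)+
  then show ?case by (simp add: Suc i S_square algebra_simps) }
qed

lemma maximal_dyadic:
 assumes \<delta>: "0 < \<delta>"
 shows "prob {x\<in>space M. \<exists>j\<le>2 ^ r. \<delta> <= \<bar>S j x\<bar>} <= (real r + 1)\<^sup>2 * 2 ^ r * (LINT x|M. (X x)\<^sup>2) / \<delta>\<^sup>2"
proof -
 have "prob {x\<in>space M. \<exists>j\<le>2 ^ r. \<delta> <= \<bar>S j x\<bar>} <= prob {x\<in>space M. \<delta>\<^sup>2 / (real r + 1) <= Q r x}"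
 proof (rule finite_measure_mono)
  show "{x \<in> space M. \<exists>j\<le>2 ^ r. \<delta> <= \<bar>S j x\<bar>} \<subseteq> {x \<in> space M. \<delta>\<^sup>2 / (real r + 1) <= Q r x}"
  proof safe
   fix x j assume j: "j <= 2 ^ r" "\<delta> <= \<bar>S j x\<bar>"
   have "\<delta>\<^sup>2 <= (S j x)\<^sup>2" using j(2) \<delta> by (metis abs_le_square_iff abs_of_pos)
   also have "\<dots> <= (real r + 1) * Q r x" by (rule S_le_Q[OF j(1)])
   finally show "\<delta>\<^sup>2 / (real r + 1) <= Q r x" by (simp add: field_simps)
  qed
 qed measurable
 also have "\<dots> <= (LINT x|M. Q r x) / (\<delta>\<^sup>2 / (real r + 1))"
  by (rule integral_Markov_inequality_measure[OF Q_integral(1) sets.empty_sets]) (use \<delta> in \<open>auto intro!: AE_I2 Q_nonneg\<close>)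
 also have "\<dots> = (real r + 1)\<^sup>2 * 2 ^ r * (LINT x|M. (X x)\<^sup>2) / \<delta>\<^sup>2"
  by (simp add: Q_integral power2_eq_square)
 finally show ?thesis .
qed

text \<open>The logarithmic factor \<open>(r + 1)^2\<close> of the maximal inequality is absorbed by a small
power \<open>\<eta>\<close>, for which the strict inequality \<open>a < 2 * b\<close> leaves room.\<close>
lemma fluctuation:
 assumes e: "0 < e" and a: "0 < a" "a < 2 * b" and J: "\<forall>\<^sub>F n in sequentially. real (J n) <= C * real n powr a"
 shows "vanishing (\<lambda>n. {x\<in>space M. \<exists>j\<le>J n. e * real n powr b <= \<bar>S j x\<bar>})"
proof -
 define \<eta> where "\<eta> = (2 * b / a - 1) / 2"
 have \<eta>: "0 < \<eta>" "a * (1 + \<eta>) < 2 * b" using a by (simp_all add: \<eta>_def field_simps)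
 (* The factor by which (r + 1)^2 may exceed (2^r)^\<eta>, from x^2 <= 2 * exp x. *)
 define B where "B = 2 * 2 powr \<eta> / (\<eta> * ln 2)\<^sup>2"
 have B1: "B > 0" using \<eta> by (simp add: B_def)
 have B2: "(real r + 1)\<^sup>2 <= B * (2 powr real r) powr \<eta>" for r
 proof -
  define x where "x = \<eta> * ln 2 * (real r + 1)"
  have "0 <= x" using \<eta> by (simp add: x_def)
  from exp_lower_Taylor_quadratic[OF this] have "x\<^sup>2 <= 2 * exp x" using \<open>0 <= x\<close> by (simp add: field_simps)
  also have "exp x = 2 powr \<eta> * (2 powr real r) powr \<eta>" by (simp add: x_def powr_def algebra_simps exp_add)
  finally have "(\<eta> * ln 2)\<^sup>2 * (real r + 1)\<^sup>2 <= 2 * (2 powr \<eta> * (2 powr real r) powr \<eta>)"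
   by (simp only: x_def power_mult_distrib)
  moreover have "(\<eta> * ln 2)\<^sup>2 > 0" using \<eta> by simp
  ultimately show ?thesis by (simp add: B_def field_simps)
 qed
 define E where "E = (LINT x|M. (X x)\<^sup>2)"
 have E: "0 <= E" unfolding E_def by (rule integral_nonneg_AE) simp
 define K where "K = max C 1"
 have "(\<lambda>n. (B * (2 * K) powr (1 + \<eta>) * E / e\<^sup>2) * real n powr (a * (1 + \<eta>) - 2 * b)) \<longlonglongrightarrow> 0"
  by (rule tendsto_mult_right_zero[OF tendsto_neg_powr[OF _ filterlim_real_sequentially]]) (use \<eta> in simp)
 moreover have "\<forall>\<^sub>F n in sequentially. norm (prob {x\<in>space M. \<exists>j\<le>J n. e * real n powr b <= \<bar>S j x\<bar>})
   <= (B * (2 * K) powr (1 + \<eta>) * E / e\<^sup>2) * real n powr (a * (1 + \<eta>) - 2 * b)"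
  using J eventually_gt_at_top[of 0]
 proof eventually_elim
  case (elim n)
  define y where "y = K * real n powr a"
  define r where "r = nat \<lceil>log 2 y\<rceil>"
  define \<delta> where "\<delta> = e * real n powr b"
  have \<delta>: "0 < \<delta>" using e elim by (simp add: \<delta>_def)
  have "1 * 1 <= y" unfolding y_def using elim a by (intro mult_mono ge_one_powr_ge_zero) (auto simp: K_def)
  then have y: "1 <= y" by simp
  have Jy: "real (J n) <= y" using elim(1) mult_right_mono[of C K "real n powr a"] by (simp add: y_def K_def)
  have "0 <= log 2 y" using y by simp
  then have "log 2 y <= real r" "real r <= 1 + log 2 y" unfolding r_def by linarith+
  then have "2 powr log 2 y <= 2 powr real r" "2 powr real r <= 2 powr (1 + log 2 y)" by simp_all
  then have r: "y <= 2 powr real r" "2 powr real r <= 2 * y" using y by (simp_all add: powr_add)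
  have "real (J n) <= 2 powr real r" by (rule order_trans[OF Jy r(1)])
  then have Jr: "J n <= 2 ^ r" by (simp add: powr_realpow)
  have "prob {x\<in>space M. \<exists>j\<le>J n. \<delta> <= \<bar>S j x\<bar>} <= prob {x\<in>space M. \<exists>j\<le>2 ^ r. \<delta> <= \<bar>S j x\<bar>}"
   using order_trans[OF _ Jr] by (intro finite_measure_mono) (auto, measurable)
  also have "\<dots> <= (real r + 1)\<^sup>2 * 2 ^ r * E / \<delta>\<^sup>2" unfolding E_def by (rule maximal_dyadic[OF \<delta>])
  also have "\<dots> <= (B * (2 * y) powr \<eta> * (2 * y)) * E / \<delta>\<^sup>2"
  proof (intro divide_right_mono mult_right_mono mult_mono E)
   have "B * (2 powr real r) powr \<eta> <= B * (2 * y) powr \<eta>" using B1 r(2) \<eta> by (intro mult_left_mono powr_mono2) auto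
   then show "(real r + 1)\<^sup>2 <= B * (2 * y) powr \<eta>" using B2[of r] by linarith
   show "2 ^ r <= 2 * y" using r(2) by (simp add: powr_realpow)
  qed (use B1 in auto)
  also have "\<dots> = B * (2 * y) powr (1 + \<eta>) * E / \<delta>\<^sup>2" using y by (simp add: powr_add)
  also have "\<dots> = (B * (2 * K) powr (1 + \<eta>) * E / e\<^sup>2) * real n powr (a * (1 + \<eta>) - 2 * b)"
  proof -
   have "(2 * y) powr (1 + \<eta>) = (2 * K) powr (1 + \<eta>) * real n powr (a * (1 + \<eta>))"
    by (simp add: y_def powr_mult powr_powr K_def)
   then show ?thesis using elim by (simp add: \<delta>_def powr_diff power_mult_distrib powr_power mult.commute)
  qed
  finally show ?case unfolding \<delta>_def by (simp add: measure_nonneg)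
 qed
 ultimately show ?thesis unfolding vanishing_def by (intro conjI allI) (measurable, rule Lim_null_comparison)
qed

end

lemma tight_individual:
 assumes "real_distribution M" "0 < e"
 shows "\<exists>K::real. \<forall>L\<ge>K. measure M {- L<..L} > 1 - e"
proof -
 interpret real_distribution M by fact
 have *: "(\<Union>k::nat. {- real k<..real k}) = UNIV"
 proof -
  have "x \<in> (\<Union>k::nat. {- real k<..real k})" for x :: real
  proof -
  obtain k :: nat where "\<bar>x\<bar> < real k" using reals_Archimedean2 by blast
  then show "x \<in> (\<Union>k::nat. {- real k<..real k})" by (auto intro!: exI[of _ k])
  qed
  then show ?thesis by blast
 qed
 have "(\<lambda>k. measure M {- real k<..real k}) \<longlonglongrightarrow> measure M (\<Union>k::nat. {- real k<..real k})"
  by (rule finite_Lim_measure_incseq) (auto simp: incseq_def)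
 then have "(\<lambda>k. measure M {- real k<..real k}) \<longlonglongrightarrow> 1"
  using prob_space unfolding * by simp
 from order_tendstoD(1)[OF this, of "1 - e"] assms(2) obtain k where k: "1 - e < measure M {- real k<..real k}"
  by (auto simp: eventually_sequentially)
 show ?thesis
 proof (intro exI allI impI)
  fix L assume "real k <= L"
  then have "measure M {- real k<..real k} <= measure M {- L<..L}" by (intro finite_measure_mono) auto
  with k show "1 - e < measure M {- L<..L}" by simp
 qed
qed

text \<open>Averaging a characteristic function over Gaussian arguments gives the integral of a Gaussian, which
decays outside \<open>[-1/\<delta>, 1/\<delta>]\<close> and thus detects tails.\<close>
lemma char_gaussian_smoothing:
 assumes "real_distribution M"
 shows "(LINT t|std_normal_distribution. char M (\<delta> * t)) = (LINT x|M. exp (- (\<delta> * x)\<^sup>2 / 2))"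
proof -
 interpret M: real_distribution M by fact
 interpret N: real_distribution std_normal_distribution by (rule real_dist_normal_dist)
 interpret P: pair_prob_space M std_normal_distribution ..
 have i: "integrable (M \<Otimes>\<^sub>M std_normal_distribution) (\<lambda>(x, t). iexp (\<delta> * t * x))"
  by (rule P.P.integrable_const_bound[where B = 1]) (auto simp: split_beta simp del: of_real_mult)
 have "(LINT t|std_normal_distribution. char M (\<delta> * t)) = (LINT t|std_normal_distribution. (\<integral>x. iexp (\<delta> * t * x) \<partial>M))"
  by (simp add: char_def)
 also have "\<dots> = (LINT x|M. (\<integral>t. iexp (\<delta> * t * x) \<partial>std_normal_distribution))"
  by (rule P.Fubini_integral[OF i])
 also have "\<dots> = (LINT x|M. char std_normal_distribution (\<delta> * x))"
  by (simp add: char_def mult_ac)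
 also have "\<dots> = (LINT x|M. complex_of_real (exp (- (\<delta> * x)\<^sup>2 / 2)))"
  by (simp add: char_std_normal_distribution)
 finally show ?thesis by simp
qed

text \<open>Continuity of the limit at 0 gives tightness: a pointwise limit close to 1 near 0 bounds the
Gaussian averages, hence the tails, uniformly in \<open>n\<close>. Any subsequential weak limit then has
\<open>\<psi>\<close> as its characteristic function.\<close>
theorem char_limit_is_char:
 fixes M :: "nat => real measure"
 assumes M: "\<And>n. real_distribution (M n)" and lim: "\<And>t. (\<lambda>n. char (M n) t) \<longlonglongrightarrow> \<psi> t" and cont: "isCont \<psi> 0"
 shows "\<exists>Z. real_distribution Z \<and> char Z = \<psi>"
proof -
 interpret M: real_distribution "M n" for n by (rule M)
 interpret N: real_distribution std_normal_distribution by (rule real_dist_normal_dist)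
 have [measurable]: "\<psi> \<in> borel_measurable borel"
  by (rule borel_measurable_LIMSEQ_metric[OF M.char_measurable lim])
 have \<psi>0: "\<psi> 0 = 1" using lim[of 0] by (simp add: M.char_zero LIMSEQ_const_iff)
 have \<psi>1: "norm (\<psi> t) <= 1" for t
  by (rule Lim_bounded[OF tendsto_norm[OF lim], of 0]) (simp add: M.cmod_char_le_1)
 have ni: "integrable std_normal_distribution (\<lambda>t. \<psi> (\<delta> * t))" "integrable std_normal_distribution (\<lambda>t. char (M n) (\<delta> * t))" for \<delta> n
  by (rule N.integrable_const_bound[where B = 1]; auto simp: \<psi>1 M.cmod_char_le_1)+
 define e where "e n \<delta> = (LINT t|std_normal_distribution. char (M n) (\<delta> * t))" for n \<delta>
 have e1: "(\<lambda>n. e n \<delta>) \<longlonglongrightarrow> (LINT t|std_normal_distribution. \<psi> (\<delta> * t))" for \<delta>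
  unfolding e_def by (rule integral_dominated_convergence[where w = "\<lambda>_. 1"]) (auto simp: lim M.cmod_char_le_1)
 have e2: "(\<lambda>k. LINT t|std_normal_distribution. \<psi> (1 / real (Suc k) * t)) \<longlonglongrightarrow> (LINT t|std_normal_distribution. 1)"
 proof (rule integral_dominated_convergence[where w = "\<lambda>_. 1"])
  show "AE t in std_normal_distribution. (\<lambda>k. \<psi> (1 / real (Suc k) * t)) \<longlonglongrightarrow> 1"
  proof (rule AE_I2)
   fix t :: real
   have "(\<lambda>k. 1 / real (Suc k) * t) \<longlonglongrightarrow> 0 * t"
    by (intro tendsto_mult tendsto_const LIMSEQ_Suc lim_1_over_n[where 'a = real])
   then have "(\<lambda>k. 1 / real (Suc k) * t) \<longlonglongrightarrow> 0" by simp
   from isCont_tendsto_compose[OF cont this] show "(\<lambda>k. \<psi> (1 / real (Suc k) * t)) \<longlonglongrightarrow> 1" by (simp add: \<psi>0)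
  qed
 qed (auto simp: \<psi>1)
 define c :: real where "c = 1 - exp (- 1 / 2)"
 have c: "c > 0" by (simp add: c_def)
 have bound: "c * measure (M n) {x. 1 <= \<bar>\<delta> * x\<bar>} <= 1 - Re (e n \<delta>)" for n \<delta>
 proof -
  have "c * measure (M n) {x. 1 <= \<bar>\<delta> * x\<bar>} = (LINT x|M n. c * indicator {x. 1 <= \<bar>\<delta> * x\<bar>} x)" by simp
  also have "\<dots> <= (LINT x|M n. 1 - exp (- (\<delta> * x)\<^sup>2 / 2))"
  proof (rule integral_mono)
   show "integrable (M n) (\<lambda>x. c * indicator {x. 1 <= \<bar>\<delta> * x\<bar>} x)"
    by (intro integrable_mult_right M.integrable_const_bound[where B = 1]) auto
   show "integrable (M n) (\<lambda>x. 1 - exp (- (\<delta> * x)\<^sup>2 / 2))"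
    by (rule M.integrable_const_bound[where B = 1]) auto
   fix x
   show "c * indicator {x. 1 <= \<bar>\<delta> * x\<bar>} x <= 1 - exp (- (\<delta> * x)\<^sup>2 / 2)"
   proof (cases "1 <= \<bar>\<delta> * x\<bar>")
    case True
    then have "1 <= (\<delta> * x)\<^sup>2" by (metis abs_le_square_iff abs_one one_power2)
    then show ?thesis using True by (simp add: c_def)
   qed simp
  qed
  also have "\<dots> = 1 - (LINT x|M n. exp (- (\<delta> * x)\<^sup>2 / 2))"
   by (subst bochner_diff)
     (auto intro!: M.integrable_const_bound[where B = 1] simp: M.prob_space[simplified])
  also have "(LINT x|M n. exp (- (\<delta> * x)\<^sup>2 / 2)) = Re (e n \<delta>)"
   unfolding e_def char_gaussian_smoothing[OF M] by simp
  finally show ?thesis .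
 qed
 have "\<exists>a b. a < b \<and> (\<forall>n. 1 - \<epsilon> < measure (M n) {a<..b})" if \<epsilon>: "0 < \<epsilon>" for \<epsilon>
 proof -
  have "(\<lambda>k. 1 - Re (LINT t|std_normal_distribution. \<psi> (1 / real (Suc k) * t))) \<longlonglongrightarrow> 1 - Re (LINT t|std_normal_distribution. 1)"
   by (intro tendsto_intros e2)
  moreover have "1 - Re (LINT t|std_normal_distribution. 1) = 0" using N.prob_space by simp
  ultimately have "(\<lambda>k. 1 - Re (LINT t|std_normal_distribution. \<psi> (1 / real (Suc k) * t))) \<longlonglongrightarrow> 0" by simp
  from order_tendstoD(2)[OF this, of "c * \<epsilon>"] c \<epsilon> obtain k
   where k: "1 - Re (LINT t|std_normal_distribution. \<psi> (1 / real (Suc k) * t)) < c * \<epsilon>"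
   by (auto simp: eventually_sequentially)
  define \<delta> where "\<delta> = 1 / real (Suc k)"
  have "(\<lambda>n. 1 - Re (e n \<delta>)) \<longlonglongrightarrow> 1 - Re (LINT t|std_normal_distribution. \<psi> (\<delta> * t))"
   by (intro tendsto_intros e1)
  from order_tendstoD(2)[OF this, of "c * \<epsilon>"] k obtain n0
   where n0: "\<And>n. n \<ge> n0 ==> 1 - Re (e n \<delta>) < c * \<epsilon>" by (auto simp: eventually_sequentially \<delta>_def)
  have A: "1 - \<epsilon> < measure (M n) {- L<..L}" if n: "n \<ge> n0" and L: "real (Suc k) <= L" for n L
  proof -
   have "c * measure (M n) {x. 1 <= \<bar>\<delta> * x\<bar>} < c * \<epsilon>" using bound[of n \<delta>] n0[OF n] by linarith
   then have "measure (M n) {x. 1 <= \<bar>\<delta> * x\<bar>} < \<epsilon>" using c by simp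
   moreover have "measure (M n) (UNIV - {x. 1 <= \<bar>\<delta> * x\<bar>}) = 1 - measure (M n) {x. 1 <= \<bar>\<delta> * x\<bar>}"
    using M.prob_compl[of "{x. 1 <= \<bar>\<delta> * x\<bar>}" n] by simp
   moreover have "measure (M n) (UNIV - {x. 1 <= \<bar>\<delta> * x\<bar>}) <= measure (M n) {- L<..L}"
   proof (rule M.finite_measure_mono)
    have "\<bar>x\<bar> < L" if "\<not> 1 <= \<bar>\<delta> * x\<bar>" for x
     using that L by (simp add: \<delta>_def abs_mult field_simps)
    then show "UNIV - {x. 1 <= \<bar>\<delta> * x\<bar>} \<subseteq> {- L<..L}" by (force simp: abs_less_iff)
   qed auto
   ultimately show ?thesis by linarith
  qed
  have "\<exists>K. \<forall>n. \<forall>L\<ge>K n. 1 - \<epsilon> < measure (M n) {- L<..L}" using tight_individual[OF M \<epsilon>] by metis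
  then obtain K where K: "\<And>n L. K n <= L ==> 1 - \<epsilon> < measure (M n) {- L<..L}" by blast
  define L where "L = Max (insert (real (Suc k)) (K ` {..<n0}))"
  have L: "real (Suc k) <= L" "\<And>n. n < n0 ==> K n <= L" unfolding L_def by (auto intro!: Max_ge)
  have "1 - \<epsilon> < measure (M n) {- L<..L}" for n
   using A[of n L] K[of n L] L by (cases "n < n0") auto
  moreover have "- L < L" using L(1) by simp
  ultimately show ?thesis by blast
 qed
 then have "tight M" unfolding tight_def using M by blast
 from tight_imp_convergent_subsubsequence[OF this strict_mono_id]
 obtain r Z where r: "strict_mono r" and Z: "real_distribution Z" and w: "weak_conv_m (M \<circ> id \<circ> r) Z" by blast
 have "char Z t = \<psi> t" for t
 proof (rule LIMSEQ_unique)
  show "(\<lambda>n. char ((M \<circ> id \<circ> r) n) t) \<longlonglongrightarrow> char Z t"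
   by (rule levy_continuity1[OF _ Z w]) (simp add: M)
  show "(\<lambda>n. char ((M \<circ> id \<circ> r) n) t) \<longlonglongrightarrow> \<psi> t"
   using LIMSEQ_subseq_LIMSEQ[OF lim r] by (simp add: comp_def)
 qed
 with Z show ?thesis by blast
qed

text \<open>Comparison with \<open>exp (z / n) ^ n\<close>. For numbers in the unit disc powers differ by at
most \<open>n\<close> times the difference of the bases; the modulus bound on \<open>w n\<close> forces
\<open>Re z \<le> 0\<close>, so that \<open>exp (z / n)\<close> is in the disc as well.\<close>
lemma tendsto_power_exp_complex:
 fixes w :: "nat => complex"
 assumes w: "\<And>n. norm (w n) <= 1" and lim: "(\<lambda>n. of_nat n * (w n - 1)) \<longlonglongrightarrow> z"
 shows "(\<lambda>n. w n ^ n) \<longlonglongrightarrow> exp z"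
proof -
 have Re: "Re z <= 0"
 proof (rule LIMSEQ_le_const2[OF tendsto_Re[OF lim]], intro exI allI impI)
  fix n :: nat
  have "Re (w n) <= 1" using complex_Re_le_cmod[of "w n"] w[of n] by linarith
  then show "Re (of_nat n * (w n - 1)) <= 0" by (simp add: mult_nonneg_nonpos)
 qed
 have e: "(\<lambda>n. of_nat n * (exp (z / of_nat n) - 1)) \<longlonglongrightarrow> z"
 proof (cases "z = 0")
  case False
  have "((\<lambda>h. (exp (0 + h) - exp 0) / h) \<longlongrightarrow> (1::complex)) (at 0)"
   using DERIV_exp[of "0::complex"] by (simp add: DERIV_def)
  moreover have "filterlim (\<lambda>n. z / of_nat n) (at 0) sequentially"
   unfolding filterlim_at using False
   by (auto intro!: tendsto_divide_0[OF tendsto_const] tendsto_of_nat eventually_sequentiallyI[of 1])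
  ultimately have "(\<lambda>n. (exp (0 + z / of_nat n) - exp 0) / (z / of_nat n)) \<longlonglongrightarrow> 1"
   by (rule filterlim_compose)
  then have "(\<lambda>n. z * ((exp (0 + z / of_nat n) - exp 0) / (z / of_nat n))) \<longlonglongrightarrow> z * 1"
   by (intro tendsto_intros)
  then show ?thesis using False by (simp add: mult.commute)
 qed simp
 have "(\<lambda>n. w n ^ n - exp (z / of_nat n) ^ n) \<longlonglongrightarrow> 0"
 proof (rule Lim_null_comparison)
  show "\<forall>\<^sub>F n in sequentially. norm (w n ^ n - exp (z / of_nat n) ^ n)
    <= norm (of_nat n * (w n - 1) - of_nat n * (exp (z / of_nat n) - 1))"
  proof (intro always_eventually allI)
   fix n :: nat
   have "norm (exp (z / of_nat n)) <= 1" using Re by (simp add: norm_exp_eq_Re Re_divide_of_nat divide_nonpos_nonneg)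
   then have "norm (w n ^ n - exp (z / of_nat n) ^ n) <= n * norm (w n - exp (z / of_nat n))"
    by (intro norm_power_diff w) auto
   also have "\<dots> = norm (of_nat n * (w n - exp (z / of_nat n)))" by (simp add: norm_mult)
   finally show "norm (w n ^ n - exp (z / of_nat n) ^ n)
    <= norm (of_nat n * (w n - 1) - of_nat n * (exp (z / of_nat n) - 1))" by (simp add: algebra_simps)
  qed
  show "(\<lambda>n. norm (of_nat n * (w n - 1) - of_nat n * (exp (z / of_nat n) - 1))) \<longlonglongrightarrow> 0"
   using tendsto_norm_zero[OF tendsto_diff[OF lim e, simplified]] .
 qed
 moreover have "(\<lambda>n. exp (z / of_nat n) ^ n) \<longlonglongrightarrow> exp z"
 proof (rule tendsto_eventually)
  show "\<forall>\<^sub>F n in sequentially. exp (z / of_nat n) ^ n = exp z"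
   using eventually_gt_at_top[of 0] by eventually_elim (simp flip: exp_of_nat_mult)
 qed
 ultimately have "(\<lambda>n. (w n ^ n - exp (z / of_nat n) ^ n) + exp (z / of_nat n) ^ n) \<longlonglongrightarrow> 0 + exp z"
  by (rule tendsto_add)
 then show ?thesis by simp
qed

text \<open>Slutsky's lemma, in the form in which it is used for characteristic functions.\<close>
lemma (in prob_space) char_close:
 fixes A B :: "nat => 'a => real"
 assumes [measurable]: "\<And>n. A n \<in> borel_measurable M" "\<And>n. B n \<in> borel_measurable M"
  and close: "\<And>e. 0 < e ==> \<exists>U. vanishing U \<and> (\<forall>\<^sub>F n in sequentially. \<forall>x\<in>space M - U n. \<bar>A n x - B n x\<bar> <= e)"
 shows "(\<lambda>n. (LINT x|M. cis (t * A n x)) - (LINT x|M. cis (t * B n x))) \<longlonglongrightarrow> 0"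
proof (rule tendstoI)
 have [measurable]: "(\<lambda>x. cis (t * A n x)) \<in> borel_measurable M" "(\<lambda>x. cis (t * B n x)) \<in> borel_measurable M" for n
  unfolding cis_conv_exp by measurable
 have ic: "integrable M (\<lambda>x. cis (t * A n x))" "integrable M (\<lambda>x. cis (t * B n x))" for n
  by (rule integrable_const_bound[where B = 1]; simp)+
 fix e :: real assume e: "0 < e"
 define \<delta> where "\<delta> = e / (2 * (\<bar>t\<bar> + 1))"
 have t: "0 < \<bar>t\<bar> + 1" using abs_ge_zero[of t] by linarith
 then have "0 < \<delta>" using e unfolding \<delta>_def by (intro divide_pos_pos mult_pos_pos) auto
 moreover have "(\<bar>t\<bar> + 1) * \<delta> = e / 2" using t unfolding \<delta>_def by (simp add: field_simps)
 ultimately have \<delta>: "0 < \<delta>" "\<bar>t\<bar> * \<delta> <= e / 2" by (simp_all add: distrib_right)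
 obtain U where "vanishing U" and AB: "\<forall>\<^sub>F n in sequentially. \<forall>x\<in>space M - U n. \<bar>A n x - B n x\<bar> <= \<delta>"
  using close[OF \<delta>(1)] by blast
 then have Um[measurable]: "U n \<in> sets M" and U0: "(\<lambda>n. prob (U n)) \<longlonglongrightarrow> 0" for n by (auto simp: vanishing_def)
 have "\<forall>\<^sub>F n in sequentially. prob (U n) < e / 4" using e by (intro order_tendstoD(2)[OF U0]) simp
 then show "\<forall>\<^sub>F n in sequentially. dist ((LINT x|M. cis (t * A n x)) - (LINT x|M. cis (t * B n x))) 0 < e" using AB
 proof eventually_elim
  case (elim n)
  have iU: "integrable M (\<lambda>x. e / 2 + 2 * indicator (U n) x :: real)"
   by (intro Bochner_Integration.integrable_add integrable_mult_right integrable_const integrable_const_bound[where B = 1]) auto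
  have "norm ((LINT x|M. cis (t * A n x)) - (LINT x|M. cis (t * B n x))) = norm (LINT x|M. cis (t * A n x) - cis (t * B n x))"
   using ic by simp
  also have "\<dots> <= (LINT x|M. norm (cis (t * A n x) - cis (t * B n x)))" by (rule integral_norm_bound)
  also have "\<dots> <= (LINT x|M. e / 2 + 2 * indicator (U n) x)"
  proof (rule integral_mono[OF _ iU])
   show "integrable M (\<lambda>x. norm (cis (t * A n x) - cis (t * B n x)))" using ic by auto
   fix x assume x: "x \<in> space M"
   show "norm (cis (t * A n x) - cis (t * B n x)) <= e / 2 + 2 * indicator (U n) x"
   proof (cases "x \<in> U n")
    case True
    have "norm (cis (t * A n x) - cis (t * B n x)) <= 1 + 1" by (rule order_trans[OF norm_triangle_ineq4]) simp
    then show ?thesis using True e by simp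
   next
    case False
    have "norm (cis (t * A n x) - cis (t * B n x)) <= \<bar>t\<bar> * \<bar>A n x - B n x\<bar>"
     using norm_cis_diff[of "t * A n x" "t * B n x"] by (simp add: abs_mult flip: right_diff_distrib)
    also have "\<dots> <= \<bar>t\<bar> * \<delta>" using False x elim(2) by (intro mult_left_mono) auto
    finally show ?thesis using False \<delta> by simp
   qed
  qed
  also have "\<dots> = e / 2 + 2 * prob (U n)"
   using sets.sets_into_space[OF Um] by (subst Bochner_Integration.integral_add) (auto simp: prob_space Int_absorb2 intro!: integrable_const_bound[where B = 1])
  also have "\<dots> < e" using elim(1) by simp
  finally show ?case by simp
 qed
qed

section \<open>The Fourier integral of the stable exponent\<close>

lemma Gamma_reflection_real:
 fixes x :: real shows "Gamma x * Gamma (1 - x) = pi / sin (pi * x)"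
proof -
 have 1: "1 - complex_of_real x = complex_of_real (1 - x)" "of_real pi * of_real x = complex_of_real (pi * x)" by simp_all
 have "complex_of_real (Gamma x * Gamma (1 - x)) = complex_of_real (pi / sin (pi * x))"
  using Gamma_reflection_complex[of "complex_of_real x"] unfolding 1
  by (simp only: Gamma_complex_of_real sin_of_real of_real_mult[symmetric] of_real_divide[symmetric])
 then show ?thesis by (simp only: of_real_eq_iff)
qed

lemma nn_integral_Gamma:
 assumes q: "0 < (q::real)" and w: "0 < w"
 shows "(\<integral>\<^sup>+u. ennreal (indicator {0<..} u * (u powr (q - 1) * exp (- (u * w)))) \<partial>lborel) = ennreal (Gamma q / w powr q)"
proof -
 define f where "f u = indicator {0<..} u * (u powr (q - 1) * exp (- u))" for u :: real
 have [measurable]: "f \<in> borel_measurable borel" unfolding f_def by measurable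
 have "(\<integral>\<^sup>+u. ennreal (f u) \<partial>lborel) = Gamma q"
 proof (rule nn_integral_has_integral_lborel)
  have "((\<lambda>t. t powr (q - 1) / exp t) has_integral Gamma q) {0..}" by (rule Gamma_integral_real[OF q])
  then have "((\<lambda>x. if x \<in> {0..} then x powr (q - 1) / exp x else 0) has_integral Gamma q) UNIV"
   by (simp only: has_integral_restrict_UNIV)
  moreover have "(\<lambda>x. if x \<in> {0..} then x powr (q - 1) / exp x else 0) = f"
   by (auto simp: f_def fun_eq_iff exp_minus divide_inverse indicator_def)
  ultimately show "(f has_integral Gamma q) UNIV" by simp
 qed (auto simp: f_def)
 moreover have "(\<integral>\<^sup>+u. ennreal (f u) \<partial>lborel) = ennreal w * (\<integral>\<^sup>+u. ennreal (f (w * u)) \<partial>lborel)"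
  using nn_integral_real_affine[of "\<lambda>u. ennreal (f u)" w 0] w by simp
 moreover have "(\<integral>\<^sup>+u. ennreal (f (w * u)) \<partial>lborel)
   = (\<integral>\<^sup>+u. ennreal (w powr (q - 1)) * ennreal (indicator {0<..} u * (u powr (q - 1) * exp (- (u * w)))) \<partial>lborel)"
  using w by (intro nn_integral_cong) (auto simp: f_def indicator_def powr_mult mult_ac zero_less_mult_iff simp flip: ennreal_mult)
 moreover have "\<dots> = ennreal (w powr (q - 1)) * (\<integral>\<^sup>+u. ennreal (indicator {0<..} u * (u powr (q - 1) * exp (- (u * w)))) \<partial>lborel)"
  by (rule nn_integral_cmult) measurable
 ultimately have e: "ennreal (Gamma q) = ennreal w * (ennreal (w powr (q - 1)) * (\<integral>\<^sup>+u. ennreal (indicator {0<..} u * (u powr (q - 1) * exp (- (u * w)))) \<partial>lborel))"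
  (is "_ = _ * (_ * ?I)") by simp
 have ww: "w * w powr (q - 1) = w powr q" using w by (simp add: powr_mult_base)
 define W where "W = w powr q"
 have W: "0 < W" using w by (simp add: W_def)
 have "ennreal W * ?I = ennreal (Gamma q)"
  unfolding e W_def ww[symmetric] using w by (simp add: ennreal_mult mult.assoc)
 then have "(ennreal (1 / W) * ennreal W) * ?I = ennreal (1 / W) * ennreal (Gamma q)" by (simp only: mult.assoc)
 moreover have "ennreal (1 / W) * ennreal W = 1" using W by (simp flip: ennreal_mult)
 moreover have "ennreal (1 / W) * ennreal (Gamma q) = ennreal (Gamma q / W)"
  using W Gamma_real_pos[OF q] by (simp flip: ennreal_mult)
 ultimately show ?thesis by (simp add: W_def)
qed

lemma integral_Gamma:
 assumes q: "0 < (q::real)" and w: "0 < w"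
 shows "integrable lborel (\<lambda>u. indicator {0<..} u * (u powr (q - 1) * exp (- (u * w))))"
  "(LINT u|lborel. indicator {0<..} u * (u powr (q - 1) * exp (- (u * w)))) = Gamma q / w powr q"
proof -
 have G: "0 <= Gamma q / w powr q" using Gamma_real_pos[OF q] by simp
 have "has_bochner_integral lborel (\<lambda>u. indicator {0<..} u * (u powr (q - 1) * exp (- (u * w)))) (Gamma q / w powr q)"
  by (rule has_bochner_integral_nn_integral[OF _ _ G nn_integral_Gamma[OF q w]]) auto
 then show "integrable lborel (\<lambda>u. indicator {0<..} u * (u powr (q - 1) * exp (- (u * w))))"
  "(LINT u|lborel. indicator {0<..} u * (u powr (q - 1) * exp (- (u * w)))) = Gamma q / w powr q"
  by (auto simp: has_bochner_integral_iff)
qed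

text \<open>Both sides are the two iterated integrals of \<open>x^(b-1) e^(-y (1+x))\<close> over the positive
quadrant.\<close>
lemma nn_integral_Beta:
 assumes b: "0 < (b::real)" "b < 1"
 shows "(\<integral>\<^sup>+x. ennreal (indicator {0<..} x * (x powr (b - 1) / (1 + x))) \<partial>lborel) = ennreal (Gamma b * Gamma (1 - b))"
proof -
 define k where "k x y = indicator {0<..} x * (indicator {0<..} y * (x powr (b - 1) * exp (- (y * (1 + x)))))" for x y :: real
 have km[measurable]: "case_prod k \<in> borel_measurable (borel \<Otimes>\<^sub>M borel)" unfolding k_def by measurable
 have "0 < Gamma b" "0 < Gamma (1 - b)" using b by (simp_all add: Gamma_real_pos)
 note G = less_imp_le[OF this(1)] less_imp_le[OF this(2)]
 have 1: "(\<integral>\<^sup>+y. ennreal (k x y) \<partial>lborel) = ennreal (indicator {0<..} x * (x powr (b - 1) / (1 + x)))" for x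
 proof (cases "0 < x")
  case True
  have "(\<integral>\<^sup>+y. ennreal (k x y) \<partial>lborel) = (\<integral>\<^sup>+y. ennreal (x powr (b - 1)) * ennreal (indicator {0<..} y * (y powr (1 - 1) * exp (- (y * (1 + x))))) \<partial>lborel)"
   using True by (intro nn_integral_cong) (auto simp: k_def indicator_def simp flip: ennreal_mult)
  also have "\<dots> = ennreal (x powr (b - 1)) * ennreal (Gamma 1 / (1 + x) powr 1)"
   using True nn_integral_Gamma[OF zero_less_one, of "1 + x"] by (subst nn_integral_cmult) auto
  finally show ?thesis using True by (simp flip: ennreal_mult)
 qed (simp add: k_def)
 have 2: "(\<integral>\<^sup>+x. ennreal (k x y) \<partial>lborel) = ennreal (Gamma b) * ennreal (indicator {0<..} y * (y powr ((1 - b) - 1) * exp (- (y * 1))))" for y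
 proof (cases "0 < y")
  case True
  have "(\<integral>\<^sup>+x. ennreal (k x y) \<partial>lborel) = (\<integral>\<^sup>+x. ennreal (exp (- y)) * ennreal (indicator {0<..} x * (x powr (b - 1) * exp (- (x * y)))) \<partial>lborel)"
   using True by (intro nn_integral_cong) (auto simp: k_def indicator_def algebra_simps exp_add[symmetric] simp flip: ennreal_mult exp_add)
  also have "\<dots> = ennreal (exp (-y)) * ennreal (Gamma b / y powr b)"
   by (subst nn_integral_cmult) (auto simp: nn_integral_Gamma[OF b(1) True])
  also have "\<dots> = ennreal (Gamma b) * ennreal (y powr ((1 - b) - 1) * exp (- (y * 1)))"
   using True G by (simp add: powr_minus field_simps flip: ennreal_mult)
  finally show ?thesis using True by simp
 qed (simp add: k_def)
 have "(\<integral>\<^sup>+x. ennreal (indicator {0<..} x * (x powr (b - 1) / (1 + x))) \<partial>lborel) = (\<integral>\<^sup>+y. \<integral>\<^sup>+x. ennreal (k x y) \<partial>lborel \<partial>lborel)"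
  unfolding 1[symmetric] by (rule lborel_pair.Fubini'[symmetric]) measurable
 also have "\<dots> = ennreal (Gamma b) * ennreal (Gamma (1 - b) / 1 powr (1 - b))"
  unfolding 2 by (subst nn_integral_cmult, measurable) (subst nn_integral_Gamma, use b in auto)
 finally show ?thesis using G by (simp flip: ennreal_mult)
qed

text \<open>The substitution \<open>u = sqrt x\<close> reduces this to the Beta integral with parameter
\<open>a / 2\<close>, evaluated by the reflection formula.\<close>
lemma rational_Mellin:
 assumes a: "0 < (a::real)" "a < 2"
 shows "integrable lborel (\<lambda>u. indicator {0<..} u * (u powr (a - 1) / (1 + u\<^sup>2)))"
  "(LINT u|lborel. indicator {0<..} u * (u powr (a - 1) / (1 + u\<^sup>2))) = pi / (2 * sin (pi * a / 2))"
proof -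
 define f where "f u = u powr (a - 1) / (1 + u\<^sup>2)" for u :: real
 define q where "q x = indicator {0<..} x * (x powr (a / 2 - 1) / (1 + x))" for x :: real
 define B where "B = Gamma (a / 2) * Gamma (1 - a / 2)"
 have "0 < Gamma (a / 2)" "0 < Gamma (1 - a / 2)" using a by (simp_all add: Gamma_real_pos)
 then have B: "0 <= B" by (simp add: B_def)
 have q: "has_bochner_integral lborel q B"
  using nn_integral_Beta[of "a / 2"] a B unfolding q_def[abs_def]
  by (intro has_bochner_integral_nn_integral) (auto simp: B_def indicator_def)
 have e: "indicator {0<..} x * (f (sqrt x) * (inverse (sqrt x) / 2)) = q x / 2" for x
 proof (cases "0 < x")
  case True
  have "sqrt x powr (a - 1) / sqrt x = x powr (a / 2 - 1)"
   using True by (simp add: powr_half_sqrt[symmetric] powr_powr diff_divide_distrib powr_diff[symmetric])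
  then show ?thesis using True by (simp add: f_def q_def divide_simps)
 qed (simp add: q_def)
 have E: "einterval 0 \<infinity> = {0::real<..}" by (simp add: einterval_def zero_ereal_def greaterThan_def)
 have S: "set_integrable lborel (einterval 0 \<infinity>) (\<lambda>x. f (sqrt x) * (inverse (sqrt x) / 2))"
  unfolding set_integrable_def E real_scaleR_def e using q by (auto simp: has_bochner_integral_iff)
 have c: "isCont f (sqrt x)" if "0 < x" for x
  unfolding f_def using that zero_le_power2[of "sqrt x"] by (intro continuous_intros) (auto simp del: zero_le_power2)
 have l: "((ereal \<circ> sqrt \<circ> real_of_ereal) \<longlongrightarrow> 0) (at_right 0)" "((ereal \<circ> sqrt \<circ> real_of_ereal) \<longlongrightarrow> \<infinity>) (at_left \<infinity>)"
  unfolding zero_ereal_def ereal_tendsto_simps by (auto intro!: tendsto_eq_intros simp: sqrt_at_top)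
 have d: "DERIV sqrt x :> inverse (sqrt x) / 2" "isCont (\<lambda>x. inverse (sqrt x) / 2) x" if "0 < x" for x
  using that by (auto intro!: DERIV_real_sqrt continuous_intros)
 note sub = interval_integral_substitution_nonneg[of 0 \<infinity> sqrt "\<lambda>x. inverse (sqrt x) / 2" f, OF _ d(1) c d(2) _ _ l S]
 have i: "(LBINT x=0..\<infinity>. w x) = (LINT x|lborel. indicator {0<..} x * w x)" for w :: "real => real"
  by (simp add: interval_lebesgue_integral_def set_lebesgue_integral_def E)
 show "integrable lborel (\<lambda>u. indicator {0<..} u * (u powr (a - 1) / (1 + u\<^sup>2)))"
  using sub(1) unfolding set_integrable_def E by (simp add: f_def zero_ereal_def)
 have "(LINT u|lborel. indicator {0<..} u * f u) = B / 2"
  using sub(2) q unfolding i e by (simp add: has_bochner_integral_iff f_def zero_ereal_def)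
 then show "(LINT u|lborel. indicator {0<..} u * (u powr (a - 1) / (1 + u\<^sup>2))) = pi / (2 * sin (pi * a / 2))"
  using Gamma_reflection_real[of "a / 2"] by (simp add: B_def f_def)
qed

lemma integrable_min_powr:
 assumes p: "1 < (p::real)" "p < 2" and A: "0 <= A"
 shows "integrable lborel (\<lambda>x. indicator {0<..} x * (min 2 (A * x) * x powr (- p)))"
proof (rule bochner_dominated)
 define f where "f x = A * (indicator {0..1} x * x powr (1 - p)) + 2 * (indicator {1..} x * x powr (- p))" for x :: real
 have nn: "integrable lborel (\<lambda>x. indicator S x * x powr e)"
  if "((\<lambda>x. x powr e) has_integral I) S" and [measurable]: "S \<in> sets borel" for S I and e :: real
 proof -
  have "(\<integral>\<^sup>+x. ennreal (indicator S x * x powr e) \<partial>lborel) = ennreal I"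
  proof (rule nn_integral_has_integral_lborel)
   have "((\<lambda>x. if x \<in> S then x powr e else 0) has_integral I) UNIV" using that(1) by (simp only: has_integral_restrict_UNIV)
   moreover have "(\<lambda>x. if x \<in> S then x powr e else 0) = (\<lambda>x. indicator S x * x powr e)" by (auto simp: indicator_def)
   ultimately show "((\<lambda>x. indicator S x * x powr e) has_integral I) UNIV" by simp
  qed auto
  then show ?thesis by (intro integrableI_nonneg) (auto simp: ennreal_less_top)
 qed
 show "integrable lborel f"
  unfolding f_def using p
  by (intro Bochner_Integration.integrable_add integrable_mult_right nn[OF has_integral_powr_from_0] nn[OF has_integral_powr_to_inf]) auto
 show "AE x in lborel. norm (indicator {0<..} x * (min 2 (A * x) * x powr (- p))) <= norm (f x)"
 proof (rule AE_I2)
  fix x :: real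
  have f0: "0 <= f x" using A by (simp add: f_def)
  have "indicator {0<..} x * (min 2 (A * x) * x powr (- p)) <= f x"
  proof (cases "0 < x")
   case True
   have e: "x powr (1 - p) = x * x powr (- p)" using True by (simp add: powr_diff powr_minus divide_inverse)
   show ?thesis
   proof (cases "x <= 1")
    case x1: True
    have "min 2 (A * x) * x powr (- p) <= (A * x) * x powr (- p)" by (intro mult_right_mono) auto
    also have "\<dots> <= f x" using True x1 A by (simp add: f_def e)
    finally show ?thesis using True by simp
   next
    case False
    have "min 2 (A * x) * x powr (- p) <= 2 * x powr (- p)" by (intro mult_right_mono) auto
    also have "\<dots> <= f x" using True False by (simp add: f_def)
    finally show ?thesis using True by simp
   qed
  qed (use f0 in simp)
  moreover have "0 <= indicator {0<..} x * (min 2 (A * x) * x powr (- p))"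
   using A by (auto simp: indicator_def)
  ultimately show "norm (indicator {0<..} x * (min 2 (A * x) * x powr (- p))) <= norm (f x)" using f0 by simp
 qed
qed measurable

lemma norm_cis_minus_one_min: "norm (cis a - 1) <= min 2 \<bar>a\<bar>"
 using norm_cis_minus_one[of a] norm_triangle_ineq4[of "cis a" 1] by simp

text \<open>Translation by 1 multiplies the integral over the half-line by \<open>exp z\<close>; the integral
over the unit interval left over is elementary. The resulting linear equation determines the value.\<close>
lemma integral_exp_halfline:
 assumes z: "Re z < 0"
 shows "integrable lborel (\<lambda>w. indicator {0<..} w *\<^sub>R exp (z * of_real w))"
  "(LINT w|lborel. indicator {0<..} w *\<^sub>R exp (z * of_real w)) = - 1 / z"
proof -
 define f where "f w = indicator {0<..} w *\<^sub>R exp (z * of_real w)" for w :: real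
 define J where "J = (LINT w|lborel. f w)"
 have z0: "z \<noteq> 0" using z by auto
 have [measurable]: "f \<in> borel_measurable lborel" unfolding f_def by measurable
 have "integrable lborel (\<lambda>w. indicator {0<..} w * (w powr (1 - 1) * exp (- (w * - Re z))))"
  by (rule integral_Gamma(1)) (use z in auto)
 then have int: "integrable lborel f"
  by (rule bochner_dominated) (auto simp: f_def indicator_def norm_exp_eq_Re mult.commute intro!: AE_I2)
 then show "integrable lborel (\<lambda>w. indicator {0<..} w *\<^sub>R exp (z * of_real w))" unfolding f_def .
 have c: "continuous_on {0..1} (\<lambda>w::real. exp (z * of_real w))" by (intro continuous_intros)
 have F: "(LINT w|lborel. indicator {0..1} w *\<^sub>R exp (z * of_real w)) = exp (z * of_real 1) / z - exp (z * of_real 0) / z"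
 proof (rule integral_FTC_Icc[OF _ _ c])
  fix w :: real
  have "((\<lambda>x. exp (z * x) / z) has_field_derivative exp (z * of_real w)) (at (of_real w))"
   using z0 by (auto intro!: derivative_eq_intros)
  from has_vector_derivative_real_field[OF this]
  show "((\<lambda>w. exp (z * of_real w) / z) has_vector_derivative exp (z * of_real w)) (at w within {0..1})"
   by (rule has_vector_derivative_at_within)
 qed simp
 have i1: "integrable lborel (\<lambda>w. indicator {0..1} w *\<^sub>R exp (z * of_real w))"
  by (rule borel_integrable_compact[OF _ c]) simp
 have "J = (LINT w|lborel. f (- 1 + 1 * w))" unfolding J_def by (subst lborel_integral_real_affine[of 1 _ "-1"]) simp_all
 also have "\<dots> = (LINT w|lborel. exp (- z) * (f w - indicator {0..1} w *\<^sub>R exp (z * of_real w)))"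
 proof (rule integral_cong_AE)
  show "AE w in lborel. f (- 1 + 1 * w) = exp (- z) * (f w - indicator {0..1} w *\<^sub>R exp (z * of_real w))"
   using AE_lborel_singleton[of 0]
   by eventually_elim (auto simp: f_def indicator_def exp_add[symmetric] algebra_simps)
 qed (unfold f_def, measurable)
 also have "\<dots> = exp (- z) * (J - (exp z / z - 1 / z))"
  unfolding J_def using int i1 F by (subst integral_mult_right_zero) simp
 finally have "exp z * J = exp z * (exp (- z) * (J - (exp z / z - 1 / z)))" by (rule arg_cong)
 then have "(exp z - 1) * (J + 1 / z) = 0"
  unfolding mult.assoc[symmetric] exp_minus_inverse by (simp add: algebra_simps)
 moreover have "exp z \<noteq> 1"
 proof
  assume "exp z = 1"
  then have "exp (Re z) = 1" using norm_exp_eq_Re[of z] by simp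
  then show False using z by simp
 qed
 ultimately show "(LINT w|lborel. indicator {0<..} w *\<^sub>R exp (z * of_real w)) = - 1 / z"
  by (simp add: J_def f_def eq_neg_iff_add_eq_0)
qed

lemma exponential_cis_integral:
 assumes u: "0 < (u::real)"
 shows "(LINT w|lborel. indicator {0<..} w *\<^sub>R ((cis w - 1) * exp (- (w * u)))) = (\<i> * u - 1) / (u * (u\<^sup>2 + 1))"
proof -
 define z where "z = complex_of_real u"
 have z: "z \<noteq> 0" "\<i> - z \<noteq> 0" "z + \<i> \<noteq> 0" using u by (auto simp: z_def complex_eq_iff)
 have "(LINT w|lborel. indicator {0<..} w *\<^sub>R ((cis w - 1) * exp (- (w * u))))
  = (LINT w|lborel. indicator {0<..} w *\<^sub>R exp ((\<i> - z) * of_real w) - indicator {0<..} w *\<^sub>R exp (- z * of_real w))"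
  by (intro bochner_cong)
   (auto simp: z_def cis_conv_exp algebra_simps exp_of_real[symmetric] exp_add[symmetric] exp_diff exp_minus divide_inverse)
 also have "\<dots> = - 1 / (\<i> - z) - - 1 / - z"
  using u integral_exp_halfline[of "\<i> - z"] integral_exp_halfline[of "- z"] by (subst bochner_diff) (simp_all add: z_def)
 also have "\<dots> = (\<i> * (z + \<i>)) / (z * - ((\<i> - z) * (z + \<i>)))" using z by (simp add: divide_simps)
 also have "\<i> * (z + \<i>) = \<i> * z - 1" by (simp add: algebra_simps)
 also have "z * - ((\<i> - z) * (z + \<i>)) = z * (z\<^sup>2 + 1)" by (simp add: algebra_simps power2_eq_square)
 finally show ?thesis by (simp add: z_def)
qed

definition stable_K :: "real => complex" where
 "stable_K p = (LINT w|lborel. indicator {0<..} w *\<^sub>R ((cis w - 1) * of_real (w powr (- p))))"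

lemma stable_K_integrable:
 assumes p: "1 < (p::real)" "p < 2"
 shows "integrable lborel (\<lambda>w. indicator {0<..} w *\<^sub>R ((cis (t * w) - 1) * complex_of_real (w powr (- p))))"
proof (rule bochner_dominated[OF integrable_min_powr[OF p abs_ge_zero[of t]]])
 show "AE w in lborel. norm (indicator {0<..} w *\<^sub>R ((cis (t * w) - 1) * complex_of_real (w powr (- p))))
   <= norm (indicator {0<..} w * (min 2 (\<bar>t\<bar> * w) * w powr (- p)))"
 proof (rule AE_I2)
  fix w :: real
  show "norm (indicator {0<..} w *\<^sub>R ((cis (t * w) - 1) * complex_of_real (w powr (- p))))
   <= norm (indicator {0<..} w * (min 2 (\<bar>t\<bar> * w) * w powr (- p)))"
   using norm_cis_minus_one_min[of "t * w"]
   by (cases "0 < w") (auto simp: norm_mult abs_mult intro!: mult_right_mono)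
 qed
qed (unfold cis_conv_exp, measurable)

text \<open>Writing \<open>w^(-p)\<close> as \<open>1 / Gamma p\<close> times the Laplace transform of
\<open>u^(p-1)\<close> and exchanging the integrals reduces the oscillating integral over \<open>w\<close> to
elementary ones and leaves two integrals of rational functions times powers of \<open>u\<close>.\<close>
lemma stable_K_eq:
 assumes p: "1 < (p::real)" "p < 2"
 shows "stable_K p = complex_of_real (Gamma (1 - p)) * Complex (sin (p * pi / 2)) (cos (p * pi / 2))"
proof -
 define k where "k w u = (indicator {0<..} w * indicator {0<..} u * (u powr (p - 1) * exp (- (w * u)))) *\<^sub>R (cis w - 1)" for w u :: real
 have km[measurable]: "case_prod k \<in> borel_measurable (lborel \<Otimes>\<^sub>M lborel)"
  unfolding k_def cis_conv_exp by measurable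
 have p0: "0 < p" using p by simp
 have G0: "0 < Gamma p" by (rule Gamma_real_pos[OF p0])
 have inner: "integrable lborel (\<lambda>u. k w u)" "(LINT u|lborel. k w u) = Gamma p *\<^sub>R (indicator {0<..} w *\<^sub>R ((cis w - 1) * of_real (w powr (- p))))"
   "(LINT u|lborel. norm (k w u)) = Gamma p * norm (indicator {0<..} w *\<^sub>R ((cis w - 1) * complex_of_real (w powr (- p))))" for w
 proof -
  show "integrable lborel (\<lambda>u. k w u)"
  proof (cases "0 < w")
   case True
   have "k w = (\<lambda>u. (indicator {0<..} u * (u powr (p - 1) * exp (- (u * w)))) *\<^sub>R (cis w - 1))"
    using True by (simp add: k_def mult_ac fun_eq_iff)
   then show ?thesis using integral_Gamma(1)[OF p0 True] by simp
  qed (simp add: k_def)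
  show "(LINT u|lborel. k w u) = Gamma p *\<^sub>R (indicator {0<..} w *\<^sub>R ((cis w - 1) * of_real (w powr (- p))))"
  proof (cases "0 < w")
   case True
   have "(LINT u|lborel. k w u) = (LINT u|lborel. (indicator {0<..} u * (u powr (p - 1) * exp (- (u * w)))) *\<^sub>R (cis w - 1))"
    using True by (simp add: k_def mult_ac)
   also have "\<dots> = (Gamma p / w powr p) *\<^sub>R (cis w - 1)"
    using integral_Gamma[OF p0 True] by simp
   finally show ?thesis using True by (simp add: powr_minus scaleR_conv_of_real divide_inverse mult_ac)
  qed (simp add: k_def)
  show "(LINT u|lborel. norm (k w u)) = Gamma p * norm (indicator {0<..} w *\<^sub>R ((cis w - 1) * complex_of_real (w powr (- p))))"
  proof (cases "0 < w")
   case True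
   have "(LINT u|lborel. norm (k w u)) = (LINT u|lborel. (indicator {0<..} u * (u powr (p - 1) * exp (- (u * w)))) * norm (cis w - 1))"
    using True by (intro bochner_cong) (auto simp: k_def mult_ac indicator_def)
   also have "\<dots> = (Gamma p / w powr p) * norm (cis w - 1)"
    using integral_Gamma[OF p0 True] by simp
   finally show ?thesis using True by (simp add: powr_minus norm_mult norm_inverse divide_inverse mult_ac)
  qed (simp add: k_def)
 qed
 have kint: "integrable (lborel \<Otimes>\<^sub>M lborel) (case_prod k)"
 proof (rule lborel_pair.Fubini_integrable[OF km])
  have "integrable lborel (\<lambda>w. indicator {0<..} w *\<^sub>R ((cis (1 * w) - 1) * complex_of_real (w powr (- p))))"
   by (rule stable_K_integrable[OF p])
  from integrable_norm[OF this] show "integrable lborel (\<lambda>w. LINT u|lborel. norm (case_prod k (w, u)))"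
   unfolding case_prod_conv inner(3) by (intro integrable_mult_right) simp
 qed (simp add: inner(1))
 have outer: "(LINT w|lborel. k w u) = of_real (- (indicator {0<..} u * (u powr ((p - 1) - 1) / (1 + u\<^sup>2)))) + \<i> * of_real (indicator {0<..} u * (u powr (p - 1) / (1 + u\<^sup>2)))" for u
 proof (cases "0 < u")
  case True
  have "(LINT w|lborel. k w u) = (LINT w|lborel. (u powr (p - 1)) *\<^sub>R (indicator {0<..} w *\<^sub>R ((cis w - 1) * exp (- (w * u)))))"
   using True by (intro bochner_cong) (auto simp: k_def scaleR_conv_of_real exp_of_real mult_ac)
  also have "\<dots> = (u powr (p - 1)) *\<^sub>R ((\<i> * u - 1) / (u * (u\<^sup>2 + 1)))"
   by (subst integral_scaleR_right) (simp add: exponential_cis_integral[OF True])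
  also have "\<dots> = of_real (- (u powr ((p - 1) - 1) / (1 + u\<^sup>2))) + \<i> * of_real (u powr (p - 1) / (1 + u\<^sup>2))"
  proof -
   have "u powr (p - 1) = u * u powr (p - 1 - 1)" using True by (simp add: powr_mult_base)
   moreover have "1 + u\<^sup>2 \<noteq> 0" using zero_le_power2[of u] by linarith
   then have "1 + (complex_of_real u)\<^sup>2 \<noteq> 0" using of_real_eq_0_iff[where 'a = complex, of "1 + u\<^sup>2"] by simp
   ultimately show ?thesis using True
    by (simp add: scaleR_conv_of_real divide_simps add.commute) (simp add: algebra_simps)
  qed
  finally show ?thesis using True by simp
 qed (simp add: k_def)
 have "Gamma p *\<^sub>R stable_K p = (LINT w|lborel. (\<integral>u. k w u \<partial>lborel))"
  unfolding inner(2) stable_K_def by (rule integral_scaleR_right[symmetric])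
 also have "\<dots> = (LINT u|lborel. (\<integral>w. k w u \<partial>lborel))"
  by (rule lborel_pair.Fubini_integral[OF kint, symmetric])
 also have "\<dots> = of_real (- (pi / (2 * sin (pi * (p - 1) / 2)))) + \<i> * of_real (pi / (2 * sin (pi * p / 2)))"
 proof -
  have "integrable lborel (\<lambda>u. indicator {0<..} u * (u powr ((p - 1) - 1) / (1 + u\<^sup>2)))"
   "integrable lborel (\<lambda>u. indicator {0<..} u * (u powr (p - 1) / (1 + u\<^sup>2)))"
   by (rule rational_Mellin(1); use p in simp)+
  then show ?thesis unfolding outer
   using rational_Mellin(2)[of "p - 1"] rational_Mellin(2)[of p] p
   by (simp del: of_real_mult of_real_divide of_real_minus of_real_add of_real_power)
 qed
 finally have K: "Gamma p *\<^sub>R stable_K p = Complex (- (pi / (2 * sin (pi * (p - 1) / 2)))) (pi / (2 * sin (pi * p / 2)))"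
  by (simp add: complex_eq_iff)
 define s where "s = sin (p * pi / 2)"
 define c where "c = cos (p * pi / 2)"
 have s: "s \<noteq> 0" unfolding s_def using sin_gt_zero[of "p * pi / 2"] p by simp
 have c: "c \<noteq> 0"
 proof -
  have "cos (p * pi / 2) < cos (pi / 2)" by (rule cos_monotone_0_pi) (use p in auto)
  then show ?thesis by (simp add: c_def)
 qed
 have sin1: "sin (pi * (p - 1) / 2) = - c"
 proof -
  have "pi * (p - 1) / 2 = p * pi / 2 - pi / 2" by (simp add: field_simps)
  then show ?thesis unfolding c_def by (simp only: sin_diff cos_pi_half sin_pi_half)
 qed
 have refl: "Gamma p * Gamma (1 - p) = pi / (2 * s * c)"
  using Gamma_reflection_real[of p] sin_double[of "p * pi / 2"] by (simp add: s_def c_def mult_ac)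
 have "Gamma p *\<^sub>R stable_K p = Gamma p *\<^sub>R (complex_of_real (Gamma (1 - p)) * Complex s c)"
 proof -
  have "Gamma p *\<^sub>R (complex_of_real (Gamma (1 - p)) * Complex s c) = Complex ((Gamma p * Gamma (1 - p)) * s) ((Gamma p * Gamma (1 - p)) * c)"
   by (simp add: complex_eq_iff)
  then show ?thesis unfolding K sin1 refl using s c by (simp add: s_def[symmetric] mult.commute[of pi p] complex_eq_iff)
 qed
 then show ?thesis using G0 by (simp add: s_def c_def)
qed

text \<open>Positive \<open>t\<close> enter by scaling, negative ones by complex conjugation, which produces
\<open>sgn t\<close>.\<close>
lemma scaled_stable_K:
 assumes p: "1 < (p::real)" "p < 2"
 shows "(LINT w|lborel. indicator {0<..} w *\<^sub>R (\<i> * t * ((cis (t * w) - 1) * of_real (w powr (- p)))))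
  = - of_real (Gamma (1 - p) * cos (p * pi / 2) * \<bar>t\<bar> powr p) * (1 - \<i> * of_real (sgn t * tan (p * pi / 2)))"
proof -
 define s where "s = sin (p * pi / 2)"
 define c where "c = cos (p * pi / 2)"
 have c: "c \<noteq> 0"
 proof -
  have "cos (p * pi / 2) < cos (pi / 2)" by (rule cos_monotone_0_pi) (use p in auto)
  then show ?thesis by (simp add: c_def)
 qed
 define J where "J t = (LINT w|lborel. indicator {0<..} w *\<^sub>R ((cis (t * w) - 1) * complex_of_real (w powr (- p))))" for t
 have pos: "J t = t powr (p - 1) *\<^sub>R stable_K p" if t: "0 < t" for t
 proof -
  have "stable_K p = t *\<^sub>R (LINT w|lborel. indicator {0<..} (t * w) *\<^sub>R ((cis (t * w) - 1) * of_real ((t * w) powr (- p))))"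
   unfolding stable_K_def using lborel_integral_real_affine[of t "\<lambda>w. indicator {0<..} w *\<^sub>R ((cis w - 1) * complex_of_real (w powr (- p)))" 0] t
   by simp
  also have "(LINT w|lborel. indicator {0<..} (t * w) *\<^sub>R ((cis (t * w) - 1) * complex_of_real ((t * w) powr (- p))))
   = (LINT w|lborel. (t powr (- p)) *\<^sub>R (indicator {0<..} w *\<^sub>R ((cis (t * w) - 1) * of_real (w powr (- p)))))"
   using t by (intro bochner_cong) (auto simp: indicator_def zero_less_mult_iff powr_mult scaleR_conv_of_real)
  also have "\<dots> = t powr (- p) *\<^sub>R J t" unfolding J_def by (rule integral_scaleR_right)
  finally have "stable_K p = (t * t powr (- p)) *\<^sub>R J t" by simp
  moreover have "t powr (p - 1) * (t * t powr (- p)) = 1" using t by (simp add: powr_diff powr_minus field_simps)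
  ultimately show ?thesis by simp
 qed
 have neg: "J (- t) = cnj (J t)" for t
 proof -
  have "J (- t) = (LINT w|lborel. cnj (indicator {0<..} w *\<^sub>R ((cis (t * w) - 1) * complex_of_real (w powr (- p)))))"
   unfolding J_def by (intro bochner_cong) (auto simp: indicator_def cis_cnj)
  also have "\<dots> = cnj (J t)" unfolding J_def by (rule Bochner_Integration.integral_cnj)
  finally show ?thesis .
 qed
 have e: "(LINT w|lborel. indicator {0<..} w *\<^sub>R (\<i> * t * ((cis (t * w) - 1) * of_real (w powr (- p))))) = \<i> * t * J t"
 proof -
  have "(LINT w|lborel. indicator {0<..} w *\<^sub>R (\<i> * t * ((cis (t * w) - 1) * of_real (w powr (- p)))))
    = (LINT w|lborel. \<i> * t * (indicator {0<..} w *\<^sub>R ((cis (t * w) - 1) * of_real (w powr (- p)))))"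
   by (intro bochner_cong) (auto simp: indicator_def)
  also have "\<dots> = \<i> * t * J t" unfolding J_def by (rule integral_mult_right_zero)
  finally show ?thesis .
 qed
 have K: "stable_K p = complex_of_real (Gamma (1 - p)) * Complex s c" unfolding stable_K_eq[OF p] s_def c_def ..
 have t1: "t * t powr (p - 1) = t powr p" if "0 < t" for t using that by (simp add: powr_mult_base)
 have tan: "tan (p * pi / 2) = s / c" by (simp add: s_def c_def tan_def)
 consider "t = 0" | "0 < t" | "t < 0" by linarith
 then show ?thesis
 proof cases
  case 2
  show ?thesis unfolding e pos[OF 2] K tan c_def[symmetric] using 2 c t1[OF 2]
   by (simp add: complex_eq_iff) (simp add: field_simps)
 next
  case 3
  then have m: "0 < - t" by simp
  have "J t = cnj (J (- t))" using neg[of "- t"] by simp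
  also have "\<dots> = (- t) powr (p - 1) *\<^sub>R cnj (stable_K p)" by (simp add: pos[OF m])
  finally have Jt: "J t = (- t) powr (p - 1) *\<^sub>R cnj (stable_K p)" .
  have ab: "\<bar>t\<bar> powr p = - t * (- t) powr (p - 1)" using 3 t1[OF m] by simp
  show ?thesis unfolding e Jt K tan c_def[symmetric] ab using 3 c
   by (simp add: complex_eq_iff)
 qed (simp add: e)
qed

section \<open>Heavy tails and the expansion of characteristic functions\<close>

definition stable_exponent :: "real => real => real => complex" where
 "stable_exponent p c t = - of_real (c * \<bar>t\<bar> powr p) * (1 - \<i> * of_real (sgn t * tan (p * pi / 2)))"

lemma filterlim_powr_at_top:
 assumes "0 < (a::real)" shows "filterlim (\<lambda>x::real. x powr a) at_top at_top"
proof (rule filterlim_cong[THEN iffD1, rotated 3])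
 show "filterlim (\<lambda>x. exp (a * ln x)) at_top at_top"
  by (intro filterlim_compose[OF exp_at_top] filterlim_tendsto_pos_mult_at_top[OF tendsto_const assms] ln_at_top)
 show "\<forall>\<^sub>F x in at_top. exp (a * ln x) = x powr a"
  using eventually_gt_at_top[of 0] by eventually_elim (simp add: powr_def)
qed auto

definition stable_kernel :: "real => real => real => complex" where
 "stable_kernel t x r = indicator {0<..} x *\<^sub>R (\<i> * t * ((cis (t * x) - 1) * of_real r))"

lemma stable_kernel_scale: "stable_kernel t x (a * r) = of_real a * stable_kernel t x r"
 by (simp add: stable_kernel_def scaleR_conv_of_real mult_ac)

lemma norm_stable_kernel:
 "norm (stable_kernel t x r) <= \<bar>t\<bar> * (indicator {0<..} x * (min 2 (\<bar>t\<bar> * x) * \<bar>r\<bar>))"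
proof (cases "0 < x")
 case True
 have "norm (cis (t * x) - 1) * \<bar>r\<bar> <= min 2 (\<bar>t\<bar> * x) * \<bar>r\<bar>"
  using norm_cis_minus_one_min[of "t * x"] True by (intro mult_right_mono) (simp_all add: abs_mult)
 then show ?thesis using True by (simp add: stable_kernel_def norm_mult mult_left_mono)
qed (simp add: stable_kernel_def)

context prob_space
begin

text \<open>Integration by parts: \<open>e^(ity) - 1 - ity\<close> is the integral of
\<open>it (e^(itx) - 1)\<close> over \<open>0 \<le> x \<le> y\<close>, and Fubini replaces the law of
\<open>\<phi>\<close> by its tail.\<close>
lemma tail_representation:
 fixes \<phi> :: "'a => real"
 assumes [measurable]: "\<phi> \<in> borel_measurable M" and pos: "\<And>\<omega>. \<omega> \<in> space M ==> 0 <= \<phi> \<omega>" and int: "integrable M \<phi>"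
 shows "(LINT \<omega>|M. cis (t * \<phi> \<omega>)) - 1 - \<i> * t * (LINT \<omega>|M. \<phi> \<omega>)
  = (LINT x|lborel. stable_kernel t x (prob {\<omega>\<in>space M. x <= \<phi> \<omega>}))"
proof -
 interpret P: pair_sigma_finite M lborel ..
 define e where "e x = \<i> * t * (cis (t * x) - 1)" for x
 have em[measurable]: "e \<in> borel_measurable borel" unfolding e_def cis_conv_exp by measurable
 have e_le: "norm (e x) <= 2 * \<bar>t\<bar>" for x
 proof -
  have "norm (cis (t * x) - 1) <= 2" using norm_cis_minus_one_min[of "t * x"] by simp
  then have "\<bar>t\<bar> * norm (cis (t * x) - 1) <= \<bar>t\<bar> * 2" by (rule mult_left_mono) simp
  then show ?thesis by (simp add: e_def norm_mult)
 qed
 define k where "k \<omega> x = (if 0 <= x \<and> x <= \<phi> \<omega> then e x else 0)" for \<omega> x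
 have km[measurable]: "case_prod k \<in> borel_measurable (M \<Otimes>\<^sub>M lborel)" unfolding k_def by measurable
 have k_ind: "k \<omega> = (\<lambda>x. indicator {0..\<phi> \<omega>} x *\<^sub>R e x)" for \<omega> by (auto simp: k_def fun_eq_iff)
 have ki: "integrable lborel (k \<omega>)" for \<omega>
  unfolding k_ind by (rule borel_integrable_compact) (auto simp: e_def cis_conv_exp intro!: continuous_intros)
 have kn: "(LINT x|lborel. norm (k \<omega> x)) <= 2 * \<bar>t\<bar> * \<phi> \<omega>" if \<omega>: "\<omega> \<in> space M" for \<omega>
 proof -
  have "(LINT x|lborel. norm (k \<omega> x)) <= (LINT x|lborel. 2 * \<bar>t\<bar> * indicator {0..\<phi> \<omega>} x)"
  proof (rule integral_mono[OF integrable_norm[OF ki]])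
   show "integrable lborel (\<lambda>x. 2 * \<bar>t\<bar> * indicator {0..\<phi> \<omega>} x)"
    using pos[OF \<omega>] by (intro integrable_mult_right integrable_real_indicator) auto
  qed (auto simp: k_def indicator_def e_le)
  then show ?thesis using pos[OF \<omega>] by simp
 qed
 have Kint: "integrable (M \<Otimes>\<^sub>M lborel) (case_prod k)"
 proof (rule P.Fubini_integrable[OF km])
  show "integrable M (\<lambda>\<omega>. LINT x|lborel. norm (case_prod k (\<omega>, x)))"
  proof (rule bochner_dominated[OF integrable_mult_right[OF int, of "2 * \<bar>t\<bar>"]])
   show "AE \<omega> in M. norm (LINT x|lborel. norm (case_prod k (\<omega>, x))) <= norm (2 * \<bar>t\<bar> * \<phi> \<omega>)"
    using kn pos by (auto intro!: AE_I2 simp: abs_mult)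
  qed measurable
 qed (simp add: ki)
 have inner: "(LINT x|lborel. k \<omega> x) = cis (t * \<phi> \<omega>) - 1 - \<i> * t * \<phi> \<omega>" if \<omega>: "\<omega> \<in> space M" for \<omega>
 proof -
  define E where "E x = cis (t * x) - \<i> * t * x" for x
  have "(LINT x|lborel. indicator {0..\<phi> \<omega>} x *\<^sub>R e x) = E (\<phi> \<omega>) - E 0"
  proof (rule integral_FTC_Icc[OF pos[OF \<omega>]])
   fix x
   have "((\<lambda>z. exp (\<i> * of_real t * z) - \<i> * of_real t * z) has_field_derivative e x) (at (of_real x))"
    by (auto intro!: derivative_eq_intros simp: e_def cis_conv_exp algebra_simps)
   from has_vector_derivative_real_field[OF this]
   show "(E has_vector_derivative e x) (at x within {0..\<phi> \<omega>})"
    by (simp add: E_def[abs_def] cis_conv_exp mult.assoc has_vector_derivative_at_within)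
   show "continuous_on {0..\<phi> \<omega>} e" unfolding e_def cis_conv_exp by (intro continuous_intros)
  qed
  then show ?thesis by (simp add: k_ind E_def)
 qed
 have outer: "(LINT \<omega>|M. k \<omega> x) = stable_kernel t x (prob {\<omega>\<in>space M. x <= \<phi> \<omega>})" for x
 proof (cases "0 < x")
  case True
  have "(LINT \<omega>|M. k \<omega> x) = (LINT \<omega>|M. indicator {\<omega>\<in>space M. x <= \<phi> \<omega>} \<omega> *\<^sub>R e x)"
   using True by (intro bochner_cong) (auto simp: k_def indicator_def)
  also have "\<dots> = (LINT \<omega>|M. indicator {\<omega>\<in>space M. x <= \<phi> \<omega>} \<omega>) *\<^sub>R e x"
   by (rule integral_scaleR_left) (rule integrable_const_bound[where B = 1], auto)
  also have "(LINT \<omega>|M. indicator {\<omega>\<in>space M. x <= \<phi> \<omega>} \<omega>) = prob {\<omega>\<in>space M. x <= \<phi> \<omega>}"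
   by (simp add: Int_def conj_ac)
  finally show ?thesis using True by (simp add: stable_kernel_def e_def scaleR_conv_of_real)
 next
  case False
  then have "k \<omega> x = 0" for \<omega> by (cases "x = 0") (auto simp: k_def e_def)
  then show ?thesis using False by (simp add: stable_kernel_def)
 qed
 have ci: "integrable M (\<lambda>\<omega>. cis (t * \<phi> \<omega>))"
  by (rule integrable_const_bound[where B = 1]) (auto simp: cis_conv_exp)
 have "(LINT \<omega>|M. cis (t * \<phi> \<omega>)) - 1 - \<i> * t * (LINT \<omega>|M. \<phi> \<omega>) = (LINT \<omega>|M. cis (t * \<phi> \<omega>) - 1 - \<i> * t * \<phi> \<omega>)"
  using ci int by (simp add: prob_space)
 also have "\<dots> = (LINT \<omega>|M. (\<integral>x. k \<omega> x \<partial>lborel))"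
  by (intro bochner_cong) (auto simp: inner)
 also have "\<dots> = (LINT x|lborel. (\<integral>\<omega>. k \<omega> x \<partial>M))" by (rule P.Fubini_integral[OF Kint, symmetric])
 finally show ?thesis unfolding outer .
qed

text \<open>After scaling by \<open>N = n^(1/p)\<close>, the tail times \<open>n\<close> at \<open>N * x\<close>
converges to \<open>C * x^(-p)\<close>, dominated by a multiple of the same power. The tail representation then
turns into the integral defining the stable exponent.\<close>
lemma stable_expansion:
 fixes \<phi> :: "'a => real"
 assumes [measurable]: "\<phi> \<in> borel_measurable M" and pos: "\<And>\<omega>. \<omega> \<in> space M ==> 0 <= \<phi> \<omega>" and int: "integrable M \<phi>"
  and p: "1 < p" "p < 2"
  and tail: "((\<lambda>x. x powr p * prob {\<omega>\<in>space M. x <= \<phi> \<omega>}) \<longlongrightarrow> C) at_top"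
 shows "(\<lambda>n. of_nat n * ((LINT \<omega>|M. cis (t / real n powr (1 / p) * (\<phi> \<omega> - (LINT \<omega>|M. \<phi> \<omega>)))) - 1))
  \<longlonglongrightarrow> stable_exponent p (C * Gamma (1 - p) * cos (p * pi / 2)) t"
proof -
 define m where "m = (LINT \<omega>|M. \<phi> \<omega>)"
 define N where "N n = real n powr (1 / p)" for n
 have N: "0 < N n" "N n powr p = n" if "0 < n" for n using that p by (auto simp: N_def powr_powr)
 have Ninf: "filterlim N at_top sequentially"
  unfolding N_def using p
  by (intro filterlim_compose[OF filterlim_powr_at_top filterlim_real_sequentially]) auto
 define R where "R y = y powr p * prob {\<omega>\<in>space M. y <= \<phi> \<omega>}" for y
 have RC: "(R \<longlongrightarrow> C) at_top" using tail by (simp add: R_def[abs_def])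
 have R0: "0 <= R y" for y by (simp add: R_def)
 (* The normalised tail R is bounded: near infinity since it converges, elsewhere by a power of y. *)
 obtain D where D: "\<And>y. 0 < y ==> R y <= D"
 proof -
  have "\<forall>\<^sub>F y in at_top. R y < \<bar>C\<bar> + 1" by (rule order_tendstoD(2)[OF RC]) simp
  then obtain y0 where y0: "\<And>y. y0 <= y ==> R y < \<bar>C\<bar> + 1" by (auto simp: eventually_at_top_linorder)
  have "R y <= max (\<bar>C\<bar> + 1) (\<bar>y0\<bar> powr p)" if "0 < y" for y
  proof (cases "y0 <= y")
   case True then show ?thesis using y0[OF True] by simp
  next
   case False
   have "R y <= \<bar>y0\<bar> powr p * 1" unfolding R_def using False that p by (intro mult_mono powr_mono2) auto
   then show ?thesis by simp
  qed
  then show ?thesis by (rule that)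
 qed
 have Rm[measurable]: "R \<in> borel_measurable borel"
 proof -
  have "mono (\<lambda>x. - prob {\<omega>\<in>space M. x <= \<phi> \<omega>})" by (intro monoI) (auto intro!: finite_measure_mono)
  then have "(\<lambda>x. - prob {\<omega>\<in>space M. x <= \<phi> \<omega>}) \<in> borel_measurable borel" by (rule borel_measurable_mono)
  then have [measurable]: "(\<lambda>x. prob {\<omega>\<in>space M. x <= \<phi> \<omega>}) \<in> borel_measurable borel"
   by (subst (asm) borel_measurable_uminus_eq)
  show ?thesis unfolding R_def by measurable
 qed
 define J where "J n = (LINT x|lborel. stable_kernel t x (prob {\<omega>\<in>space M. N n * x <= \<phi> \<omega>}))" for n
 have char_eq: "(LINT \<omega>|M. cis (t / N n * \<phi> \<omega>)) = 1 + \<i> * (t / N n * m) + J n" if n: "0 < n" for n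
 proof -
  have "(LINT \<omega>|M. cis (t * (\<phi> \<omega> / N n))) - 1 - \<i> * t * (LINT \<omega>|M. \<phi> \<omega> / N n)
   = (LINT x|lborel. stable_kernel t x (prob {\<omega>\<in>space M. x <= \<phi> \<omega> / N n}))"
   using N[OF n] pos int by (intro tail_representation) auto
  moreover have "(x <= \<phi> \<omega> / N n) = (N n * x <= \<phi> \<omega>)" for x \<omega> using N[OF n] by (simp add: field_simps)
  ultimately have "(LINT \<omega>|M. cis (t / N n * \<phi> \<omega>)) - 1 - \<i> * t * (m / N n) = J n"
   by (simp add: J_def m_def)
  then show ?thesis by (simp add: algebra_simps)
 qed
 define L where "L = stable_exponent p (C * Gamma (1 - p) * cos (p * pi / 2)) t"
 have J: "(\<lambda>n. of_nat n * J n) \<longlonglongrightarrow> L"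
 proof (rule Lim_transform_eventually)
  have "(\<lambda>n. LINT x|lborel. stable_kernel t x (R (N n * x) * x powr (- p))) \<longlonglongrightarrow> (LINT x|lborel. stable_kernel t x (C * x powr (- p)))"
  proof (rule integral_dominated_convergence[where w = "\<lambda>x. \<bar>t\<bar> * D * (indicator {0<..} x * (min 2 (\<bar>t\<bar> * x) * x powr (- p)))"])
   show "AE x in lborel. (\<lambda>n. stable_kernel t x (R (N n * x) * x powr (- p))) \<longlonglongrightarrow> stable_kernel t x (C * x powr (- p))"
   proof (rule AE_I2)
    fix x :: real
    show "(\<lambda>n. stable_kernel t x (R (N n * x) * x powr (- p))) \<longlonglongrightarrow> stable_kernel t x (C * x powr (- p))"
    proof (cases "0 < x")
     case True
     have "(\<lambda>n. R (N n * x)) \<longlonglongrightarrow> C"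
      by (rule filterlim_compose[OF RC filterlim_at_top_mult_tendsto_pos[OF tendsto_const True Ninf]])
     then show ?thesis unfolding stable_kernel_scale by (intro tendsto_mult tendsto_const tendsto_of_real)
    qed (simp add: stable_kernel_def)
   qed
   show "AE x in lborel. norm (stable_kernel t x (R (N n * x) * x powr (- p)))
     <= \<bar>t\<bar> * D * (indicator {0<..} x * (min 2 (\<bar>t\<bar> * x) * x powr (- p)))" for n
   proof (rule AE_I2)
    fix x :: real
    have "indicator {0<..} x * (min 2 (\<bar>t\<bar> * x) * \<bar>R (N n * x) * x powr (- p)\<bar>)
     <= D * (indicator {0<..} x * (min 2 (\<bar>t\<bar> * x) * x powr (- p)))"
    proof (cases "0 < x")
     case True
     have "0 <= N n" by (simp add: N_def)
     then have "R (N n * x) <= D" using D[of "N n * x"] order_trans[OF R0 D[OF zero_less_one]] True by (cases "N n = 0") (auto simp: R_def)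
     then have "min 2 (\<bar>t\<bar> * x) * x powr (- p) * R (N n * x) <= min 2 (\<bar>t\<bar> * x) * x powr (- p) * D"
      using True by (intro mult_left_mono) auto
     then show ?thesis using True R0[of "N n * x"] by (simp add: abs_mult mult_ac)
    qed simp
    from mult_left_mono[OF this, of "\<bar>t\<bar>"]
    show "norm (stable_kernel t x (R (N n * x) * x powr (- p))) <= \<bar>t\<bar> * D * (indicator {0<..} x * (min 2 (\<bar>t\<bar> * x) * x powr (- p)))"
     using norm_stable_kernel[of t x "R (N n * x) * x powr (- p)"] by (simp add: mult.assoc)
   qed
   show "integrable lborel (\<lambda>x. \<bar>t\<bar> * D * (indicator {0<..} x * (min 2 (\<bar>t\<bar> * x) * x powr (- p))))"
    by (intro integrable_mult_right integrable_min_powr p) simp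
  qed (unfold stable_kernel_def cis_conv_exp, measurable)
  also have "(LINT x|lborel. stable_kernel t x (C * x powr (- p))) = L"
   unfolding stable_kernel_scale integral_mult_right_zero
   unfolding stable_kernel_def scaled_stable_K[OF p] by (simp add: L_def stable_exponent_def mult_ac)
  finally show "(\<lambda>n. LINT x|lborel. stable_kernel t x (R (N n * x) * x powr (- p))) \<longlonglongrightarrow> L" .
  show "\<forall>\<^sub>F n in sequentially. (LINT x|lborel. stable_kernel t x (R (N n * x) * x powr (- p))) = of_nat n * J n"
   using eventually_gt_at_top[of 0]
  proof eventually_elim
   case (elim n)
   have "stable_kernel t x (R (N n * x) * x powr (- p)) = of_real (real n) * stable_kernel t x (prob {\<omega>\<in>space M. N n * x <= \<phi> \<omega>})" for x
   proof (cases "0 < x")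
    case True
    have "R (N n * x) * x powr (- p) = real n * prob {\<omega>\<in>space M. N n * x <= \<phi> \<omega>}"
     using N[OF elim] True by (simp add: R_def powr_mult powr_minus)
    then show ?thesis by (simp only: stable_kernel_scale[symmetric])
   qed (simp add: stable_kernel_def)
   then show ?case by (simp add: J_def)
  qed
 qed
 have p2: "2 / p > 1" using p by simp
 (* Centring by the mean m costs only a second-order term, negligible because p < 2. *)
 have sq: "(\<lambda>n. of_nat n * (1 + \<i> * (t / N n * m) - cis (t / N n * m))) \<longlonglongrightarrow> 0"
 proof (rule Lim_null_comparison)
  show "\<forall>\<^sub>F n in sequentially. norm (of_nat n * (1 + \<i> * (t / N n * m) - cis (t / N n * m))) <= (t * m)\<^sup>2 / 2 * real n powr (1 - 2 / p)"
   using eventually_gt_at_top[of 0]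
  proof eventually_elim
   case (elim n)
   define a where "a = t / N n * m"
   have "norm (1 + \<i> * a - cis a) <= \<bar>a\<bar>\<^sup>2 / 2"
    using iexp_approx1[of a 1] by (subst norm_minus_commute) (simp add: cis_conv_exp numeral_2_eq_2 algebra_simps diff_diff_eq)
   then have "real n * norm (1 + \<i> * a - cis a) <= n * (\<bar>a\<bar>\<^sup>2 / 2)" by (rule mult_left_mono) simp
   then have "norm (of_nat n * (1 + \<i> * a - cis a)) <= n * (a\<^sup>2 / 2)" by (simp add: norm_mult)
   also have "n * (a\<^sup>2 / 2) = (t * m)\<^sup>2 / 2 * (n / (N n)\<^sup>2)" by (simp add: a_def power_divide power_mult_distrib mult_ac)
   also have "n / (N n)\<^sup>2 = real n powr (1 - 2 / p)"
    using elim by (simp add: N_def powr_diff powr_powr flip: powr_numeral)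
   finally show ?case by (simp add: a_def)
  qed
  show "(\<lambda>n. (t * m)\<^sup>2 / 2 * real n powr (1 - 2 / p)) \<longlonglongrightarrow> 0"
   using p2 by (intro tendsto_mult_right_zero tendsto_neg_powr filterlim_real_sequentially) simp
 qed
 have cis1: "(\<lambda>n. cis (- (t / N n * m))) \<longlonglongrightarrow> 1"
 proof -
  have z: "(\<lambda>n. - (t / N n * m)) \<longlonglongrightarrow> - (0 * m)"
   by (intro tendsto_intros tendsto_divide_0[OF tendsto_const] filterlim_at_top_imp_at_infinity Ninf)
  have "(\<lambda>n. exp (\<i> * complex_of_real (- (t / N n * m)))) \<longlonglongrightarrow> exp (\<i> * complex_of_real (- (0 * m)))"
   by (intro tendsto_exp tendsto_mult tendsto_const tendsto_of_real[OF z])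
  then show ?thesis by (simp add: cis_conv_exp)
 qed
 have "(\<lambda>n. cis (- (t / N n * m)) * (of_nat n * J n + of_nat n * (1 + \<i> * (t / N n * m) - cis (t / N n * m)))) \<longlonglongrightarrow> 1 * (L + 0)"
  by (intro tendsto_mult tendsto_add cis1 J sq)
 then have lim: "(\<lambda>n. cis (- (t / N n * m)) * (of_nat n * J n + of_nat n * (1 + \<i> * (t / N n * m) - cis (t / N n * m)))) \<longlonglongrightarrow> L" by simp
 show ?thesis unfolding m_def[symmetric] N_def[symmetric] L_def[symmetric]
 proof (rule Lim_transform_eventually[OF lim])
  show "\<forall>\<^sub>F n in sequentially. cis (- (t / N n * m)) * (of_nat n * J n + of_nat n * (1 + \<i> * (t / N n * m) - cis (t / N n * m)))
    = of_nat n * ((LINT \<omega>|M. cis (t / N n * (\<phi> \<omega> - m))) - 1)"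
   using eventually_gt_at_top[of 0]
  proof eventually_elim
   case (elim n)
   have "(LINT \<omega>|M. cis (t / N n * (\<phi> \<omega> - m))) = (LINT \<omega>|M. cis (- (t / N n * m)) * cis (t / N n * \<phi> \<omega>))"
    by (simp add: cis_mult right_diff_distrib)
   also have "\<dots> = cis (- (t / N n * m)) * (1 + \<i> * (t / N n * m) + J n)"
    unfolding integral_mult_right_zero char_eq[OF elim] ..
   finally have "(LINT \<omega>|M. cis (t / N n * (\<phi> \<omega> - m))) - 1
     = cis (- (t / N n * m)) * (J n + (1 + \<i> * (t / N n * m) - cis (t / N n * m)))"
    by (simp add: algebra_simps cis_mult)
   then show ?case unfolding distrib_left[of "of_nat n", symmetric] by (simp only: mult.left_commute)
  qed
 qed
qed

end

section \<open>Geometry of the left branch\<close>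

locale lsv =
 fixes \<alpha> :: real
 assumes \<alpha>: "0 < \<alpha>" "\<alpha> < 1"
begin

definition lbr :: "real => real" where "lbr x = x * (1 + 2 powr \<alpha> * x powr \<alpha>)"

definition dT :: "real => real" where "dT x = 1 + (1 + \<alpha>) * 2 powr \<alpha> * x powr \<alpha>"

lemma lbr_0[simp]: "lbr 0 = 0" by (simp add: lbr_def)

lemma lbr_half[simp]: "lbr (1/2) = 1"
 by (simp add: lbr_def powr_divide)

lemma lbr_expand: "0 <= x ==> lbr x = x + 2 powr \<alpha> * x powr (1 + \<alpha>)"
 by (simp add: lbr_def algebra_simps powr_mult_base)

lemma lbr_diff: "0 <= x ==> x <= y ==> y - x <= lbr y - lbr x"
 using \<alpha> by (simp add: lbr_expand powr_mono2)

lemma lbr_ge: "0 <= x ==> x <= lbr x"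
 using lbr_diff[of 0 x] by simp

lemma lbr_strict_mono: "0 <= x ==> x < y ==> lbr x < lbr y"
 using lbr_diff[of x y] by simp

lemma lbr_le_double: "0 <= x ==> x <= 1/2 ==> lbr x <= 2 * x"
proof -
 assume x: "0 <= x" "x <= 1/2"
 have "2 powr \<alpha> * x powr \<alpha> = (2 * x) powr \<alpha>" using x by (simp add: powr_mult)
 also have "\<dots> <= 1 powr \<alpha>" using x \<alpha> by (intro powr_mono2) auto
 finally have "x * (2 powr \<alpha> * x powr \<alpha>) <= x * 1" using x by (intro mult_left_mono) auto
 then show ?thesis by (simp add: lbr_def algebra_simps)
qed

lemma continuous_on_lbr: "continuous_on {0..} lbr"
 unfolding lbr_def using \<alpha> by (intro continuous_intros continuous_on_powr') auto

lemma DERIV_lbr: "0 < x ==> (lbr has_real_derivative dT x) (at x)"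
 unfolding lbr_def[abs_def] dT_def
 by (auto intro!: derivative_eq_intros simp: powr_diff field_simps)

lemma dT_ge_1: "1 <= dT x"
 using \<alpha> by (simp add: dT_def)

lemma dT_mono: "0 <= x ==> x <= y ==> dT x <= dT y"
 using \<alpha> by (simp add: dT_def powr_mono2)

lemma dT_half: "dT (1/2) = 2 + \<alpha>"
 by (simp add: dT_def powr_divide)

definition linv :: "real => real" where "linv y = (THE x. 0 <= x \<and> lbr x = y)"

lemma linv:
 assumes "0 <= y" shows "0 <= linv y" "lbr (linv y) = y"
proof -
 have "\<exists>x\<ge>0. x <= y \<and> lbr x = y"
  by (rule IVT') (use assms lbr_ge[OF assms] in \<open>auto intro: continuous_on_subset[OF continuous_on_lbr]\<close>)
 then obtain x where x: "0 <= x" "lbr x = y" by auto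
 have u: "x' = x" if "0 <= x'" "lbr x' = y" for x'
  using lbr_strict_mono[of x x'] lbr_strict_mono[of x' x] x that by (cases x x' rule: linorder_cases) auto
 have "linv y = x" unfolding linv_def by (rule the_equality) (use x u in blast)+
 with x show "0 <= linv y" "lbr (linv y) = y" by auto
qed

lemma linv_lbr: "0 <= x ==> linv (lbr x) = x"
 using linv[of "lbr x"] lbr_ge[of x] lbr_strict_mono[of x "linv (lbr x)"] lbr_strict_mono[of "linv (lbr x)" x]
 by (cases x "linv (lbr x)" rule: linorder_cases) auto

lemma linv_0[simp]: "linv 0 = 0" using linv_lbr[of 0] by simp

lemma linv_1[simp]: "linv 1 = 1/2" using linv_lbr[of "1/2"] by simp

lemma linv_strict_mono: "0 <= x ==> x < y ==> linv x < linv y"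
 using linv[of x] linv[of y] lbr_strict_mono[of "linv y" "linv x"] by (cases "linv x" "linv y" rule: linorder_cases) auto

lemma linv_mono: "0 <= x ==> x <= y ==> linv x <= linv y"
 using linv_strict_mono[of x y] by (cases "x = y") auto

lemma linv_pos: "0 < y ==> 0 < linv y"
 using linv_strict_mono[of 0 y] by simp

lemma linv_lipschitz: "0 <= x ==> 0 <= y ==> \<bar>linv x - linv y\<bar> <= \<bar>x - y\<bar>"
proof (induction x y rule: linorder_wlog)
 case (le x y)
 then have "linv y - linv x <= lbr (linv y) - lbr (linv x)" by (intro lbr_diff linv_mono linv) auto
 then show ?case using linv[of x] linv[of y] le linv_mono[of x y] by simp
qed (simp add: abs_minus_commute)

lemma isCont_linv: "0 < y ==> isCont linv y"
proof -
 assume y: "0 < y"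
 have "1-lipschitz_on {0..} linv"
  by (rule lipschitz_onI) (auto simp: dist_real_def intro: linv_lipschitz)
 then have "continuous_on {0..} linv" by (rule lipschitz_on_continuous_on)
 then have "continuous_on {0<..} linv" by (rule continuous_on_subset) auto
 then show ?thesis using y by (simp add: continuous_on_eq_continuous_at)
qed

lemma DERIV_linv: assumes y: "0 < y" shows "(linv has_real_derivative 1 / dT (linv y)) (at y)"
proof -
 have "(linv has_real_derivative inverse (dT (linv y))) (at y)"
 proof (rule DERIV_inverse_function[where f = lbr and a = 0 and b = "y + 1"])
  show "(lbr has_real_derivative dT (linv y)) (at (linv y))" by (rule DERIV_lbr[OF linv_pos[OF y]])
  show "dT (linv y) \<noteq> 0" using dT_ge_1[of "linv y"] by simp
 qed (use y linv isCont_linv in auto)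
 then show ?thesis by (simp add: inverse_eq_divide)
qed

abbreviation lp :: "nat => real => real" where "lp n \<equiv> linv ^^ n"

text \<open>The preimages of 1 under the left branch; points between \<open>xs (Suc n)\<close> and
\<open>xs n\<close> need exactly \<open>n\<close> steps to reach \<open>(1/2, 1]\<close>.\<close>
definition xs :: "nat => real" where "xs n = lp n 1"

lemma lp_Suc: "lp (Suc n) y = linv (lp n y)" by simp

lemma lp_nonneg: "0 <= y ==> 0 <= lp n y" and lp_pos: "0 < y ==> 0 < lp n y"
 by (induction n) (auto intro: linv linv_pos)

lemma lp_mono: "0 <= x ==> x <= y ==> lp n x <= lp n y"
 by (induction n) (auto intro: linv_mono lp_nonneg)

lemma lp_strict_mono: "0 <= x ==> x < y ==> lp n x < lp n y"
 by (induction n) (auto intro: linv_strict_mono lp_nonneg)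

lemma lp_lipschitz: "0 <= x ==> 0 <= y ==> \<bar>lp n x - lp n y\<bar> <= \<bar>x - y\<bar>"
proof (induction n)
 case (Suc n)
 have "\<bar>lp (Suc n) x - lp (Suc n) y\<bar> <= \<bar>lp n x - lp n y\<bar>"
  using linv_lipschitz[OF lp_nonneg lp_nonneg, of x y n n] Suc.prems by simp
 then show ?case using Suc by simp
qed simp

lemma xs_0[simp]: "xs 0 = 1" and xs_1[simp]: "xs (Suc 0) = 1/2" by (simp_all add: xs_def)

lemma xs_Suc: "xs (Suc n) = linv (xs n)" by (simp add: xs_def)

lemma xs_pos: "0 < xs n" by (simp add: xs_def lp_pos)

lemma lbr_xs: "lbr (xs (Suc n)) = xs n"
 using linv(2)[of "xs n"] xs_pos[of n] by (simp add: xs_Suc)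

lemma xs_decreasing: "xs (Suc n) < xs n"
proof -
 have "0 < 2 powr \<alpha> * xs (Suc n) powr (1 + \<alpha>)" using xs_pos[of "Suc n"] by simp
 then show ?thesis using lbr_expand[of "xs (Suc n)"] xs_pos[of "Suc n"] lbr_xs[of n] by simp
qed

lemma xs_diff: "xs n - xs (Suc n) = 2 powr \<alpha> * xs (Suc n) powr (1 + \<alpha>)"
 using lbr_expand[of "xs (Suc n)"] xs_pos[of "Suc n"] lbr_xs[of n] by simp

lemma xs_antimono: "m <= n ==> xs n <= xs m"
 by (rule lift_Suc_antimono_le[of xs]) (auto intro: less_imp_le xs_decreasing)

lemma xs_le_1: "xs n <= 1" using xs_antimono[of 0 n] by simp

lemma xs_le_half: "xs (Suc n) <= 1/2" using xs_antimono[of 1 "Suc n"] by simp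

lemma xs_ratio: "xs n <= 2 * xs (Suc n)"
 using lbr_le_double[of "xs (Suc n)"] xs_pos[of "Suc n"] xs_le_half[of n] by (simp add: lbr_xs)

lemma lp_half: "lp n (1/2) = xs (Suc n)"
 by (simp add: xs_def funpow_swap1 del: funpow.simps) (simp add: funpow_Suc_right del: funpow.simps)

lemma lp_bounds: "1/2 <= y ==> y <= 1 ==> xs (Suc n) <= lp n y \<and> lp n y <= xs n"
 using lp_mono[of "1/2" y n] lp_mono[of y 1 n] by (simp add: lp_half) (simp add: xs_def)

lemma xs_tendsto_0: "xs \<longlonglongrightarrow> 0"
proof -
 have dec: "decseq xs" using xs_antimono by (simp add: decseq_def)
 have "0 <= xs n" for n using xs_pos[of n] by simp
 then obtain L where L: "xs \<longlonglongrightarrow> L" "\<forall>n. L <= xs n"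
  using decseq_convergent[OF dec, of 0] by metis
 have L0: "0 <= L" by (rule LIMSEQ_le_const[OF L(1)]) (auto intro: less_imp_le xs_pos)
 have "(\<lambda>n. 2 powr \<alpha> * xs (Suc n) powr (1 + \<alpha>)) \<longlonglongrightarrow> L - L"
  unfolding xs_diff[symmetric] by (intro tendsto_diff L LIMSEQ_Suc)
 moreover have "(\<lambda>n. 2 powr \<alpha> * xs (Suc n) powr (1 + \<alpha>)) \<longlonglongrightarrow> 2 powr \<alpha> * L powr (1 + \<alpha>)"
  using \<alpha> by (intro tendsto_mult tendsto_const tendsto_powr2 LIMSEQ_Suc L always_eventually allI less_imp_le xs_pos) simp
 ultimately have "2 powr \<alpha> * L powr (1 + \<alpha>) = 0" using LIMSEQ_unique by fastforce
 then have "L = 0" using L0 by auto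
 with L show ?thesis by simp
qed

definition dl :: "nat => real => real" where "dl n y = (\<Prod>j<n. 1 / dT (lp (Suc j) y))"

lemma dl_0[simp]: "dl 0 y = 1" by (simp add: dl_def)

lemma dl_Suc: "dl (Suc n) y = dl n y / dT (lp (Suc n) y)" by (simp add: dl_def)

lemma dl_pos: "0 < dl n y"
 unfolding dl_def using dT_ge_1 by (intro prod_pos) (auto intro: less_le_trans[OF zero_less_one])

lemma DERIV_lp: "0 < y ==> (lp n has_real_derivative dl n y) (at y)"
proof (induction n)
 case 0
 show ?case by (simp add: id_def)
next
 case (Suc n)
 have "((\<lambda>y. linv (lp n y)) has_real_derivative 1 / dT (linv (lp n y)) * dl n y) (at y)"
  by (rule DERIV_chain2[OF DERIV_linv[OF lp_pos[OF Suc.prems]] Suc.IH[OF Suc.prems]])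
 then show ?case by (simp add: dl_Suc comp_def)
qed

lemma dl_antimono: "0 <= x ==> x <= y ==> dl n y <= dl n x"
proof (induction n)
 case (Suc n)
 have "dT (lp (Suc n) x) <= dT (lp (Suc n) y)" using Suc.prems by (intro dT_mono lp_nonneg lp_mono)
 then show ?case unfolding dl_Suc
  using Suc dl_pos[of n y] dT_ge_1[of "lp (Suc n) x"] by (intro frac_le) (auto intro: less_imp_le)
qed simp

text \<open>The orbit of 1/2 is the orbit of 1 shifted by one step, so the two products of derivatives share all
factors but the first and the last.\<close>
lemma dl_endpoints: "dl n (1/2) * dT (xs (Suc n)) = dl n 1 * dT (1/2)"
proof (induction n)
 case (Suc n)
 have a: "dT (xs (Suc n)) \<noteq> 0" "dT (xs (Suc (Suc n))) \<noteq> 0"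
  using dT_ge_1[of "xs (Suc n)"] dT_ge_1[of "xs (Suc (Suc n))"] by auto
 have "dl (Suc n) (1/2) * dT (xs (Suc (Suc n))) = dl n (1/2)"
  using a(2) lp_half[of "Suc n"] by (simp add: dl_Suc)
 also have "\<dots> = (dl n (1/2) * dT (xs (Suc n))) / dT (xs (Suc n))" using a by simp
 also have "\<dots> = dl n 1 * dT (1/2) / dT (lp (Suc n) 1)" unfolding Suc by (simp add: xs_def)
 also have "\<dots> = dl (Suc n) 1 * dT (1/2)" by (simp add: dl_Suc)
 finally show ?case .
qed simp

text \<open>The derivative is decreasing, so its ratio is largest for the endpoints, where it is at most
\<open>dT (1/2) = 2 + \<alpha>\<close>.\<close>
lemma dl_bounded_distortion:
 assumes "1/2 <= x" "x <= 1" "1/2 <= y" "y <= 1"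
 shows "dl n x <= 3 * dl n y"
proof -
 have "dl n x <= dl n (1/2)" using assms by (intro dl_antimono) auto
 also have "\<dots> <= dl n (1/2) * dT (xs (Suc n))"
  using dT_ge_1 dl_pos[of n "1/2"] by (simp add: mult_le_cancel_left1 not_less less_imp_le)
 also have "\<dots> = dl n 1 * (2 + \<alpha>)" unfolding dl_endpoints dT_half ..
 also have "\<dots> <= dl n 1 * 3" using \<alpha> dl_pos[of n 1] by (intro mult_left_mono) auto
 also have "\<dots> <= dl n y * 3" using assms by (intro mult_right_mono dl_antimono) auto
 finally show ?thesis by simp
qed

text \<open>By the mean value theorem the derivative takes somewhere the value
\<open>2 * (xs n - xs (Suc n))\<close>; bounded distortion extends this to all points up to the factor
3.\<close>
lemma dl_le:
 assumes "1/2 <= y" "y <= 1" shows "dl n y <= 6 * (xs n - xs (Suc n))"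
proof -
 obtain \<xi> where \<xi>: "1/2 < \<xi>" "\<xi> < 1" "lp n 1 - lp n (1/2) = (1 - 1/2) * dl n \<xi>"
  using MVT2[of "1/2" 1 "lp n" "dl n"] DERIV_lp by force
 have "dl n y <= 3 * dl n \<xi>" using assms \<xi> by (intro dl_bounded_distortion) auto
 also have "\<dots> = 6 * (lp n 1 - lp n (1/2))" unfolding \<xi>(3) by simp
 also have "\<dots> = 6 * (xs n - xs (Suc n))" by (simp add: lp_half) (simp add: xs_def)
 finally show ?thesis .
qed

lemma lp_diff_le:
 assumes "1/2 <= x" "x <= y" "y <= 1" shows "lp n y - lp n x <= 6 * (xs n - xs (Suc n)) * (y - x)"
proof (cases "x = y")
 case False
 then have "x < y" using assms by simp
 then obtain \<xi> where \<xi>: "x < \<xi>" "\<xi> < y" "lp n y - lp n x = (y - x) * dl n \<xi>"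
  using MVT2[of x y "lp n" "dl n"] DERIV_lp assms by force
 have "dl n \<xi> <= 6 * (xs n - xs (Suc n))" using \<xi> assms by (intro dl_le) auto
 then show ?thesis using \<xi> by (simp add: mult.commute mult_right_mono)
qed simp

lemma powr_concave:
 assumes "0 < a" "a <= b"
 shows "\<alpha> * b powr (\<alpha> - 1) * (b - a) <= b powr \<alpha> - a powr \<alpha>"
  "b powr \<alpha> - a powr \<alpha> <= \<alpha> * a powr (\<alpha> - 1) * (b - a)"
proof -
 have "\<exists>\<xi>. a <= \<xi> \<and> \<xi> <= b \<and> b powr \<alpha> - a powr \<alpha> = (b - a) * (\<alpha> * \<xi> powr (\<alpha> - 1))"
 proof (cases "a = b")
  case False
  then have "a < b" using assms by simp
  then obtain \<xi> where "a < \<xi>" "\<xi> < b" "b powr \<alpha> - a powr \<alpha> = (b - a) * (\<alpha> * \<xi> powr (\<alpha> - 1))"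
   using MVT2[of a b "\<lambda>x. x powr \<alpha>" "\<lambda>x. \<alpha> * x powr (\<alpha> - 1)"] assms
   by (force intro!: has_real_derivative_powr)
  then show ?thesis by (intro exI[of _ \<xi>]) auto
 qed auto
 then obtain \<xi> where \<xi>: "a <= \<xi>" "\<xi> <= b" "b powr \<alpha> - a powr \<alpha> = (b - a) * (\<alpha> * \<xi> powr (\<alpha> - 1))" by blast
 have "b powr (\<alpha> - 1) <= \<xi> powr (\<alpha> - 1)" "\<xi> powr (\<alpha> - 1) <= a powr (\<alpha> - 1)"
  using assms \<xi> \<alpha> by (auto intro!: powr_mono2')
 then have "(b - a) * (\<alpha> * b powr (\<alpha> - 1)) <= (b - a) * (\<alpha> * \<xi> powr (\<alpha> - 1))"
   "(b - a) * (\<alpha> * \<xi> powr (\<alpha> - 1)) <= (b - a) * (\<alpha> * a powr (\<alpha> - 1))"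
  using assms \<alpha> by (auto intro!: mult_left_mono)
 then show "\<alpha> * b powr (\<alpha> - 1) * (b - a) <= b powr \<alpha> - a powr \<alpha>"
  "b powr \<alpha> - a powr \<alpha> <= \<alpha> * a powr (\<alpha> - 1) * (b - a)" unfolding \<xi>(3) by (simp_all add: mult_ac)
qed

text \<open>Since \<open>dT\<close> is affine in \<open>x powr \<alpha>\<close>, the variation of its logarithm
along the two orbits is governed by these differences. They are compared with the increments of
\<open>xs j powr \<alpha>\<close> because those telescope.\<close>
lemma dl_distortion_step:
 assumes "1/2 <= x" "x <= y" "y <= 1"
 shows "lp (Suc j) y powr \<alpha> - lp (Suc j) x powr \<alpha> <= 12 * (y - x) * (xs (Suc j) powr \<alpha> - xs (Suc (Suc j)) powr \<alpha>)"
proof -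
 let ?j = "Suc j"
 have a: "xs (Suc ?j) <= lp ?j x" "0 < lp ?j x" "lp ?j x <= lp ?j y"
  using lp_bounds[of x ?j] lp_pos[of x ?j] lp_mono[of x y ?j] assms by auto
 have "lp ?j y powr \<alpha> - lp ?j x powr \<alpha> <= \<alpha> * lp ?j x powr (\<alpha> - 1) * (lp ?j y - lp ?j x)"
  by (rule powr_concave(2)[OF a(2,3)])
 also have "\<dots> <= \<alpha> * (2 * xs ?j powr (\<alpha> - 1)) * (6 * (xs ?j - xs (Suc ?j)) * (y - x))"
 proof (intro mult_mono lp_diff_le assms order_refl)
  have "lp ?j x powr (\<alpha> - 1) <= (xs ?j / 2) powr (\<alpha> - 1)"
   using a xs_ratio[of ?j] xs_pos[of ?j] \<alpha> by (intro powr_mono2') auto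
  also have "\<dots> = 2 powr (1 - \<alpha>) * xs ?j powr (\<alpha> - 1)"
   using xs_pos[of ?j] by (simp add: powr_divide powr_diff)
  also have "\<dots> <= 2 powr 1 * xs ?j powr (\<alpha> - 1)" using \<alpha> by (intro mult_right_mono powr_mono) auto
  finally show "lp ?j x powr (\<alpha> - 1) <= 2 * xs ?j powr (\<alpha> - 1)" by simp
 qed (use \<alpha> a in auto)
 also have "\<dots> = 12 * (y - x) * (\<alpha> * xs ?j powr (\<alpha> - 1) * (xs ?j - xs (Suc ?j)))"
  by (simp only: mult_ac)
 also have "\<dots> <= 12 * (y - x) * (xs ?j powr \<alpha> - xs (Suc ?j) powr \<alpha>)"
  using assms xs_pos xs_decreasing[of ?j] by (intro mult_left_mono powr_concave(1)) (auto intro: less_imp_le)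
 finally show ?thesis .
qed

text \<open>The exponent keeps the telescoped sum. Here \<open>48 = 4 * 12\<close>, where \<open>4\<close>
bounds \<open>(1 + \<alpha>) * 2 powr \<alpha>\<close>.\<close>
lemma dl_distortion_le:
 assumes "1/2 <= x" "x <= y" "y <= 1"
 shows "dl n x <= dl n y * exp (48 * (y - x) * ((1/2) powr \<alpha> - xs (Suc n) powr \<alpha>))"
proof (induction n)
 case 0
 then show ?case by (simp del: powr_half_sqrt)
next
 case (Suc n)
 define a where "a = lp (Suc n) x"
 define b where "b = lp (Suc n) y"
 define \<Delta> where "\<Delta> = xs (Suc n) powr \<alpha> - xs (Suc (Suc n)) powr \<alpha>"
 have ab: "0 <= a" "a <= b"
  using assms lp_nonneg[of x "Suc n"] lp_mono[of x y "Suc n"] by (simp_all add: a_def b_def del: funpow.simps)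
 have "dT b = dT a + (1 + \<alpha>) * 2 powr \<alpha> * (b powr \<alpha> - a powr \<alpha>)" by (simp add: dT_def algebra_simps)
 also have "\<dots> <= dT a + 4 * (b powr \<alpha> - a powr \<alpha>)"
 proof -
  have "2 powr \<alpha> <= 2 powr 1" using \<alpha> by (intro powr_mono) auto
  then have "(1 + \<alpha>) * 2 powr \<alpha> <= 2 * 2" using \<alpha> by (intro mult_mono) auto
  moreover have "0 <= b powr \<alpha> - a powr \<alpha>" using ab \<alpha> by (simp add: powr_mono2)
  ultimately show ?thesis by (intro add_left_mono mult_right_mono) auto
 qed
 also have "\<dots> <= dT a + 4 * (12 * (y - x) * \<Delta>)"
  using dl_distortion_step[OF assms, of n] by (simp add: a_def b_def \<Delta>_def)
 also have "\<dots> <= dT a * (1 + 48 * (y - x) * \<Delta>)"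
 proof -
  have "0 <= \<Delta>" unfolding \<Delta>_def using powr_mono2[of \<alpha> "xs (Suc (Suc n))" "xs (Suc n)"] xs_decreasing[of "Suc n"] xs_pos[of "Suc (Suc n)"] \<alpha> by simp
  then have "0 <= 48 * (y - x) * \<Delta>" using assms by simp
  then have "1 * (48 * (y - x) * \<Delta>) <= dT a * (48 * (y - x) * \<Delta>)" using dT_ge_1[of a] by (intro mult_right_mono) auto
  moreover have "4 * (12 * (y - x) * \<Delta>) = 48 * (y - x) * \<Delta>" by (simp add: algebra_simps)
  ultimately show ?thesis unfolding distrib_left by linarith
 qed
 also have "\<dots> <= dT a * exp (48 * (y - x) * \<Delta>)"
  using dT_ge_1[of a] by (intro mult_left_mono exp_ge_add_one_self) auto
 finally have dTb: "dT b <= dT a * exp (48 * (y - x) * \<Delta>)" .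
 have pos: "0 < dT a" "0 < dT b" using dT_ge_1[of a] dT_ge_1[of b] by auto
 have "dl (Suc n) x = dl n x / dT a" by (simp add: dl_Suc a_def)
 also have "\<dots> <= (dl n y * exp (48 * (y - x) * ((1/2) powr \<alpha> - xs (Suc n) powr \<alpha>))) / dT a"
  using Suc pos by (intro divide_right_mono) auto
 also have "\<dots> <= (dl n y * exp (48 * (y - x) * ((1/2) powr \<alpha> - xs (Suc n) powr \<alpha>))) * (exp (48 * (y - x) * \<Delta>) / dT b)"
 proof -
  have "1 / dT a <= exp (48 * (y - x) * \<Delta>) / dT b" using dTb pos by (simp add: field_simps)
  moreover have "0 <= dl n y * exp (48 * (y - x) * ((1/2) powr \<alpha> - xs (Suc n) powr \<alpha>))"
   using dl_pos[of n y] by (intro mult_nonneg_nonneg) auto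
  ultimately have "(dl n y * exp (48 * (y - x) * ((1/2) powr \<alpha> - xs (Suc n) powr \<alpha>))) * (1 / dT a)
   <= (dl n y * exp (48 * (y - x) * ((1/2) powr \<alpha> - xs (Suc n) powr \<alpha>))) * (exp (48 * (y - x) * \<Delta>) / dT b)"
   by (rule mult_left_mono)
  then show ?thesis by (simp only: times_divide_eq_right mult_1_right)
 qed
 also have "\<dots> = dl (Suc n) y * exp (48 * (y - x) * ((1/2) powr \<alpha> - xs (Suc (Suc n)) powr \<alpha>))"
  by (simp add: dl_Suc b_def \<Delta>_def exp_add[symmetric] algebra_simps del: powr_half_sqrt)
 finally show ?case .
qed

lemma dl_distortion:
 assumes "1/2 <= x" "x <= 1" "1/2 <= y" "y <= 1"
 shows "dl n x <= dl n y * exp (48 * \<bar>x - y\<bar>)"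
proof (cases "x <= y")
 case True
 have "(1/2) powr \<alpha> <= 1" using \<alpha> by (simp add: powr_le1)
 then have "48 * (y - x) * ((1/2) powr \<alpha> - xs (Suc n) powr \<alpha>) <= 48 * (y - x) * 1"
  using True by (intro mult_left_mono) (auto intro: order_trans[of _ "(1/2) powr \<alpha>"])
 then have "exp (48 * (y - x) * ((1/2) powr \<alpha> - xs (Suc n) powr \<alpha>)) <= exp (48 * \<bar>x - y\<bar>)" using True by simp
 then show ?thesis using dl_distortion_le[OF assms(1) True assms(4), of n] dl_pos[of n y]
  by (meson mult_left_mono order_trans less_imp_le)
next
 case False
 have "dl n x <= dl n y" using False assms by (intro dl_antimono) auto
 also have "\<dots> <= dl n y * exp (48 * \<bar>x - y\<bar>)" using dl_pos[of n y] by (simp add: mult_le_cancel_left1 not_less less_imp_le)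
 finally show ?thesis .
qed

lemma cesaro:
 fixes a :: "nat => real"
 assumes "(\<lambda>n. a (Suc n) - a n) \<longlonglongrightarrow> L" shows "(\<lambda>n. a n / real n) \<longlonglongrightarrow> L"
proof (rule LIMSEQ_I)
 fix e :: real assume e: "0 < e"
 from LIMSEQ_D[OF assms, of "e/2"] e obtain N where N: "\<And>n. n \<ge> N ==> \<bar>a (Suc n) - a n - L\<bar> < e/2" by auto
 have *: "\<bar>a (N + k) - a N - real k * L\<bar> <= real k * (e/2)" for k
 proof (induction k)
  case (Suc k)
  have "a (N + Suc k) - a N - real (Suc k) * L = (a (N + k) - a N - real k * L) + (a (Suc (N + k)) - a (N + k) - L)"
   by (simp add: algebra_simps)
  also have "\<bar>\<dots>\<bar> <= real k * (e/2) + e/2"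
   using Suc N[of "N + k"] by (intro order_trans[OF abs_triangle_ineq] add_mono) auto
  finally show ?case by (simp add: algebra_simps)
 qed simp
 define C where "C = \<bar>a N\<bar> + real N * \<bar>L\<bar>"
 obtain N' :: nat where N': "2 * C / e < real N'" using reals_Archimedean2 by blast
 show "\<exists>no. \<forall>n\<ge>no. norm (a n / real n - L) < e"
 proof (intro exI allI impI)
  fix n assume n: "max (Suc N) N' <= n"
  then have n0: "0 < real n" "N' <= n" "N <= n" by auto
  define k where "k = n - N"
  have nk: "n = N + k" using n0 by (simp add: k_def)
  have "a n - real n * L = (a (N + k) - a N - real k * L) + (a N - real N * L)" by (simp add: nk algebra_simps)
  also have "\<bar>\<dots>\<bar> <= real k * (e/2) + C"
   using *[of k] by (intro order_trans[OF abs_triangle_ineq] add_mono) (auto simp: C_def abs_mult intro: order_trans[OF abs_triangle_ineq4])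
  also have "\<dots> < real n * (e/2) + real n * (e/2)"
  proof (intro add_le_less_mono)
   show "real k * (e/2) <= real n * (e/2)" using e by (intro mult_right_mono) (auto simp: nk)
   have "2 * C / e < real n" using N' n0 by linarith
   then show "C < real n * (e/2)" using e by (simp add: field_simps)
  qed
  finally have *: "\<bar>a n - real n * L\<bar> / real n < e" using n0 by (simp add: field_simps)
  have "a n / real n - L = (a n - real n * L) / real n" using n0 by (simp add: field_simps)
  with * show "norm (a n / real n - L) < e" using n0 by (simp add: abs_div)
 qed
qed

text \<open>In the coordinate \<open>z = x powr (- \<alpha>)\<close> the dynamics near 0 is asymptotically a
translation by \<open>2 powr \<alpha> * \<alpha>\<close>, so \<open>z n\<close> grows linearly.\<close>
lemma xs_asymptotics: "(\<lambda>n. real n powr (1 / \<alpha>) * xs n) \<longlonglongrightarrow> (1/2) * \<alpha> powr (- (1 / \<alpha>))"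
proof -
 define z where "z n = xs n powr (- \<alpha>)" for n
 have zpos: "0 < z n" for n using xs_pos[of n] by (simp add: z_def)
 define w where "w n = 2 powr \<alpha> * xs (Suc n) powr \<alpha>" for n
 have wpos: "0 < w n" for n using xs_pos[of "Suc n"] by (simp add: w_def)
 have w0: "w \<longlonglongrightarrow> 0"
 proof -
  have "(\<lambda>n. 2 powr \<alpha> * xs (Suc n) powr \<alpha>) \<longlonglongrightarrow> 2 powr \<alpha> * 0 powr \<alpha>"
   using \<alpha> by (intro tendsto_mult tendsto_const tendsto_powr2 LIMSEQ_Suc xs_tendsto_0 always_eventually allI less_imp_le xs_pos)
  then show ?thesis by (simp add: w_def[abs_def])
 qed
 have step: "z (Suc n) - z n = 2 powr \<alpha> * ((1 - (1 + w n) powr (- \<alpha>)) / w n)" for n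
 proof -
  have "xs n = xs (Suc n) * (1 + w n)" using lbr_xs[of n] by (simp add: lbr_def w_def)
  then have "z n = z (Suc n) * (1 + w n) powr (- \<alpha>)"
   using xs_pos[of "Suc n"] wpos[of n] by (simp add: z_def powr_mult)
  then have "z (Suc n) - z n = z (Suc n) * (1 - (1 + w n) powr (- \<alpha>))" by (simp add: algebra_simps)
  moreover have "z (Suc n) = 2 powr \<alpha> / w n" using xs_pos[of "Suc n"] by (simp add: z_def w_def powr_minus divide_inverse)
  ultimately show ?thesis by simp
 qed
 have "((\<lambda>x. ((1 + x) powr (- \<alpha>) - (1 + 0) powr (- \<alpha>)) / x) \<longlongrightarrow> - \<alpha>) (at 0)"
 proof -
  have "((\<lambda>x. (1 + x) powr (- \<alpha>)) has_real_derivative - \<alpha>) (at 0)"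
   by (auto intro!: derivative_eq_intros)
  then show ?thesis by (simp add: has_field_derivative_iff)
 qed
 moreover have "filterlim w (at 0) sequentially"
  unfolding filterlim_at using w0 wpos by (auto intro!: always_eventually simp: less_imp_neq[symmetric])
 ultimately have "(\<lambda>n. ((1 + w n) powr (- \<alpha>) - (1 + 0) powr (- \<alpha>)) / w n) \<longlonglongrightarrow> - \<alpha>" by (rule filterlim_compose)
 then have "(\<lambda>n. 2 powr \<alpha> * - (((1 + w n) powr (- \<alpha>) - (1 + 0) powr (- \<alpha>)) / w n)) \<longlonglongrightarrow> 2 powr \<alpha> * - (- \<alpha>)"
  by (intro tendsto_intros)
 then have "(\<lambda>n. z (Suc n) - z n) \<longlonglongrightarrow> 2 powr \<alpha> * \<alpha>"
  unfolding step by (simp add: minus_divide_left)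
 then have lim: "(\<lambda>n. z n / real n) \<longlonglongrightarrow> 2 powr \<alpha> * \<alpha>" by (rule cesaro)
 have c: "0 < 2 powr \<alpha> * \<alpha>" using \<alpha> by simp
 have l2: "(\<lambda>n. (z n / real n) powr (- (1 / \<alpha>))) \<longlonglongrightarrow> (2 powr \<alpha> * \<alpha>) powr (- (1 / \<alpha>))"
  using \<alpha> by (intro tendsto_powr lim tendsto_const) simp
 have l3: "(2 powr \<alpha> * \<alpha>) powr (- (1 / \<alpha>)) = (1/2) * \<alpha> powr (- (1 / \<alpha>))"
  using \<alpha> by (simp add: powr_mult powr_powr powr_minus)
 have "\<forall>\<^sub>F n in sequentially. (z n / real n) powr (- (1 / \<alpha>)) = real n powr (1 / \<alpha>) * xs n"
  using eventually_gt_at_top[of 0]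
 proof eventually_elim
  case (elim n)
  have "(z n / real n) powr (- (1 / \<alpha>)) = z n powr (- (1 / \<alpha>)) / real n powr (- (1 / \<alpha>))"
   using zpos[of n] elim by (simp add: powr_divide)
  moreover have "z n powr (- (1 / \<alpha>)) = xs n" using xs_pos[of n] \<alpha> by (simp add: z_def powr_powr)
  ultimately show ?case by (simp add: powr_minus divide_inverse mult.commute)
 qed
 with l2 show ?thesis unfolding l3 by (rule Lim_transform_eventually)
qed

lemma xs_bound: "\<exists>C>0. \<forall>n. xs n <= C * real (Suc n) powr (- (1 / \<alpha>))"
proof -
 have "Bseq (\<lambda>n. real n powr (1 / \<alpha>) * xs n)" by (rule convergent_imp_Bseq[OF convergentI[OF xs_asymptotics]])
 then obtain B where B: "B > 0" "\<And>n. norm (real n powr (1 / \<alpha>) * xs n) <= B" by (auto elim: BseqE)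
 have "xs n <= 2 * B * real (Suc n) powr (- (1 / \<alpha>))" for n
 proof -
  have "real (Suc n) powr (1 / \<alpha>) * xs (Suc n) <= B" using B(2)[of "Suc n"] xs_pos[of "Suc n"] by (simp add: abs_mult)
  then have "xs (Suc n) <= B * real (Suc n) powr (- (1 / \<alpha>))" by (simp add: powr_minus field_simps)
  then show ?thesis using xs_ratio[of n] by simp
 qed
 then show ?thesis using B(1) by (intro exI[of _ "2 * B"]) auto
qed

lemma xs_diff_bound: "\<exists>C>0. \<forall>n. xs n - xs (Suc n) <= C * real (Suc n) powr (- (1 + 1 / \<alpha>))"
proof -
 obtain C where C: "C > 0" "\<And>n. xs n <= C * real (Suc n) powr (- (1 / \<alpha>))" using xs_bound by blast
 have "xs n - xs (Suc n) <= 2 powr \<alpha> * C powr (1 + \<alpha>) * real (Suc n) powr (- (1 + 1 / \<alpha>))" for n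
 proof -
  have "xs (Suc n) <= C * real (Suc n) powr (- (1 / \<alpha>))" using C(2)[of n] xs_decreasing[of n] by linarith
  then have "xs (Suc n) powr (1 + \<alpha>) <= (C * real (Suc n) powr (- (1 / \<alpha>))) powr (1 + \<alpha>)"
   using xs_pos[of "Suc n"] \<alpha> by (intro powr_mono2) auto
  also have "\<dots> = C powr (1 + \<alpha>) * real (Suc n) powr (- (1 + 1 / \<alpha>))"
   using C(1) \<alpha> by (simp add: powr_mult powr_powr field_simps)
  finally show ?thesis unfolding xs_diff by (simp add: mult.assoc)
 qed
 then show ?thesis using C(1) by (intro exI[of _ "2 powr \<alpha> * C powr (1 + \<alpha>)"]) auto
qed

end

section \<open>The first return map\<close>

abbreviation Ybase :: "real set" where "Ybase \<equiv> {1/2<..1}"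

abbreviation lebY :: "real measure" where "lebY \<equiv> restrict_space lborel Ybase"

lemma space_lebY: "space lebY = Ybase" by (simp add: space_restrict_space)

lemma emeasure_lebY: "A \<subseteq> Ybase ==> emeasure lebY A = emeasure lborel A"
 by (rule emeasure_restrict_space) auto

lemma finite_measure_lebY: "finite_measure lebY"
 by (rule finite_measureI) (simp add: space_lebY emeasure_lebY)

lemma measure_lebY: "measure lebY (space lebY) = 1/2"
 by (simp add: space_lebY measure_restrict_space)

lemma borel_measurable_lebY_continuous:
 fixes u :: "real => real"
 assumes "continuous_on Ybase u" shows "u \<in> borel_measurable lebY"
proof -
 have "u \<in> borel_measurable (restrict_space borel Ybase)"
  by (rule borel_measurable_continuous_on_restrict[OF assms])
 moreover have "sets lebY = sets (restrict_space borel Ybase)" by (simp add: sets_restrict_space)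
 ultimately show ?thesis using measurable_cong_sets by blast
qed

lemma holder_continuous_on:
 fixes u :: "real => real"
 assumes \<theta>: "0 < \<theta>" and h: "\<And>x y. x \<in> S ==> y \<in> S ==> \<bar>u x - u y\<bar> <= C * \<bar>x - y\<bar> powr \<theta>"
 shows "continuous_on S u"
 unfolding continuous_on_def
proof
 fix x assume x: "x \<in> S"
 have "((\<lambda>y. C * \<bar>y - x\<bar> powr \<theta>) \<longlongrightarrow> C * \<bar>x - x\<bar> powr \<theta>) (at x within S)"
  by (intro tendsto_intros tendsto_powr2) (use \<theta> in auto)
 then have z: "((\<lambda>y. C * \<bar>y - x\<bar> powr \<theta>) \<longlongrightarrow> 0) (at x within S)" using \<theta> by simp
 have "((\<lambda>y. u y - u x) \<longlongrightarrow> 0) (at x within S)"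
  by (rule Lim_null_comparison[OF _ z]) (use h x in \<open>auto simp: eventually_at_filter\<close>)
 then show "(u \<longlongrightarrow> u x) (at x within S)" by (rule LIM_zero_cancel)
qed

context lsv
begin

abbreviation T :: "real => real" where "T \<equiv> lsv_map \<alpha>"

text \<open>The inverse branch of the return map for return time \<open>n + 1\<close>: one preimage under the
right branch \<open>2 * x - 1\<close> of a point that takes \<open>n\<close> further steps along the left
branch.\<close>
definition v :: "nat => real => real" where "v n y = (1 + lp n y) / 2"
definition g :: "nat => real => real" where "g n y = dl n y / 2"
definition p :: "nat => real" where "p n = 3 * (xs n - xs (Suc n))"
definition ix :: "real => nat" where "ix y = (LEAST n. 1/2 < (T ^^ Suc n) y)"
definition F :: "real => real" where "F y = (T ^^ Suc (ix y)) y"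

lemma T_left: "0 <= x ==> x <= 1/2 ==> T x = lbr x"
 by (simp add: lsv_map_def lbr_def)

lemma T_right: "1/2 < x ==> T x = 2 * x - 1"
 by (simp add: lsv_map_def)

lemma T_in: "x \<in> {0..1} ==> T x \<in> {0..1}"
proof (cases "x <= 1/2")
 case True
 assume "x \<in> {0..1}"
 then have "lbr x <= 2 * x" "0 <= lbr x" using lbr_le_double[of x] lbr_ge[of x] True by auto
 then show ?thesis using True \<open>x \<in> {0..1}\<close> by (auto simp: T_left)
qed (auto simp: T_right)

lemma T_pow_in: "x \<in> {0..1} ==> (T ^^ n) x \<in> {0..1}"
 by (induction n) (auto simp del: atLeastAtMost_iff intro: T_in)

lemma T_linv: "0 <= y ==> y <= 1 ==> T (linv y) = y"
 using linv[of y] linv_mono[of y 1] by (simp add: T_left)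

lemma lp_in01: "y \<in> Ybase ==> 0 < lp n y \<and> lp n y <= 1"
 using lp_bounds[of y n] xs_le_1[of n] xs_pos[of "Suc n"] by (auto intro: less_le_trans)

lemma T_lp_Suc: "y \<in> Ybase ==> T (lp (Suc n) y) = lp n y"
 using lp_in01[of y n] by (simp add: T_linv)

lemma v_in: "y \<in> Ybase ==> v n y \<in> Ybase"
 using lp_in01[of y n] by (simp add: v_def)

lemma T_v: "y \<in> Ybase ==> T (v n y) = lp n y"
 using v_in[of y n] by (simp add: T_right) (simp add: v_def field_simps)

lemma T_pow_v: "y \<in> Ybase ==> j <= n ==> (T ^^ Suc j) (v n y) = lp (n - j) y"
proof (induction j)
 case (Suc j)
 have "(T ^^ Suc (Suc j)) (v n y) = T (lp (n - j) y)" using Suc by simp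
 also have "n - j = Suc (n - Suc j)" using Suc.prems by simp
 finally show ?case using T_lp_Suc[OF Suc.prems(1)] by simp
qed (simp add: T_v)

lemma lp_le_half: "y \<in> Ybase ==> lp (Suc n) y <= 1/2"
 using lp_bounds[of y "Suc n"] xs_le_half[of n] by auto

lemma ix_v: assumes y: "y \<in> Ybase" shows "ix (v n y) = n"
 unfolding ix_def
proof (rule Least_equality)
 show "1/2 < (T ^^ Suc n) (v n y)" using T_pow_v[OF y, of n n] y by simp
 fix j assume j: "1/2 < (T ^^ Suc j) (v n y)"
 show "n <= j"
 proof (rule ccontr)
  assume "\<not> n <= j"
  then obtain k where k: "n - j = Suc k" "j <= n" by (metis not_le Suc_diff_Suc less_imp_le)
  then show False using j T_pow_v[OF y k(2)] lp_le_half[OF y, of k] by simp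
 qed
qed

lemma F_v: "y \<in> Ybase ==> F (v n y) = y"
 using T_pow_v[of y n n] by (simp add: F_def ix_v)

text \<open>The intervals between consecutive \<open>xs n\<close> are the images of \<open>Ybase\<close> under
the inverse branches, hence every point of \<open>(0, 1]\<close> reaches \<open>Ybase\<close>.\<close>
lemma fundamental_domain: "xs (Suc n) < z ==> z <= xs n ==> \<exists>y\<in>Ybase. z = lp n y"
proof (induction n arbitrary: z)
 case 0 then show ?case by auto
next
 case (Suc n)
 have z: "0 <= z" using Suc.prems xs_pos[of "Suc (Suc n)"] by simp
 have "xs (Suc n) < lbr z" using lbr_strict_mono[of "xs (Suc (Suc n))" z] Suc.prems xs_pos[of "Suc (Suc n)"] by (simp add: lbr_xs)
 moreover have "lbr z <= xs n"
  using lbr_strict_mono[OF z, of "xs (Suc n)"] Suc.prems lbr_xs[of n] by (cases "z = xs (Suc n)") auto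
 ultimately obtain y where y: "y \<in> Ybase" "lbr z = lp n y" using Suc.IH by blast
 then have "z = lp (Suc n) y" using linv_lbr[OF z] by simp
 then show ?case using y by blast
qed

lemma level_exists:
 assumes "0 < z" "z <= 1" shows "\<exists>n. xs (Suc n) < z \<and> z <= xs n"
proof -
 have "\<exists>n. xs n < z"
  using order_tendstoD(2)[OF xs_tendsto_0 assms(1)] by (auto simp: eventually_sequentially)
 define k where "k = (LEAST n. xs n < z)"
 have k: "xs k < z" unfolding k_def using \<open>\<exists>n. xs n < z\<close> by (rule LeastI_ex)
 have "k \<noteq> 0" using k assms by (auto intro: Nat.gr0I)
 then obtain n where n: "k = Suc n" by (cases k) auto
 have "\<not> xs n < z" using not_less_Least[of n "\<lambda>n. xs n < z"] n by (simp add: k_def)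
 then show ?thesis using k n by auto
qed

lemma branch_exists: assumes z: "z \<in> Ybase" shows "\<exists>n. \<exists>y\<in>Ybase. z = v n y"
proof -
 have "0 < 2 * z - 1" "2 * z - 1 <= 1" using z by auto
 from level_exists[OF this] obtain n where "xs (Suc n) < 2 * z - 1" "2 * z - 1 <= xs n" by blast
 from fundamental_domain[OF this] obtain y where "y \<in> Ybase" "2 * z - 1 = lp n y" by blast
 then show ?thesis by (intro exI[of _ n] bexI[of _ y]) (auto simp: v_def)
qed

lemma v_F: "z \<in> Ybase ==> v (ix z) (F z) = z" and F_in: "z \<in> Ybase ==> F z \<in> Ybase"
 using branch_exists[of z] by (auto simp: ix_v F_v)

lemma T_measurable[measurable]: "T \<in> borel_measurable borel"
 unfolding lsv_map_def[abs_def] by measurable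

lemma T_pow_measurable[measurable]: "(T ^^ n) \<in> borel_measurable borel"
 by (induction n) (auto simp: measurable_comp)

lemma ix_measurable_borel[measurable]: "ix \<in> measurable borel (count_space UNIV)"
 unfolding ix_def[abs_def] by measurable

lemma F_measurable_borel[measurable]: "F \<in> borel_measurable borel"
 unfolding F_def[abs_def]
 by (rule measurable_compose_countable[of "\<lambda>n y. (T ^^ Suc n) y"]) (auto intro: T_pow_measurable)

lemma lebY_measurable: "f \<in> measurable borel N ==> f \<in> measurable lebY N"
 by (rule measurable_restrict_space1) simp

lemma continuous_lp: "continuous_on {1/2..1} (lp n)"
 by (intro continuous_at_imp_continuous_on ballI DERIV_isCont[OF DERIV_lp]) auto

lemma continuous_dl: "continuous_on {1/2..1} (dl n)"
proof -
 have "continuous_on {1/2..1} (\<lambda>y. dT (lp (Suc j) y))" for j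
 proof -
  have "lp (Suc j) y \<noteq> 0" if "y \<in> {1/2..1}" for y using lp_pos[of y "Suc j"] that by auto
  then show ?thesis unfolding dT_def
   by (intro continuous_on_add continuous_on_mult continuous_on_const continuous_on_powr continuous_lp) auto
 qed
 moreover have "dT (lp (Suc j) y) \<noteq> 0" for j y using dT_ge_1[of "lp (Suc j) y"] by simp
 ultimately show ?thesis unfolding dl_def by (intro continuous_intros) auto
qed

lemma DERIV_v: "0 < y ==> (v n has_real_derivative g n y) (at y)"
 unfolding v_def[abs_def] g_def by (auto intro!: derivative_eq_intros DERIV_lp)

lemma p_nonneg: "0 <= p n" using xs_decreasing[of n] by (simp add: p_def)

lemma p_summable: "summable p"
proof -
 have "(\<lambda>n. xs n - xs (Suc n)) sums (xs 0 - 0)" by (rule telescope_sums'[OF xs_tendsto_0])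
 then have "summable (\<lambda>n. 3 * (xs n - xs (Suc n)))" by (intro summable_mult) (auto simp: sums_iff)
 then show ?thesis by (simp add: p_def[abs_def])
qed

lemma v_contraction: "x \<in> Ybase ==> y \<in> Ybase ==> \<bar>v n x - v n y\<bar> <= \<bar>x - y\<bar> / 2"
 using lp_lipschitz[of x y n] by (simp add: v_def flip: diff_divide_distrib)

text \<open>Substitution on the closed interval \<open>[1/2, 1]\<close>. Its left endpoint is outside
\<open>Ybase\<close>, but it is mapped into the next branch, where the indicator vanishes.\<close>
lemma change_of_variables:
 fixes u :: "real => ennreal"
 assumes u: "u \<in> borel_measurable lebY"
 shows "(\<integral>\<^sup>+y. u y * indicator {y. ix y = n} y \<partial>lebY) = (\<integral>\<^sup>+x. ennreal (g n x) * u (v n x) \<partial>lebY)"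
proof -
 define f where "f y = u y * indicator Ybase y * indicator {y. ix y = n} y" for y
 have u1: "(\<lambda>y. u y * indicator Ybase y) \<in> borel_measurable borel"
  using u borel_measurable_restrict_space_iff_ennreal[of Ybase lborel u] by simp
 have ind: "(\<lambda>y. indicator {y. ix y = n} y :: ennreal) \<in> borel_measurable borel"
  unfolding indicator_def mem_Collect_eq by measurable
 have fm: "f \<in> borel_measurable borel" unfolding f_def using u1 ind by measurable
 have "(\<integral>\<^sup>+y. u y * indicator {y. ix y = n} y \<partial>lebY) = (\<integral>\<^sup>+y. f y \<partial>lborel)"
  by (subst nn_integral_restrict_space) (auto simp: f_def mult_ac intro!: nn_integral_cong)
 also have "\<dots> = (\<integral>\<^sup>+y. f y * indicator {v n (1/2)..v n 1} y \<partial>lborel)"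
 proof (rule nn_integral_cong)
  fix y :: real
  show "f y = f y * indicator {v n (1/2)..v n 1} y"
  proof (cases "y \<in> Ybase \<and> ix y = n")
   case True
   then have y: "y = v n (F y)" "F y \<in> Ybase" using v_F[of y] F_in[of y] by auto
   have "lp n (1/2) <= lp n (F y)" "lp n (F y) <= lp n 1" using y(2) by (auto intro!: lp_mono)
   then have "y \<in> {v n (1/2)..v n 1}" by (subst y(1)) (simp add: v_def)
   then show ?thesis by simp
  qed (auto simp: f_def)
 qed
 also have "\<dots> = (\<integral>\<^sup>+x. f (v n x) * ennreal (g n x) * indicator {1/2..1} x \<partial>lborel)"
 proof (rule nn_integral_substitution_aux[OF fm])
  show "(v n has_real_derivative g n x) (at x)" if "x \<in> {1/2..1}" for x using that by (intro DERIV_v) auto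
  show "continuous_on {1/2..1} (g n)" unfolding g_def by (intro continuous_intros continuous_dl) auto
  show "0 <= g n x" for x using dl_pos[of n x] by (simp add: g_def)
 qed auto
 also have "\<dots> = (\<integral>\<^sup>+x. (ennreal (g n x) * u (v n x)) * indicator Ybase x \<partial>lborel)"
 proof (rule nn_integral_cong)
  fix x :: real
  show "f (v n x) * ennreal (g n x) * indicator {1/2..1} x = (ennreal (g n x) * u (v n x)) * indicator Ybase x"
  proof (cases "x \<in> Ybase")
   case True
   then show ?thesis using v_in[OF True, of n] ix_v[OF True, of n] by (simp add: f_def mult.commute)
  next
   case False
   have "f (v n (1/2)) = 0"
   proof -
    have "lp n (1/2) = lp (Suc n) 1" by (simp only: lp_half) (simp add: xs_def)
    then have "v n (1/2) = v (Suc n) 1" by (simp add: v_def)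
    then have "ix (v n (1/2)) = Suc n" using ix_v[of 1 "Suc n"] by simp
    then show ?thesis by (simp add: f_def)
   qed
   then have z: "f (v n x) = 0" if "x = 1/2" unfolding that .
   have "indicator {1/2..1} x = (0::ennreal) \<or> f (v n x) = 0"
   proof (cases "x = 1/2")
    case True show ?thesis using z[OF True] by blast
   qed (use False in \<open>auto simp: indicator_def\<close>)
   then show ?thesis using False by auto
  qed
 qed
 also have "\<dots> = (\<integral>\<^sup>+x. ennreal (g n x) * u (v n x) \<partial>lebY)"
  by (subst nn_integral_restrict_space) auto
 finally show ?thesis .
qed

text \<open>Taking a power of the distance with exponent \<open>\<theta> \<le> 1\<close> weakens the contraction
rate to \<open>(1/2) powr \<theta>\<close>; the distortion bound persists since distances are at most 1.\<close>
lemma full_branch_map: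
 assumes \<theta>: "0 < \<theta>" "\<theta> <= 1"
 shows "full_branch_map lebY (\<lambda>x y. \<bar>x - y\<bar> powr \<theta>) v F ix g p ((1/2) powr \<theta>) 48"
proof -
 interpret finite_measure lebY by (rule finite_measure_lebY)
 show ?thesis
 proof (unfold_locales, unfold space_lebY)
  show "0 < measure lebY Ybase" using measure_lebY by (simp add: space_lebY)
  fix x y :: real assume xy: "x \<in> Ybase" "y \<in> Ybase"
  have le1: "\<bar>x - y\<bar> <= 1" using xy by auto
  show "\<bar>x - y\<bar> powr \<theta> <= 1" using le1 \<theta> by (intro powr_le1) auto
  show "\<bar>x - y\<bar> powr \<theta> = \<bar>y - x\<bar> powr \<theta>" by (simp add: abs_minus_commute)
  show "\<bar>v n x - v n y\<bar> powr \<theta> <= (1/2) powr \<theta> * \<bar>x - y\<bar> powr \<theta>" for n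
  proof -
   have "\<bar>v n x - v n y\<bar> powr \<theta> <= (\<bar>x - y\<bar> / 2) powr \<theta>" using v_contraction[OF xy] \<theta> by (intro powr_mono2) auto
   also have "\<dots> = (1/2) powr \<theta> * \<bar>x - y\<bar> powr \<theta>" by (simp add: powr_divide del: powr_half_sqrt)
   finally show ?thesis .
  qed
  show "g n x <= g n y * exp (48 * \<bar>x - y\<bar> powr \<theta>)" for n
  proof -
   have "\<bar>x - y\<bar> powr 1 <= \<bar>x - y\<bar> powr \<theta>" using le1 \<theta> powr_mono'[of \<theta> 1 "\<bar>x - y\<bar>"] by simp
   then have "48 * \<bar>x - y\<bar> <= 48 * \<bar>x - y\<bar> powr \<theta>" by simp
   then have "dl n y * exp (48 * \<bar>x - y\<bar>) <= dl n y * exp (48 * \<bar>x - y\<bar> powr \<theta>)"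
    using dl_pos[of n y] by (intro mult_left_mono) (auto intro: less_imp_le)
   then show ?thesis using dl_distortion[of x y n] xy by (simp add: g_def)
  qed
 next
  fix u :: "real => real" assume u: "\<And>x y. x \<in> Ybase ==> y \<in> Ybase ==> \<bar>u x - u y\<bar> <= \<bar>x - y\<bar> powr \<theta>"
  show "u \<in> borel_measurable lebY"
   by (rule borel_measurable_lebY_continuous[OF holder_continuous_on[OF \<theta>(1), of _ _ 1]]) (use u in auto)
 next
  show "v n \<in> measurable lebY lebY" for n
  proof (rule measurable_restrict_space2)
   show "v n \<in> space lebY \<rightarrow> Ybase" using v_in by (auto simp: space_lebY simp del: greaterThanAtMost_iff)
   have "continuous_on Ybase (v n)"
    unfolding v_def by (intro continuous_intros continuous_on_subset[OF continuous_lp]) auto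
   then show "v n \<in> measurable lebY lborel" using borel_measurable_lebY_continuous by simp
  qed
  show "F \<in> measurable lebY lebY"
   by (rule measurable_restrict_space2) (use F_in lebY_measurable[OF F_measurable_borel] in \<open>auto simp: space_lebY\<close>)
  show "ix \<in> measurable lebY (count_space UNIV)" by (rule lebY_measurable) simp
  show "0 < (1/2::real) powr \<theta>" "(1/2::real) powr \<theta> < 1" using \<theta> powr_less_mono2[of \<theta> "1/2" 1] by (simp_all del: powr_half_sqrt)
  show "summable p" by (rule p_summable)
  show "0 <= g n x" for n x using dl_pos[of n x] by (simp add: g_def)
  show "g n x <= p n" if "x \<in> Ybase" for n x using dl_le[of x n] that by (simp add: g_def p_def)
  show "(\<integral>\<^sup>+y. u y * indicator {y. ix y = n} y \<partial>lebY) = (\<integral>\<^sup>+x. ennreal (g n x) * u (v n x) \<partial>lebY)"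
   if "u \<in> borel_measurable lebY" for n and u :: "real => ennreal" by (rule change_of_variables[OF that])
 qed (use F_v ix_v v_F in \<open>auto simp del: greaterThanAtMost_iff\<close>)
qed

end

section \<open>The invariant measure and Kac's formula\<close>

locale lsv_acip = lsv +
 fixes m :: "real measure" and h :: "real => real"
 assumes acip: "is_acip (lsv_map \<alpha>) m" and dens: "is_lipschitz_density m h"
begin

sublocale m: prob_space m using acip by (simp add: is_acip_def)

lemma sets_m[measurable_cong]: "sets m = sets leb01" using acip by (simp add: is_acip_def)

lemma space_m: "space m = {0..1}" using sets_eq_imp_space_eq[OF sets_m] by (simp add: space_restrict_space)

lemma T_measurable_m[measurable]: "T \<in> measurable m m" and distr_T: "distr m m T = m"
 using acip by (auto simp: is_acip_def)

lemma T_pow_m[measurable]: "(T ^^ n) \<in> measurable m m"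
 by (induction n) (auto intro: measurable_comp)

lemma borel_measurable_m: "f \<in> measurable borel N ==> f \<in> measurable m N"
proof -
 assume "f \<in> measurable borel N"
 then have "f \<in> measurable leb01 N" by (intro measurable_restrict_space1) simp
 then show ?thesis using measurable_cong_sets[OF sets_m refl] by blast
qed

lemma invariant_integral_m:
 fixes W :: "real => 'b::{banach, second_countable_topology}"
 assumes [measurable]: "W \<in> borel_measurable m"
 shows "(LINT x|m. W (T x)) = (LINT x|m. W x)"
proof -
 have "integral\<^sup>L (distr m m T) W = (LINT x|m. W (T x))" by (rule integral_distr) measurable
 then show ?thesis by (simp add: distr_T)
qed

lemma ix_le_iff: assumes y: "y \<in> Ybase" shows "J <= ix y \<longleftrightarrow> T y <= xs J"
proof -
 define z where "z = F y"
 define n where "n = ix y"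
 have z: "z \<in> Ybase" "y = v n z" using F_in[OF y] v_F[OF y] by (auto simp: z_def n_def)
 have Ty: "T y = lp n z" using T_v[OF z(1)] z(2) by simp
 have b: "xs (Suc n) < lp n z" "lp n z <= xs n"
 proof -
  have "lp n (1/2) < lp n z" using z(1) by (intro lp_strict_mono) auto
  then show "xs (Suc n) < lp n z" by (simp only: lp_half)
  show "lp n z <= xs n" using lp_mono[of z 1 n] z(1) by (simp add: xs_def)
 qed
 show ?thesis
 proof
  assume "J <= ix y"
  then have "xs n <= xs J" by (intro xs_antimono) (simp add: n_def)
  then show "T y <= xs J" using b Ty by simp
 next
  assume le: "T y <= xs J"
  show "J <= ix y"
  proof (rule ccontr)
   assume "\<not> J <= ix y"
   then have "xs J <= xs (Suc n)" by (intro xs_antimono) (simp add: n_def)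
   then show False using b Ty le by simp
  qed
 qed
qed

lemma T_le_xs_iff: assumes x: "x \<in> {0..1}"
 shows "T x <= xs (Suc J) \<longleftrightarrow> (x \<in> Ybase \<and> Suc J <= ix x) \<or> x <= xs (Suc (Suc J))"
proof (cases "x <= 1/2")
 case True
 have 0: "0 <= x" using x by simp
 have "lbr x <= xs (Suc J) \<longleftrightarrow> x <= xs (Suc (Suc J))"
  using lbr_strict_mono[OF 0, of "xs (Suc (Suc J))"] lbr_strict_mono[of "xs (Suc (Suc J))" x] xs_pos[of "Suc (Suc J)"] lbr_xs[of "Suc J"]
  by (cases x "xs (Suc (Suc J))" rule: linorder_cases) auto
 then show ?thesis using True 0 by (simp add: T_left)
next
 case False
 then have y: "x \<in> Ybase" using x by auto
 have "\<not> x <= xs (Suc (Suc J))" using False xs_le_half[of "Suc J"] by simp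
 then show ?thesis using ix_le_iff[OF y, of "Suc J"] y by blast
qed

text \<open>The points of \<open>Ybase\<close> with return time larger than \<open>j\<close>.\<close>
abbreviation E :: "nat => real set" where "E j \<equiv> {y \<in> Ybase. j <= ix y}"

lemma E_measurable[measurable]: "E j \<in> sets borel"
proof -
 have "{y \<in> space borel. y \<in> Ybase \<and> j <= ix y} \<in> sets borel" by measurable
 then show ?thesis by simp
qed

lemma in_sets_m: "A \<in> sets borel ==> A \<inter> {0..1} \<in> sets m"
 by (auto simp: sets_m sets_restrict_space)

lemma indicator_m[measurable]: "A \<in> sets borel ==> (indicator A :: real => real) \<in> borel_measurable m"
 by (intro borel_measurable_m) simp

lemma measure_xs_tendsto: "(\<lambda>n. measure m {0..xs n}) \<longlonglongrightarrow> 0"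
proof -
 have "(\<lambda>n. measure m {0..xs n}) \<longlonglongrightarrow> measure m (\<Inter>n. {0..xs n})"
 proof (rule m.finite_Lim_measure_decseq)
  show "range (\<lambda>n. {0..xs n}) \<subseteq> sets m"
  proof safe
   fix n
   have "{0..xs n} = {0..xs n} \<inter> {0..1}" using xs_le_1[of n] by auto
   then show "{0..xs n} \<in> sets m" by (metis in_sets_m atLeastAtMost_borel)
  qed
  show "decseq (\<lambda>n. {0..xs n})" using xs_antimono by (force simp: decseq_def)
 qed
 moreover have "(\<Inter>n. {0..xs n}) = {0}"
 proof -
  have "x <= 0" if "\<And>n. x <= xs n" for x by (rule LIMSEQ_le_const[OF xs_tendsto_0]) (use that in auto)
  moreover have "0 <= xs n" for n using xs_pos[of n] by simp
  ultimately show ?thesis by (auto intro: antisym)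
 qed
 moreover have "measure m {0} = 0"
 proof -
  have ac: "absolutely_continuous leb01 m" using acip by (simp add: is_acip_def)
  have "emeasure leb01 {0} = 0" by (subst emeasure_restrict_space) auto
  moreover have "{0::real} \<in> sets leb01" by (auto simp: sets_restrict_space intro!: image_eqI[of _ _ "{0}"])
  ultimately have "{0} \<in> null_sets leb01" by (intro null_setsI)
  then have "{0} \<in> null_sets m" using ac by (auto simp: absolutely_continuous_def)
  then show ?thesis by (auto simp: null_sets_def measure_def)
 qed
 ultimately show ?thesis by simp
qed

text \<open>The integral is pulled back along \<open>T\<close> repeatedly, by invariance. The part of each
preimage in \<open>Ybase\<close> gives the next term, the rest lies in \<open>{0..xs n}\<close>, whose measure
tends to 0 because 0 carries no mass.\<close>
lemma kac:
 fixes G :: "real => 'b::euclidean_space"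
 assumes G[measurable]: "G \<in> borel_measurable m" and B: "\<And>x. x \<in> {0..1} ==> norm (G x) <= B"
 shows "(\<lambda>j. LINT x|m. indicator (E j) x *\<^sub>R G ((T ^^ j) x)) sums (LINT x|m. G x)"
proof -
 have B0: "0 <= B" using order_trans[OF norm_ge_zero B[of 0]] by simp
 define a where "a J = (LINT x|m. indicator {..xs (Suc J)} x *\<^sub>R G ((T ^^ J) x))" for J
 have bd: "norm (indicator S x *\<^sub>R G ((T ^^ J) x)) <= B * indicator S x" if "x \<in> {0..1}" for S x J
  using B[OF T_pow_in[OF that]] by (auto simp: indicator_def)
 have int: "integrable m (\<lambda>x. indicator S x *\<^sub>R G ((T ^^ J) x))" if [measurable]: "S \<in> sets borel" for S J
 proof (rule m.integrable_const_bound[where B = B])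
  show "AE x in m. norm (indicator S x *\<^sub>R G ((T ^^ J) x)) <= B"
  proof (rule AE_I2)
   fix x assume "x \<in> space m"
   then have "norm (indicator S x *\<^sub>R G ((T ^^ J) x)) <= B * indicator S x" by (intro bd) (simp add: space_m)
   also have "\<dots> <= B" using B0 by (simp add: indicator_def)
   finally show "norm (indicator S x *\<^sub>R G ((T ^^ J) x)) <= B" .
  qed
 qed measurable
 have step: "a J = (LINT x|m. indicator (E (Suc J)) x *\<^sub>R G ((T ^^ Suc J) x)) + a (Suc J)" for J
 proof -
  have "a J = (LINT x|m. indicator {..xs (Suc J)} (T x) *\<^sub>R G ((T ^^ J) (T x)))"
   unfolding a_def by (rule invariant_integral_m[symmetric]) measurable
  also have "\<dots> = (LINT x|m. indicator (E (Suc J)) x *\<^sub>R G ((T ^^ Suc J) x) + indicator {..xs (Suc (Suc J))} x *\<^sub>R G ((T ^^ Suc J) x))"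
  proof (rule bochner_cong[OF refl])
   fix x assume "x \<in> space m"
   then have x: "x \<in> {0..1}" by (simp add: space_m)
   have "\<not> (x \<in> E (Suc J) \<and> x <= xs (Suc (Suc J)))" using xs_le_half[of "Suc J"] by auto
   then have "(indicator {..xs (Suc J)} (T x) :: real) = indicator (E (Suc J)) x + indicator {..xs (Suc (Suc J))} x"
    using T_le_xs_iff[OF x, of J] by (auto simp: indicator_def)
   then show "indicator {..xs (Suc J)} (T x) *\<^sub>R G ((T ^^ J) (T x))
     = indicator (E (Suc J)) x *\<^sub>R G ((T ^^ Suc J) x) + indicator {..xs (Suc (Suc J))} x *\<^sub>R G ((T ^^ Suc J) x)"
    by (simp add: scaleR_add_left funpow_swap1)
  qed
  also have "\<dots> = (LINT x|m. indicator (E (Suc J)) x *\<^sub>R G ((T ^^ Suc J) x)) + a (Suc J)"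
   unfolding a_def by (rule Bochner_Integration.integral_add) (rule int, measurable)+
  finally show ?thesis .
 qed
 have start: "(LINT x|m. G x) = (LINT x|m. indicator (E 0) x *\<^sub>R G ((T ^^ 0) x)) + a 0"
 proof -
  have "(LINT x|m. G x) = (LINT x|m. indicator (E 0) x *\<^sub>R G ((T ^^ 0) x) + indicator {..xs (Suc 0)} x *\<^sub>R G ((T ^^ 0) x))"
   by (rule bochner_cong) (auto simp: space_m indicator_def)
  also have "\<dots> = (LINT x|m. indicator (E 0) x *\<^sub>R G ((T ^^ 0) x)) + a 0"
   unfolding a_def by (rule Bochner_Integration.integral_add) (rule int, measurable)+
  finally show ?thesis .
 qed
 have partial: "(\<Sum>j<Suc J. LINT x|m. indicator (E j) x *\<^sub>R G ((T ^^ j) x)) = (LINT x|m. G x) - a J" for J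
 proof (induction J)
  case 0 then show ?case using start by simp
 next
  case (Suc J)
  then show ?case using step[of J] by (subst sum.lessThan_Suc) (simp del: funpow.simps)
 qed
 have a0: "a \<longlonglongrightarrow> 0"
 proof (rule Lim_null_comparison)
  show "\<forall>\<^sub>F J in sequentially. norm (a J) <= B * measure m {0..xs (Suc J)}"
  proof (intro always_eventually allI)
   fix J
   have "norm (a J) <= (LINT x|m. norm (indicator {..xs (Suc J)} x *\<^sub>R G ((T ^^ J) x)))"
    unfolding a_def by (rule integral_norm_bound)
   also have "\<dots> <= (LINT x|m. B * indicator {0..xs (Suc J)} x)"
   proof (rule integral_mono[OF integrable_norm[OF int]])
    show "integrable m (\<lambda>x. B * indicator {0..xs (Suc J)} x)"
     by (intro integrable_mult_right m.integrable_const_bound[where B = 1]) auto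
    fix x assume "x \<in> space m"
    then have x: "x \<in> {0..1}" by (simp add: space_m)
    have "indicator {0..xs (Suc J)} x = (indicator {..xs (Suc J)} x :: real)" using x by (auto simp: indicator_def)
    then show "norm (indicator {..xs (Suc J)} x *\<^sub>R G ((T ^^ J) x)) <= B * indicator {0..xs (Suc J)} x"
     using bd[OF x, of "{..xs (Suc J)}" J] by simp
   qed measurable
   also have "\<dots> = B * measure m ({0..xs (Suc J)} \<inter> space m)" by simp
   also have "{0..xs (Suc J)} \<inter> space m = {0..xs (Suc J)}" using xs_le_1[of "Suc J"] by (auto simp: space_m)
   finally show "norm (a J) <= B * measure m {0..xs (Suc J)}" .
  qed
  show "(\<lambda>J. B * measure m {0..xs (Suc J)}) \<longlonglongrightarrow> 0"
   by (intro tendsto_mult_right_zero LIMSEQ_Suc measure_xs_tendsto)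
 qed
 have "(\<lambda>J. (LINT x|m. G x) - a J) \<longlonglongrightarrow> (LINT x|m. G x) - 0" by (intro tendsto_diff tendsto_const a0)
 then have "(\<lambda>J. \<Sum>j<Suc J. LINT x|m. indicator (E j) x *\<^sub>R G ((T ^^ j) x)) \<longlonglongrightarrow> (LINT x|m. G x)" unfolding partial by simp
 then show ?thesis unfolding sums_def by (subst (asm) filterlim_sequentially_Suc)
qed

text \<open>A Lipschitz constant of \<open>h\<close> on \<open>(1/4, 1]\<close>: a neighbourhood of the closure
of \<open>Ybase\<close>, so that the value at 1/2 is controlled too.\<close>
definition hL :: real where "hL = (SOME L. L-lipschitz_on {1/4<..1} h)"

lemma h_lipschitz: "hL-lipschitz_on {1/4<..1} h"
proof -
 have "\<forall>\<epsilon>>0. \<exists>L. L-lipschitz_on {\<epsilon><..1} h" using dens by (simp add: is_lipschitz_density_def)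
 then have "\<exists>L. L-lipschitz_on {1/4<..1} h" by simp
 then show ?thesis unfolding hL_def by (rule someI_ex)
qed

lemma h_lip: "x \<in> {1/4<..1} ==> y \<in> {1/4<..1} ==> \<bar>h x - h y\<bar> <= hL * \<bar>x - y\<bar>"
 using lipschitz_onD[OF h_lipschitz] by (simp add: dist_real_def)

lemma hL_nonneg: "0 <= hL" using lipschitz_on_nonneg[OF h_lipschitz] .

lemma h_nonneg: "x \<in> {0..1} ==> 0 <= h x" using dens by (simp add: is_lipschitz_density_def)

lemma m_density: "m = density leb01 (\<lambda>x. ennreal (h x))" using dens by (simp add: is_lipschitz_density_def)

lemma h_measurable_leb01[measurable]: "h \<in> borel_measurable leb01" using dens by (simp add: is_lipschitz_density_def)

lemma integral_m_Y:
 fixes w :: "real => 'b::euclidean_space"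
 assumes w: "w \<in> borel_measurable lebY"
 shows "(LINT x|m. indicator Ybase x *\<^sub>R w x) = (LINT x|lebY. h x *\<^sub>R w x)"
proof -
 have w1: "(\<lambda>x. indicator Ybase x *\<^sub>R w x) \<in> borel_measurable borel"
  using w borel_measurable_restrict_space_iff[of Ybase lborel w] by simp
 then have w2[measurable]: "(\<lambda>x. indicator Ybase x *\<^sub>R w x) \<in> borel_measurable leb01"
  by (intro measurable_restrict_space1) simp
 have "(LINT x|m. indicator Ybase x *\<^sub>R w x) = (LINT x|leb01. h x *\<^sub>R (indicator Ybase x *\<^sub>R w x))"
  unfolding m_density by (rule integral_density) (auto intro!: AE_I2 simp: h_nonneg space_restrict_space)
 also have "\<dots> = (LINT x|lborel. indicator {0..1} x *\<^sub>R (h x *\<^sub>R (indicator Ybase x *\<^sub>R w x)))"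
  by (rule integral_restrict_space) simp
 also have "\<dots> = (LINT x|lborel. indicator Ybase x *\<^sub>R (h x *\<^sub>R w x))"
  by (intro bochner_cong) (auto simp: indicator_def)
 also have "\<dots> = (LINT x|lebY. h x *\<^sub>R w x)"
  by (rule integral_restrict_space[symmetric]) simp
 finally show ?thesis .
qed

end

locale lsv_holder = lsv_acip +
 fixes \<theta> :: real
 assumes \<theta>: "0 < \<theta>" "\<theta> <= 1"
begin

sublocale Y: full_branch_map lebY "\<lambda>x y. \<bar>x - y\<bar> powr \<theta>" v F ix g p "(1/2) powr \<theta>" 48
 by (rule full_branch_map[OF \<theta>])

definition hH :: real where "hH = \<bar>h 1\<bar> + hL + 1"

lemma abs_le_powr: "x \<in> Ybase ==> y \<in> Ybase ==> \<bar>x - y\<bar> <= \<bar>x - y\<bar> powr \<theta>"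
 using powr_mono'[of \<theta> 1 "\<bar>x - y\<bar>"] \<theta> by auto

lemma hol_h: "Y.hol hH h"
 unfolding Y.hol_def space_lebY
proof (intro conjI ballI)
 fix x :: real assume x: "x \<in> Ybase"
 have "\<bar>h x - h 1\<bar> <= hL * \<bar>x - 1\<bar>" using x by (intro h_lip) auto
 also have "\<dots> <= hL * 1" using x hL_nonneg by (intro mult_left_mono) auto
 finally show "norm (h x) <= hH" by (simp add: hH_def)
 fix y :: real assume y: "y \<in> Ybase"
 have "\<bar>h x - h y\<bar> <= hL * \<bar>x - y\<bar>" using x y by (intro h_lip) auto
 also have "\<dots> <= hH * \<bar>x - y\<bar> powr \<theta>"
  using abs_le_powr[OF x y] hL_nonneg by (intro mult_mono) (auto simp: hH_def)
 finally show "norm (h x - h y) <= hH * \<bar>x - y\<bar> powr \<theta>" by simp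
qed

text \<open>A continuous function that vanishes almost everywhere on \<open>Ybase\<close> vanishes there; left
neighbourhoods have positive measure.\<close>
lemma hol_zero:
 fixes u :: "real => real"
 assumes u: "Y.hol M u" and ae: "AE y in lebY. u y = 0" and x: "x \<in> Ybase" shows "u x = 0"
proof (rule ccontr)
 assume nz: "u x \<noteq> 0"
 have cont: "continuous_on Ybase u"
  by (rule holder_continuous_on[OF \<theta>(1), of _ _ M]) (use u in \<open>auto simp: Y.hol_def space_lebY\<close>)
 have "(u \<longlongrightarrow> u x) (at x within Ybase)" using cont x by (simp add: continuous_on_def)
 then have "\<forall>\<^sub>F y in at x within Ybase. u y \<noteq> 0" by (rule tendsto_imp_eventually_ne) (rule nz)
 then obtain e where e: "e > 0" "\<And>y. y \<in> Ybase ==> y \<noteq> x ==> dist y x < e ==> u y \<noteq> 0"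
  by (auto simp: eventually_at)
 define a where "a = max (1/2) (x - e)"
 have a: "a < x" using e x by (auto simp: a_def)
 have sub: "{a<..<x} \<subseteq> Ybase" using x by (auto simp: a_def)
 have nzI: "u y \<noteq> 0" if "y \<in> {a<..<x}" for y
  using that sub by (intro e(2)) (auto simp: a_def dist_real_def)
 from ae obtain N where N: "{y \<in> space lebY. u y \<noteq> 0} \<subseteq> N" "emeasure lebY N = 0" "N \<in> sets lebY"
  by (auto elim: AE_E)
 have "{a<..<x} \<subseteq> N"
 proof
  fix y assume y: "y \<in> {a<..<x}"
  then have "y \<in> {y \<in> space lebY. u y \<noteq> 0}" using nzI[OF y] sub unfolding space_lebY by blast
  then show "y \<in> N" using N(1) by blast
 qed
 then have "emeasure lebY {a<..<x} <= emeasure lebY N" by (intro emeasure_mono N)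
 then have "emeasure lborel {a<..<x} = 0" using N(2) emeasure_lebY[OF sub] by simp
 then show False using a by simp
qed

lemma id_lebY_m: "(\<lambda>x. x) \<in> measurable lebY m"
proof -
 have "(\<lambda>x. x) \<in> measurable lebY leb01"
 proof (rule measurable_restrict_space2)
  show "(\<lambda>x. x) \<in> space lebY \<rightarrow> {0..1}" by (auto simp: space_lebY)
  show "(\<lambda>x. x) \<in> measurable lebY lborel" by (rule lebY_measurable) simp
 qed
 then show ?thesis unfolding measurable_cong_sets[OF refl sets_m, of lebY] .
qed

lemma m_measurable_lebY: "f \<in> measurable m N ==> f \<in> measurable lebY N"
 by (rule measurable_compose[OF id_lebY_m])

lemma Ybase_unit: "x \<in> Ybase ==> x \<in> {0..1}" by simp

lemma h_le: "x \<in> Ybase ==> \<bar>h x\<bar> <= hH"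
 using Y.holD(1)[OF hol_h, of x] by (simp add: space_lebY)

lemma lebY_integrable:
 fixes w :: "real => 'b::{banach, second_countable_topology}"
 shows "w \<in> borel_measurable lebY ==> (\<And>x. x \<in> Ybase ==> norm (w x) <= B) ==> integrable lebY w"
 by (rule Y.integrable_const_bound[where B=B]) (auto simp: space_lebY)

text \<open>Kac's formula, with the sum over \<open>j\<close> carried out under the integral: \<open>m\<close>
is the restriction of \<open>m\<close> to \<open>Ybase\<close>, spread over the excursions.\<close>
lemma kac_return:
 fixes G :: "real => 'b::euclidean_space"
 assumes G[measurable]: "G \<in> borel_measurable m" and B: "\<And>x. x \<in> {0..1} ==> norm (G x) <= B"
 shows "integrable lebY (\<lambda>x. h x *\<^sub>R (\<Sum>j\<le>ix x. G ((T ^^ j) x)))"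
  and "(LINT x|lebY. h x *\<^sub>R (\<Sum>j\<le>ix x. G ((T ^^ j) x))) = (LINT x|m. G x)"
proof -
 define e :: "nat => real => real" where "e j = indicator (E j)" for j
 define u where "u j x = h x *\<^sub>R (e j x *\<^sub>R G ((T ^^ j) x))" for j x
 have em[measurable]: "e j \<in> borel_measurable lebY" for j unfolding e_def by (rule lebY_measurable) measurable
 have [measurable]: "(\<lambda>x. e j x *\<^sub>R G ((T ^^ j) x)) \<in> borel_measurable lebY" for j
  unfolding e_def by (rule m_measurable_lebY) measurable
 have hm[measurable]: "h \<in> borel_measurable lebY" by (rule Y.hol_measurable[OF hol_h])
 have um[measurable]: "u j \<in> borel_measurable lebY" for j unfolding u_def by measurable
 have Y_E: "indicator Ybase x * e j x = indicator (E j) x" for x j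
  by (auto simp: e_def indicator_def)
 have iu: "(LINT x|lebY. u j x) = (LINT x|m. indicator (E j) x *\<^sub>R G ((T ^^ j) x))" for j
  unfolding u_def by (subst integral_m_Y[symmetric]) (measurable, simp only: scaleR_scaleR Y_E)
 have ie: "(LINT x|lebY. h x * e j x) = (LINT x|m. indicator (E j) x *\<^sub>R (1::real))" for j
  using integral_m_Y[OF em[of j]] by (simp add: Y_E)
 have ub: "norm (u j x) <= B * (h x * e j x)" if "x \<in> Ybase" for j x
  using mult_left_mono[OF B[OF T_pow_in[OF Ybase_unit[OF that], of j]], of "h x * e j x"] h_nonneg[of x] that
  by (simp add: u_def e_def mult_ac)
 have eint: "integrable lebY (\<lambda>x. h x * e j x)" for j
  by (rule lebY_integrable[where B=hH, OF borel_measurable_times[OF hm em]])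
   (use h_le order_trans[OF abs_ge_zero h_le] in \<open>auto simp: e_def indicator_def\<close>)
 have uint: "integrable lebY (u j)" for j
  by (rule bochner_dominated[OF integrable_mult_right[OF eint[of j], of B] um])
   (use ub in \<open>auto intro!: AE_I2 order_trans[OF _ abs_ge_self] simp: space_lebY\<close>)
 have su: "summable (\<lambda>j. LINT x|lebY. norm (u j x))"
 proof (rule summable_comparison_test')
  show "summable (\<lambda>j. B * (LINT x|lebY. h x * e j x))"
   unfolding ie using sums_summable[OF kac[of "\<lambda>_. 1::real" 1]] by (intro summable_mult) auto
  have "(LINT x|lebY. norm (u j x)) <= (LINT x|lebY. B * (h x * e j x))" for j
   using uint eint ub by (intro integral_mono) (auto simp: space_lebY)
  then show "norm (LINT x|lebY. norm (u j x)) <= B * (LINT x|lebY. h x * e j x)" for j by simp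
 qed
 have fin: "u j x = 0" if "ix x < j" for j x using that by (simp add: u_def e_def)
 have sm: "summable (\<lambda>j. norm (u j x))" for x
  by (rule summable_finite[of "{..ix x}"]) (auto simp: fin)
 have sumu: "(\<Sum>j. u j x) = h x *\<^sub>R (\<Sum>j\<le>ix x. G ((T ^^ j) x))" if "x \<in> space lebY" for x
 proof -
  have "(\<Sum>j. u j x) = (\<Sum>j\<le>ix x. u j x)" by (rule suminf_finite) (auto simp: fin)
  also have "\<dots> = h x *\<^sub>R (\<Sum>j\<le>ix x. G ((T ^^ j) x))" using that
   by (simp add: u_def e_def scaleR_right.sum space_lebY)
  finally show ?thesis .
 qed
 have "integrable lebY (\<lambda>x. \<Sum>j. u j x)"
  by (rule integrable_suminf[OF uint _ su]) (simp add: sm)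
 then show "integrable lebY (\<lambda>x. h x *\<^sub>R (\<Sum>j\<le>ix x. G ((T ^^ j) x)))"
  by (simp only: Bochner_Integration.integrable_cong[OF refl sumu])
 have "(\<lambda>j. LINT x|lebY. u j x) sums (LINT x|lebY. (\<Sum>j. u j x))"
  by (rule sums_integral[OF uint _ su]) (simp add: sm)
 moreover have "(\<lambda>j. LINT x|lebY. u j x) sums (LINT x|m. G x)" unfolding iu by (rule kac[OF G B])
 ultimately have "(LINT x|lebY. (\<Sum>j. u j x)) = (LINT x|m. G x)" by (rule sums_unique2)
 then show "(LINT x|lebY. h x *\<^sub>R (\<Sum>j\<le>ix x. G ((T ^^ j) x))) = (LINT x|m. G x)"
  by (simp only: bochner_cong[OF refl sumu])
qed

text \<open>For a function supported in \<open>Ybase\<close>, an excursion shifted by one step sees only the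
return point. So Kac's formula turns the invariance of \<open>m\<close> under \<open>T\<close> into invariance
of its restriction under \<open>F\<close>.\<close>
lemma invariant_Y:
 fixes w :: "real => real"
 assumes w: "w \<in> borel_measurable lebY" and B: "\<And>x. x \<in> Ybase ==> \<bar>w x\<bar> <= B"
 shows "(LINT x|lebY. h x * w (F x)) = (LINT x|lebY. h x * w x)"
proof -
 define G where "G x = indicator Ybase x *\<^sub>R w x" for x
 have "G \<in> borel_measurable borel"
  using w borel_measurable_restrict_space_iff[of Ybase lborel w] by (simp add: G_def[abs_def])
 then have Gm[measurable]: "G \<in> borel_measurable m" by (rule borel_measurable_m)
 have "0 <= B" using B[of 1] by simp
 then have GB: "norm (G x) <= B" for x using B[of x] by (auto simp: G_def indicator_def)
 have eq: "(\<Sum>j\<le>ix x. G (T ((T ^^ j) x))) = w (F x)" if x: "x \<in> Ybase" for x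
 proof -
  have e: "T ((T ^^ j) x) = lp (ix x - j) (F x)" if "j <= ix x" for j
   using T_pow_v[OF F_in[OF x] that] v_F[OF x] by simp
  have "G (T ((T ^^ j) x)) = 0" if "j < ix x" for j
   using e[of j] that lp_le_half[OF F_in[OF x], of "ix x - Suc j"] by (simp add: G_def Suc_diff_Suc)
  then have "(\<Sum>j\<le>ix x. G (T ((T ^^ j) x))) = G (T ((T ^^ ix x) x))" by (simp add: lessThan_Suc_atMost[symmetric])
  then show ?thesis using e[of "ix x"] F_in[OF x] by (simp add: G_def)
 qed
 have "(LINT x|lebY. h x * w (F x)) = (LINT x|lebY. h x *\<^sub>R (\<Sum>j\<le>ix x. G (T ((T ^^ j) x))))"
  by (rule bochner_cong) (simp_all add: eq space_lebY)
 also have "\<dots> = (LINT x|m. G (T x))" by (rule kac_return(2)[where B=B]) (use GB in auto)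
 also have "\<dots> = (LINT x|m. G x)" by (rule invariant_integral_m[OF Gm])
 also have "\<dots> = (LINT x|lebY. h x * w x)" using integral_m_Y[OF w] by (simp add: G_def)
 finally show ?thesis .
qed

text \<open>Invariance and duality make \<open>transfer h - h\<close> orthogonal to every bounded function, in
particular to itself, hence zero almost everywhere, and everywhere by continuity.\<close>
lemma transfer_h: assumes x: "x \<in> Ybase" shows "Y.transfer h x = h x"
proof -
 define u where "u x = Y.transfer h x - h x" for x
 have ht: "Y.hol (Y.CL * suminf p * hH) (Y.transfer h)" by (rule Y.hol_transfer[OF hol_h])
 have u: "Y.hol (Y.CL * suminf p * hH + hH) u" unfolding u_def by (rule Y.hol_diff[OF ht hol_h])
 define C where "C = Y.CL * suminf p * hH + hH"
 have um: "u \<in> borel_measurable lebY" by (rule Y.hol_measurable[OF u])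
 have uB: "\<bar>u x\<bar> <= C" if "x \<in> Ybase" for x using Y.holD(1)[OF u] that by (simp add: space_lebY C_def)
 have hm[measurable]: "h \<in> borel_measurable lebY" "Y.transfer h \<in> borel_measurable lebY" "u \<in> borel_measurable lebY"
  by (rule Y.hol_measurable[OF hol_h] Y.hol_measurable[OF ht] um)+
 have i: "integrable lebY (\<lambda>x. u x * u x)"
  by (rule Y.hol_integrable[OF Y.hol_mult[OF u u]])
 have "(LINT x|lebY. u x * u x) = (LINT x|lebY. Y.transfer h x * u x - h x * u x)"
  by (simp add: u_def algebra_simps)
 also have "\<dots> = (LINT x|lebY. Y.transfer h x * u x) - (LINT x|lebY. h x * u x)"
  by (rule bochner_diff) (rule Y.hol_integrable[OF Y.hol_mult[OF ht u]] Y.hol_integrable[OF Y.hol_mult[OF hol_h u]])+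
 also have "(LINT x|lebY. Y.transfer h x * u x) = (LINT x|lebY. h x * u (F x))"
  by (rule Y.duality_hol(1)[OF hol_h um, symmetric]) (use uB in \<open>auto simp: space_lebY\<close>)
 also have "\<dots> = (LINT x|lebY. h x * u x)" by (rule invariant_Y[OF um uB])
 finally have "(LINT x|lebY. u x * u x) = 0" by simp
 then have "AE x in lebY. u x * u x = 0"
  using integral_nonneg_eq_0_iff_AE[OF i] by simp
 then have "AE x in lebY. u x = 0" by simp
 from hol_zero[OF u this x] show ?thesis by (simp add: u_def)
qed

text \<open>If \<open>h\<close> vanished on \<open>Ybase\<close>, Kac's formula for the constant 1 would give
\<open>m\<close> total mass 0.\<close>
lemma m_Y_pos: "0 < (LINT x|lebY. h x)"
proof (rule ccontr)
 assume neg: "\<not> 0 < (LINT x|lebY. h x)"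
 have nn: "AE x in lebY. 0 <= h x" by (rule AE_I2) (simp add: space_lebY h_nonneg)
 from neg integral_nonneg_AE[OF nn] have "(LINT x|lebY. h x) = 0" by linarith
 then have h0: "AE x in lebY. h x = 0"
  using integral_nonneg_eq_0_iff_AE[OF Y.hol_integrable[OF hol_h] nn] by simp
 have "1 = (LINT x|lebY. h x *\<^sub>R (\<Sum>j\<le>ix x. (1::real)))"
  using kac_return(2)[of "\<lambda>_. 1::real" 1] by (simp add: m.prob_space)
 also have "\<dots> = 0" by (rule integral_eq_zero_AE) (use h0 in \<open>auto elim: eventually_mono\<close>)
 finally show False by simp
qed

definition hlow :: real where "hlow = exp (- Y.cone_width) * (LINT x|lebY. h x) / Y.vol"

sublocale Y: full_branch_density lebY "\<lambda>x y. \<bar>x - y\<bar> powr \<theta>" v F ix g p "(1/2) powr \<theta>" 48 h hH hlow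
proof (unfold_locales, unfold space_lebY)
 show "Y.hol hH h" by (rule hol_h)
 show "0 < hlow" unfolding hlow_def using m_Y_pos Y.vol_pos by (simp add: space_lebY)
 show "hlow <= h x" if "x \<in> Ybase" for x
  unfolding hlow_def using that m_Y_pos
  by (intro Y.invariant_density_lower_bound[OF hol_h]) (auto simp: transfer_h space_lebY)
 show "Y.transfer h x = h x" if "x \<in> Ybase" for x by (rule transfer_h[OF that])
qed

end

section \<open>The return time and its tail\<close>

context lsv_holder
begin

lemma h_pos: "x \<in> Ybase ==> 0 < h x"
 using Y.h_pos[of x] by (simp add: space_lebY)

definition rt :: "real => real" where "rt x = real (Suc (ix x))"

lemma rt_measurable[measurable]: "rt \<in> borel_measurable lebY"
 unfolding rt_def by (rule lebY_measurable) measurable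

lemma rt_v: "y \<in> Ybase ==> rt (v n y) = real (Suc n)" by (simp add: rt_def ix_v)

lemma branch_hol_rt: "Y.branch_hol (\<lambda>n. real (Suc n)) rt"
 by (auto simp: Y.branch_hol_def space_lebY rt_v)

lemma rt_integral: "integrable lebY (\<lambda>x. h x * rt x)" "(LINT x|lebY. h x * rt x) = 1"
 using kac_return[of "\<lambda>_. 1::real" 1] by (simp_all add: rt_def m.prob_space)

end

locale lsv_slow = lsv_holder +
 assumes half: "1/2 < \<alpha>"
begin

lemma summable_powr: "s < -1 ==> summable (\<lambda>n. real (Suc n) powr s)"
 using summable_Suc_iff[of "\<lambda>n. real n powr s"] by (simp add: summable_real_powr_iff)

text \<open>The measure of the \<open>n\<close>-th branch decays like \<open>n^(-1-1/\<alpha>)\<close>, so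
branch bounds growing more slowly than \<open>n^(1/\<alpha>)\<close> are summable.\<close>
lemma p_powr_summable:
 assumes b: "\<And>n. 0 <= b n" "\<And>n. b n <= C * real (Suc n) powr s" and s: "s < 1 / \<alpha>"
 shows "summable (\<lambda>n. p n * b n)"
proof -
 obtain D where D: "D > 0" "\<And>n. xs n - xs (Suc n) <= D * real (Suc n) powr (- (1 + 1 / \<alpha>))"
  using xs_diff_bound by blast
 show ?thesis
 proof (rule summable_comparison_test')
  show "summable (\<lambda>n. 3 * D * C * real (Suc n) powr (s - (1 + 1/\<alpha>)))"
   by (intro summable_mult summable_powr) (use s in simp)
  show "norm (p n * b n) <= 3 * D * C * real (Suc n) powr (s - (1 + 1/\<alpha>))" for n
  proof -
   have "p n * b n <= (3 * (D * real (Suc n) powr (- (1 + 1 / \<alpha>)))) * (C * real (Suc n) powr s)"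
   proof (rule mult_mono[OF _ b(2) _ b(1)])
    show "p n <= 3 * (D * real (Suc n) powr (- (1 + 1 / \<alpha>)))"
     unfolding p_def by (rule mult_left_mono[OF D(2)]) simp
    show "0 <= 3 * (D * real (Suc n) powr (- (1 + 1 / \<alpha>)))" using D(1) by simp
   qed
   also have "\<dots> = 3 * D * C * real (Suc n) powr (s - (1 + 1/\<alpha>))"
   proof -
    have "real (Suc n) powr (- (1 + 1 / \<alpha>)) * real (Suc n) powr s = real (Suc n) powr (s - (1 + 1/\<alpha>))"
     unfolding powr_add[symmetric] by (rule arg_cong[where f="\<lambda>z. real (Suc n) powr z"]) simp
    then show ?thesis by (simp only: mult.assoc mult.left_commute[of _ C])
   qed
   finally show ?thesis using b(1)[of n] p_nonneg[of n] by simp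
  qed
 qed
qed

lemma inv_\<alpha>: "1 < 1 / \<alpha>" "1 / \<alpha> < 2" using \<alpha> half by (simp_all add: field_simps)

lemma p_rt_summable: "summable (\<lambda>n. p n * real (Suc n))"
 by (rule p_powr_summable[where C=1 and s=1]) (use inv_\<alpha> in auto)

lemma F_pow_T: "x \<in> Ybase ==> \<exists>j. (F ^^ k) x = (T ^^ j) x"
proof (induction k)
 case 0 then show ?case by (metis funpow_0)
next
 case (Suc k)
 then obtain j where j: "(F ^^ k) x = (T ^^ j) x" by blast
 have "(F ^^ Suc k) x = (T ^^ (Suc (ix ((T ^^ j) x)) + j)) x" by (simp add: j F_def funpow_add)
 then show ?case by blast
qed

text \<open>By Kac's formula the integral over \<open>m\<close> is an integral over \<open>Ybase\<close> of a
sum along excursions, whose terms agree asymptotically by almost invariance. This leaves an integral against the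
density \<open>rt * h\<close>, to which mixing applies.\<close>
lemma char_m_limit:
 fixes A :: "nat => real => real"
 assumes A[measurable]: "\<And>n. A n \<in> borel_measurable m"
  and inv: "\<And>j x. x \<in> {0..1} ==> (\<lambda>n. A n ((T ^^ j) x) - A n x) \<longlonglongrightarrow> 0"
 shows "(\<lambda>n. (LINT x|m. cis (t * A n x)) - (LINT x|Y.\<mu>. cis (t * A n x))) \<longlonglongrightarrow> 0"
proof -
 define G where "G n x = cis (t * A n x)" for n x
 have Gm: "G n \<in> borel_measurable m" for n
  unfolding G_def cis_conv_exp by measurable
 have Gy[measurable]: "G n \<in> borel_measurable lebY" for n by (rule m_measurable_lebY[OF Gm])
 have G1: "norm (G n x) = 1" for n x by (simp add: G_def)
 have Ginv: "(\<lambda>n. G n ((T ^^ j) x) - G n x) \<longlonglongrightarrow> 0" if "x \<in> {0..1}" for j x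
 proof (rule Lim_null_comparison)
  have "(\<lambda>n. \<bar>t\<bar> * \<bar>A n ((T ^^ j) x) - A n x\<bar>) \<longlonglongrightarrow> \<bar>t\<bar> * \<bar>0\<bar>" by (intro tendsto_intros inv that)
  then show "(\<lambda>n. \<bar>t\<bar> * \<bar>A n ((T ^^ j) x) - A n x\<bar>) \<longlonglongrightarrow> 0" by simp
  show "\<forall>\<^sub>F n in sequentially. norm (G n ((T ^^ j) x) - G n x) <= \<bar>t\<bar> * \<bar>A n ((T ^^ j) x) - A n x\<bar>"
  proof (rule always_eventually, rule allI)
   fix n
   show "norm (G n ((T ^^ j) x) - G n x) <= \<bar>t\<bar> * \<bar>A n ((T ^^ j) x) - A n x\<bar>"
    using norm_cis_diff[of "t * A n ((T ^^ j) x)" "t * A n x"]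
    by (simp add: G_def abs_mult[symmetric] right_diff_distrib)
  qed
 qed
 have Fin: "(\<lambda>n. G n ((F ^^ k) x) - G n x) \<longlonglongrightarrow> 0" if "x \<in> space lebY" for k x
 proof -
  have x: "x \<in> Ybase" using that by (simp add: space_lebY)
  obtain j where "(F ^^ k) x = (T ^^ j) x" using F_pow_T[OF x] by blast
  then show ?thesis using Ginv[OF Ybase_unit[OF x], of j] by simp
 qed
 define w where "w x = rt x * h x" for x
 have wb: "Y.branch_hol (\<lambda>n. 2 * real (Suc n) * hH) w" unfolding w_def
  by (rule Y.branch_hol_mult[OF branch_hol_rt hol_h])
 have ws: "summable (\<lambda>n. p n * (2 * real (Suc n) * hH))" by (rule Y.summable_branch_mult[OF p_rt_summable])
 have w1: "(LINT x|lebY. w x) = 1" using rt_integral(2) by (simp add: w_def mult.commute)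
 have "(\<lambda>n. (LINT x|lebY. of_real (w x) * G n x) - of_real (LINT x|lebY. w x) * (LINT x|Y.\<mu>. G n x)) \<longlonglongrightarrow> 0"
  by (rule Y.mixing_branch[OF wb ws Gy _ Fin]) (simp add: G1)
 then have d2: "(\<lambda>n. (LINT x|lebY. of_real (w x) * G n x) - (LINT x|Y.\<mu>. G n x)) \<longlonglongrightarrow> 0" by (simp add: w1)
 have wm[measurable]: "w \<in> borel_measurable lebY" by (rule Y.branch_hol_measurable[OF wb])
 have hm[measurable]: "h \<in> borel_measurable lebY" by (rule Y.h_measurable)
 have wint: "integrable lebY w" using rt_integral(1) by (simp add: w_def[abs_def] mult.commute)
 have wG: "integrable lebY (\<lambda>x. of_real (w x) * G n x)" for n
  by (rule bochner_dominated[OF wint]) (simp_all add: norm_mult G1)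
 have K1: "integrable lebY (\<lambda>x. h x *\<^sub>R (\<Sum>j\<le>ix x. G n ((T ^^ j) x)))"
  "(LINT x|lebY. h x *\<^sub>R (\<Sum>j\<le>ix x. G n ((T ^^ j) x))) = (LINT x|m. G n x)" for n
  using kac_return[OF Gm, of n 1] by (simp_all add: G1)
 have "(\<lambda>n. LINT x|lebY. (h x *\<^sub>R (\<Sum>j\<le>ix x. G n ((T ^^ j) x)) - of_real (w x) * G n x)) \<longlonglongrightarrow> (LINT x|lebY. 0)"
 proof (rule integral_dominated_convergence[where w="\<lambda>x. 2 * w x"])
  show "integrable lebY (\<lambda>x. 2 * w x)" using wint by simp
  show "(\<lambda>x. h x *\<^sub>R (\<Sum>j\<le>ix x. G n ((T ^^ j) x)) - of_real (w x) * G n x) \<in> borel_measurable lebY" for n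
   by (intro borel_measurable_diff borel_measurable_integrable K1(1) wG)
  have eq: "h x *\<^sub>R (\<Sum>j\<le>ix x. G n ((T ^^ j) x)) - of_real (w x) * G n x
   = h x *\<^sub>R (\<Sum>j\<le>ix x. G n ((T ^^ j) x) - G n x)" for n x
   by (simp add: w_def rt_def sum_subtractf scaleR_conv_of_real algebra_simps)
  show "AE x in lebY. (\<lambda>n. h x *\<^sub>R (\<Sum>j\<le>ix x. G n ((T ^^ j) x)) - of_real (w x) * G n x) \<longlonglongrightarrow> 0"
  proof (rule AE_I2)
   fix x assume "x \<in> space lebY"
   then have x: "x \<in> {0..1}" by (simp add: space_lebY)
   have "(\<lambda>n. h x *\<^sub>R (\<Sum>j\<le>ix x. G n ((T ^^ j) x) - G n x)) \<longlonglongrightarrow> h x *\<^sub>R (\<Sum>j\<le>ix x. 0)"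
    by (intro tendsto_intros Ginv x)
   then show "(\<lambda>n. h x *\<^sub>R (\<Sum>j\<le>ix x. G n ((T ^^ j) x)) - of_real (w x) * G n x) \<longlonglongrightarrow> 0"
    by (simp add: eq)
  qed
  show "AE x in lebY. norm (h x *\<^sub>R (\<Sum>j\<le>ix x. G n ((T ^^ j) x)) - of_real (w x) * G n x) <= 2 * w x" for n
  proof (rule AE_I2)
   fix x assume "x \<in> space lebY"
   then have h0: "0 < h x" using h_pos by (simp add: space_lebY)
   have "norm (\<Sum>j\<le>ix x. G n ((T ^^ j) x) - G n x) <= (\<Sum>j\<le>ix x. 2)"
   proof (rule order_trans[OF norm_sum sum_mono])
    show "norm (G n ((T ^^ j) x) - G n x) <= 2" for j
     using norm_triangle_ineq4[of "G n ((T ^^ j) x)" "G n x"] by (simp only: G1)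
   qed
   then have "norm (\<Sum>j\<le>ix x. G n ((T ^^ j) x) - G n x) <= 2 * rt x" by (simp add: rt_def)
   then have "h x * norm (\<Sum>j\<le>ix x. G n ((T ^^ j) x) - G n x) <= h x * (2 * rt x)"
    using h0 by (intro mult_left_mono) simp_all
   then have "norm (h x *\<^sub>R (\<Sum>j\<le>ix x. G n ((T ^^ j) x) - G n x)) <= 2 * w x"
    by (simp only: norm_scaleR abs_of_pos[OF h0] w_def mult.commute mult.left_commute)
   then show "norm (h x *\<^sub>R (\<Sum>j\<le>ix x. G n ((T ^^ j) x)) - of_real (w x) * G n x) <= 2 * w x"
    by (simp only: eq)
  qed
 qed simp
 then have d1: "(\<lambda>n. (LINT x|m. G n x) - (LINT x|lebY. of_real (w x) * G n x)) \<longlonglongrightarrow> 0"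
  by (simp only: bochner_diff[OF K1(1) wG] K1(2) Bochner_Integration.integral_zero)
 show ?thesis using tendsto_add[OF d1 d2] by (simp add: G_def)
qed

end

lemma norm_stable_exponent: "norm (stable_exponent p c t) <= \<bar>c\<bar> * \<bar>t\<bar> powr p * (1 + \<bar>tan (p * pi / 2)\<bar>)"
proof -
 have "norm (1 - \<i> * of_real (sgn t * tan (p * pi / 2))) <= 1 + \<bar>tan (p * pi / 2)\<bar>"
  by (rule order_trans[OF norm_triangle_ineq4]) (simp add: norm_mult abs_mult sgn_if)
 then show ?thesis by (simp add: stable_exponent_def norm_mult abs_mult mult_left_mono)
qed

lemma stable_exponent_0: "stable_exponent p c 0 = 0" by (simp add: stable_exponent_def)

lemma isCont_exp_stable_exponent:
 assumes p: "0 < p" shows "isCont (\<lambda>t. exp (stable_exponent p c t)) 0"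
proof -
 have A: "(\<lambda>t. \<bar>t\<bar> powr p) \<midarrow>0\<rightarrow> (0::real)"
  by (rule tendsto_zero_powrI[where b=p]) (use p in \<open>auto intro!: tendsto_rabs_zero\<close>)
 have "(\<lambda>t. \<bar>c\<bar> * \<bar>t\<bar> powr p * (1 + \<bar>tan (p * pi / 2)\<bar>)) \<midarrow>0\<rightarrow> \<bar>c\<bar> * 0 * (1 + \<bar>tan (p * pi / 2)\<bar>)"
  by (intro tendsto_mult tendsto_const A)
 then have Z: "(\<lambda>t. \<bar>c\<bar> * \<bar>t\<bar> powr p * (1 + \<bar>tan (p * pi / 2)\<bar>)) \<midarrow>0\<rightarrow> 0" by simp
 have "stable_exponent p c \<midarrow>0\<rightarrow> 0"
  by (rule Lim_null_comparison[OF _ Z], rule always_eventually, rule allI, rule norm_stable_exponent)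
 then have "stable_exponent p c \<midarrow>0\<rightarrow> stable_exponent p c 0" by (simp only: stable_exponent_0)
 then show ?thesis unfolding isCont_def by (rule tendsto_exp)
qed

lemma stable_exponent_scale:
 assumes p: "0 < p" and a: "a \<noteq> 0"
 shows "stable_exponent p c (a * t) = - of_real ((c * \<bar>a\<bar> powr p) * \<bar>t\<bar> powr p) * (1 - \<i> * of_real (sgn a * sgn t * tan (p * pi / 2)))"
 by (simp add: stable_exponent_def abs_mult powr_mult sgn_mult mult_ac)

context lsv_slow
begin

lemma space_\<mu>_Ybase: "space Y.\<mu> = Ybase"
 by (simp_all add: space_lebY)

lemma measurable_\<mu>: "f \<in> measurable lebY N ==> f \<in> measurable Y.\<mu> N"
 by (simp only: measurable_cong_sets[OF Y.sets_\<mu> refl])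

lemma rt_\<mu>: "integrable Y.\<mu> rt" "(LINT x|Y.\<mu>. rt x) = 1 / Y.\<kappa>"
 using rt_integral Y.integral_\<mu>[OF rt_measurable] by (simp_all add: inverse_eq_divide)

lemma E_eq: "E n = Ybase \<inter> {1/2..(1 + xs n) / 2}"
 using ix_le_iff[of _ n] T_right by (auto simp: field_simps)

lemma E_lebY: "E n \<in> sets lebY"
proof -
 have "E n \<inter> Ybase \<in> sets lebY" by (subst sets_restrict_space) (auto intro!: image_eqI[of _ _ "E n"] E_measurable[THEN iffD1[OF sets_lborel[THEN arg_cong[where f="\<lambda>S. E n \<in> S"], symmetric]]])
 moreover have "E n \<inter> Ybase = E n" by auto
 ultimately show ?thesis by simp
qed

lemma E_indicator: "(LINT x|lebY. indicator (E n) x) = xs n / 2"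
proof -
 have sub: "E n \<subseteq> Ybase" by auto
 have E: "E n = {1/2<..(1 + xs n) / 2}" unfolding E_eq using xs_le_1[of n] xs_pos[of n] by (auto simp: field_simps)
 have "(LINT x|lebY. indicator (E n) x) = measure lebY (E n)" using sub by (simp add: space_lebY Int_absorb2)
 also have "\<dots> = measure lborel (E n)" unfolding measure_def emeasure_lebY[OF sub] ..
 also have "\<dots> = xs n / 2" unfolding E using xs_pos[of n] by (simp add: field_simps)
 finally show ?thesis .
qed

text \<open>\<open>E n\<close> is an interval with left endpoint 1/2 and length \<open>xs n / 2\<close>, on
which \<open>h\<close> is close to \<open>h (1/2)\<close>.\<close>
lemma prob_E: "\<bar>Y.\<mu>.prob (E n) - h (1/2) * xs n / (2 * Y.\<kappa>)\<bar> <= hL * (xs n)\<^sup>2 / (4 * Y.\<kappa>)"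
proof -
 have [measurable]: "E n \<in> sets lebY" by (rule E_lebY)
 have hm[measurable]: "h \<in> borel_measurable lebY" by (rule Y.h_measurable)
 have i1: "integrable lebY (indicator (E n) :: real => real)"
  by (rule Y.bounded_integrable(1)[where B=1, OF borel_measurable_indicator[OF E_lebY]]) (simp add: indicator_def)
 have i2: "integrable lebY (\<lambda>x. h x * indicator (E n) x)"
  by (rule Y.bounded_integrable(1)[where B=hH, OF borel_measurable_times[OF hm borel_measurable_indicator[OF E_lebY]]])
   (use h_le order_trans[OF abs_ge_zero h_le] in \<open>auto simp: indicator_def space_lebY\<close>)
 have "Y.\<mu>.prob (E n) = (LINT x|Y.\<mu>. indicator (E n) x)"
 proof -
  have "E n \<inter> space Y.\<mu> = E n" unfolding space_\<mu>_Ybase by auto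
  then show ?thesis by (simp only: Bochner_Integration.integral_indicator)
 qed
 also have "\<dots> = (LINT x|lebY. h x * indicator (E n) x) / Y.\<kappa>"
  by (subst Y.integral_\<mu>(1)[OF borel_measurable_indicator[OF E_lebY]]) (simp add: inverse_eq_divide)
 finally have P: "Y.\<mu>.prob (E n) = (LINT x|lebY. h x * indicator (E n) x) / Y.\<kappa>" .
 have "\<bar>(LINT x|lebY. h x * indicator (E n) x) - (LINT x|lebY. h (1/2) * indicator (E n) x)\<bar>
   <= (LINT x|lebY. \<bar>h x * indicator (E n) x - h (1/2) * indicator (E n) x\<bar>)"
  using i1 i2 integral_abs_bound[of lebY "\<lambda>x. h x * indicator (E n) x - h (1/2) * indicator (E n) x"] by simp
 also have "\<dots> <= (LINT x|lebY. (hL * (xs n / 2)) * indicator (E n) x)"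
 proof (rule integral_mono)
  show "integrable lebY (\<lambda>x. \<bar>h x * indicator (E n) x - h (1/2) * indicator (E n) x\<bar>)"
   using i1 i2 by (intro integrable_abs Bochner_Integration.integrable_diff integrable_mult_right)
  show "integrable lebY (\<lambda>x. (hL * (xs n / 2)) * indicator (E n) x)" by (intro integrable_mult_right i1)
  fix x assume "x \<in> space lebY"
  show "\<bar>h x * indicator (E n) x - h (1/2) * indicator (E n) x\<bar> <= (hL * (xs n / 2)) * indicator (E n) x"
  proof (cases "x \<in> E n")
   case True
   then have x: "1/2 < x" "x <= 1" "x - 1/2 <= xs n / 2" unfolding E_eq by (auto simp: field_simps)
   have "\<bar>h x - h (1/2)\<bar> <= hL * \<bar>x - 1/2\<bar>" by (rule h_lip) (use x in auto)
   also have "\<dots> <= hL * (xs n / 2)" using x by (intro mult_left_mono hL_nonneg) auto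
   finally show ?thesis using True by simp
  qed simp
 qed
 also have "\<dots> = hL * (xs n / 2) * (xs n / 2)" by (simp only: E_indicator Bochner_Integration.integral_mult_right_zero)
 finally have B: "\<bar>(LINT x|lebY. h x * indicator (E n) x) - h (1/2) * (xs n / 2)\<bar> <= hL * (xs n / 2) * (xs n / 2)"
  by (simp only: E_indicator Bochner_Integration.integral_mult_right_zero)
 have "Y.\<mu>.prob (E n) - h (1/2) * xs n / (2 * Y.\<kappa>) = ((LINT x|lebY. h x * indicator (E n) x) - h (1/2) * (xs n / 2)) / Y.\<kappa>"
  unfolding P by (simp add: diff_divide_distrib)
 then have "\<bar>Y.\<mu>.prob (E n) - h (1/2) * xs n / (2 * Y.\<kappa>)\<bar>
  = \<bar>(LINT x|lebY. h x * indicator (E n) x) - h (1/2) * (xs n / 2)\<bar> / Y.\<kappa>"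
  using Y.\<kappa>_pos by simp
 also have "\<dots> <= (hL * (xs n / 2) * (xs n / 2)) / Y.\<kappa>" by (intro divide_right_mono B less_imp_le Y.\<kappa>_pos)
 also have "\<dots> = hL * (xs n)\<^sup>2 / (4 * Y.\<kappa>)" by (simp add: power2_eq_square)
 finally show ?thesis .
qed

definition Crt :: real where "Crt = h (1/2) / (4 * Y.\<kappa>) * \<alpha> powr (- (1 / \<alpha>))"

lemma prob_E_asymptotics: "(\<lambda>n. real n powr (1 / \<alpha>) * Y.\<mu>.prob (E n)) \<longlonglongrightarrow> Crt"
proof -
 let ?q = "\<lambda>n. real n powr (1 / \<alpha>)"
 have "(\<lambda>n. ?q n * xs n * (hL / (4 * Y.\<kappa>) * xs n)) \<longlonglongrightarrow> (1/2) * \<alpha> powr (- (1 / \<alpha>)) * (hL / (4 * Y.\<kappa>) * 0)"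
  by (intro tendsto_mult xs_asymptotics tendsto_const xs_tendsto_0)
 then have z: "(\<lambda>n. ?q n * xs n * (hL / (4 * Y.\<kappa>) * xs n)) \<longlonglongrightarrow> 0" by simp
 have "(\<lambda>n. ?q n * Y.\<mu>.prob (E n) - ?q n * xs n * (h (1/2) / (2 * Y.\<kappa>))) \<longlonglongrightarrow> 0"
 proof (rule Lim_null_comparison[OF always_eventually z], rule allI)
  fix n
  have "norm (?q n * Y.\<mu>.prob (E n) - ?q n * xs n * (h (1/2) / (2 * Y.\<kappa>)))
   = norm (?q n * (Y.\<mu>.prob (E n) - h (1/2) * xs n / (2 * Y.\<kappa>)))" by (simp add: algebra_simps)
  also have "\<dots> = ?q n * \<bar>Y.\<mu>.prob (E n) - h (1/2) * xs n / (2 * Y.\<kappa>)\<bar>" by (simp add: abs_mult)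
  also have "\<dots> <= ?q n * (hL * (xs n)\<^sup>2 / (4 * Y.\<kappa>))" by (intro mult_left_mono prob_E) simp
  also have "\<dots> = ?q n * xs n * (hL / (4 * Y.\<kappa>) * xs n)" by (simp add: power2_eq_square)
  finally show "norm (?q n * Y.\<mu>.prob (E n) - ?q n * xs n * (h (1/2) / (2 * Y.\<kappa>))) <= ?q n * xs n * (hL / (4 * Y.\<kappa>) * xs n)" .
 qed
 moreover have "(\<lambda>n. ?q n * xs n * (h (1/2) / (2 * Y.\<kappa>))) \<longlonglongrightarrow> (1/2) * \<alpha> powr (- (1 / \<alpha>)) * (h (1/2) / (2 * Y.\<kappa>))"
  by (intro tendsto_mult xs_asymptotics tendsto_const)
 ultimately have "(\<lambda>n. ?q n * Y.\<mu>.prob (E n)) \<longlonglongrightarrow> 0 + (1/2) * \<alpha> powr (- (1 / \<alpha>)) * (h (1/2) / (2 * Y.\<kappa>))"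
  by (auto dest: tendsto_add)
 then show ?thesis by (simp add: Crt_def mult.commute)
qed

text \<open>Passes from integer to real thresholds: \<open>x \<le> rt\<close> is the event
\<open>E (k x)\<close> with \<open>k x = \<lceil>x\<rceil> - 1\<close>.\<close>
lemma rt_tail: "((\<lambda>x. x powr (1 / \<alpha>) * Y.\<mu>.prob {\<omega>\<in>space Y.\<mu>. x <= rt \<omega>}) \<longlongrightarrow> Crt) at_top"
proof -
 define k where "k x = nat \<lceil>x\<rceil> - 1" for x :: real
 have k: "x - 1 <= real (k x)" "real (k x) <= x" if "1 <= x" for x using that by (simp_all add: k_def) linarith+
 have k_lim: "filterlim k sequentially at_top" unfolding filterlim_at_top
 proof
  fix Z show "eventually (\<lambda>x. Z <= k x) at_top"
   using eventually_ge_at_top[of "real Z + 2"]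
  proof eventually_elim
   case (elim x) then show ?case using k(1)[of x] by simp
  qed
 qed
 have ev: "eventually (\<lambda>x. 1 <= k x \<and> 1 <= x) at_top"
  using k_lim[unfolded filterlim_at_top, rule_format, of 1] eventually_ge_at_top[of 1] by eventually_elim simp
 have "((\<lambda>x. x / real (k x) - 1) \<longlongrightarrow> 0) at_top"
 proof (rule Lim_null_comparison)
  show "((\<lambda>x. 1 / real (k x)) \<longlongrightarrow> 0) at_top"
   using filterlim_compose[OF lim_1_over_n k_lim] by simp
  show "\<forall>\<^sub>F x in at_top. norm (x / real (k x) - 1) <= 1 / real (k x)"
   using ev
  proof eventually_elim
   case (elim x)
   have "x / real (k x) - 1 = (x - real (k x)) / real (k x)" using elim by (simp add: field_simps)
   then show ?case using k[of x] elim by (simp add: divide_right_mono)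
  qed
 qed
 then have "((\<lambda>x. x / real (k x)) \<longlongrightarrow> 1) at_top" by (rule LIM_zero_cancel)
 then have "((\<lambda>x. (x / real (k x)) powr (1 / \<alpha>)) \<longlongrightarrow> 1 powr (1 / \<alpha>)) at_top"
  by (intro tendsto_powr tendsto_const) simp_all
 then have "((\<lambda>x. (x / real (k x)) powr (1 / \<alpha>) * (real (k x) powr (1 / \<alpha>) * Y.\<mu>.prob (E (k x)))) \<longlongrightarrow> 1 powr (1/\<alpha>) * Crt) at_top"
  by (rule tendsto_mult[OF _ filterlim_compose[OF prob_E_asymptotics k_lim]])
 moreover have "\<forall>\<^sub>F x in at_top. (x / real (k x)) powr (1 / \<alpha>) * (real (k x) powr (1 / \<alpha>) * Y.\<mu>.prob (E (k x)))
  = x powr (1 / \<alpha>) * Y.\<mu>.prob {\<omega>\<in>space Y.\<mu>. x <= rt \<omega>}"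
  using ev
 proof eventually_elim
  case (elim x)
  have "(x <= rt \<omega>) = (k x <= ix \<omega>)" for \<omega> unfolding rt_def k_def using elim by linarith
  then have "{\<omega>\<in>space Y.\<mu>. x <= rt \<omega>} = E (k x)" unfolding space_\<mu>_Ybase by simp
  then show ?case using elim by (simp only: mult.assoc[symmetric] powr_mult[symmetric]) simp
 qed
 ultimately show ?thesis by (auto elim: Lim_transform_eventually)
qed

end

section \<open>The stable law of the return times and its inversion\<close>

lemma (in prob_space) char_distr:
 assumes "A \<in> borel_measurable M"
 shows "char (distr M borel A) t = (LINT x|M. cis (t * A x))"
proof -
 have [measurable]: "(\<lambda>x. cis (t * x)) \<in> borel_measurable borel" unfolding cis_conv_exp by measurable
 have "char (distr M borel A) t = (\<integral>x. cis (t * x) \<partial>distr M borel A)" by (simp add: char_def cis_conv_exp)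
 also have "\<dots> = (LINT x|M. cis (t * A x))" by (rule integral_distr[OF assms]) measurable
 finally show ?thesis .
qed

lemma (in prob_space) real_distribution_law:
 "A \<in> borel_measurable M ==> real_distribution (distr M borel A)"
 by (rule real_distribution_distr)

lemma (in prob_space) weak_conv_of_char:
 assumes "\<And>n. A n \<in> borel_measurable M" "real_distribution Z"
  and "\<And>t. (\<lambda>n. LINT x|M. cis (t * A n x)) \<longlonglongrightarrow> char Z t"
 shows "weak_conv_m (\<lambda>n. distr M borel (A n)) Z"
 by (rule levy_continuity) (use assms in \<open>simp_all add: real_distribution_law char_distr\<close>)

lemma (in prob_space) limit_law_exists:
 assumes A: "\<And>n. A n \<in> borel_measurable M"
  and lim: "\<And>t. (\<lambda>n. LINT x|M. cis (t * A n x)) \<longlonglongrightarrow> \<psi> t" and c: "isCont \<psi> 0"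
 shows "\<exists>Z. real_distribution Z \<and> char Z = \<psi> \<and> weak_conv_m (\<lambda>n. distr M borel (A n)) Z"
proof -
 have "\<exists>Z. real_distribution Z \<and> char Z = \<psi>"
  by (rule char_limit_is_char[OF _ _ c, where M="\<lambda>n. distr M borel (A n)"])
   (simp_all add: real_distribution_law A char_distr lim)
 then obtain Z where Z: "real_distribution Z" "char Z = \<psi>" by blast
 have "weak_conv_m (\<lambda>n. distr M borel (A n)) Z" by (rule weak_conv_of_char[OF A Z(1)]) (simp add: Z(2) lim)
 then show ?thesis using Z by blast
qed

text \<open>The indicators of the tails are bounded by \<open>min 1 (\<bar>x\<bar> / l)\<close>, a bounded
continuous function whose integral against the limit law is small for large \<open>l\<close>.\<close>
lemma (in prob_space) tight_of_weak_conv: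
 assumes A[measurable]: "\<And>n. A n \<in> borel_measurable M" and Z: "real_distribution Z"
  and w: "weak_conv_m (\<lambda>n. distr M borel (A n)) Z" and L: "filterlim L at_top sequentially"
 shows "vanishing (\<lambda>n. {x\<in>space M. L n <= \<bar>A n x\<bar>})"
 unfolding vanishing_def
proof (intro conjI allI tendstoI)
 show "{x\<in>space M. L n <= \<bar>A n x\<bar>} \<in> sets M" for n by measurable
 fix e :: real assume e: "0 < e"
 interpret Z: real_distribution Z by fact
 define u :: "nat => real => real" where "u l x = min 1 (\<bar>x\<bar> / real (Suc l))" for l x
 have uc: "isCont (u l) x" for l x unfolding u_def by (intro continuous_intros) simp
 have um[measurable]: "u l \<in> borel_measurable borel" for l unfolding u_def by measurable
 have ub: "\<bar>u l x\<bar> <= 1" for l x by (simp add: u_def)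
 have "(\<lambda>l. LINT x|Z. u l x) \<longlonglongrightarrow> (LINT x|Z. 0)"
 proof (rule integral_dominated_convergence[where w="\<lambda>_. 1"])
  show "AE x in Z. (\<lambda>l. u l x) \<longlonglongrightarrow> 0"
  proof (rule AE_I2)
   fix x
   have "(\<lambda>l. \<bar>x\<bar> * (1 / real (Suc l))) \<longlonglongrightarrow> \<bar>x\<bar> * 0" by (intro tendsto_mult tendsto_const LIMSEQ_Suc[OF lim_1_over_n])
   then have "(\<lambda>l. min 1 (\<bar>x\<bar> / real (Suc l))) \<longlonglongrightarrow> min 1 0" by (intro tendsto_min tendsto_const) simp
   then show "(\<lambda>l. u l x) \<longlonglongrightarrow> 0" by (simp add: u_def)
  qed
 qed (use ub in simp_all)
 then obtain l where l: "\<bar>\<integral>x. u l x \<partial>Z\<bar> < e" using LIMSEQ_D[OF _ e] by fastforce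
 have "(\<lambda>n. LINT x|distr M borel (A n). u l x) \<longlonglongrightarrow> (LINT x|Z. u l x)"
  by (rule weak_conv_imp_integral_bdd_continuous_conv[OF _ Z w, where B=1]) (use ub uc real_distribution_law in simp_all)
 then have "(\<lambda>n. LINT x|M. u l (A n x)) \<longlonglongrightarrow> (LINT x|Z. u l x)" by (simp add: integral_distr)
 then have "eventually (\<lambda>n. (LINT x|M. u l (A n x)) < e) sequentially"
  by (rule order_tendstoD) (use l in simp)
 moreover have "eventually (\<lambda>n. real (Suc l) <= L n) sequentially" using L unfolding filterlim_at_top by blast
 ultimately show "eventually (\<lambda>n. dist (prob {x\<in>space M. L n <= \<bar>A n x\<bar>}) 0 < e) sequentially"
 proof eventually_elim
  case (elim n)
  have "prob {x\<in>space M. L n <= \<bar>A n x\<bar>} = (LINT x|M. indicator {x\<in>space M. L n <= \<bar>A n x\<bar>} x)"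
   by (simp add: Int_absorb2)
  also have "\<dots> <= (LINT x|M. u l (A n x))"
  proof (rule integral_mono)
   show "integrable M (\<lambda>x. u l (A n x))" by (rule integrable_const_bound[where B=1]) (use ub in auto)
   fix x assume "x \<in> space M"
   show "indicator {x\<in>space M. L n <= \<bar>A n x\<bar>} x <= u l (A n x)"
    using elim(2) by (auto simp: u_def indicator_def field_simps)
  qed (rule integrable_real_indicator, simp, simp add: less_top[symmetric])
  finally show ?case using elim(1) by (simp add: measure_nonneg)
 qed
qed

context lsv_slow
begin

definition crt :: real where "crt = Crt * Gamma (1 - 1 / \<alpha>) * cos (1 / \<alpha> * pi / 2)"

abbreviation rtc :: "real => real" where "rtc x \<equiv> rt x - 1 / Y.\<kappa>"

lemma branch_hol_rtc: "Y.branch_hol (\<lambda>n. real (Suc n) + 1 / Y.\<kappa>) rtc"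
proof -
 have "norm (rt (v n x) - 1 / Y.\<kappa>) <= real (Suc n) + 1 / Y.\<kappa>" if "x \<in> Ybase" for n x
  using that Y.\<kappa>_pos norm_triangle_ineq4[of "real (Suc n)" "1 / Y.\<kappa>"] by (simp add: rt_v)
 then show ?thesis using Y.\<kappa>_pos by (auto simp: Y.branch_hol_def space_lebY rt_v)
qed

lemma rtc_summable: "summable (\<lambda>n. p n * (real (Suc n) + 1 / Y.\<kappa>))"
 using summable_add[OF p_rt_summable summable_mult2[OF p_summable, of "1 / Y.\<kappa>"]] by (simp only: distrib_left)

lemma half_powr_tendsto: "s < 0 ==> (\<lambda>n. real n powr s) \<longlonglongrightarrow> 0"
 by (rule tendsto_neg_powr[OF _ filterlim_real_sequentially])

text \<open>The stable expansion describes a single return time, and \<open>charS_power_crude\<close> reduces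
the sum to this case with an error of order \<open>k^(1 - 2\<alpha>)\<close>.\<close>
lemma return_time_char:
 "(\<lambda>k. LINT x|Y.\<mu>. cis (t * (birkhoff_sum F rtc k x / real k powr \<alpha>))) \<longlonglongrightarrow> exp (stable_exponent (1 / \<alpha>) crt t)"
proof -
 interpret W: twisted_transfer lebY "\<lambda>x y. \<bar>x - y\<bar> powr \<theta>" v F ix g p "(1/2) powr \<theta>" 48 h hH hlow rtc "\<lambda>n. real (Suc n) + 1 / Y.\<kappa>"
  by unfold_locales (rule branch_hol_rtc, rule rtc_summable)
 define s where "s k = t / real k powr \<alpha>" for k
 have s0: "s \<longlonglongrightarrow> 0"
 proof -
  have "(\<lambda>k. t * real k powr (-\<alpha>)) \<longlonglongrightarrow> t * 0" by (intro tendsto_mult tendsto_const half_powr_tendsto) (use \<alpha> in simp)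
  then show ?thesis by (simp add: s_def[abs_def] powr_minus divide_inverse)
 qed
 have "(\<lambda>k. Y.Cpert * W.Ctw * \<bar>s k\<bar>) \<longlonglongrightarrow> Y.Cpert * W.Ctw * \<bar>0\<bar>" by (intro tendsto_intros s0)
 then have "eventually (\<lambda>k. Y.Cpert * W.Ctw * \<bar>s k\<bar> < Y.gap / 2) sequentially"
  by (rule order_tendstoD) (use Y.gap(1) in simp)
 then have ev: "eventually (\<lambda>k. norm (W.charS (s k) k - W.char1 (s k) ^ k) <= W.Drate * W.Ctw * hH * t\<^sup>2 * real k powr (1 - 2 * \<alpha>)) sequentially"
  using eventually_gt_at_top[of 0]
 proof eventually_elim
  case (elim k)
  have "real k * (s k)\<^sup>2 = t\<^sup>2 * real k powr (1 - 2 * \<alpha>)"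
   using elim(2) by (simp add: s_def power_divide powr_power powr_diff)
  then have "real k * (W.Drate * W.Ctw * hH * (s k)\<^sup>2) = W.Drate * W.Ctw * hH * t\<^sup>2 * real k powr (1 - 2 * \<alpha>)"
   by (simp only: mult.left_commute[of "real k"] mult.assoc)
  then show ?case using W.charS_power_crude[OF less_imp_le, OF elim(1), of k] by (simp only:)
 qed
 have "(\<lambda>k. W.Drate * W.Ctw * hH * t\<^sup>2 * real k powr (1 - 2 * \<alpha>)) \<longlonglongrightarrow> W.Drate * W.Ctw * hH * t\<^sup>2 * 0"
  by (intro tendsto_mult tendsto_const half_powr_tendsto) (use half in simp)
 then have d: "(\<lambda>k. W.charS (s k) k - W.char1 (s k) ^ k) \<longlonglongrightarrow> 0"
  by (intro Lim_null_comparison[OF ev]) simp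
 have "(\<lambda>n. of_nat n * ((LINT \<omega>|Y.\<mu>. cis (t / real n powr (1 / (1 / \<alpha>)) * (rt \<omega> - (LINT \<omega>|Y.\<mu>. rt \<omega>)))) - 1))
  \<longlonglongrightarrow> stable_exponent (1 / \<alpha>) (Crt * Gamma (1 - 1 / \<alpha>) * cos (1 / \<alpha> * pi / 2)) t"
  by (rule Y.\<mu>.stable_expansion[OF _ _ rt_\<mu>(1) inv_\<alpha> rt_tail]) (simp_all add: measurable_\<mu> rt_def)
 then have "(\<lambda>n. of_nat n * (W.char1 (s n) - 1)) \<longlonglongrightarrow> stable_exponent (1 / \<alpha>) crt t"
  by (simp add: W.char1_def s_def crt_def rt_\<mu>)
 then have "(\<lambda>n. W.char1 (s n) ^ n) \<longlonglongrightarrow> exp (stable_exponent (1 / \<alpha>) crt t)"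
  by (rule tendsto_power_exp_complex[rotated]) (use W.norm_charS[of "s _" "Suc 0"] in \<open>simp add: W.char1_def W.charS_def birkhoff_sum_def\<close>)
 from tendsto_add[OF d this] show ?thesis by (simp add: W.charS_def s_def mult_ac)
qed

text \<open>The time of the \<open>k\<close>-th return to \<open>Ybase\<close>.\<close>
definition \<tau> :: "nat => real => nat" where "\<tau> k x = (\<Sum>i<k. Suc (ix ((F ^^ i) x)))"

lemma \<tau>_0[simp]: "\<tau> 0 x = 0" and \<tau>_Suc: "\<tau> (Suc k) x = \<tau> k x + Suc (ix ((F ^^ k) x))"
 by (simp_all add: \<tau>_def)

lemma \<tau>_ge: "k <= \<tau> k x" by (induction k) (simp_all add: \<tau>_Suc)

lemma \<tau>_mono: "j <= k ==> \<tau> j x <= \<tau> k x"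
 by (induction rule: dec_induct) (auto simp: \<tau>_Suc intro: trans_le_add1)

lemma \<tau>_birkhoff: "real (\<tau> k x) = birkhoff_sum F rtc k x + real k / Y.\<kappa>"
 by (simp add: \<tau>_def birkhoff_sum_def rt_def sum_subtractf)

lemma \<tau>_measurable[measurable]: "\<tau> k \<in> measurable borel (count_space UNIV)"
proof -
 have [measurable]: "(F ^^ i) \<in> borel_measurable borel" for i by (induction i) simp_all
 show ?thesis unfolding \<tau>_def by measurable
qed

definition returns :: "nat => real => nat" where "returns n x = (LEAST k. n < \<tau> (Suc k) x)"

lemma returns_upper: "n < \<tau> (Suc (returns n x)) x"
 unfolding returns_def by (rule LeastI[of _ n]) (use \<tau>_ge[of "Suc n" x] in simp)

lemma le_returns_iff: "k <= returns n x \<longleftrightarrow> \<tau> k x <= n"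
proof
 assume k: "k <= returns n x"
 show "\<tau> k x <= n"
 proof (cases k)
  case (Suc j)
  then have "j < returns n x" using k by simp
  then have "\<not> n < \<tau> (Suc j) x" unfolding returns_def by (rule not_less_Least)
  then show ?thesis using Suc by simp
 qed simp
next
 assume "\<tau> k x <= n"
 then show "k <= returns n x" using returns_upper[of n x] \<tau>_mono[of "Suc (returns n x)" k x] by (force simp: not_le[symmetric])
qed

lemma returns_le: "returns n x <= n"
 using le_returns_iff[of "returns n x" n x] \<tau>_ge[of "returns n x" x] by simp

lemma returns_measurable[measurable]: "returns n \<in> measurable borel (count_space UNIV)"
 unfolding returns_def by measurable

text \<open>The normalised difference between \<open>n\<close> and the mean time of as many returns as have been
observed.\<close>
definition lag :: "nat => real => real" where
 "lag n x = (real n - real (returns n x) / Y.\<kappa>) / real n powr \<alpha>"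

lemma lag_measurable[measurable]: "lag n \<in> borel_measurable lebY"
 unfolding lag_def by (rule lebY_measurable) measurable

lemma real_power_tendsto: "0 < s ==> filterlim (\<lambda>n. real n powr s) at_top sequentially"
 by (rule filterlim_compose[OF filterlim_powr_at_top filterlim_real_sequentially])

lemma lag_le_iff:
 assumes n: "0 < n"
 shows "lag n \<omega> <= x \<longleftrightarrow> \<tau> (nat \<lceil>Y.\<kappa> * (real n - x * real n powr \<alpha>)\<rceil>) \<omega> <= n"
proof -
 have "lag n \<omega> <= x \<longleftrightarrow> Y.\<kappa> * (real n - x * real n powr \<alpha>) <= real (returns n \<omega>)"
  using n Y.\<kappa>_pos by (simp add: lag_def divide_simps algebra_simps)
 also have "\<dots> \<longleftrightarrow> nat \<lceil>Y.\<kappa> * (real n - x * real n powr \<alpha>)\<rceil> <= returns n \<omega>" by linarith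
 finally show ?thesis by (simp add: le_returns_iff)
qed

text \<open>The threshold \<open>k\<close> corresponding to \<open>x\<close> is asymptotic to
\<open>\<kappa> * n\<close>, so the normalisations \<open>n^\<alpha>\<close> and \<open>k^\<alpha>\<close>
differ by the factor \<open>\<kappa>^\<alpha>\<close>.\<close>
lemma lag_threshold:
 fixes x :: real
 defines "k \<equiv> \<lambda>n. nat \<lceil>Y.\<kappa> * (real n - x * real n powr \<alpha>)\<rceil>"
 shows "filterlim k sequentially sequentially"
  and "(\<lambda>n. (real n - real (k n) / Y.\<kappa>) / real (k n) powr \<alpha>) \<longlonglongrightarrow> x / Y.\<kappa> powr \<alpha>"
proof -
 have a0: "(\<lambda>n. real n powr (\<alpha> - 1)) \<longlonglongrightarrow> 0" by (rule half_powr_tendsto) (use \<alpha> in simp)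
 have a1: "(\<lambda>n. real n powr (- \<alpha>)) \<longlonglongrightarrow> 0" by (rule half_powr_tendsto) (use \<alpha> in simp)
 have "(\<lambda>n. x * real n powr (\<alpha> - 1)) \<longlonglongrightarrow> x * 0" by (intro tendsto_mult tendsto_const a0)
 then have "eventually (\<lambda>n. x * real n powr (\<alpha> - 1) < 1/2) sequentially" by (rule order_tendstoD) simp
 then have pos: "eventually (\<lambda>n. 0 < n \<and> real n / 2 <= real n - x * real n powr \<alpha>) sequentially"
  using eventually_gt_at_top[of 0]
 proof eventually_elim
  case (elim n)
  have "x * real n powr \<alpha> = real n * (x * real n powr (\<alpha> - 1))" using elim by (simp add: powr_diff)
  also have "\<dots> <= real n * (1/2)" using elim by (intro mult_left_mono) simp_all
  finally show ?case using elim by simp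
 qed
 have kb: "eventually (\<lambda>n. 0 < n \<and> Y.\<kappa> * (real n - x * real n powr \<alpha>) <= real (k n) \<and> real (k n) <= Y.\<kappa> * (real n - x * real n powr \<alpha>) + 1
   \<and> Y.\<kappa> / 2 * real n <= real (k n)) sequentially" using pos
 proof eventually_elim
  case (elim n)
  have "Y.\<kappa> * (real n / 2) <= Y.\<kappa> * (real n - x * real n powr \<alpha>)" using elim Y.\<kappa>_pos by (intro mult_left_mono) auto
  moreover have "0 <= Y.\<kappa> * (real n / 2)" using Y.\<kappa>_pos by simp
  ultimately have "Y.\<kappa> * (real n - x * real n powr \<alpha>) <= real (k n) \<and> real (k n) <= Y.\<kappa> * (real n - x * real n powr \<alpha>) + 1"
   "Y.\<kappa> * (real n / 2) <= real (k n)"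
   unfolding k_def by linarith+
  then show ?case using elim by simp
 qed
 show k: "filterlim k sequentially sequentially"
 proof -
  have "filterlim (\<lambda>n. Y.\<kappa> / 2 * real n) at_top sequentially"
   by (rule filterlim_tendsto_pos_mult_at_top[OF tendsto_const _ filterlim_real_sequentially]) (use Y.\<kappa>_pos in simp)
  then have "filterlim (\<lambda>n. real (k n)) at_top sequentially"
   by (rule filterlim_at_top_mono) (use kb in \<open>auto elim: eventually_mono\<close>)
  then show ?thesis by (simp add: filterlim_sequentially_iff_filterlim_real)
 qed
 have lim1: "(\<lambda>n. (real n - real (k n) / Y.\<kappa>) / real n powr \<alpha>) \<longlonglongrightarrow> x"
 proof -
  have "(\<lambda>n. (real n - real (k n) / Y.\<kappa>) / real n powr \<alpha> - x) \<longlonglongrightarrow> 0"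
  proof (rule Lim_null_comparison)
   show "(\<lambda>n. 1 / Y.\<kappa> * real n powr (- \<alpha>)) \<longlonglongrightarrow> 0" by (rule tendsto_mult_right_zero[OF a1])
   show "eventually (\<lambda>n. norm ((real n - real (k n) / Y.\<kappa>) / real n powr \<alpha> - x) <= 1 / Y.\<kappa> * real n powr (- \<alpha>)) sequentially"
    using kb
   proof eventually_elim
    case (elim n)
    have "(real n - real (k n) / Y.\<kappa>) / real n powr \<alpha> - x
     = (Y.\<kappa> * (real n - x * real n powr \<alpha>) - real (k n)) / (Y.\<kappa> * real n powr \<alpha>)"
     using elim Y.\<kappa>_pos by (simp add: field_simps)
    moreover have "\<bar>Y.\<kappa> * (real n - x * real n powr \<alpha>) - real (k n)\<bar> <= 1" using elim by linarith
    ultimately have "norm ((real n - real (k n) / Y.\<kappa>) / real n powr \<alpha> - x) <= 1 / (Y.\<kappa> * real n powr \<alpha>)"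
     using Y.\<kappa>_pos by (simp add: abs_mult divide_right_mono)
    then show ?case by (simp add: powr_minus_divide)
   qed
  qed
  then show ?thesis by (rule LIM_zero_cancel)
 qed
 have lim2: "(\<lambda>n. real (k n) / real n) \<longlonglongrightarrow> Y.\<kappa>"
 proof -
  have "(\<lambda>n. Y.\<kappa> * (1 - (real n - real (k n) / Y.\<kappa>) / real n powr \<alpha> * real n powr (\<alpha> - 1))) \<longlonglongrightarrow> Y.\<kappa> * (1 - x * 0)"
   by (intro tendsto_intros lim1 a0)
  moreover have "eventually (\<lambda>n. Y.\<kappa> * (1 - (real n - real (k n) / Y.\<kappa>) / real n powr \<alpha> * real n powr (\<alpha> - 1)) = real (k n) / real n) sequentially"
   using eventually_gt_at_top[of 0]
  proof eventually_elim
   case (elim n)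
   have "(real n - real (k n) / Y.\<kappa>) / real n powr \<alpha> * real n powr (\<alpha> - 1) = (real n - real (k n) / Y.\<kappa>) / real n"
    using elim by (simp add: powr_diff)
   then show ?case using elim Y.\<kappa>_pos by (simp add: field_simps)
  qed
  ultimately show ?thesis by (simp add: tendsto_cong)
 qed
 have "(\<lambda>n. (real n - real (k n) / Y.\<kappa>) / real n powr \<alpha> / (real (k n) / real n) powr \<alpha>) \<longlonglongrightarrow> x / Y.\<kappa> powr \<alpha>"
  by (intro tendsto_divide lim1 tendsto_powr lim2 tendsto_const) (use Y.\<kappa>_pos in auto)
 moreover have "eventually (\<lambda>n. (real n - real (k n) / Y.\<kappa>) / real n powr \<alpha> / (real (k n) / real n) powr \<alpha>
   = (real n - real (k n) / Y.\<kappa>) / real (k n) powr \<alpha>) sequentially"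
  using eventually_gt_at_top[of 0] by eventually_elim (simp add: powr_divide)
 ultimately show "(\<lambda>n. (real n - real (k n) / Y.\<kappa>) / real (k n) powr \<alpha>) \<longlonglongrightarrow> x / Y.\<kappa> powr \<alpha>"
  by (rule Lim_transform_eventually)
qed

lemma birkhoff_rtc_measurable[measurable]: "birkhoff_sum F rtc k \<in> borel_measurable Y.\<mu>"
 by (rule measurable_\<mu>[OF Y.birkhoff_measurable]) (rule borel_measurable_diff, rule rt_measurable, simp)

lemma lag_measurable_\<mu>[measurable]: "lag n \<in> borel_measurable Y.\<mu>" by (rule measurable_\<mu>[OF lag_measurable])

text \<open>Distribution functions are compared at a continuity point \<open>x\<close>: the event
\<open>lag n \<le> x\<close> is \<open>\<tau> k \<le> n\<close> for the threshold \<open>k\<close> of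
\<open>x\<close>. Inversion preserves the direction of the asymmetry since long excursions mean few returns,
that is, a large lag.\<close>
theorem lag_limit:
 "\<exists>Z. real_distribution Z \<and> (\<forall>t. char Z t = exp (stable_exponent (1 / \<alpha>) crt (Y.\<kappa> powr \<alpha> * t))) \<and>
   weak_conv_m (\<lambda>n. distr Y.\<mu> borel (lag n)) Z"
proof -
 let ?V = "\<lambda>k x. birkhoff_sum F rtc k x / real k powr \<alpha>"
 have Vm: "?V k \<in> borel_measurable Y.\<mu>" for k by measurable
 obtain Z where Z: "real_distribution Z" "char Z = (\<lambda>t. exp (stable_exponent (1 / \<alpha>) crt t))"
  using Y.\<mu>.limit_law_exists[OF Vm return_time_char isCont_exp_stable_exponent] \<alpha> by auto
 interpret Z: real_distribution Z by fact
 define Z' where "Z' = distr Z borel (\<lambda>z. Y.\<kappa> powr \<alpha> * z)"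
 have kp: "0 < Y.\<kappa> powr \<alpha>" using Y.\<kappa>_pos by simp
 have Z': "real_distribution Z'" unfolding Z'_def by (rule Z.real_distribution_law) simp
 interpret Z': real_distribution Z' by fact
 have "char Z' t = (LINT z|Z. cis (t * (Y.\<kappa> powr \<alpha> * z)))" for t
  unfolding Z'_def by (rule Z.char_distr) simp
 also have "\<dots> t = char Z (Y.\<kappa> powr \<alpha> * t)" for t by (simp add: char_def cis_conv_exp mult_ac)
 finally have chZ': "char Z' t = exp (stable_exponent (1 / \<alpha>) crt (Y.\<kappa> powr \<alpha> * t))" for t by (simp add: Z(2))
 have cdfZ: "cdf Z' x = cdf Z (x / Y.\<kappa> powr \<alpha>)" for x
 proof -
  have "(\<lambda>z. Y.\<kappa> powr \<alpha> * z) -` {..x} \<inter> space Z = {..x / Y.\<kappa> powr \<alpha>}" using kp by (auto simp: field_simps)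
  then show ?thesis unfolding cdf_def Z'_def by (subst measure_distr) simp_all
 qed
 have "weak_conv_m (\<lambda>n. distr Y.\<mu> borel (lag n)) Z'"
  unfolding weak_conv_m_def weak_conv_def
 proof (intro allI impI)
  fix x assume cont: "isCont (cdf Z') x"
  define k where "k n = nat \<lceil>Y.\<kappa> * (real n - x * real n powr \<alpha>)\<rceil>" for n
  define y where "y n = (real n - real (k n) / Y.\<kappa>) / real (k n) powr \<alpha>" for n
  define y0 where "y0 = x / Y.\<kappa> powr \<alpha>"
  have k: "filterlim k sequentially sequentially" and y: "y \<longlonglongrightarrow> y0"
   using lag_threshold[of x] by (simp_all add: k_def[abs_def] y_def[abs_def] y0_def)
  have ct: "isCont (cdf Z) y0"
  proof -
   have "(\<lambda>y. cdf Z' (Y.\<kappa> powr \<alpha> * y)) = cdf Z" using kp by (simp add: cdfZ)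
   moreover have "isCont (\<lambda>y. cdf Z' (Y.\<kappa> powr \<alpha> * y)) y0"
    by (rule isCont_o2[where g="cdf Z'"]) (use kp cont in \<open>auto simp: y0_def\<close>)
   ultimately show ?thesis by simp
  qed
  (* The moving threshold y n is absorbed into the variable, so that weak convergence applies at the fixed point
  y0. *)
  define U where "U n \<omega> = ?V (k n) \<omega> - (y n - y0)" for n \<omega>
  have Um[measurable]: "U n \<in> borel_measurable Y.\<mu>" for n unfolding U_def by measurable
  have "weak_conv_m (\<lambda>n. distr Y.\<mu> borel (U n)) Z"
  proof (rule Y.\<mu>.weak_conv_of_char[OF Um Z(1)])
   fix t
   have "(\<lambda>n. cis (- t * (y n - y0)) * (LINT \<omega>|Y.\<mu>. cis (t * ?V (k n) \<omega>))) \<longlonglongrightarrow> cis (- t * (y0 - y0)) * exp (stable_exponent (1 / \<alpha>) crt t)"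
    by (intro tendsto_mult tendsto_cis tendsto_intros y filterlim_compose[OF return_time_char k])
   moreover have "(LINT \<omega>|Y.\<mu>. cis (t * U n \<omega>)) = cis (- t * (y n - y0)) * (LINT \<omega>|Y.\<mu>. cis (t * ?V (k n) \<omega>))" for n
   proof -
    have "cis (t * U n \<omega>) = cis (- t * (y n - y0)) * cis (t * ?V (k n) \<omega>)" for \<omega>
     by (simp only: cis_mult U_def) (rule arg_cong[where f=cis], simp add: algebra_simps)
    then show ?thesis by simp
   qed
   ultimately show "(\<lambda>n. LINT \<omega>|Y.\<mu>. cis (t * U n \<omega>)) \<longlonglongrightarrow> char Z t" by (simp add: Z(2))
  qed
  then have "(\<lambda>n. cdf (distr Y.\<mu> borel (U n)) y0) \<longlonglongrightarrow> cdf Z y0" using ct by (simp add: weak_conv_m_def weak_conv_def)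
  moreover have "eventually (\<lambda>n. cdf (distr Y.\<mu> borel (U n)) y0 = cdf (distr Y.\<mu> borel (lag n)) x) sequentially"
   using eventually_gt_at_top[of 0] k[unfolded filterlim_at_top, rule_format, of 1]
  proof eventually_elim
   case (elim n)
   have "U n \<omega> <= y0 \<longleftrightarrow> lag n \<omega> <= x" for \<omega>
   proof -
    have "U n \<omega> <= y0 \<longleftrightarrow> ?V (k n) \<omega> <= y n" by (simp add: U_def)
    also have "\<dots> \<longleftrightarrow> birkhoff_sum F rtc (k n) \<omega> <= real n - real (k n) / Y.\<kappa>"
     using elim by (simp add: y_def divide_le_cancel)
    also have "\<dots> \<longleftrightarrow> real (\<tau> (k n) \<omega>) <= real n" unfolding \<tau>_birkhoff by linarith
    also have "\<dots> \<longleftrightarrow> lag n \<omega> <= x" using lag_le_iff[OF elim(1), of \<omega> x] by (simp add: k_def)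
    finally show ?thesis .
   qed
   then have "U n -` {..y0} = lag n -` {..x}" by auto
   then show ?case unfolding cdf_def by (subst (1 2) measure_distr) simp_all
  qed
  ultimately show "(\<lambda>n. cdf (distr Y.\<mu> borel (lag n)) x) \<longlonglongrightarrow> cdf Z' x"
   by (simp add: cdfZ y0_def tendsto_cong)
 qed
 then show ?thesis using Z' chZ' by blast
qed

end

section \<open>Induced observables and their martingale decomposition\<close>

lemma powr_sum_bound:
 assumes s: "0 < s" "s < 1"
 shows "(\<Sum>i<n. real (Suc i) powr (s - 1)) <= real n powr s / s"
proof (induction n)
 case (Suc n)
 interpret lsv s by unfold_locales (use s in auto)
 have "s * real (Suc n) powr (s - 1) <= real (Suc n) powr s - real n powr s"
 proof (cases n)
  case 0 then show ?thesis using s by simp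
 next
  case (Suc j) then show ?thesis using powr_concave(1)[of "real n" "real (Suc n)"] by simp
 qed
 then have "real (Suc n) powr (s - 1) <= (real (Suc n) powr s - real n powr s) / s"
  using s by (simp add: pos_le_divide_eq mult.commute)
 then show ?case using Suc by (simp add: diff_divide_distrib)
qed simp

text \<open>Exponents can be decreased, so \<open>\<gamma> < \<alpha>\<close> may be assumed; the excursion sums
below are then bounded by a positive power.\<close>
locale lsv_observable = lsv_slow +
 fixes f :: "real => real" and Cf \<gamma> :: real
 assumes f_hol: "\<And>x y. x \<in> {0..1} ==> y \<in> {0..1} ==> \<bar>f x - f y\<bar> <= Cf * \<bar>x - y\<bar> powr \<theta>"
  and f_zero: "\<And>x. x \<in> {0..1} ==> \<bar>f x - f 0\<bar> <= Cf * x powr \<gamma>"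
  and \<gamma>: "\<alpha> - 1/2 < \<gamma>" "\<gamma> < \<alpha>"
  and f_mean: "(LINT x|m. f x) = 0"
begin

lemma Cf_nonneg: "0 <= Cf" using f_zero[of 1] by (simp add: order_trans[OF abs_ge_zero])

lemma \<gamma>_pos: "0 < \<gamma>" using \<gamma> half by simp

lemma f_measurable[measurable]: "f \<in> borel_measurable m"
proof -
 have "continuous_on {0..1} f" by (rule holder_continuous_on[OF \<theta>(1) f_hol])
 then have "f \<in> borel_measurable (restrict_space borel {0..1})" by (rule borel_measurable_continuous_on_restrict)
 moreover have "sets (restrict_space borel {0..1::real}) = sets m" by (simp add: sets_m sets_restrict_space)
 ultimately show ?thesis using measurable_cong_sets[OF _ refl] by blast
qed

definition fB :: real where "fB = \<bar>f 0\<bar> + Cf"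

lemma f_bound: "x \<in> {0..1} ==> \<bar>f x\<bar> <= fB"
proof -
 assume x: "x \<in> {0..1}"
 have "Cf * x powr \<gamma> <= Cf * 1" using x \<gamma>_pos Cf_nonneg by (intro mult_left_mono powr_le1) auto
 then show ?thesis using f_zero[OF x] by (simp add: fB_def)
qed

abbreviation f0 :: "real => real" where "f0 x \<equiv> f x - f 0"

lemma f0_bound: "x \<in> {0..1} ==> \<bar>f0 x\<bar> <= Cf"
proof -
 assume x: "x \<in> {0..1}"
 have "Cf * x powr \<gamma> <= Cf * 1" using x \<gamma>_pos Cf_nonneg by (intro mult_left_mono powr_le1) auto
 then show ?thesis using f_zero[OF x] by simp
qed

text \<open>Bounds the sums of \<open>f - f 0\<close> along any initial part of an excursion with return time
\<open>n + 1\<close>: the step \<open>i + 1\<close> before its end is at a distance at most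
\<open>xs (i + 1)\<close> from 0.\<close>
definition env :: "nat => real" where "env n = Cf + (\<Sum>i<n. Cf * xs (Suc i) powr \<gamma>)"

lemma env_nonneg: "0 <= env n" unfolding env_def by (intro add_nonneg_nonneg sum_nonneg mult_nonneg_nonneg Cf_nonneg) simp_all

lemma excursion_bound:
 assumes x: "x \<in> Ybase" and J: "J <= Suc (ix x)"
 shows "\<bar>birkhoff_sum T f0 J x\<bar> <= env (ix x)"
proof -
 define n y where "n = ix x" and "y = F x"
 have y: "y \<in> Ybase" and xv: "x = v n y" using v_F[OF x] F_in[OF x] by (simp_all add: n_def y_def)
 have x1: "x \<in> {0..1}" using x by simp
 have "\<bar>birkhoff_sum T f0 J x\<bar> <= (\<Sum>j<J. \<bar>f0 ((T ^^ j) x)\<bar>)" unfolding birkhoff_sum_def by (rule sum_abs)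
 also have "\<dots> <= (\<Sum>j<Suc n. \<bar>f0 ((T ^^ j) x)\<bar>)" using J by (intro sum_mono2) (auto simp: n_def)
 also have "\<dots> = \<bar>f0 x\<bar> + (\<Sum>j<n. \<bar>f0 ((T ^^ Suc j) x)\<bar>)" by (subst sum.lessThan_Suc_shift) simp
 also have "\<dots> <= Cf + (\<Sum>j<n. Cf * xs (n - j) powr \<gamma>)"
 proof (intro add_mono f0_bound x1 sum_mono)
  fix j assume "j \<in> {..<n}"
  then have T: "(T ^^ Suc j) x = lp (n - j) y" unfolding xv using T_pow_v[OF y, of j n] by simp
  have "\<bar>f0 (lp (n - j) y)\<bar> <= Cf * lp (n - j) y powr \<gamma>" using lp_in01[OF y, of "n - j"] by (intro f_zero) auto
  also have "\<dots> <= Cf * xs (n - j) powr \<gamma>"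
   using lp_bounds[of y "n - j"] y lp_in01[OF y, of "n - j"] \<gamma>_pos
   by (intro mult_left_mono Cf_nonneg powr_mono2) auto
  finally show "\<bar>f0 ((T ^^ Suc j) x)\<bar> <= Cf * xs (n - j) powr \<gamma>" by (simp only: T)
 qed
 also have "(\<Sum>j<n. Cf * xs (n - j) powr \<gamma>) = (\<Sum>j<n. Cf * xs (Suc (n - Suc j)) powr \<gamma>)"
  by (rule sum.cong) (auto simp: Suc_diff_Suc)
 also have "\<dots> = (\<Sum>i<n. Cf * xs (Suc i) powr \<gamma>)" by (rule sum.nat_diff_reindex)
 finally show ?thesis by (simp add: env_def n_def)
qed

definition growth :: real where "growth = 1 - \<gamma> / \<alpha>"

text \<open>The last inequality, equivalent to \<open>\<gamma> > \<alpha> - 1/2\<close>, is what makes the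
envelope square integrable.\<close>
lemma growth: "0 < growth" "growth < 1" "2 * growth < 1 / \<alpha>"
proof -
 have "\<alpha> * (2 * \<alpha>) < \<alpha> * (1 + 2 * \<gamma>)" using \<gamma> \<alpha> by (intro mult_strict_left_mono) auto
 then show "2 * growth < 1 / \<alpha>" using \<alpha> by (simp add: growth_def field_simps)
qed (use \<gamma> \<gamma>_pos \<alpha> in \<open>simp_all add: growth_def\<close>)

text \<open>The terms of \<open>env\<close> decay like \<open>i^(-\<gamma>/\<alpha>)\<close>.\<close>
lemma env_bound: "\<exists>C\<ge>0. \<forall>n. env n <= C * real (Suc n) powr growth"
proof -
 obtain C where C: "C > 0" "\<And>n. xs n <= C * real (Suc n) powr (- (1 / \<alpha>))" using xs_bound by blast
 define D where "D = Cf * C powr \<gamma>"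
 have D: "0 <= D" using Cf_nonneg by (simp add: D_def)
 have term_bound: "Cf * xs (Suc i) powr \<gamma> <= D * real (Suc i) powr (growth - 1)" for i
 proof -
  have "xs (Suc i) <= C * real (Suc i) powr (- (1 / \<alpha>))"
  proof (rule order_trans[OF C(2)])
   have "real (Suc (Suc i)) powr (- (1 / \<alpha>)) <= real (Suc i) powr (- (1 / \<alpha>))" using \<alpha> by (intro powr_mono2') auto
   then show "C * real (Suc (Suc i)) powr (- (1 / \<alpha>)) <= C * real (Suc i) powr (- (1 / \<alpha>))" using C(1) by simp
  qed
  then have "xs (Suc i) powr \<gamma> <= (C * real (Suc i) powr (- (1 / \<alpha>))) powr \<gamma>"
   using xs_pos[of "Suc i"] \<gamma>_pos by (intro powr_mono2) auto
  also have "\<dots> = C powr \<gamma> * real (Suc i) powr (growth - 1)"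
   using C(1) by (simp add: powr_mult powr_powr growth_def)
  finally show ?thesis using Cf_nonneg by (simp add: D_def mult.assoc mult_left_mono)
 qed
 have "env n <= (Cf + D / growth) * real (Suc n) powr growth" for n
 proof -
  have "(\<Sum>i<n. Cf * xs (Suc i) powr \<gamma>) <= D * (\<Sum>i<n. real (Suc i) powr (growth - 1))"
   unfolding sum_distrib_left by (rule sum_mono) (rule term_bound)
  also have "\<dots> <= D * (real n powr growth / growth)" using powr_sum_bound[OF growth(1,2)] D by (rule mult_left_mono)
  also have "\<dots> <= D * (real (Suc n) powr growth / growth)"
   using growth D by (intro mult_left_mono divide_right_mono powr_mono2) auto
  finally have "(\<Sum>i<n. Cf * xs (Suc i) powr \<gamma>) <= D / growth * real (Suc n) powr growth" by simp
  moreover have "Cf * 1 <= Cf * real (Suc n) powr growth" using growth by (intro mult_left_mono Cf_nonneg ge_one_powr_ge_zero) auto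
  ultimately show ?thesis by (simp add: env_def distrib_right)
 qed
 moreover have "0 <= Cf + D / growth" using Cf_nonneg D growth by simp
 ultimately show ?thesis by blast
qed

lemma env_square_summable: "summable (\<lambda>n. p n * (env n + c)\<^sup>2)" if c: "0 <= c"
proof -
 obtain C where C: "C \<ge> 0" "\<And>n. env n <= C * real (Suc n) powr growth" using env_bound by blast
 show ?thesis
 proof (rule p_powr_summable[where s="2 * growth" and C="(C + c)\<^sup>2"])
  show "(env n + c)\<^sup>2 <= (C + c)\<^sup>2 * real (Suc n) powr (2 * growth)" for n
  proof -
   have "c * 1 <= c * real (Suc n) powr growth" using growth c by (intro mult_left_mono ge_one_powr_ge_zero) auto
   then have "env n + c <= (C + c) * real (Suc n) powr growth" using C(2)[of n] by (simp add: distrib_right)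
   then have "(env n + c)\<^sup>2 <= ((C + c) * real (Suc n) powr growth)\<^sup>2" using env_nonneg[of n] c by (intro power_mono) auto
   also have "\<dots> = (C + c)\<^sup>2 * real (Suc n) powr (2 * growth)"
    by (simp add: power_mult_distrib powr_power mult.commute)
   finally show ?thesis .
  qed
 qed (use growth in auto)
qed

text \<open>The induced observable; the constant makes its mean zero, because \<open>f\<close> has mean zero and
excursions have mean length \<open>1 / \<kappa>\<close>.\<close>
definition X :: "real => real" where "X x = birkhoff_sum T f0 (Suc (ix x)) x + f 0 / Y.\<kappa>"

text \<open>The values of \<open>X\<close> grow more slowly, but its Hoelder constants on the branches may grow
linearly; they remain summable against \<open>p\<close>.\<close>
definition Xb :: "nat => real" where "Xb n = (Cf + \<bar>f 0\<bar> / Y.\<kappa>) * real (Suc n)"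

lemma Xb_summable: "summable (\<lambda>n. p n * Xb n)"
 using summable_mult[OF p_rt_summable, of "Cf + \<bar>f 0\<bar> / Y.\<kappa>"] by (simp only: Xb_def mult.left_commute)

lemma X_bound: "x \<in> Ybase ==> \<bar>X x\<bar> <= env (ix x) + \<bar>f 0\<bar> / Y.\<kappa>"
 using excursion_bound[of x "Suc (ix x)"] Y.\<kappa>_pos abs_triangle_ineq[of "birkhoff_sum T f0 (Suc (ix x)) x" "f 0 / Y.\<kappa>"]
 by (simp add: X_def)

lemma X_branch_hol: "Y.branch_hol Xb X"
proof -
 have env_le: "env n <= Cf * real (Suc n)" for n
 proof -
  have "(\<Sum>i<n. Cf * xs (Suc i) powr \<gamma>) <= (\<Sum>i<n. Cf * 1)"
   using xs_le_1 less_imp_le[OF xs_pos] \<gamma>_pos by (intro sum_mono mult_left_mono Cf_nonneg powr_le1) auto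
  then show ?thesis by (simp add: env_def algebra_simps)
 qed
 have a: "norm (X (v n x)) <= Xb n" if x: "x \<in> Ybase" for n x
 proof -
  have "\<bar>X (v n x)\<bar> <= env n + \<bar>f 0\<bar> / Y.\<kappa> * 1" using X_bound[OF v_in[OF x], of n] ix_v[OF x, of n] by simp
  also have "\<dots> <= Cf * real (Suc n) + \<bar>f 0\<bar> / Y.\<kappa> * real (Suc n)"
   using Y.\<kappa>_pos by (intro add_mono env_le mult_left_mono) auto
  finally show ?thesis by (simp add: Xb_def distrib_right)
 qed
 have b: "norm (X (v n x) - X (v n y)) <= Xb n * \<bar>x - y\<bar> powr \<theta>" if x: "x \<in> Ybase" and y: "y \<in> Ybase" for n x y
 proof -
  have st: "\<bar>(T ^^ j) (v n x) - (T ^^ j) (v n y)\<bar> <= \<bar>x - y\<bar>" if "j < Suc n" for j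
  proof (cases j)
   case 0 show ?thesis unfolding 0 funpow_0 by (rule order_trans[OF v_contraction[OF x y]]) simp
  next
   case (Suc i)
   have "(T ^^ j) (v n x) - (T ^^ j) (v n y) = lp (n - i) x - lp (n - i) y"
    using that Suc T_pow_v[OF x, of i n] T_pow_v[OF y, of i n] by (simp only: Suc)
   then show ?thesis using lp_lipschitz[of x y "n - i"] x y by simp
  qed
  have "X (v n x) - X (v n y) = (\<Sum>j<Suc n. f ((T ^^ j) (v n x)) - f ((T ^^ j) (v n y)))"
   by (simp only: X_def birkhoff_sum_def ix_v[OF x] ix_v[OF y]) (simp add: sum_subtractf)
  then have "\<bar>X (v n x) - X (v n y)\<bar> <= (\<Sum>j<Suc n. \<bar>f ((T ^^ j) (v n x)) - f ((T ^^ j) (v n y))\<bar>)" by (simp only: sum_abs)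
  also have "\<dots> <= (\<Sum>j<Suc n. Cf * \<bar>x - y\<bar> powr \<theta>)"
  proof (rule sum_mono)
   fix j assume "j \<in> {..<Suc n}"
   then have j: "j < Suc n" by simp
   have "\<bar>f ((T ^^ j) (v n x)) - f ((T ^^ j) (v n y))\<bar> <= Cf * \<bar>(T ^^ j) (v n x) - (T ^^ j) (v n y)\<bar> powr \<theta>"
    by (rule f_hol; rule T_pow_in; rule Ybase_unit; rule v_in) (rule x, rule y)
   also have "\<dots> <= Cf * \<bar>x - y\<bar> powr \<theta>" using st[OF j] \<theta> by (intro mult_left_mono Cf_nonneg powr_mono2) auto
   finally show "\<bar>f ((T ^^ j) (v n x)) - f ((T ^^ j) (v n y))\<bar> <= Cf * \<bar>x - y\<bar> powr \<theta>" .
  qed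
  also have "\<dots> = (Cf * real (Suc n)) * \<bar>x - y\<bar> powr \<theta>" by simp
  also have "\<dots> <= Xb n * \<bar>x - y\<bar> powr \<theta>"
  proof (rule mult_right_mono)
   show "Cf * real (Suc n) <= Xb n" unfolding Xb_def using Y.\<kappa>_pos by (intro mult_right_mono) auto
  qed simp
  finally show ?thesis by simp
 qed
 show ?thesis using a b by (auto simp: Y.branch_hol_def space_lebY)
qed

lemma X_measurable[measurable]: "X \<in> borel_measurable lebY" by (rule Y.branch_hol_measurable[OF X_branch_hol])

lemma X_mean: "(LINT x|lebY. X x * h x) = 0"
proof -
 have hm[measurable]: "h \<in> borel_measurable lebY" by (rule Y.h_measurable)
 note K = kac_return[OF f_measurable, of fB]
 have K: "integrable lebY (\<lambda>x. h x * (\<Sum>j\<le>ix x. f ((T ^^ j) x)))" "(LINT x|lebY. h x * (\<Sum>j\<le>ix x. f ((T ^^ j) x))) = 0"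
  using kac_return[OF f_measurable, of fB] f_bound f_mean by simp_all
 have eq: "X x * h x = h x * (\<Sum>j\<le>ix x. f ((T ^^ j) x)) - f 0 * (h x * rt x) + f 0 / Y.\<kappa> * h x" for x
  unfolding X_def birkhoff_sum_def lessThan_Suc_atMost rt_def by (simp add: sum_subtractf algebra_simps)
 have "(LINT x|lebY. X x * h x) = 0 - f 0 * 1 + f 0 / Y.\<kappa> * Y.\<kappa>"
  unfolding eq using K rt_integral Y.h_integrable by (simp add: Y.\<kappa>_def)
 then show ?thesis using Y.\<kappa>_pos by simp
qed

lemma X_square_integrable: "integrable lebY (\<lambda>x. (X x)\<^sup>2)"
proof (rule Y.integrable_branch)
 show "summable (\<lambda>n. p n * (env n + \<bar>f 0\<bar> / Y.\<kappa>)\<^sup>2)" using Y.\<kappa>_pos by (intro env_square_summable) simp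
 show "norm ((X (v n x))\<^sup>2) <= (env n + \<bar>f 0\<bar> / Y.\<kappa>)\<^sup>2" if "x \<in> space lebY" for n x
 proof -
  have x: "x \<in> Ybase" using that by (simp add: space_lebY)
  show ?thesis using power_mono[OF X_bound[OF v_in[OF x], of n], of 2] by (simp add: ix_v[OF x])
 qed
qed measurable

lemma env_square_integrable: "integrable Y.\<mu> (\<lambda>x. (env (ix x))\<^sup>2)"
proof -
 have [measurable]: "(\<lambda>x. (env (ix x))\<^sup>2) \<in> borel_measurable lebY" by (rule lebY_measurable) measurable
 have "integrable lebY (\<lambda>x. h x * (env (ix x))\<^sup>2)"
 proof (rule Y.integrable_branch)
  have hm[measurable]: "h \<in> borel_measurable lebY" by (rule Y.h_measurable)
  show "(\<lambda>x. h x * (env (ix x))\<^sup>2) \<in> borel_measurable lebY" by measurable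
  show "summable (\<lambda>n. p n * (hH * (env n)\<^sup>2))"
   using summable_mult[OF env_square_summable[of 0], of hH] by (simp add: mult.left_commute)
  show "norm (h (v n x) * (env (ix (v n x)))\<^sup>2) <= hH * (env n)\<^sup>2" if "x \<in> space lebY" for n x
  proof -
   have x: "x \<in> Ybase" using that by (simp add: space_lebY)
   show ?thesis using mult_right_mono[OF h_le[OF v_in[OF x], of n], of "(env n)\<^sup>2"] by (simp add: ix_v[OF x] abs_mult)
  qed
 qed
 then show ?thesis by (subst Y.integral_\<mu>(2)) simp_all
qed

end

text \<open>Fixes a Gordin decomposition of \<open>X\<close>.\<close>
locale lsv_martingale = lsv_observable +
 fixes \<psi> :: "real => real" and c :: real
 assumes \<psi>_hol: "Y.hol c \<psi>"
  and D_branch_hol: "Y.branch_hol (\<lambda>n. Xb n + 2 * c) (\<lambda>x. X x + \<psi> x - \<psi> (F x))"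
  and D_transfer: "\<And>x. x \<in> Ybase ==> Y.transfer (\<lambda>x. (X x + \<psi> x - \<psi> (F x)) * h x) x = 0"
begin

definition D :: "real => real" where "D x = X x + \<psi> x - \<psi> (F x)"

lemma \<psi>_bound: "x \<in> Ybase ==> \<bar>\<psi> x\<bar> <= c" using Y.holD(1)[OF \<psi>_hol, of x] by (simp add: space_lebY)

lemma \<psi>_measurable[measurable]: "\<psi> \<in> borel_measurable lebY" by (rule Y.hol_measurable[OF \<psi>_hol])

lemma D_measurable[measurable]: "D \<in> borel_measurable lebY"
 unfolding D_def[abs_def] by (rule Y.branch_hol_measurable[OF D_branch_hol])

lemma D_square_integrable: "integrable lebY (\<lambda>x. (D x)\<^sup>2)"
proof (rule bochner_dominated)
 show "integrable lebY (\<lambda>x. 2 * (X x)\<^sup>2 + 2 * (2 * c)\<^sup>2)" using X_square_integrable by simp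
 show "AE x in lebY. norm ((D x)\<^sup>2) <= norm (2 * (X x)\<^sup>2 + 2 * (2 * c)\<^sup>2)"
 proof (rule AE_I2)
  fix x assume "x \<in> space lebY"
  then have x: "x \<in> Ybase" by (simp add: space_lebY)
  let ?e = "\<psi> x - \<psi> (F x)"
  have "\<bar>?e\<bar> <= 2 * c" using \<psi>_bound[OF x] \<psi>_bound[OF F_in[OF x]] by linarith
  then have "?e\<^sup>2 <= (2 * c)\<^sup>2" by (rule abs_le_square_iff[THEN iffD1, OF order_trans]) simp
  moreover have "(X x + ?e)\<^sup>2 <= 2 * (X x)\<^sup>2 + 2 * ?e\<^sup>2" using sum_squares_bound[of "X x" ?e] by (simp add: power2_sum)
  moreover have "D x = X x + ?e" by (simp add: D_def)
  ultimately have "(D x)\<^sup>2 <= 2 * (X x)\<^sup>2 + 2 * (2 * c)\<^sup>2" by simp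
  then show "norm ((D x)\<^sup>2) <= norm (2 * (X x)\<^sup>2 + 2 * (2 * c)\<^sup>2)" by simp
 qed
qed measurable

sublocale D: martingale_transfer lebY "\<lambda>x y. \<bar>x - y\<bar> powr \<theta>" v F ix g p "(1/2) powr \<theta>" 48 h hH hlow D "\<lambda>n. Xb n + 2 * c"
proof unfold_locales
 show "Y.branch_hol (\<lambda>n. Xb n + 2 * c) D" unfolding D_def[abs_def] by (rule D_branch_hol)
 show "summable (\<lambda>n. p n * (Xb n + 2 * c))"
  using summable_add[OF Xb_summable Y.p_summable_const[of "2 * c"]] by (simp only: distrib_left)
 show "Y.transfer (\<lambda>x. D x * h x) x = 0" if "x \<in> space lebY" for x
  unfolding D_def using D_transfer that by (simp add: space_lebY)
 show "integrable lebY (\<lambda>x. (D x)\<^sup>2)" by (rule D_square_integrable)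
qed

lemma F_\<mu>: "F \<in> measurable Y.\<mu> Y.\<mu>"
 using Y.F_measurable by (simp only: measurable_cong_sets[OF Y.sets_\<mu> Y.sets_\<mu>])

sublocale M: orthogonal_stationary Y.\<mu> F D
proof unfold_locales
 show "F \<in> measurable Y.\<mu> Y.\<mu>" by (rule F_\<mu>)
 show "distr Y.\<mu> Y.\<mu> F = Y.\<mu>" by (rule Y.distr_F)
 show "D \<in> borel_measurable Y.\<mu>" by (rule measurable_\<mu>[OF D_measurable])
 show "integrable Y.\<mu> (\<lambda>x. (D x)\<^sup>2)" by (rule D.X2_integrable)
 show "integrable Y.\<mu> (\<lambda>x. D x * D ((F ^^ j) x))" for j by (rule D.orthogonal(2))
 show "(LINT x|Y.\<mu>. D x * D ((F ^^ Suc j) x)) = 0" for j by (rule D.orthogonal(1))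
qed

lemma F_pow_in: "x \<in> Ybase ==> (F ^^ k) x \<in> Ybase" by (induction k) (simp_all only: funpow.simps id_apply o_apply F_in)

lemma F_pow_\<tau>: "(F ^^ k) x = (T ^^ \<tau> k x) x"
proof (induction k)
 case (Suc k)
 have "(F ^^ Suc k) x = (T ^^ Suc (ix ((F ^^ k) x))) ((F ^^ k) x)" by (simp add: F_def)
 also have "\<dots> = (T ^^ (Suc (ix ((F ^^ k) x)) + \<tau> k x)) x" by (simp only: Suc funpow_add o_apply)
 finally show ?case by (simp only: \<tau>_Suc add.commute)
qed simp

lemma birkhoff_sum_excursions: "birkhoff_sum T f0 (\<tau> k x) x = birkhoff_sum F X k x - real k * f 0 / Y.\<kappa>"
proof (induction k)
 case 0 show ?case by (simp add: birkhoff_sum_def)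
next
 case (Suc k)
 have "birkhoff_sum T f0 (\<tau> (Suc k) x) x = birkhoff_sum T f0 (\<tau> k x) x + (X ((F ^^ k) x) - f 0 / Y.\<kappa>)"
  unfolding \<tau>_Suc birkhoff_sum_add F_pow_\<tau>[symmetric] by (simp add: X_def)
 then show ?case using Suc by (simp add: birkhoff_sum_def algebra_simps add_divide_distrib)
qed

lemma birkhoff_sum_X: "birkhoff_sum F X k x = birkhoff_sum F D k x - \<psi> x + \<psi> ((F ^^ k) x)"
 by (induction k) (simp_all add: birkhoff_sum_def D_def)

text \<open>Cutting the orbit at the last return before time \<open>n\<close> leaves complete excursions, which
sum up to Birkhoff sums of \<open>X\<close>, and an incomplete excursion bounded by the envelope.\<close>
lemma birkhoff_sum_decomposition:
 fixes n :: nat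
 assumes x: "x \<in> Ybase"
 defines "N \<equiv> returns n x"
 shows "\<bar>birkhoff_sum T f n x - f 0 * (real n - real N / Y.\<kappa>) - birkhoff_sum F D N x\<bar> <= 2 * c + env (ix ((F ^^ N) x))"
proof -
 define y where "y = (F ^^ N) x"
 have y: "y \<in> Ybase" unfolding y_def by (rule F_pow_in[OF x])
 have N: "\<tau> N x <= n" "n < \<tau> N x + Suc (ix y)"
  using le_returns_iff[of N n x] returns_upper[of n x] by (simp_all add: N_def y_def \<tau>_Suc)
 define J where "J = n - \<tau> N x"
 have n: "n = \<tau> N x + J" and J: "J <= Suc (ix y)" using N by (simp_all add: J_def)
 have "birkhoff_sum T f n x = real n * f 0 + birkhoff_sum T f0 n x" by (simp add: birkhoff_sum_def sum_subtractf)
 also have "birkhoff_sum T f0 n x = birkhoff_sum F X N x - real N * f 0 / Y.\<kappa> + birkhoff_sum T f0 J y"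
  unfolding n birkhoff_sum_add F_pow_\<tau>[symmetric] birkhoff_sum_excursions by (simp add: y_def)
 finally have "birkhoff_sum T f n x - f 0 * (real n - real N / Y.\<kappa>) - birkhoff_sum F D N x
  = - \<psi> x + \<psi> y + birkhoff_sum T f0 J y"
  unfolding birkhoff_sum_X y_def[symmetric] by (simp add: algebra_simps)
 then show ?thesis using excursion_bound[OF y J] \<psi>_bound[OF x] \<psi>_bound[OF y] unfolding y_def[symmetric] by linarith
qed

end

section \<open>Limit theorems for the normalised restriction to the base\<close>

context lsv_martingale
begin

lemma \<mu>_set: "P \<in> measurable borel (count_space UNIV) ==> {x\<in>space Y.\<mu>. P x} \<in> sets Y.\<mu>"
proof -
 assume "P \<in> measurable borel (count_space UNIV)"
 then have "P \<in> measurable Y.\<mu> (count_space UNIV)" by (intro measurable_\<mu> lebY_measurable)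
 then show ?thesis by (rule predE)
qed

lemma prob_invariant:
 assumes A: "{x\<in>space Y.\<mu>. P x} \<in> sets Y.\<mu>"
 shows "Y.\<mu>.prob {x\<in>space Y.\<mu>. P ((F ^^ k) x)} = Y.\<mu>.prob {x\<in>space Y.\<mu>. P x}"
  and "{x\<in>space Y.\<mu>. P ((F ^^ k) x)} \<in> sets Y.\<mu>"
proof -
 have eq: "(F ^^ k) -` {x\<in>space Y.\<mu>. P x} \<inter> space Y.\<mu> = {x\<in>space Y.\<mu>. P ((F ^^ k) x)}"
  using measurable_space[OF M.F_pow[of k]] unfolding vimage_def by blast
 have "measure (distr Y.\<mu> Y.\<mu> (F ^^ k)) {x\<in>space Y.\<mu>. P x} = Y.\<mu>.prob {x\<in>space Y.\<mu>. P ((F ^^ k) x)}"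
  unfolding eq[symmetric] by (rule measure_distr[OF M.F_pow A])
 then show "Y.\<mu>.prob {x\<in>space Y.\<mu>. P ((F ^^ k) x)} = Y.\<mu>.prob {x\<in>space Y.\<mu>. P x}" by (simp only: M.inv_pow)
 show "{x\<in>space Y.\<mu>. P ((F ^^ k) x)} \<in> sets Y.\<mu>" unfolding eq[symmetric] by (rule measurable_sets[OF M.F_pow A])
qed

text \<open>The maximum of \<open>n\<close> identically distributed square integrable variables is
\<open>o(sqrt n)\<close>: a union bound with Chebyshev's inequality, in which the truncated second moment tends
to 0.\<close>
lemma overshoot_negligible:
 assumes e: "0 < e"
 shows "Y.\<mu>.vanishing (\<lambda>n. {x\<in>space Y.\<mu>. \<exists>k\<le>n. e * sqrt (real n) <= env (ix ((F ^^ k) x))})"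
proof -
 have "(F ^^ i) \<in> borel_measurable borel" for i by (induction i) simp_all
 note [measurable] = this
 let ?B = "\<lambda>x. env (ix x)"
 define S where "S n = {x\<in>space Y.\<mu>. e * sqrt (real n) <= ?B x}" for n
 have Sm[measurable]: "S n \<in> sets Y.\<mu>" for n unfolding S_def by (rule \<mu>_set) measurable
 define I where "I n = (LINT x|Y.\<mu>. indicator (S n) x * (?B x)\<^sup>2)" for n
 have Bm: "(\<lambda>x. (?B x)\<^sup>2) \<in> borel_measurable Y.\<mu>" using env_square_integrable by (rule borel_measurable_integrable)
 have iB: "integrable Y.\<mu> (\<lambda>x. indicator (S n) x * (?B x)\<^sup>2)" for n
  using integrable_mult_indicator[OF Sm env_square_integrable] by simp
 have "I \<longlonglongrightarrow> (LINT x|Y.\<mu>. 0)" unfolding I_def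
 proof (rule integral_dominated_convergence[where w="\<lambda>x. (?B x)\<^sup>2"])
  show "AE x in Y.\<mu>. (\<lambda>n. indicator (S n) x * (?B x)\<^sup>2) \<longlonglongrightarrow> 0"
  proof (rule AE_I2)
   fix x
   have "filterlim (\<lambda>n. e * sqrt (real n)) at_top sequentially"
    by (rule filterlim_tendsto_pos_mult_at_top[OF tendsto_const e]) (rule filterlim_compose[OF sqrt_at_top filterlim_real_sequentially])
   then have "eventually (\<lambda>n. ?B x < e * sqrt (real n)) sequentially" by (simp add: filterlim_at_top_dense)
   then have "eventually (\<lambda>n. indicator (S n) x * (?B x)\<^sup>2 = 0) sequentially"
    by eventually_elim (simp add: S_def)
   then show "(\<lambda>n. indicator (S n) x * (?B x)\<^sup>2) \<longlonglongrightarrow> 0" by (rule tendsto_eventually)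
  qed
  show "AE x in Y.\<mu>. norm (indicator (S n) x * (?B x)\<^sup>2) <= (?B x)\<^sup>2" for n by (rule AE_I2) (simp add: indicator_def)
  show "(\<lambda>x. indicator (S n) x * (?B x)\<^sup>2) \<in> borel_measurable Y.\<mu>" for n by (rule borel_measurable_integrable[OF iB])
  show "integrable Y.\<mu> (\<lambda>x. (?B x)\<^sup>2)" by (rule env_square_integrable)
 qed simp
 then have I0: "I \<longlonglongrightarrow> 0" by simp
 have I_nonneg: "0 <= I n" for n unfolding I_def by (rule integral_nonneg_AE) simp
 have "(\<lambda>n. 2 / e\<^sup>2 * I n) \<longlonglongrightarrow> 0" by (rule tendsto_mult_right_zero[OF I0])
 moreover have "eventually (\<lambda>n. norm (Y.\<mu>.prob {x\<in>space Y.\<mu>. \<exists>k\<le>n. e * sqrt (real n) <= ?B ((F ^^ k) x)}) <= 2 / e\<^sup>2 * I n) sequentially"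
  using eventually_gt_at_top[of 0]
 proof eventually_elim
  case (elim n)
  have SS: "{x\<in>space Y.\<mu>. e * sqrt (real n) <= ?B ((F ^^ k) x)} \<in> sets Y.\<mu>"
   "Y.\<mu>.prob {x\<in>space Y.\<mu>. e * sqrt (real n) <= ?B ((F ^^ k) x)} = Y.\<mu>.prob (S n)" for k
   using prob_invariant[OF Sm[unfolded S_def], of n k] by (simp_all add: S_def)
  have "e\<^sup>2 * real n * Y.\<mu>.prob (S n) = (LINT x|Y.\<mu>. e\<^sup>2 * real n * indicator (S n) x)"
   using sets.sets_into_space[OF Sm[of n]] by (simp add: Int_absorb2)
  also have "\<dots> <= I n" unfolding I_def
  proof (rule integral_mono)
   show "integrable Y.\<mu> (\<lambda>x. e\<^sup>2 * real n * indicator (S n) x)"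
    by (intro integrable_mult_right integrable_real_indicator Sm) (simp add: less_top[symmetric])
   fix x
   show "e\<^sup>2 * real n * indicator (S n) x <= indicator (S n) x * (?B x)\<^sup>2"
    using power_mono[of "e * sqrt (real n)" "?B x" 2] e by (simp add: indicator_def S_def power_mult_distrib)
  qed (rule iB)
  finally have P: "Y.\<mu>.prob (S n) <= I n / (e\<^sup>2 * real n)" using e elim by (simp add: pos_le_divide_eq mult.commute)
  have "{x\<in>space Y.\<mu>. \<exists>k\<le>n. e * sqrt (real n) <= ?B ((F ^^ k) x)} = (\<Union>k\<in>{..n}. {x\<in>space Y.\<mu>. e * sqrt (real n) <= ?B ((F ^^ k) x)})"
   by auto
  then have "Y.\<mu>.prob {x\<in>space Y.\<mu>. \<exists>k\<le>n. e * sqrt (real n) <= ?B ((F ^^ k) x)}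
   <= (\<Sum>k\<in>{..n}. Y.\<mu>.prob {x\<in>space Y.\<mu>. e * sqrt (real n) <= ?B ((F ^^ k) x)})"
   by (simp only:) (rule Y.\<mu>.finite_measure_subadditive_finite, use SS in auto)
  also have "\<dots> = real (Suc n) * Y.\<mu>.prob (S n)" unfolding SS(2) by simp
  also have "\<dots> <= (2 * real n) * (I n / (e\<^sup>2 * real n))" using elim by (intro mult_mono P) (auto intro: measure_nonneg)
  also have "\<dots> = 2 / e\<^sup>2 * I n" using elim e by simp
  finally show ?case by (simp add: measure_nonneg)
 qed
 ultimately have "(\<lambda>n. Y.\<mu>.prob {x\<in>space Y.\<mu>. \<exists>k\<le>n. e * sqrt (real n) <= ?B ((F ^^ k) x)}) \<longlonglongrightarrow> 0"
  by (rule Lim_null_comparison[rotated])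
 moreover have "{x\<in>space Y.\<mu>. \<exists>k\<le>n. e * sqrt (real n) <= ?B ((F ^^ k) x)} \<in> sets Y.\<mu>" for n
  by (rule \<mu>_set) measurable
 ultimately show ?thesis unfolding Y.\<mu>.vanishing_def by blast
qed

lemma birkhoff_D_measurable[measurable]: "birkhoff_sum F D k \<in> borel_measurable Y.\<mu>"
 by (rule M.S_measurable)

lemma birkhoff_f_measurable: "birkhoff_sum T f n \<in> borel_measurable m"
 unfolding birkhoff_sum_def by (intro borel_measurable_sum measurable_compose[OF T_pow_m f_measurable])

lemma birkhoff_f_measurable_\<mu>[measurable]: "birkhoff_sum T f n \<in> borel_measurable Y.\<mu>"
 by (rule measurable_\<mu>[OF m_measurable_lebY[OF birkhoff_f_measurable]])

text \<open>Since \<open>\<alpha> > 1/2\<close>, the martingale part and the incomplete excursion are negligible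
at the scale \<open>n^\<alpha>\<close>.\<close>
lemma stable_char_\<mu>:
 "(\<lambda>n. (LINT x|Y.\<mu>. cis (t * (birkhoff_sum T f n x / real n powr \<alpha>))) - (LINT x|Y.\<mu>. cis (t * (f 0 * lag n x)))) \<longlonglongrightarrow> 0"
proof (rule Y.\<mu>.char_close)
 show "(\<lambda>x. birkhoff_sum T f n x / real n powr \<alpha>) \<in> borel_measurable Y.\<mu>" for n by measurable
 show "(\<lambda>x. f 0 * lag n x) \<in> borel_measurable Y.\<mu>" for n by measurable
 fix e :: real assume e: "0 < e"
 define P where "P n = {x\<in>space Y.\<mu>. \<exists>j\<le>n. e / 3 * real n powr \<alpha> <= \<bar>birkhoff_sum F D j x\<bar>}" for n
 define Q where "Q n = {x\<in>space Y.\<mu>. \<exists>k\<le>n. e / 3 * sqrt (real n) <= env (ix ((F ^^ k) x))}" for n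
 have "Y.\<mu>.vanishing P" unfolding P_def by (rule M.fluctuation[where a=1 and C=1]) (use e half in auto)
 moreover have "Y.\<mu>.vanishing Q" unfolding Q_def by (rule overshoot_negligible) (use e in simp)
 ultimately have PQ: "Y.\<mu>.vanishing (\<lambda>n. P n \<union> Q n)" by (rule Y.\<mu>.vanishing_Un)
 have "filterlim (\<lambda>n. e / 3 * real n powr \<alpha>) at_top sequentially"
  by (rule filterlim_tendsto_pos_mult_at_top[OF tendsto_const _ real_power_tendsto]) (use e \<alpha> in auto)
 then have "\<forall>\<^sub>F n in sequentially. 2 * c < e / 3 * real n powr \<alpha>" unfolding filterlim_at_top_dense by blast
 then have "\<forall>\<^sub>F n in sequentially. \<forall>x\<in>space Y.\<mu> - (P n \<union> Q n). \<bar>birkhoff_sum T f n x / real n powr \<alpha> - f 0 * lag n x\<bar> <= e"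
  using eventually_gt_at_top[of 0]
 proof eventually_elim
  case (elim n)
  have sq: "sqrt (real n) <= real n powr \<alpha>" unfolding powr_half_sqrt[OF of_nat_0_le_iff, symmetric] using elim half by (intro powr_mono) auto
  show ?case
  proof
   fix x assume x: "x \<in> space Y.\<mu> - (P n \<union> Q n)"
   let ?N = "returns n x"
   have xY: "x \<in> Ybase" using x by (simp only: space_\<mu>_Ybase Diff_iff)
   have 1: "\<bar>birkhoff_sum F D ?N x\<bar> < e / 3 * real n powr \<alpha>"
    using x returns_le[of n x] unfolding P_def not_le[symmetric] by blast
   have 2: "env (ix ((F ^^ ?N) x)) < e / 3 * sqrt (real n)"
    using x returns_le[of n x] unfolding Q_def not_le[symmetric] by blast
   have "e / 3 * sqrt (real n) <= e / 3 * real n powr \<alpha>" using sq e by (intro mult_left_mono) auto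
   then have "\<bar>birkhoff_sum T f n x - f 0 * (real n - real ?N / Y.\<kappa>)\<bar> <= e * real n powr \<alpha>"
    using birkhoff_sum_decomposition[OF xY, of n] 1 2 elim(1) by linarith
   moreover have "birkhoff_sum T f n x / real n powr \<alpha> - f 0 * lag n x
    = (birkhoff_sum T f n x - f 0 * (real n - real ?N / Y.\<kappa>)) / real n powr \<alpha>"
    unfolding lag_def times_divide_eq_right by (rule diff_divide_distrib[symmetric])
   ultimately show "\<bar>birkhoff_sum T f n x / real n powr \<alpha> - f 0 * lag n x\<bar> <= e"
    using elim(2) by (simp add: pos_divide_le_eq)
  qed
 qed
 with PQ show "\<exists>U. Y.\<mu>.vanishing U \<and> (\<forall>\<^sub>F n in sequentially. \<forall>x\<in>space Y.\<mu> - U n. \<bar>birkhoff_sum T f n x / real n powr \<alpha> - f 0 * lag n x\<bar> <= e)"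
  by blast
qed

lemma lag_tight: "filterlim L at_top sequentially ==> Y.\<mu>.vanishing (\<lambda>n. {x\<in>space Y.\<mu>. L n <= \<bar>lag n x\<bar>})"
proof -
 assume L: "filterlim L at_top sequentially"
 obtain Z where "real_distribution Z" "weak_conv_m (\<lambda>n. distr Y.\<mu> borel (lag n)) Z" using lag_limit by blast
 then show ?thesis by (rule Y.\<mu>.tight_of_weak_conv[OF lag_measurable_\<mu> _ _ L])
qed

lemma normalized_L1: "(LINT x|Y.\<mu>. \<bar>birkhoff_sum F D k x / sqrt (real k)\<bar>) <= 1 + D.\<sigma>2"
 "integrable Y.\<mu> (\<lambda>x. \<bar>birkhoff_sum F D k x / sqrt (real k)\<bar>)"
proof -
 let ?W = "\<lambda>x. birkhoff_sum F D k x / sqrt (real k)"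
 have i: "integrable Y.\<mu> (\<lambda>x. (birkhoff_sum F D k x)\<^sup>2)" by (rule M.S_square(1))
 have eq: "(?W x)\<^sup>2 = (birkhoff_sum F D k x)\<^sup>2 / real k" for x by (simp add: power_divide)
 have i2: "integrable Y.\<mu> (\<lambda>x. 1 + (?W x)\<^sup>2)" unfolding eq using i by simp
 have "\<bar>a\<bar> <= 1 + a\<^sup>2" for a :: real
 proof -
  have "0 <= (\<bar>a\<bar> - 1)\<^sup>2 + (1 + a\<^sup>2)" by simp
  then show ?thesis by (simp add: power2_diff)
 qed
 then have le: "\<bar>?W x\<bar> <= 1 + (?W x)\<^sup>2" for x .
 show ii: "integrable Y.\<mu> (\<lambda>x. \<bar>?W x\<bar>)"
  by (rule bochner_dominated[OF i2]) (use le in \<open>auto intro!: AE_I2\<close>)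
 have "(LINT x|Y.\<mu>. \<bar>?W x\<bar>) <= (LINT x|Y.\<mu>. 1 + (?W x)\<^sup>2)" by (rule integral_mono[OF ii i2 le])
 also have "\<dots> = 1 + (real k * D.\<sigma>2) / real k"
  unfolding eq using i by (simp add: M.S_square(2) D.\<sigma>2_def Y.\<mu>.prob_space[simplified])
 also have "\<dots> <= 1 + D.\<sigma>2" using D.\<sigma>2_nonneg by simp
 finally show "(LINT x|Y.\<mu>. \<bar>?W x\<bar>) <= 1 + D.\<sigma>2" .
qed

text \<open>Passing from the normalisation \<open>sqrt (k n)\<close> to \<open>sqrt n\<close> changes the
argument by a factor tending to \<open>sqrt \<kappa>\<close>. The characteristic functions vary uniformly little
because the normalised sums are bounded in \<open>L1\<close>.\<close>
lemma clt_rescaled: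
 assumes k: "filterlim k sequentially sequentially" "(\<lambda>n. real (k n) / real n) \<longlonglongrightarrow> Y.\<kappa>"
 shows "(\<lambda>n. LINT x|Y.\<mu>. cis (t * (birkhoff_sum F D (k n) x / sqrt (real n)))) \<longlonglongrightarrow> exp (- (t\<^sup>2 * (Y.\<kappa> * D.\<sigma>2) / 2))"
proof -
 let ?W = "\<lambda>k x. birkhoff_sum F D k x / sqrt (real k)"
 define r where "r n = sqrt (real (k n) / real n)" for n
 have r: "r \<longlonglongrightarrow> sqrt Y.\<kappa>" unfolding r_def by (intro tendsto_real_sqrt k)
 have cm[measurable]: "(\<lambda>x. cis (a * ?W k x)) \<in> borel_measurable Y.\<mu>" for a k unfolding cis_conv_exp by measurable
 have ci: "integrable Y.\<mu> (\<lambda>x. cis (a * ?W k x))" for a k by (rule Y.\<mu>.integrable_const_bound[where B=1]) auto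
 have "(\<lambda>k. LINT x|Y.\<mu>. cis (sqrt Y.\<kappa> * t * ?W k x)) \<longlonglongrightarrow> exp (- ((sqrt Y.\<kappa> * t)\<^sup>2 * D.\<sigma>2 / 2))"
  using D.char_clt[of "sqrt Y.\<kappa> * t"] by (simp add: D.charS_def mult_ac)
 from filterlim_compose[OF this k(1)]
 have 1: "(\<lambda>n. LINT x|Y.\<mu>. cis (sqrt Y.\<kappa> * t * ?W (k n) x)) \<longlonglongrightarrow> exp (- (t\<^sup>2 * (Y.\<kappa> * D.\<sigma>2) / 2))"
  using Y.\<kappa>_pos by (simp add: power_mult_distrib mult_ac)
 have "(\<lambda>n. \<bar>t\<bar> * \<bar>r n - sqrt Y.\<kappa>\<bar> * (1 + D.\<sigma>2)) \<longlonglongrightarrow> \<bar>t\<bar> * \<bar>sqrt Y.\<kappa> - sqrt Y.\<kappa>\<bar> * (1 + D.\<sigma>2)"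
  by (intro tendsto_intros r)
 then have z: "(\<lambda>n. \<bar>t\<bar> * \<bar>r n - sqrt Y.\<kappa>\<bar> * (1 + D.\<sigma>2)) \<longlonglongrightarrow> 0" by simp
 have 2: "(\<lambda>n. (LINT x|Y.\<mu>. cis (r n * t * ?W (k n) x)) - (LINT x|Y.\<mu>. cis (sqrt Y.\<kappa> * t * ?W (k n) x))) \<longlonglongrightarrow> 0"
 proof (rule Lim_null_comparison[OF _ z], rule always_eventually, rule allI)
  fix n
  have "norm ((LINT x|Y.\<mu>. cis (r n * t * ?W (k n) x)) - (LINT x|Y.\<mu>. cis (sqrt Y.\<kappa> * t * ?W (k n) x)))
   = norm (LINT x|Y.\<mu>. cis (r n * t * ?W (k n) x) - cis (sqrt Y.\<kappa> * t * ?W (k n) x))"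
   by (simp only: bochner_diff[OF ci ci])
  also have "\<dots> <= (LINT x|Y.\<mu>. norm (cis (r n * t * ?W (k n) x) - cis (sqrt Y.\<kappa> * t * ?W (k n) x)))"
   by (rule integral_norm_bound)
  also have "\<dots> <= (LINT x|Y.\<mu>. \<bar>t\<bar> * \<bar>r n - sqrt Y.\<kappa>\<bar> * \<bar>?W (k n) x\<bar>)"
  proof (rule integral_mono)
   show "integrable Y.\<mu> (\<lambda>x. norm (cis (r n * t * ?W (k n) x) - cis (sqrt Y.\<kappa> * t * ?W (k n) x)))"
    by (intro integrable_norm Bochner_Integration.integrable_diff ci)
   show "integrable Y.\<mu> (\<lambda>x. \<bar>t\<bar> * \<bar>r n - sqrt Y.\<kappa>\<bar> * \<bar>?W (k n) x\<bar>)" by (intro integrable_mult_right normalized_L1(2))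
   fix x
   have "r n * t * ?W (k n) x - sqrt Y.\<kappa> * t * ?W (k n) x = t * (r n - sqrt Y.\<kappa>) * ?W (k n) x" by (simp add: algebra_simps diff_divide_distrib)
   then show "norm (cis (r n * t * ?W (k n) x) - cis (sqrt Y.\<kappa> * t * ?W (k n) x)) <= \<bar>t\<bar> * \<bar>r n - sqrt Y.\<kappa>\<bar> * \<bar>?W (k n) x\<bar>"
    using norm_cis_diff[of "r n * t * ?W (k n) x" "sqrt Y.\<kappa> * t * ?W (k n) x"] by (simp only: abs_mult)
  qed
  also have "\<dots> = \<bar>t\<bar> * \<bar>r n - sqrt Y.\<kappa>\<bar> * (LINT x|Y.\<mu>. \<bar>?W (k n) x\<bar>)" by (rule Bochner_Integration.integral_mult_right_zero)
  also have "\<dots> <= \<bar>t\<bar> * \<bar>r n - sqrt Y.\<kappa>\<bar> * (1 + D.\<sigma>2)" by (intro mult_left_mono normalized_L1(1)) simp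
  finally show "norm ((LINT x|Y.\<mu>. cis (r n * t * ?W (k n) x)) - (LINT x|Y.\<mu>. cis (sqrt Y.\<kappa> * t * ?W (k n) x))) <= \<bar>t\<bar> * \<bar>r n - sqrt Y.\<kappa>\<bar> * (1 + D.\<sigma>2)" .
 qed
 have 3: "(\<lambda>n. LINT x|Y.\<mu>. cis (r n * t * ?W (k n) x)) \<longlonglongrightarrow> exp (- (t\<^sup>2 * (Y.\<kappa> * D.\<sigma>2) / 2))"
  using tendsto_add[OF 1 2] by simp
 have "r n * t * ?W (k n) x = t * (birkhoff_sum F D (k n) x / sqrt (real n))" for n x
  by (cases "k n = 0") (simp_all add: r_def real_sqrt_divide birkhoff_sum_def)
 then show ?thesis using 3 by (simp only:)
qed

text \<open>The stable limit of the lag shows that the number of returns differs from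
\<open>\<kappa> * n\<close> by less than \<open>n^a\<close> for any \<open>a > \<alpha>\<close>, up to small
probability. For \<open>a < 1\<close> the martingale moves by only \<open>o(sqrt n)\<close> during so many
steps, so the random index can be replaced by \<open>k n\<close>.\<close>
lemma clt_char_\<mu>:
 assumes f0: "f 0 = 0"
 shows "(\<lambda>n. LINT x|Y.\<mu>. cis (t * (birkhoff_sum T f n x / sqrt (real n)))) \<longlonglongrightarrow> exp (- (t\<^sup>2 * (Y.\<kappa> * D.\<sigma>2) / 2))"
proof -
 define k where "k n = nat \<lfloor>Y.\<kappa> * real n\<rfloor>" for n
 have kb: "real (k n) <= Y.\<kappa> * real n" "Y.\<kappa> * real n < real (k n) + 1" for n
  using mult_nonneg_nonneg[of Y.\<kappa> "real n"] Y.\<kappa>_pos unfolding k_def by linarith+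
 have k1: "filterlim k sequentially sequentially"
 proof -
  have "filterlim (\<lambda>n. Y.\<kappa> * real n) at_top sequentially"
   by (rule filterlim_tendsto_pos_mult_at_top[OF tendsto_const Y.\<kappa>_pos filterlim_real_sequentially])
  then have "filterlim (\<lambda>n. real (k n) + 1) at_top sequentially"
   by (rule filterlim_at_top_mono) (use less_imp_le[OF kb(2)] in auto)
  then have "filterlim (\<lambda>n. -1 + (real (k n) + 1)) at_top sequentially"
   by (rule filterlim_tendsto_add_at_top[OF tendsto_const])
  then show ?thesis by (simp add: filterlim_sequentially_iff_filterlim_real)
 qed
 have k2: "(\<lambda>n. real (k n) / real n) \<longlonglongrightarrow> Y.\<kappa>"
 proof (rule LIM_zero_cancel, rule Lim_null_comparison[OF _ lim_1_over_n])
  show "eventually (\<lambda>n. norm (real (k n) / real n - Y.\<kappa>) <= 1 / real n) sequentially"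
   using eventually_gt_at_top[of 0]
  proof eventually_elim
   case (elim n)
   have "real (k n) / real n - Y.\<kappa> = (real (k n) - Y.\<kappa> * real n) / real n" using elim by (simp add: field_simps)
   moreover have "\<bar>real (k n) - Y.\<kappa> * real n\<bar> <= 1" using kb[of n] by linarith
   ultimately show ?case using elim by (simp add: divide_right_mono)
  qed
 qed
 define a where "a = (1 + \<alpha>) / 2"
 have a: "\<alpha> < a" "0 < a" "a < 1" using \<alpha> by (simp_all add: a_def)
 (* Both indices are compared from a common starting point b n below them, so that the maximal inequality, which
 runs forwards, applies to F^(b n) x. *)
 define b where "b n = nat \<lfloor>Y.\<kappa> * (real n - real n powr a)\<rfloor>" for n
 define J where "J n = nat \<lfloor>2 * Y.\<kappa> * real n powr a + 1\<rfloor>" for n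
 have "(\<lambda>n. (LINT x|Y.\<mu>. cis (t * (birkhoff_sum T f n x / sqrt (real n))))
   - (LINT x|Y.\<mu>. cis (t * (birkhoff_sum F D (k n) x / sqrt (real n))))) \<longlonglongrightarrow> 0"
 proof (rule Y.\<mu>.char_close)
  show "(\<lambda>x. birkhoff_sum T f n x / sqrt (real n)) \<in> borel_measurable Y.\<mu>" for n by measurable
  show "(\<lambda>x. birkhoff_sum F D (k n) x / sqrt (real n)) \<in> borel_measurable Y.\<mu>" for n by measurable
  fix e :: real assume e: "0 < e"
  let ?B = "\<lambda>n x. \<exists>j\<le>J n. e / 6 * real n powr (1/2) <= \<bar>birkhoff_sum F D j x\<bar>"
  define P where "P n = {x\<in>space Y.\<mu>. ?B n ((F ^^ b n) x)}" for n
  define Q where "Q n = {x\<in>space Y.\<mu>. \<exists>k\<le>n. e / 3 * sqrt (real n) <= env (ix ((F ^^ k) x))}" for n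
  define R where "R n = {x\<in>space Y.\<mu>. real n powr (a - \<alpha>) <= \<bar>lag n x\<bar>}" for n
  have "Y.\<mu>.vanishing (\<lambda>n. {x\<in>space Y.\<mu>. ?B n x})"
  proof (rule M.fluctuation[where C="2 * Y.\<kappa> + 1" and a=a])
   show "\<forall>\<^sub>F n in sequentially. real (J n) <= (2 * Y.\<kappa> + 1) * real n powr a"
    using eventually_gt_at_top[of 0]
   proof eventually_elim
    case (elim n)
    have "1 <= real n powr a" using elim a by (intro ge_one_powr_ge_zero) auto
    moreover have "real (J n) <= 2 * Y.\<kappa> * real n powr a + 1" using Y.\<kappa>_pos by (simp add: J_def)
    ultimately show ?case by (simp add: distrib_right)
   qed
  qed (use e a in auto)
  then have "Y.\<mu>.vanishing P" unfolding P_def Y.\<mu>.vanishing_def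
   using prob_invariant[where P="?B n" and k="b n" for n] by simp
  moreover have "Y.\<mu>.vanishing Q" unfolding Q_def by (rule overshoot_negligible) (use e in simp)
  moreover have "Y.\<mu>.vanishing R" unfolding R_def by (rule lag_tight[OF real_power_tendsto]) (use a in simp)
  ultimately have V: "Y.\<mu>.vanishing (\<lambda>n. P n \<union> Q n \<union> R n)" by (intro Y.\<mu>.vanishing_Un)
  have "filterlim (\<lambda>n. e / 3 * sqrt (real n)) at_top sequentially"
   by (rule filterlim_tendsto_pos_mult_at_top[OF tendsto_const]) (use e in \<open>auto intro: filterlim_compose[OF sqrt_at_top filterlim_real_sequentially]\<close>)
  then have "\<forall>\<^sub>F n in sequentially. 2 * c < e / 3 * sqrt (real n)" unfolding filterlim_at_top_dense by blast
  then have "\<forall>\<^sub>F n in sequentially. \<forall>x\<in>space Y.\<mu> - (P n \<union> Q n \<union> R n). \<bar>birkhoff_sum T f n x / sqrt (real n) - birkhoff_sum F D (k n) x / sqrt (real n)\<bar> <= e"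
   using eventually_gt_at_top[of 0]
  proof eventually_elim
   case (elim n)
   have sq: "real n powr (1/2) = sqrt (real n)" by (simp add: powr_half_sqrt)
   have na: "real n powr \<alpha> * real n powr (a - \<alpha>) = real n powr a" by (simp add: powr_add[symmetric])
   show ?case
   proof
    fix x assume x: "x \<in> space Y.\<mu> - (P n \<union> Q n \<union> R n)"
    let ?N = "returns n x"
    have xY: "x \<in> Ybase" using x by (simp only: space_\<mu>_Ybase Diff_iff)
    have 2: "env (ix ((F ^^ ?N) x)) < e / 3 * sqrt (real n)"
     using x returns_le[of n x] unfolding Q_def not_le[symmetric] by blast
    have "\<bar>lag n x\<bar> < real n powr (a - \<alpha>)" using x unfolding R_def not_le[symmetric] by blast
    then have "\<bar>real n - real ?N / Y.\<kappa>\<bar> < real n powr a"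
     using elim unfolding lag_def by (simp add: pos_divide_less_eq na[symmetric] mult.commute)
    then have "\<bar>Y.\<kappa> * (real n - real ?N / Y.\<kappa>)\<bar> < Y.\<kappa> * real n powr a" using Y.\<kappa>_pos by (simp add: abs_mult)
    then have N: "\<bar>Y.\<kappa> * real n - real ?N\<bar> < Y.\<kappa> * real n powr a" using Y.\<kappa>_pos by (simp add: right_diff_distrib)
    have bk: "b n <= k n" unfolding b_def k_def using Y.\<kappa>_pos by (intro nat_mono floor_mono mult_left_mono) auto
    have bN: "b n <= ?N" using N unfolding b_def right_diff_distrib by linarith
    have "Y.\<kappa> * (real n - real n powr a) < real (b n) + 1" unfolding b_def by linarith
    then have bl: "Y.\<kappa> * real n < real (b n) + 1 + Y.\<kappa> * real n powr a" by (simp add: right_diff_distrib)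
    have jN: "?N - b n <= J n" using N bl bN unfolding J_def by linarith
    have "0 <= Y.\<kappa> * real n powr a" using Y.\<kappa>_pos by simp
    then have jk: "k n - b n <= J n" using kb[of n] bl bk unfolding J_def by linarith
    have B: "\<bar>birkhoff_sum F D j ((F ^^ b n) x)\<bar> < e / 6 * sqrt (real n)" if "j <= J n" for j
     using x that unfolding P_def sq not_le[symmetric] by blast
    have "birkhoff_sum F D ?N x - birkhoff_sum F D (k n) x
     = birkhoff_sum F D (?N - b n) ((F ^^ b n) x) - birkhoff_sum F D (k n - b n) ((F ^^ b n) x)"
     using birkhoff_sum_add[of F D "b n" "?N - b n" x] birkhoff_sum_add[of F D "b n" "k n - b n" x] bk bN by simp
    moreover have "\<bar>birkhoff_sum T f n x - birkhoff_sum F D ?N x\<bar> <= 2 * c + env (ix ((F ^^ ?N) x))"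
     using birkhoff_sum_decomposition[OF xY, of n] by (simp add: f0)
    ultimately have "\<bar>birkhoff_sum T f n x - birkhoff_sum F D (k n) x\<bar> <= e * sqrt (real n)"
     using B[OF jN] B[OF jk] 2 elim(1) by linarith
    then show "\<bar>birkhoff_sum T f n x / sqrt (real n) - birkhoff_sum F D (k n) x / sqrt (real n)\<bar> <= e"
     using elim(2) by (simp add: diff_divide_distrib[symmetric] pos_divide_le_eq)
   qed
  qed
  with V show "\<exists>U. Y.\<mu>.vanishing U \<and> (\<forall>\<^sub>F n in sequentially. \<forall>x\<in>space Y.\<mu> - U n. \<bar>birkhoff_sum T f n x / sqrt (real n) - birkhoff_sum F D (k n) x / sqrt (real n)\<bar> <= e)"
   by blast
 qed
 from tendsto_add[OF this clt_rescaled[OF k1 k2, of t]] show ?thesis by simp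
qed

end

section \<open>Limit theorems for the invariant measure and degeneracy\<close>

lemma centred_normal:
 assumes v: "0 <= v"
 shows "real_distribution (centred_normal v)"
  and "char (centred_normal v) t = exp (- (t\<^sup>2 * v / 2))"
proof -
 interpret N: prob_space std_normal_distribution by (rule prob_space_normal_density) simp
 have id: "distributed std_normal_distribution lborel (\<lambda>x. x) std_normal_density"
  by (simp add: distributed_def distr_id2)
 have eq: "centred_normal v = distr std_normal_distribution borel (\<lambda>x. sqrt v * x)"
 proof (cases "v = 0")
  case True
  have "distr std_normal_distribution borel (\<lambda>x. 0::real) = return borel 0" by (rule N.distr_const) simp
  then show ?thesis using True by (simp add: centred_normal_def)
 next
  case False
  then have "distributed std_normal_distribution lborel (\<lambda>x. 0 + sqrt v * x) (normal_density (0 + sqrt v * 0) (\<bar>sqrt v\<bar> * 1))"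
   using v by (intro N.normal_density_affine id) simp_all
  then have "distr std_normal_distribution lborel (\<lambda>x. sqrt v * x) = density lborel (\<lambda>x. ennreal (normal_density 0 (sqrt v) x))"
   using v by (simp add: distributed_def)
  moreover have "distr std_normal_distribution lborel (\<lambda>x. sqrt v * x) = distr std_normal_distribution borel (\<lambda>x. sqrt v * x)"
   by (rule distr_cong) simp_all
  ultimately show ?thesis using False by (simp add: centred_normal_def)
 qed
 show "real_distribution (centred_normal v)" unfolding eq by (rule N.real_distribution_law) simp
 have "char (centred_normal v) t = (LINT x|std_normal_distribution. cis (t * (sqrt v * x)))"
  unfolding eq by (rule N.char_distr) simp
 also have "\<dots> = char std_normal_distribution (t * sqrt v)" by (simp add: char_def cis_conv_exp mult_ac)
 also have "\<dots> = exp (- (t\<^sup>2 * v / 2))" using v by (simp add: char_std_normal_distribution power_mult_distrib)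
 finally show "char (centred_normal v) t = exp (- (t\<^sup>2 * v / 2))" .
qed

context lsv_martingale
begin

lemma birkhoff_bound: "x \<in> {0..1} ==> \<bar>birkhoff_sum T f n x\<bar> <= real n * fB"
proof -
 assume x: "x \<in> {0..1}"
 have "\<bar>birkhoff_sum T f n x\<bar> <= (\<Sum>i<n. \<bar>f ((T ^^ i) x)\<bar>)" unfolding birkhoff_sum_def by (rule sum_abs)
 also have "\<dots> <= (\<Sum>i<n. fB)" by (intro sum_mono f_bound T_pow_in x)
 finally show ?thesis by simp
qed

text \<open>Shifting the starting point by \<open>j\<close> steps changes a Birkhoff sum by at most
\<open>2 * j\<close> terms, so normalised sums are almost invariant.\<close>
lemma char_m:
 assumes b: "filterlim b at_top sequentially"
  and lim: "(\<lambda>n. LINT x|Y.\<mu>. cis (t * (birkhoff_sum T f n x / b n))) \<longlonglongrightarrow> l"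
 shows "(\<lambda>n. LINT x|m. cis (t * (birkhoff_sum T f n x / b n))) \<longlonglongrightarrow> l"
proof -
 have "(\<lambda>n. (LINT x|m. cis (t * (birkhoff_sum T f n x / b n))) - (LINT x|Y.\<mu>. cis (t * (birkhoff_sum T f n x / b n)))) \<longlonglongrightarrow> 0"
 proof (rule char_m_limit)
  show "(\<lambda>x. birkhoff_sum T f n x / b n) \<in> borel_measurable m" for n
   by (intro borel_measurable_divide birkhoff_f_measurable borel_measurable_const)
  fix j x assume x: "x \<in> {0..1::real}"
  show "(\<lambda>n. birkhoff_sum T f n ((T ^^ j) x) / b n - birkhoff_sum T f n x / b n) \<longlonglongrightarrow> 0"
  proof (rule Lim_null_comparison)
   show "(\<lambda>n. 2 * (real j * fB) / b n) \<longlonglongrightarrow> 0"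
    by (rule tendsto_divide_0[OF tendsto_const]) (rule filterlim_at_top_imp_at_infinity[OF b])
   have "eventually (\<lambda>n. 0 < b n) sequentially" using b unfolding filterlim_at_top_dense by blast
   then show "eventually (\<lambda>n. norm (birkhoff_sum T f n ((T ^^ j) x) / b n - birkhoff_sum T f n x / b n) <= 2 * (real j * fB) / b n) sequentially"
   proof eventually_elim
    case (elim n)
    have "birkhoff_sum T f j x + birkhoff_sum T f n ((T ^^ j) x) = birkhoff_sum T f n x + birkhoff_sum T f j ((T ^^ n) x)"
     using birkhoff_sum_add[of T f j n x] birkhoff_sum_add[of T f n j x] by (simp add: add.commute)
    then have "\<bar>birkhoff_sum T f n ((T ^^ j) x) - birkhoff_sum T f n x\<bar> <= 2 * (real j * fB)"
     using birkhoff_bound[OF x, of j] birkhoff_bound[OF T_pow_in[OF x], of j n] by linarith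
    then show ?case using elim by (simp add: diff_divide_distrib[symmetric] divide_right_mono)
   qed
  qed
 qed
 from tendsto_add[OF this lim] show ?thesis by simp
qed

text \<open>The factors \<open>\<kappa>\<close> from the tail constant and from inversion cancel:
\<open>\<bar>\<kappa>^\<alpha> * f 0\<bar>^(1/\<alpha>) = \<kappa> * \<bar>f 0\<bar>^(1/\<alpha>)\<close>.\<close>
lemma stable_limit:
 "\<exists>Z. is_stable_law (1 / \<alpha>) (h (1/2) / (4 * (\<alpha> / \<bar>f 0\<bar>) powr (1 / \<alpha>)) * Gamma (1 - 1 / \<alpha>) * cos (pi / (2 * \<alpha>))) (sgn (f 0)) Z \<and>
   weak_conv_m (\<lambda>n. distr m borel (\<lambda>x. birkhoff_sum T f n x / real n powr \<alpha>)) Z"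
 if f0: "f 0 \<noteq> 0"
proof -
 define a where "a = Y.\<kappa> powr \<alpha> * f 0"
 have a: "a \<noteq> 0" "sgn a = sgn (f 0)" using f0 Y.\<kappa>_pos by (simp_all add: a_def sgn_mult)
 obtain Z where Z: "real_distribution Z" "\<And>t. char Z t = exp (stable_exponent (1 / \<alpha>) crt (Y.\<kappa> powr \<alpha> * t))"
  "weak_conv_m (\<lambda>n. distr Y.\<mu> borel (lag n)) Z" using lag_limit by blast
 have "(\<lambda>n. char (distr Y.\<mu> borel (lag n)) (t * f 0)) \<longlonglongrightarrow> char Z (t * f 0)" for t
  by (rule levy_continuity1[OF _ Z(1,3)]) (rule Y.\<mu>.real_distribution_law, measurable)
 then have L: "(\<lambda>n. LINT x|Y.\<mu>. cis (t * (f 0 * lag n x))) \<longlonglongrightarrow> exp (stable_exponent (1 / \<alpha>) crt (a * t))" for t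
  by (simp add: Y.\<mu>.char_distr Z(2) a_def mult_ac)
 have "(\<lambda>n. LINT x|Y.\<mu>. cis (t * (birkhoff_sum T f n x / real n powr \<alpha>))) \<longlonglongrightarrow> exp (stable_exponent (1 / \<alpha>) crt (a * t))" for t
  using tendsto_add[OF stable_char_\<mu>[of t] L[of t]] by simp
 then have lim: "(\<lambda>n. LINT x|m. cis (t * (birkhoff_sum T f n x / real n powr \<alpha>))) \<longlonglongrightarrow> exp (stable_exponent (1 / \<alpha>) crt (a * t))" for t
  by (rule char_m[OF real_power_tendsto[OF \<alpha>(1)]])
 have cont: "isCont (\<lambda>t. exp (stable_exponent (1 / \<alpha>) crt (a * t))) 0"
 proof (rule isCont_o2[where g="\<lambda>t. exp (stable_exponent (1 / \<alpha>) crt t)" and f="\<lambda>t. a * t"])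
  show "isCont (\<lambda>t. exp (stable_exponent (1 / \<alpha>) crt t)) (a * 0)"
   using isCont_exp_stable_exponent[of "1 / \<alpha>" crt] \<alpha> by simp
 qed simp
 have Am: "(\<lambda>x. birkhoff_sum T f n x / real n powr \<alpha>) \<in> borel_measurable m" for n
  by (intro borel_measurable_divide birkhoff_f_measurable borel_measurable_const)
 obtain W where W: "real_distribution W" "char W = (\<lambda>t. exp (stable_exponent (1 / \<alpha>) crt (a * t)))"
  "weak_conv_m (\<lambda>n. distr m borel (\<lambda>x. birkhoff_sum T f n x / real n powr \<alpha>)) W"
  using m.limit_law_exists[OF Am lim cont] by blast
 have c: "crt * \<bar>a\<bar> powr (1 / \<alpha>) = h (1/2) / (4 * (\<alpha> / \<bar>f 0\<bar>) powr (1 / \<alpha>)) * Gamma (1 - 1 / \<alpha>) * cos (pi / (2 * \<alpha>))"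
 proof -
  have "\<bar>a\<bar> powr (1 / \<alpha>) = Y.\<kappa> * \<bar>f 0\<bar> powr (1 / \<alpha>)"
   using Y.\<kappa>_pos \<alpha> by (simp add: a_def abs_mult powr_mult powr_powr)
  moreover have "cos (1 / \<alpha> * pi / 2) = cos (pi / (2 * \<alpha>))" by (rule arg_cong[where f=cos]) simp
  ultimately show ?thesis using Y.\<kappa>_pos \<alpha> f0
   by (simp add: crt_def Crt_def powr_divide powr_minus_divide)
 qed
 have "is_stable_law (1 / \<alpha>) (crt * \<bar>a\<bar> powr (1 / \<alpha>)) (sgn (f 0)) W"
  unfolding is_stable_law_def W(2) using W(1) \<alpha> a by (simp add: stable_exponent_scale)
 then show ?thesis using W(3) unfolding c by blast
qed

lemma clt_char_m:
 "f 0 = 0 ==> (\<lambda>n. LINT x|m. cis (t * (birkhoff_sum T f n x / sqrt (real n)))) \<longlonglongrightarrow> exp (- (t\<^sup>2 * (Y.\<kappa> * D.\<sigma>2) / 2))"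
 by (rule char_m[where b="\<lambda>n. sqrt (real n)", OF filterlim_compose[OF sqrt_at_top filterlim_real_sequentially] clt_char_\<mu>])

text \<open>The Birkhoff sums \<open>u \<circ> T^n - u\<close> are bounded in probability, so their quotient by
\<open>sqrt n\<close> has the limit 0, and the Gaussian limit is degenerate.\<close>
lemma degenerate_if_coboundary:
 assumes f0: "f 0 = 0" and u[measurable]: "u \<in> borel_measurable m" and cob: "AE x in m. f x = u (T x) - u x"
 shows "D.\<sigma>2 = 0"
proof -
 have AE: "AE x in m. birkhoff_sum T f n x = u ((T ^^ n) x) - u x" for n
 proof (induction n)
  case 0 show ?case by (simp add: birkhoff_sum_def)
 next
  case (Suc n)
  have "AE x in distr m m T. birkhoff_sum T f n x = u ((T ^^ n) x) - u x" using Suc by (simp only: distr_T)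
  then have "AE x in m. birkhoff_sum T f n (T x) = u ((T ^^ n) (T x)) - u (T x)" by (rule AE_distrD[OF T_measurable_m])
  then show ?case using cob by eventually_elim (simp add: birkhoff_sum_Suc funpow_swap1)
 qed
 have Am: "(\<lambda>x. birkhoff_sum T f n x / sqrt (real n)) \<in> borel_measurable m" for n
  by (intro borel_measurable_divide birkhoff_f_measurable borel_measurable_const)
 have "(\<lambda>n. (LINT x|m. cis (1 * (birkhoff_sum T f n x / sqrt (real n)))) - (LINT x|m. cis (1 * 0))) \<longlonglongrightarrow> 0"
 proof (rule m.char_close[OF Am])
  fix e :: real assume e: "0 < e"
  define U where "U n = {x\<in>space m. e / 2 * sqrt (real n) <= \<bar>u x\<bar>}" for n
  define V where "V n = (T ^^ n) -` U n \<inter> space m" for n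
  define Z where "Z n = {x\<in>space m. birkhoff_sum T f n x \<noteq> u ((T ^^ n) x) - u x}" for n
  have U: "m.vanishing U" unfolding U_def
  proof (rule m.tight_of_weak_conv[OF u m.real_distribution_law[OF u]])
   (* A single law is tight: apply the tightness of convergent sequences to a constant one. *)
   show "weak_conv_m (\<lambda>n. distr m borel u) (distr m borel u)" by (simp add: weak_conv_m_def weak_conv_def)
   show "filterlim (\<lambda>n. e / 2 * sqrt (real n)) at_top sequentially"
    by (rule filterlim_tendsto_pos_mult_at_top[OF tendsto_const]) (use e in \<open>auto intro: filterlim_compose[OF sqrt_at_top filterlim_real_sequentially]\<close>)
  qed
  then have Um: "U n \<in> sets m" for n by (simp add: m.vanishing_def)
  have "m.prob (V n) = m.prob (U n)" "V n \<in> sets m" for n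
   using measure_distr[OF T_pow_m Um, of n n] measurable_sets[OF T_pow_m Um, of n n]
   by (simp_all only: V_def distr_funpow[OF T_measurable_m distr_T])
  then have V: "m.vanishing V" using U by (simp add: m.vanishing_def)
  have [measurable]: "birkhoff_sum T f n \<in> borel_measurable m" for n by (rule birkhoff_f_measurable)
  have Zm: "Z n \<in> sets m" for n unfolding Z_def by measurable
  have "m.prob (Z n) = 0" for n
   using AE[of n] by (subst m.prob_eq_0[OF Zm]) (auto simp: Z_def elim: eventually_mono)
  then have Z: "m.vanishing Z" using Zm by (simp add: m.vanishing_def)
  have "\<forall>\<^sub>F n in sequentially. \<forall>x\<in>space m - (U n \<union> V n \<union> Z n). \<bar>birkhoff_sum T f n x / sqrt (real n) - 0\<bar> <= e"
   using eventually_gt_at_top[of 0]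
  proof eventually_elim
   case (elim n)
   show ?case
   proof
    fix x assume x: "x \<in> space m - (U n \<union> V n \<union> Z n)"
    then have "(T ^^ n) x \<in> space m" using measurable_space[OF T_pow_m] by blast
    then have "\<bar>u x\<bar> < e / 2 * sqrt (real n)" "\<bar>u ((T ^^ n) x)\<bar> < e / 2 * sqrt (real n)"
     "birkhoff_sum T f n x = u ((T ^^ n) x) - u x"
     using x unfolding U_def V_def Z_def vimage_def not_le[symmetric] by blast+
    then have "\<bar>birkhoff_sum T f n x\<bar> <= e * sqrt (real n)" by linarith
    then show "\<bar>birkhoff_sum T f n x / sqrt (real n) - 0\<bar> <= e" using elim by (simp add: pos_divide_le_eq)
   qed
  qed
  with m.vanishing_Un[OF m.vanishing_Un[OF U V] Z]
  show "\<exists>U. m.vanishing U \<and> (\<forall>\<^sub>F n in sequentially. \<forall>x\<in>space m - U n. \<bar>birkhoff_sum T f n x / sqrt (real n) - 0\<bar> <= e)" by blast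
 qed simp
 then have "(\<lambda>n. LINT x|m. cis (1 * (birkhoff_sum T f n x / sqrt (real n)))) \<longlonglongrightarrow> 1"
  using LIM_zero_cancel[where l="1::complex"] by (simp add: m.prob_space)
 then have "complex_of_real (exp (- (1\<^sup>2 * (Y.\<kappa> * D.\<sigma>2) / 2))) = 1" by (rule LIMSEQ_unique[OF clt_char_m[OF f0]])
 then show ?thesis using Y.\<kappa>_pos by (simp only: of_real_eq_1_iff exp_eq_one_iff) simp
qed

lemma AE_m: "AE x in lborel. P x ==> AE x in m. P x"
proof (rule absolutely_continuous_AE[OF sets_m])
 show "absolutely_continuous leb01 m" using acip by (simp add: is_acip_def)
 assume "AE x in lborel. P x"
 then show "AE x in leb01. P x" by (subst AE_restrict_space_iff) (auto elim: eventually_mono)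
qed

text \<open>The time of the first visit to \<open>Ybase\<close>. The point \<open>(1 + x) / 2\<close> is the
preimage of \<open>x\<close> in \<open>Ybase\<close>, so its return index is this time.\<close>
definition entry :: "real => nat" where "entry x = ix ((1 + x) / 2)"

lemma entry_eq:
 assumes x: "0 < x" "x <= 1" shows "entry x = (LEAST n. 1/2 < (T ^^ n) x)" "F ((1 + x) / 2) = (T ^^ entry x) x"
proof -
 have T: "T ((1 + x) / 2) = x" using x by (subst T_right) (auto simp: field_simps)
 have P: "(T ^^ Suc n) ((1 + x) / 2) = (T ^^ n) x" for n by (simp only: funpow_Suc_right o_apply T)
 show "entry x = (LEAST n. 1/2 < (T ^^ n) x)" unfolding entry_def ix_def P ..
 show "F ((1 + x) / 2) = (T ^^ entry x) x" unfolding F_def P entry_def ..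
qed

text \<open>If \<open>D = 0\<close>, then \<open>X = \<psi> \<circ> F - \<psi>\<close>. The transfer function
for \<open>T\<close> extends \<open>\<psi>\<close> from \<open>Ybase\<close> by following the orbit of
\<open>x\<close> to its entry point and subtracting the Birkhoff sum collected on the way. Then the coboundary
equation is a tautology off \<open>Ybase\<close> and is the equation for \<open>X\<close> on it.\<close>
lemma coboundary_if_degenerate:
 assumes f0: "f 0 = 0" and deg: "D.\<sigma>2 = 0"
 shows "\<exists>u\<in>borel_measurable m. AE x in m. f x = u (T x) - u x"
proof -
 have "AE x in Y.\<mu>. (D x)\<^sup>2 = 0"
  using integral_nonneg_eq_0_iff_AE[OF D.X2_integrable] deg by (simp add: D.\<sigma>2_def)
 then have "AE x in lebY. 0 < ennreal (h x / Y.\<kappa>) \<longrightarrow> (D x)\<^sup>2 = 0"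
  unfolding Y.\<mu>_def by (subst (asm) AE_density) (use Y.h_measurable in \<open>auto intro!: borel_measurable_divide\<close>)
 then have "AE x in lborel. x \<in> Ybase \<longrightarrow> (0 < ennreal (h x / Y.\<kappa>) \<longrightarrow> (D x)\<^sup>2 = 0)"
  by (subst (asm) AE_restrict_space_iff) auto
 then have D0: "AE x in m. x \<in> Ybase \<longrightarrow> D x = 0"
  by (intro AE_m) (auto elim!: eventually_mono simp: h_pos Y.\<kappa>_pos)
 have x0: "AE x in m. x \<noteq> 0" by (rule AE_m[OF AE_lborel_singleton])
 define \<psi>' where "\<psi>' x = indicator Ybase x * \<psi> x" for x
 have [measurable]: "\<psi>' \<in> borel_measurable borel"
  using borel_measurable_restrict_space_iff[of Ybase borel \<psi>] \<psi>_measurable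
   measurable_cong_sets[of lebY "restrict_space borel Ybase" borel borel]
  by (simp add: \<psi>'_def[abs_def] sets_restrict_space mult.commute)
 define u where "u x = \<psi>' (F ((1 + x) / 2)) - birkhoff_sum T f (entry x) x" for x
 have [measurable]: "entry \<in> measurable borel (count_space UNIV)" unfolding entry_def by measurable
 have em: "entry \<in> measurable m (count_space UNIV)" by (rule borel_measurable_m) measurable
 have "(\<lambda>x. birkhoff_sum T f (entry x) x) \<in> borel_measurable m"
  by (rule measurable_compose_countable[OF birkhoff_f_measurable em])
 moreover have "(\<lambda>x. \<psi>' (F ((1 + x) / 2))) \<in> borel_measurable m" by (rule borel_measurable_m) measurable
 ultimately have um: "u \<in> borel_measurable m" unfolding u_def[abs_def] by (rule borel_measurable_diff[rotated])
 have "AE x in m. f x = u (T x) - u x"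
  using D0 x0 AE_space
 proof eventually_elim
  case (elim x)
  then have x: "0 < x" "x <= 1" by (simp_all add: space_m)
  show ?case
  proof (cases "x <= 1/2")
   case True
   have "x <= T x" using lbr_ge[of x] T_left[of x] x True by simp
   then have Tx: "0 < T x" "T x <= 1" using T_in[of x] x by auto
   obtain n where n: "1/2 < (T ^^ n) x"
   proof -
    obtain n where "xs (Suc n) < x" "x <= xs n" using level_exists[OF x] by blast
    then obtain y where y: "y \<in> Ybase" "x = lp n y" using fundamental_domain by blast
    have "(T ^^ n) x = y" using T_pow_v[OF y(1), of n n] T_v[OF y(1), of n] by (simp only: funpow_Suc_right o_apply y) simp
    then show ?thesis using y that[of n] by simp
   qed
   have "\<not> 1/2 < (T ^^ 0) x" using True by simp
   then have e: "entry x = Suc (entry (T x))"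
    unfolding entry_eq(1)[OF x] entry_eq(1)[OF Tx] using Least_Suc[where P="\<lambda>n. 1/2 < (T ^^ n) x", OF n \<open>\<not> 1/2 < (T ^^ 0) x\<close>]
    by (simp only: funpow_Suc_right o_apply)
   have "F ((1 + T x) / 2) = F ((1 + x) / 2)"
    unfolding entry_eq(2)[OF x] entry_eq(2)[OF Tx] e by (simp only: funpow_Suc_right o_apply)
   then show ?thesis by (simp add: u_def e birkhoff_sum_Suc)
  next
   case False
   then have xY: "x \<in> Ybase" using x by simp
   have Tx: "T x = 2 * x - 1" using False by (simp add: T_right)
   have Tx01: "0 < T x" "T x <= 1" using xY Tx by auto
   have e0: "entry x = 0" unfolding entry_eq(1)[OF x] using False by (intro Least_eq_0) simp
   have sx: "(1 + T x) / 2 = x" by (simp add: Tx)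
   have "u x = \<psi> x" unfolding u_def entry_eq(2)[OF x] e0 using xY by (simp add: \<psi>'_def birkhoff_sum_def)
   moreover have "u (T x) = \<psi> (F x) - birkhoff_sum T f (ix x) (T x)"
    unfolding u_def entry_def sx using F_in[OF xY] by (simp add: \<psi>'_def)
   moreover have "X x = \<psi> (F x) - \<psi> x" using elim(1) xY by (simp add: D_def)
   moreover have "X x = f x + birkhoff_sum T f (ix x) (T x)"
    unfolding X_def birkhoff_sum_Suc by (simp add: f0)
   ultimately show ?thesis by simp
  qed
 qed
 then show ?thesis using um by blast
qed

lemma central_limit:
 assumes f0: "f 0 = 0"
 shows "\<exists>v\<ge>0. weak_conv_m (\<lambda>n. distr m borel (\<lambda>x. birkhoff_sum T f n x / sqrt (real n))) (centred_normal v) \<and>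
   (v = 0 \<longleftrightarrow> (\<exists>u\<in>borel_measurable m. AE x in m. f x = u (T x) - u x))"
proof (intro exI conjI)
 show v: "0 <= Y.\<kappa> * D.\<sigma>2" using Y.\<kappa>_pos D.\<sigma>2_nonneg by simp
 show "weak_conv_m (\<lambda>n. distr m borel (\<lambda>x. birkhoff_sum T f n x / sqrt (real n))) (centred_normal (Y.\<kappa> * D.\<sigma>2))"
 proof (rule m.weak_conv_of_char[OF _ centred_normal(1)[OF v]])
  show "(\<lambda>x. birkhoff_sum T f n x / sqrt (real n)) \<in> borel_measurable m" for n
   by (intro borel_measurable_divide birkhoff_f_measurable borel_measurable_const)
  show "(\<lambda>n. LINT x|m. cis (t * (birkhoff_sum T f n x / sqrt (real n)))) \<longlonglongrightarrow> char (centred_normal (Y.\<kappa> * D.\<sigma>2)) t" for t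
   unfolding centred_normal(2)[OF v] by (rule clt_char_m[OF f0])
 qed
 show "Y.\<kappa> * D.\<sigma>2 = 0 \<longleftrightarrow> (\<exists>u\<in>borel_measurable m. AE x in m. f x = u (T x) - u x)"
  using Y.\<kappa>_pos coboundary_if_degenerate[OF f0] degenerate_if_coboundary[OF f0] by fastforce
qed

end

lemma (in lsv_observable) martingale_exists:
 "\<exists>\<psi> c. lsv_martingale \<alpha> m h \<theta> f Cf \<gamma> \<psi> c"
proof -
 obtain c and \<psi> :: "real => real" where "Y.hol c \<psi>"
  "Y.branch_hol (\<lambda>n. Xb n + 2 * c) (\<lambda>x. X x + \<psi> x - \<psi> (F x))"
  "\<forall>x\<in>space lebY. Y.transfer (\<lambda>x. (X x + \<psi> x - \<psi> (F x)) * h x) x = 0"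
  using Y.gordin_decomposition[OF X_branch_hol Xb_summable X_mean] by blast
 then have "lsv_martingale \<alpha> m h \<theta> f Cf \<gamma> \<psi> c"
  by unfold_locales (simp_all add: space_lebY)
 then show ?thesis by blast
qed

theorem theorem1p3:
  fixes \<alpha> \<gamma> :: real and m :: "real measure" and T h f :: "real \<Rightarrow> real"
  assumes "1/2 < \<alpha>" and "\<alpha> < 1"
    and T: "T = lsv_map \<alpha>"
    and acip: "is_acip T m"
    and acip_unique: "\<And>m'. is_acip T m' \<Longrightarrow> m' = m"
    and density: "is_lipschitz_density m h"
    and f_holder: "\<exists>\<theta>>0. holder_on \<theta> {0..1} f"
    and f_holder_0: "\<exists>U. open U \<and> 0 \<in> U \<and> holder_on \<gamma> (U \<inter> {0..1}) f"
    and \<gamma>: "\<gamma> > (2 * \<alpha> - 1) / (\<alpha> + 1)"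
    and f_mean: "(\<integral>x. f x \<partial>m) = 0"
  shows
    "(f 0 = 0 \<longrightarrow>
       (\<exists>v\<ge>0.
          weak_conv_m (\<lambda>n. distr m borel (\<lambda>x. birkhoff_sum T f n x / sqrt (real n)))
            (centred_normal v) \<and>
          (v = 0 \<longleftrightarrow> (\<exists>u\<in>borel_measurable m. AE x in m. f x = u (T x) - u x))))
     \<and>
     (f 0 \<noteq> 0 \<longrightarrow>
       (\<exists>X. is_stable_law (1 / \<alpha>)
              (h (1/2) / (4 * (\<alpha> / \<bar>f 0\<bar>) powr (1 / \<alpha>)) *
                 Gamma (1 - 1 / \<alpha>) * cos (pi / (2 * \<alpha>)))
              (sgn (f 0)) X \<and>
            weak_conv_m (\<lambda>n. distr m borel (\<lambda>x. birkhoff_sum T f n x / real n powr \<alpha>)) X))"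
proof -
 obtain \<theta> C where \<theta>: "0 < \<theta>" and C: "\<And>x y. x \<in> {0..1} ==> y \<in> {0..1} ==> \<bar>f x - f y\<bar> <= C * \<bar>x - y\<bar> powr \<theta>"
  using f_holder unfolding holder_on_def by blast
 have C0: "0 <= C" using C[of 1 0] by (simp add: order_trans[OF abs_ge_zero])
 obtain U C' where U: "open U" "0 \<in> U"
  and C': "\<And>x y. x \<in> U \<inter> {0..1} ==> y \<in> U \<inter> {0..1} ==> \<bar>f x - f y\<bar> <= C' * \<bar>x - y\<bar> powr \<gamma>"
  using f_holder_0 unfolding holder_on_def by blast
 obtain r where r: "0 < r" "\<And>x. dist x 0 < r ==> x \<in> U" using U unfolding open_dist by blast
 define \<theta>1 where "\<theta>1 = min \<theta> 1"
 (* Decreasing the exponents is harmless on the unit interval, and \<alpha> - 1/4 lies strictly between the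
 bounds \<alpha> - 1/2 and \<alpha>. *)
 define \<gamma>1 where "\<gamma>1 = min \<gamma> (\<alpha> - 1/4)"
 define K where "K = C + \<bar>C'\<bar> + C * r powr (- \<gamma>1)"
 have \<theta>1: "0 < \<theta>1" "\<theta>1 <= 1" using \<theta> by (simp_all add: \<theta>1_def)
 (* Since \<alpha> + 1 < 2, the given bound on \<gamma> is stronger than \<gamma> > \<alpha> - 1/2. *)
 have \<gamma>': "\<alpha> - 1/2 < \<gamma>"
 proof -
  have "(\<alpha> - 1/2) * (\<alpha> + 1) <= (\<alpha> - 1/2) * 2" using assms(1,2) by (intro mult_left_mono) auto
  then have "\<alpha> - 1/2 <= (2 * \<alpha> - 1) / (\<alpha> + 1)" using assms(1) by (subst pos_le_divide_eq) auto
  then show ?thesis using \<gamma> by linarith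
 qed
 have \<gamma>1: "\<alpha> - 1/2 < \<gamma>1" "\<gamma>1 < \<alpha>" "\<gamma>1 <= \<gamma>" "0 < \<gamma>1" using \<gamma>' assms(1) by (auto simp: \<gamma>1_def)
 have K: "C <= K" "\<bar>C'\<bar> <= K" "C * r powr (- \<gamma>1) <= K" using C0 by (simp_all add: K_def)
 interpret lsv_observable \<alpha> m h \<theta>1 f K \<gamma>1
 proof unfold_locales
  show "is_acip (lsv_map \<alpha>) m" using acip T by simp
  show "\<bar>f x - f y\<bar> <= K * \<bar>x - y\<bar> powr \<theta>1" if "x \<in> {0..1}" "y \<in> {0..1}" for x y
  proof -
   have "\<bar>f x - f y\<bar> <= C * \<bar>x - y\<bar> powr \<theta>" by (rule C[OF that])
   also have "\<dots> <= K * \<bar>x - y\<bar> powr \<theta>1"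
    using that C0 K(1) by (intro mult_mono powr_mono') (auto simp: \<theta>1_def)
   finally show ?thesis .
  qed
  show "\<bar>f x - f 0\<bar> <= K * x powr \<gamma>1" if x: "x \<in> {0..1}" for x
  proof (cases "x < r")
   case True
   have "\<bar>f x - f 0\<bar> <= C' * \<bar>x - 0\<bar> powr \<gamma>" by (rule C') (use x True r U in auto)
   also have "\<dots> <= \<bar>C'\<bar> * x powr \<gamma>" using x by (simp add: mult_right_mono)
   also have "\<dots> <= K * x powr \<gamma>1" using x \<gamma>1 K C0 by (intro mult_mono powr_mono') auto
   finally show ?thesis .
  next
   case False
   (* Away from 0 the power of x is bounded below, and the global Hoelder bound suffices. *)
   have "\<bar>f x - f 0\<bar> <= C * \<bar>x - 0\<bar> powr \<theta>" by (rule C) (use x in auto)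
   also have "\<dots> <= C * 1" using x \<theta> C0 by (intro mult_left_mono powr_le1) auto
   also have "\<dots> <= C * (r powr (- \<gamma>1) * x powr \<gamma>1)"
   proof (rule mult_left_mono[OF _ C0])
    have "1 <= (x / r) powr \<gamma>1" using False r \<gamma>1 by (intro ge_one_powr_ge_zero) auto
    then show "1 <= r powr (- \<gamma>1) * x powr \<gamma>1" using r(1) x by (simp add: powr_divide powr_minus_divide)
   qed
   also have "\<dots> <= K * x powr \<gamma>1" unfolding mult.assoc[symmetric] by (intro mult_right_mono K) simp
   finally show ?thesis .
  qed
 qed (rule assms(1,2) density \<theta>1 \<gamma>1(1,2) f_mean less_trans[OF _ assms(1)] | simp)+
 obtain \<psi> c where "lsv_martingale \<alpha> m h \<theta>1 f K \<gamma>1 \<psi> c" using martingale_exists by blast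
 then interpret lsv_martingale \<alpha> m h \<theta>1 f K \<gamma>1 \<psi> c .
 show ?thesis unfolding T by (intro conjI impI; rule central_limit stable_limit)
qed

end
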